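(* Consider independent particles on $\mathbb{Z}$ in an i.i.d. space-time environment with bounded jumps satisfying assumptions (A1)–(A3) of the context. Let the $\omega$-dependent initial distribution satisfy (B1) and (B2) of the context. Fix $N\in\mathbb{N}$, time points $0<t_1<t_2<\cdots<t_N$ in $\mathbb{R}_+$, space points $r_1,\dots,r_N\in\mathbb{R}$, and $(\theta_1,\dots,\theta_N)\in\mathbb{R}^N$. Let $$\overline Y_n(t,r)=n^{-1/4}\{Y_n(t,r)-E^\omega[Y_n(t,r)]\},\quad \overline Y_n(\boldsymbol\theta)=\sum_{i=1}^N\theta_i\overline Y_n(t_i,r_i),\quad Z(\boldsymbol\theta)=\sum_{i=1}^N\theta_iZ(t_i,r_i),$$ where $Y_n$ is the current and $Z$ is the centered Gaussian process defined in the context. Then the quenched characteristic functions converge in $L^1(\mathbb{P})$: $$\lim_{n\to\infty}\mathbb{E}\bigl|E^\omega(e^{i\overline Y_n(\boldsymbol\theta)})-\mathbf{E}(e^{iZ(\boldsymbol\theta)})\bigr|=0.$$ In particular, under the averaged distribution $P$, the $\mathbb{R}^N$-valued vectors converge in distribution as $n\to\infty$: $$(\overline Y_n(t_1,r_1),\dots,\overline Y_n(t_N,r_N))\Rightarrow(Z(t_1,r_1),\dots,Z(t_N,r_N)).$$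
   Context: Environment (dimension $d=1$). Fix a finite constant $R$. An environment is $\omega=(\omega_{x,s})_{(x,s)\in\mathbb{Z}\times\mathbb{Z}}$ where each $\omega_{x,s}=(\omega_{x,s}(z):z\in\mathbb{Z},|z|\le R)$ is a probability vector; $(T_{x,s}\omega)_{y,t}=\omega_{x+y,s+t}$. $\mathbb{P}$ is a probability measure on the space $\Omega$ of environments, with expectation $\mathbb{E}$. Let $p(u)=\mathbb{E}[\omega_{0,0}(u)]$. Assumptions on the environment. (A1) The vectors $(\omega_{x,s})_{(x,s)}$ are i.i.d. under $\mathbb{P}$. (A2) $\mathbb{P}\{\exists z: 0<\omega_{0,0}(z)<1\}>0$. (A3) There do not exist $x\in\mathbb{Z}$ and an additive subgroup $\mathbb{G}\subsetneq\mathbb{Z}$ with $\sum_{z\in\mathbb{G}}p(x+z)=1$. Particles. Given $\omega$, initial occupation variables $\eta_0=(\eta_0(x))_{x\in\mathbb{Z}}$ (with values in $\mathbb{Z}_+$) have distribution $\mu^\omega$, and, independently of $\eta_0$, walks $X^{x,j}_\bullet$ ($x\in\mathbb{Z}$, $j\in\mathbb{N}$) start at $X^{x,j}_0=x$ and evolve independently with $P^\omega[X_{s+1}=y\mid X_s=x]=\omega_{x,s}(y-x)$. $P^\omega$ (expectation $E^\omega$, variance $\mathrm{Var}^\omega$) is the quenched law of initial occupation variables and walks; $P=\int P^\omega(\cdot)\,\mathbb{P}(d\omega)$ (expectation $E$) is the averaged law. Assumptions on the initial distribution. (B1) $\mu^\omega(d\eta_0)=\bigotimes_{x\in\mathbb{Z}}\mu^\omega_x(d\eta_0(x))$,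 where $\mu^\omega_x$ may depend measurably on the past levels $(\omega_{y,s}: y\in\mathbb{Z}, s\le-1)$ only, and $\mu^\omega_x=\mu^{T_{x,0}\omega}_0$. (B2) $E[\eta_0(0)^2]<\infty$. Parameters. $v=\sum_x xp(x)$, $\sigma^2=\sum_x x^2p(x)-v^2$, $\rho_0=E[\eta_0(x)]$, $\sigma_0^2=\mathbb{E}[\mathrm{Var}^\omega(\eta_0(0))]$. Current. For $t\in\mathbb{R}_+$, $r\in\mathbb{R}$, $$Y_n(t,r)=\sum_{x>0}\sum_{j=1}^{\eta_0(x)}\mathbf{1}\{X^{x,j}_{\lfloor nt\rfloor}\le\lfloor nvt\rfloor+\lfloor r\sqrt n\rfloor\}-\sum_{x\le0}\sum_{j=1}^{\eta_0(x)}\mathbf{1}\{X^{x,j}_{\lfloor nt\rfloor}>\lfloor nvt\rfloor+\lfloor r\sqrt n\rfloor\}.$$ Limit process. Let $\varphi_{\nu^2}(x)=(2\pi\nu^2)^{-1/2}e^{-x^2/(2\nu^2)}$, $\Phi_{\nu^2}(x)=\int_{-\infty}^x\varphi_{\nu^2}(y)\,dy$, $\Psi_{\nu^2}(x)=\nu^2\varphi_{\nu^2}(x)-x(1-\Phi_{\nu^2}(x))$ for $\nu>0$, and $\Psi_0(x)=\max(-x,0)$ (the limit as $\nu\to0$). $Z=\{Z(t,r):t\in\mathbb{R}_+,r\in\mathbb{R}\}$ is the mean-zero Gaussian process with covariance $$\mathbf{E}[Z(s,q)Z(t,r)]=\rho_0\Gamma_1((s,q),(t,r))+\sigma_0^2\Gamma_2((s,q),(t,r)),$$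 $$\Gamma_1((s,q),(t,r))=\Psi_{\sigma^2(t+s)}(r-q)-\Psi_{\sigma^2|t-s|}(r-q),$$ $$\Gamma_2((s,q),(t,r))=\Psi_{\sigma^2s}(-q)+\Psi_{\sigma^2t}(r)-\Psi_{\sigma^2(t+s)}(r-q).$$ Equivalently, $Z$ has the law of the mild solution of $Z_t=\frac{\sigma^2}{2}Z_{rr}+\sigma\sqrt{\rho_0}\,\dot W$, $Z(0,r)=\sigma_0B(r)$, with $\dot W$ space-time white noise and $B$ an independent two-sided Brownian motion. Here $\mathbf{E}$ is expectation for $Z$. *)

theory Defs
  imports "HOL-Probability.Probability" "HOL-Algebra.Elementary_Groups"
begin

section \<open>Space-time environments on \<int>\<close>

text \<open>An environment assigns to the space-time site \<open>(x, s)\<close> the jump vector \<open>z \<mapsto> \<omega> (x, s) z\<close>,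
  which vanishes for \<open>\<bar>z\<bar> > R\<close>.\<close>

type_synonym env = "int \<times> int \<Rightarrow> int \<Rightarrow> real"

definition jump_space :: "nat \<Rightarrow> (int \<Rightarrow> real) measure" where
  "jump_space R = restrict_space (\<Pi>\<^sub>M z\<in>UNIV. borel)
     {w. (\<forall>z. 0 \<le> w z) \<and> (\<forall>z. \<bar>z\<bar> > int R \<longrightarrow> w z = 0) \<and> (\<Sum>z\<in>{- int R..int R}. w z) = 1}"

definition env_space :: "nat \<Rightarrow> env measure" where
  "env_space R = (\<Pi>\<^sub>M i\<in>UNIV. jump_space R)"

definition shift :: "int \<Rightarrow> int \<Rightarrow> env \<Rightarrow> env" where
  "shift x s \<omega> = (\<lambda>(y, t). \<omega> (x + y, s + t))"

text \<open>The sigma-algebra generated by the levels \<open>s \<le> -1\<close>.\<close>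

definition past_space :: "nat \<Rightarrow> env measure" where
  "past_space R = vimage_algebra (space (env_space R)) (\<lambda>\<omega>. restrict \<omega> {(y, s). s \<le> -1})
     (\<Pi>\<^sub>M i\<in>{(y, s). s \<le> -1}. jump_space R)"

definition mean_jump :: "env measure \<Rightarrow> int \<Rightarrow> real" where
  "mean_jump \<P> u = (\<integral>\<omega>. \<omega> (0, 0) u \<partial>\<P>)"

definition A1 :: "nat \<Rightarrow> env measure \<Rightarrow> bool" where
  "A1 R \<P> \<longleftrightarrow> prob_space.indep_vars \<P> (\<lambda>_. jump_space R) (\<lambda>i \<omega>. \<omega> i) UNIV \<and>
     (\<forall>i j. distr \<P> (jump_space R) (\<lambda>\<omega>. \<omega> i) = distr \<P> (jump_space R) (\<lambda>\<omega>. \<omega> j))"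

definition A2 :: "env measure \<Rightarrow> bool" where
  "A2 \<P> \<longleftrightarrow> measure \<P> {\<omega> \<in> space \<P>. \<exists>z. 0 < \<omega> (0, 0) z \<and> \<omega> (0, 0) z < 1} > 0"

definition A3 :: "env measure \<Rightarrow> bool" where
  "A3 \<P> \<longleftrightarrow> \<not> (\<exists>x G. subgroup G integer_group \<and> G \<subset> UNIV \<and>
     (\<Sum>\<^sub>\<infinity>z\<in>G. mean_jump \<P> (x + z)) = 1)"

section \<open>Particles\<close>

text \<open>A configuration \<open>(\<eta>, X)\<close> consists of the initial occupation variables \<open>\<eta> x\<close> and the walks
  \<open>s \<mapsto> X (x, j) s\<close>.\<close>

type_synonym conf = "(int \<Rightarrow> nat) \<times> (int \<times> nat \<Rightarrow> nat \<Rightarrow> int)"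

definition conf_space :: "conf measure" where
  "conf_space = (\<Pi>\<^sub>M x\<in>UNIV. count_space UNIV) \<Otimes>\<^sub>M
     (\<Pi>\<^sub>M i\<in>UNIV. \<Pi>\<^sub>M s\<in>UNIV. count_space UNIV)"

text \<open>The conditional law of the position at time \<open>n\<close> given the positions at the times before \<open>n\<close>,
  for the walk in the environment \<open>\<omega>\<close> started at \<open>x\<close>.\<close>

definition walk_step :: "env \<Rightarrow> int \<Rightarrow> nat \<Rightarrow> (nat \<Rightarrow> int) \<Rightarrow> int measure" where
  "walk_step \<omega> x n X = (case n of
       0 \<Rightarrow> return (count_space UNIV) x
     | Suc s \<Rightarrow> measure_pmf (embed_pmf (\<lambda>y. \<omega> (X s, int s) (y - X s))))"

text \<open>The Ionescu-Tulcea measure of these kernels, on paths.\<close>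

definition walk_law :: "env \<Rightarrow> int \<Rightarrow> (nat \<Rightarrow> int) measure" where
  "walk_law \<omega> x = projective_family.lim UNIV
     (Ionescu_Tulcea.CI (walk_step \<omega> x) (\<lambda>_. count_space UNIV)) (\<lambda>_. count_space UNIV)"

lemma env_spaceD: "\<omega> \<in> space (env_space R) \<Longrightarrow> \<omega> i \<in> space (jump_space R)"
  unfolding env_space_def space_PiM by (rule PiE_mem) auto

lemma pmf_walk_kernel:
  assumes "\<omega> \<in> space (env_space R)"
  shows "pmf (embed_pmf (\<lambda>y. \<omega> i (y - u))) y = \<omega> i (y - u)"
proof (rule pmf_embed_pmf)
  have w: "\<forall>z. 0 \<le> \<omega> i z" "\<forall>z. \<bar>z\<bar> > int R \<longrightarrow> \<omega> i z = 0" "(\<Sum>z\<in>{- int R..int R}. \<omega> i z) = 1"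
    using env_spaceD[OF assms, of i] by (auto simp: jump_space_def space_restrict_space)
  then show "0 \<le> \<omega> i (y - u)" for y by simp
  have "(\<integral>\<^sup>+y. ennreal (\<omega> i (y - u)) \<partial>count_space UNIV)
      = (\<integral>\<^sup>+z. ennreal (\<omega> i z) \<partial>count_space UNIV)"
    by (rule nn_integral_bij_count_space[where g = "\<lambda>y. y - u"])
       (rule bij_betwI[where g = "\<lambda>y. y + u"]; simp)
  also have "\<dots> = (\<Sum>z\<in>{- int R..int R}. ennreal (\<omega> i z))"
    using w by (intro nn_integral_count_space') (auto simp: not_le)
  also have "\<dots> = 1" using w by (subst sum_ennreal) auto
  finally show "(\<integral>\<^sup>+y. ennreal (\<omega> i (y - u)) \<partial>count_space UNIV) = 1" .
qed

lemma Ionescu_Tulcea_walk_step: "Ionescu_Tulcea (walk_step \<omega> x) (\<lambda>_. count_space UNIV)"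
proof (rule Ionescu_Tulcea.intro)
  fix n :: nat and X :: "nat \<Rightarrow> int"
  show "prob_space (walk_step \<omega> x n X)"
    by (auto simp: walk_step_def prob_space_measure_pmf intro!: prob_space_return split: nat.split)
  show "walk_step \<omega> x n \<in> (\<Pi>\<^sub>M i\<in>{0..<n}. count_space UNIV) \<rightarrow>\<^sub>M subprob_algebra (count_space UNIV)"
  proof (cases n)
    case 0 then show ?thesis
      by (auto simp: walk_step_def[abs_def] space_subprob_algebra
          intro!: measurable_const prob_space_imp_subprob_space prob_space_return)
  next
    case (Suc s)
    have "(\<lambda>u. measure_pmf (embed_pmf (\<lambda>y. \<omega> (u, int s) (y - u))))
        \<in> count_space UNIV \<rightarrow>\<^sub>M subprob_algebra (count_space UNIV)"
      by (auto intro!: measure_pmf_in_subprob_space simp: space_subprob_algebra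
            prob_space_imp_subprob_space prob_space_measure_pmf)
    moreover have "(\<lambda>X. X s) \<in> (\<Pi>\<^sub>M i\<in>{0..<n}. count_space UNIV) \<rightarrow>\<^sub>M count_space (UNIV :: int set)"
      using Suc by (intro measurable_component_singleton) auto
    ultimately have "(\<lambda>X. measure_pmf (embed_pmf (\<lambda>y. \<omega> (X s, int s) (y - X s))))
        \<in> (\<Pi>\<^sub>M i\<in>{0..<n}. count_space UNIV) \<rightarrow>\<^sub>M subprob_algebra (count_space UNIV)"
      by (rule measurable_compose[rotated])
    then show ?thesis using Suc by (simp add: walk_step_def[abs_def])
  qed
qed

text \<open>Hence, under \<open>walk_law \<omega> x\<close>, the path is a Markov chain from \<open>x\<close> with the transition probabilities
  \<open>P\<^sup>\<omega>[X (s + 1) = y | X s = u] = \<omega> (u, s) (y - u)\<close>.\<close>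

lemma emeasure_walk_law:
  assumes "\<omega> \<in> space (env_space R)"
  shows "emeasure (walk_law \<omega> x) {X. \<forall>k\<le>m. X k = y k} =
    ennreal (of_bool (y 0 = x) * (\<Prod>k<m. \<omega> (y k, int k) (y (Suc k) - y k)))"
proof -
  let ?M = "\<lambda>_::nat. count_space (UNIV :: int set)"
  interpret Ionescu_Tulcea "walk_step \<omega> x" ?M by (rule Ionescu_Tulcea_walk_step)
  have nn: "0 \<le> \<omega> i z" for i z
    using env_spaceD[OF assms, of i] by (auto simp: jump_space_def space_restrict_space)
  have sing: "{restrict y {0..<n}} \<in> sets (PiM {0..<n} ?M)" for n
  proof -
    have "{restrict y {0..<n}} = PiE {0..<n} (\<lambda>i. {y i})"
      by (auto simp: PiE_singleton restrict_def fun_eq_iff PiE_iff extensional_def)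
    then show ?thesis by (auto intro!: sets_PiM_I_finite)
  qed
  have ist: "\<omega>' \<in> space (PiM {0..<n} ?M) \<Longrightarrow>
     emeasure (eP n \<omega>') {restrict y {0..<Suc n}} =
      indicator {restrict y {0..<n}} \<omega>' * emeasure (walk_step \<omega> x n (restrict y {0..<n})) {y n}" for n \<omega>'
  proof -
    assume h: "\<omega>' \<in> space (PiM {0..<n} ?M)"
    have "(\<lambda>z. \<omega>'(n := z)) -` {restrict y {0..<Suc n}} = (if \<omega>' = restrict y {0..<n} then {y n} else {})"
    proof -
      have "\<omega>' = restrict y {0..<n} \<and> z = y n" if e: "\<omega>'(n := z) = restrict y {0..<Suc n}" for z
      proof
        show "\<omega>' = restrict y {0..<n}"
        proof
          fix k show "\<omega>' k = restrict y {0..<n} k"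
            using fun_cong[OF e, of k] h
            by (cases "k < n") (auto simp: space_PiM PiE_iff extensional_def)
        qed
        show "z = y n" using fun_cong[OF e, of n] by simp
      qed
      moreover have "(restrict y {0..<n})(n := y n) = restrict y {0..<Suc n}"
        by (auto simp: fun_eq_iff restrict_def)
      ultimately show ?thesis by auto
    qed
    then show ?thesis
      by (simp add: emeasure_eP[OF h sing])
  qed
  have C: "emeasure (C 0 (Suc n) (\<lambda>_. undefined)) {restrict y {0..<Suc n}} =
     ennreal (of_bool (y 0 = x) * (\<Prod>k<n. \<omega> (y k, int k) (y (Suc k) - y k)))" for n
  proof -
    have step: "emeasure (C 0 (Suc n) (\<lambda>_. undefined)) {restrict y {0..<Suc n}} =
      emeasure (C 0 n (\<lambda>_. undefined)) {restrict y {0..<n}} *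
        emeasure (walk_step \<omega> x n (restrict y {0..<n})) {y n}" for n
    proof -
      have sp: "space (C 0 n (\<lambda>_. undefined)) = space (PiM {0..<n} ?M)"
        using space_C[of "\<lambda>_. undefined" 0 n] by simp
      have st: "sets (C 0 n (\<lambda>_. undefined)) = sets (PiM {0..<n} ?M)"
        using sets_C[of "\<lambda>_. undefined" 0 n] by simp
      have "emeasure (C 0 (Suc n) (\<lambda>_. undefined)) {restrict y {0..<Suc n}} =
        (\<integral>\<^sup>+\<omega>'. emeasure (eP n \<omega>') {restrict y {0..<Suc n}} \<partial>C 0 n (\<lambda>_. undefined))"
        unfolding C.simps add_0
        by (rule emeasure_bind[OF _ _ sing])
           (simp_all add: sp measurable_cong_sets[OF st] measurable_eP space_PiM PiE_eq_empty_iff)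
      also have "\<dots> = (\<integral>\<^sup>+\<omega>'. emeasure (walk_step \<omega> x n (restrict y {0..<n})) {y n} *
           indicator {restrict y {0..<n}} \<omega>' \<partial>C 0 n (\<lambda>_. undefined))"
        by (rule nn_integral_cong) (simp add: sp ist mult.commute)
      also have "\<dots> = emeasure (walk_step \<omega> x n (restrict y {0..<n})) {y n} *
          emeasure (C 0 n (\<lambda>_. undefined)) {restrict y {0..<n}}"
        by (rule nn_integral_cmult_indicator) (simp add: st sing)
      finally show ?thesis by (simp add: mult.commute)
    qed
    show ?thesis
    proof (induction n)
      case 0
      show ?case
        unfolding step by (auto simp: walk_step_def space_PiM PiE_iff fun_eq_iff indicator_def PiM_empty restrict_def)
    next
      case (Suc n)
      show ?case unfolding step[of "Suc n"] Suc
        by (simp add: walk_step_def emeasure_pmf_single pmf_walk_kernel[OF assms] nn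
            ennreal_mult prod_nonneg)
    qed
  qed
  have "{X. \<forall>k\<le>m. X k = y k} = prod_emb UNIV ?M {0..<Suc m} {restrict y {0..<Suc m}}"
    by (auto simp: prod_emb_def fun_eq_iff restrict_def) (metis less_Suc_eq_le)
  then have "emeasure (walk_law \<omega> x) {X. \<forall>k\<le>m. X k = y k} = emeasure (CI {0..<Suc m}) {restrict y {0..<Suc m}}"
    unfolding walk_law_def using lim[OF _ sing] by simp
  also have "\<dots> = emeasure (C 0 (Suc m) (\<lambda>_. undefined)) {restrict y {0..<Suc m}}"
    by (subst emeasure_CI[OF _ sing, of _ "Suc m"]) (auto simp: prod_emb_id space_PiM PiE_iff)
  finally show ?thesis using C by simp
qed

text \<open>The occupation numbers have the law \<open>\<Otimes>\<^sub>x \<mu> \<omega> x\<close>.\<close>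

definition quenched :: "(env \<Rightarrow> int \<Rightarrow> nat measure) \<Rightarrow> env \<Rightarrow> conf measure" where
  "quenched \<mu> \<omega> = (\<Pi>\<^sub>M x\<in>UNIV. \<mu> \<omega> x) \<Otimes>\<^sub>M (\<Pi>\<^sub>M (x, j)\<in>UNIV. walk_law \<omega> x)"

text \<open>The averaged law is kept jointly with the environment, since \<open>E\<^sup>\<omega>[Y\<^sub>n]\<close> depends on \<open>\<omega>\<close>.\<close>

definition averaged :: "env measure \<Rightarrow> (env \<Rightarrow> int \<Rightarrow> nat measure) \<Rightarrow> (env \<times> conf) measure" where
  "averaged \<P> \<mu> = \<P> \<bind> (\<lambda>\<omega>. distr (quenched \<mu> \<omega>) (\<P> \<Otimes>\<^sub>M conf_space) (Pair \<omega>))"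

definition B1 :: "nat \<Rightarrow> (env \<Rightarrow> int \<Rightarrow> nat measure) \<Rightarrow> bool" where
  "B1 R \<mu> \<longleftrightarrow>
     (\<forall>x. (\<lambda>\<omega>. \<mu> \<omega> x) \<in> past_space R \<rightarrow>\<^sub>M prob_algebra (count_space UNIV)) \<and>
     (\<forall>x. \<forall>\<omega>\<in>space (env_space R). \<mu> \<omega> x = \<mu> (shift x 0 \<omega>) 0)"

definition B2 :: "env measure \<Rightarrow> (env \<Rightarrow> int \<Rightarrow> nat measure) \<Rightarrow> bool" where
  "B2 \<P> \<mu> \<longleftrightarrow> integrable (averaged \<P> \<mu>) (\<lambda>(\<omega>, \<eta>, X). (real (\<eta> 0))\<^sup>2)"

section \<open>Parameters and the current\<close>

definition velocity :: "env measure \<Rightarrow> real" where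
  "velocity \<P> = (\<Sum>\<^sub>\<infinity>x. real_of_int x * mean_jump \<P> x)"

definition jump_var :: "env measure \<Rightarrow> real" where
  "jump_var \<P> = (\<Sum>\<^sub>\<infinity>x. (real_of_int x)\<^sup>2 * mean_jump \<P> x) - (velocity \<P>)\<^sup>2"

definition rho0 :: "env measure \<Rightarrow> (env \<Rightarrow> int \<Rightarrow> nat measure) \<Rightarrow> real" where
  "rho0 \<P> \<mu> = (\<integral>(\<omega>, \<eta>, X). real (\<eta> 0) \<partial>averaged \<P> \<mu>)"

definition quenched_var :: "(env \<Rightarrow> int \<Rightarrow> nat measure) \<Rightarrow> env \<Rightarrow> (conf \<Rightarrow> real) \<Rightarrow> real" where
  "quenched_var \<mu> \<omega> f = (\<integral>c. (f c - (\<integral>c'. f c' \<partial>quenched \<mu> \<omega>))\<^sup>2 \<partial>quenched \<mu> \<omega>)"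

definition init_var :: "env measure \<Rightarrow> (env \<Rightarrow> int \<Rightarrow> nat measure) \<Rightarrow> real" where
  "init_var \<P> \<mu> = (\<integral>\<omega>. quenched_var \<mu> \<omega> (\<lambda>(\<eta>, X). real (\<eta> 0)) \<partial>\<P>)"

text \<open>Jumps are bounded, so almost surely only finitely many terms of the two sums are nonzero.\<close>

definition current :: "real \<Rightarrow> nat \<Rightarrow> real \<Rightarrow> real \<Rightarrow> conf \<Rightarrow> real" where
  "current v n t r = (\<lambda>(\<eta>, X).
     (\<Sum>\<^sub>\<infinity>x\<in>{0<..}. \<Sum>j\<in>{1..\<eta> x}.
        of_bool (X (x, j) (nat \<lfloor>real n * t\<rfloor>) \<le> \<lfloor>real n * v * t\<rfloor> + \<lfloor>r * sqrt (real n)\<rfloor>)) -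
     (\<Sum>\<^sub>\<infinity>x\<in>{..0}. \<Sum>j\<in>{1..\<eta> x}.
        of_bool (X (x, j) (nat \<lfloor>real n * t\<rfloor>) > \<lfloor>real n * v * t\<rfloor> + \<lfloor>r * sqrt (real n)\<rfloor>)))"

definition current_bar ::
    "env measure \<Rightarrow> (env \<Rightarrow> int \<Rightarrow> nat measure) \<Rightarrow> nat \<Rightarrow> real \<Rightarrow> real \<Rightarrow> env \<Rightarrow> conf \<Rightarrow> real" where
  "current_bar \<P> \<mu> n t r \<omega> c = real n powr (-1/4) *
     (current (velocity \<P>) n t r c - (\<integral>c'. current (velocity \<P>) n t r c' \<partial>quenched \<mu> \<omega>))"

section \<open>The limit process\<close>

text \<open>The subscript \<open>a = \<nu>\<^sup>2\<close> of \<open>\<phi>\<close>, \<open>\<Phi>\<close>, \<open>\<Psi>\<close> is the variance, while \<^const>\<open>normal_density\<close> takes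
  the standard deviation.\<close>

definition gphi :: "real \<Rightarrow> real \<Rightarrow> real" where
  "gphi a x = normal_density 0 (sqrt a) x"

definition gPhi :: "real \<Rightarrow> real \<Rightarrow> real" where
  "gPhi a x = set_lebesgue_integral lborel {..x} (gphi a)"

definition gPsi :: "real \<Rightarrow> real \<Rightarrow> real" where
  "gPsi a x = (if a = 0 then max (- x) 0 else a * gphi a x - x * (1 - gPhi a x))"

definition Gamma1 :: "real \<Rightarrow> real \<times> real \<Rightarrow> real \<times> real \<Rightarrow> real" where
  "Gamma1 \<sigma>2 = (\<lambda>(s, q) (t, r). gPsi (\<sigma>2 * (t + s)) (r - q) - gPsi (\<sigma>2 * \<bar>t - s\<bar>) (r - q))"

definition Gamma2 :: "real \<Rightarrow> real \<times> real \<Rightarrow> real \<times> real \<Rightarrow> real" where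
  "Gamma2 \<sigma>2 = (\<lambda>(s, q) (t, r).
     gPsi (\<sigma>2 * s) (- q) + gPsi (\<sigma>2 * t) r - gPsi (\<sigma>2 * (t + s)) (r - q))"

definition normal_law :: "real \<Rightarrow> real \<Rightarrow> real measure" where
  "normal_law m s = (if s = 0 then return borel m else density lborel (normal_density m s))"

text \<open>All finite linear combinations are normal, possibly degenerate.\<close>

definition gaussian_process :: "'z measure \<Rightarrow> 'i set \<Rightarrow> ('i \<Rightarrow> 'z \<Rightarrow> real) \<Rightarrow> bool" where
  "gaussian_process M I Z \<longleftrightarrow> prob_space M \<and> (\<forall>i\<in>I. Z i \<in> borel_measurable M) \<and>
     (\<forall>J c. finite J \<and> J \<subseteq> I \<longrightarrow>
        (\<exists>m s. 0 \<le> s \<and> distr M borel (\<lambda>z. \<Sum>i\<in>J. c i * Z i z) = normal_law m s))"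

definition limit_process ::
    "real \<Rightarrow> real \<Rightarrow> real \<Rightarrow> 'z measure \<Rightarrow> (real \<times> real \<Rightarrow> 'z \<Rightarrow> real) \<Rightarrow> bool" where
  "limit_process \<sigma>2 \<rho> \<sigma>02 M Z \<longleftrightarrow> gaussian_process M ({0..} \<times> UNIV) Z \<and>
     (\<forall>i\<in>{0..} \<times> UNIV. (\<integral>z. Z i z \<partial>M) = 0) \<and>
     (\<forall>i\<in>{0..} \<times> UNIV. \<forall>j\<in>{0..} \<times> UNIV.
        (\<integral>z. Z i z * Z j z \<partial>M) = \<rho> * Gamma1 \<sigma>2 i j + \<sigma>02 * Gamma2 \<sigma>2 i j)"

section \<open>Convergence in distribution\<close>

text \<open>The library's \<^const>\<open>weak_conv_m\<close> is for measures on \<real> only.\<close>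

definition weak_conv_vec :: "(nat \<Rightarrow> (real ^ 'n) measure) \<Rightarrow> (real ^ 'n) measure \<Rightarrow> bool" where
  "weak_conv_vec L L' \<longleftrightarrow> (\<forall>f :: real ^ 'n \<Rightarrow> real. continuous_on UNIV f \<and> bounded (range f) \<longrightarrow>
     (\<lambda>n. \<integral>x. f x \<partial>L n) \<longlonglongrightarrow> (\<integral>x. f x \<partial>L'))"

end

theory Submission
  imports Defs "HOL-Real_Asymp.Real_Asymp"
begin

text \<open>
A particle that starts at \<open>x\<close> and sits at \<open>y\<close> at the time in question contributes
\<open>1{x > 0} - 1{y > a}\<close> to the current through the level \<open>a\<close>, with the right sign on both sides of the
origin (\<open>side\<close>). Hence \<open>\<Sum>\<^sub>i \<theta>\<^sub>i Y\<^sub>n(t\<^sub>i, r\<^sub>i)\<close> is a sum over the sites \<open>x\<close> of compound sums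
\<open>\<Sum>j \<le> \<eta>(x). W(X\<^sup>x\<^sup>,\<^sup>j)\<close> of one path functional \<open>W\<close> bounded by \<open>\<Sum>\<^sub>i |\<theta>\<^sub>i|\<close>
(\<open>sum_current_bar_eq_sum_site_dev\<close>). Once \<open>\<omega>\<close> is fixed, the sites are independent, so the quenched
characteristic function is a product over the sites, and the Lindeberg comparison of each factor with
\<open>exp (- v\<^sub>x / 2)\<close> gives (\<open>quenched_char_vs_gauss\<close>)
\<open>E\<^sup>\<omega> exp (i Y) \<approx> exp (- V\<^sub>n(\<omega>) / 2)\<close>, where by the variance formula for compound sums
\<open>V\<^sub>n(\<omega>) = n\<^sup>-\<^sup>1\<^sup>/\<^sup>2 \<Sum>\<^sub>x m\<^sub>x Var\<^sup>\<omega>(W | x) + s\<^sub>x (E\<^sup>\<omega>(W | x))\<^sup>2\<close>, with \<open>m\<^sub>x\<close> and \<open>s\<^sub>x\<close> the quenched mean and variance of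
\<open>\<eta>(x)\<close>. Everything therefore reduces to the convergence of \<open>V\<^sub>n\<close> in \<open>L\<^sup>1\<close> to the variance of
\<open>\<Sum>\<^sub>i \<theta>\<^sub>i Z(t\<^sub>i, r\<^sub>i)\<close> (\<open>total_var_limit\<close>). Three facts give it.

\<^item> A quenched expectation of a path functional with bounded differences is close to its average over
the environment (\<open>quenched_concentration\<close>): two walks in one environment differ from two independent
walks only through the steps that they take from a common site, and they meet of order \<open>\<surd>n\<close> times. The
functional \<open>W\<close> is an indicator and has no bounded differences, but it is close to a function with slope
\<open>1/h\<close>, up to paths that end within \<open>h\<close> of the level; after summing over \<open>x\<close>, and dividing by \<open>\<surd>n\<close>, both errors vanish
for suitable \<open>h\<close> (\<open>smoothing_limit\<close>).

\<^item> The occupation laws depend on the past of the environment and the walks on its future, so the two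
are independent, and a weighted law of large numbers replaces \<open>m\<^sub>x\<close> and \<open>s\<^sub>x\<close> by \<open>\<rho>\<^sub>0\<close> and \<open>\<sigma>\<^sub>0\<^sup>2\<close>
(\<open>weighted_LLN\<close>).

\<^item> For the averaged walk, the sum over all \<open>x\<close> of a product of two crossing indicators is a combination
of three positive parts of displacements (\<open>sum_side_product\<close>), each of which the central limit theorem
turns into a value of \<open>\<Psi>\<close> (\<open>plus_part_lin_tendsto\<close>). Both factors along the same walk produce
\<open>\<Gamma>\<^sub>1 + \<Gamma>\<^sub>2\<close>, with time parameter \<open>|t - s|\<close>; along two independent walks they produce \<open>\<Gamma>\<^sub>2\<close>, with time
parameter \<open>t + s\<close>.

Averaging the first assertion over the environment gives convergence of the characteristic functions
under the averaged law, and the continuity theorem in \<open>\<real>\<^sup>N\<close> (\<open>levy_continuity_vec\<close>) turns this into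
convergence in distribution.
\<close>

section \<open>Convergence of characteristic functions in several dimensions\<close>

lemma tendsto_if_uniformly_approximable:
  fixes u :: "nat \<Rightarrow> real"
  assumes "\<And>e. e > 0 \<Longrightarrow> \<exists>v v'. v \<longlonglongrightarrow> v' \<and> (\<forall>\<^sub>F n in sequentially. \<bar>u n - v n\<bar> \<le> e) \<and> \<bar>u' - v'\<bar> \<le> e"
  shows "u \<longlonglongrightarrow> u'"
proof (rule tendstoI)
  fix e :: real assume "e > 0"
  then obtain v v' where g: "v \<longlonglongrightarrow> v'" "\<forall>\<^sub>F n in sequentially. \<bar>u n - v n\<bar> \<le> e/4" "\<bar>u' - v'\<bar> \<le> e/4"
    using assms[of "e/4"] by auto
  have "\<forall>\<^sub>F n in sequentially. dist (v n) v' < e/4"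
    using g(1) \<open>e > 0\<close> by (intro tendstoD) auto
  with g(2) show "\<forall>\<^sub>F n in sequentially. dist (u n) u' < e"
  proof eventually_elim
    case (elim n)
    then show ?case using g(3) \<open>e > 0\<close> unfolding dist_real_def abs_le_iff abs_less_iff by linarith
  qed
qed

lemma tendsto_zero_if_small:
  fixes u :: "nat \<Rightarrow> real"
  assumes "\<And>n. 0 \<le> u n"
    and "\<And>e. e > 0 \<Longrightarrow> \<exists>w. w \<longlonglongrightarrow> 0 \<and> (\<forall>\<^sub>F n in sequentially. u n \<le> w n + e)"
  shows "u \<longlonglongrightarrow> 0"
proof (rule order_tendstoI)
  fix a :: real assume "a < 0"
  then have "a < u n" for n using assms(1)[of n] by linarith
  then show "\<forall>\<^sub>F n in sequentially. a < u n" by simp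
next
  fix a :: real assume a: "0 < a"
  then obtain w where w: "w \<longlonglongrightarrow> 0" "\<forall>\<^sub>F n in sequentially. u n \<le> w n + a / 2" using assms(2)[of "a / 2"] by auto
  have "\<forall>\<^sub>F n in sequentially. w n < a / 2" using w(1) a by (intro order_tendstoD) auto
  with w(2) show "\<forall>\<^sub>F n in sequentially. u n < a" by eventually_elim auto
qed

text \<open>The trigonometric polynomials form an algebra, and convergence of characteristic functions is
convergence of the integrals of its members. The functions \<open>sin (l x\<^sub>i)\<close> belong to it, hence so do all
polynomials in them.\<close>

definition trig :: "((real^'n) \<Rightarrow> complex) \<Rightarrow> bool" where
  "trig h \<longleftrightarrow> (\<exists>F c. finite F \<and> h = (\<lambda>x. \<Sum>\<theta>\<in>F. c \<theta> * iexp (\<theta> \<bullet> x)))"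

lemma trig_exp: "trig (\<lambda>x. a * iexp (\<theta> \<bullet> x))"
  unfolding trig_def by (rule exI[of _ "{\<theta>}"], rule exI[of _ "\<lambda>_. a"]) auto

lemma trig_const: "trig (\<lambda>x. a)"
  using trig_exp[of a 0] by simp

lemma trig_add: assumes "trig g" "trig h" shows "trig (\<lambda>x. g x + h x)"
proof -
  obtain F c where F: "finite F" "g = (\<lambda>x. \<Sum>\<theta>\<in>F. c \<theta> * iexp (\<theta> \<bullet> x))"
    using assms(1) unfolding trig_def by blast
  obtain G d where G: "finite G" "h = (\<lambda>x. \<Sum>\<theta>\<in>G. d \<theta> * iexp (\<theta> \<bullet> x))"
    using assms(2) unfolding trig_def by blast
  let ?c = "\<lambda>\<theta>. (if \<theta> \<in> F then c \<theta> else 0) + (if \<theta> \<in> G then d \<theta> else 0)"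
  have "g x + h x = (\<Sum>\<theta>\<in>F \<union> G. ?c \<theta> * iexp (\<theta> \<bullet> x))" for x
  proof -
    have "g x = (\<Sum>\<theta>\<in>F \<union> G. (if \<theta> \<in> F then c \<theta> else 0) * iexp (\<theta> \<bullet> x))"
      using F G unfolding F(2) by (intro sum.mono_neutral_cong_left) auto
    moreover have "h x = (\<Sum>\<theta>\<in>F \<union> G. (if \<theta> \<in> G then d \<theta> else 0) * iexp (\<theta> \<bullet> x))"
      using F G unfolding G(2) by (intro sum.mono_neutral_cong_left) auto
    ultimately show ?thesis by (simp add: sum.distrib distrib_right)
  qed
  then show ?thesis unfolding trig_def using F(1) G(1) by (intro exI[of _ "F \<union> G"] exI[of _ ?c]) auto
qed

lemma trig_sum: "finite A \<Longrightarrow> (\<And>a. a \<in> A \<Longrightarrow> trig (g a)) \<Longrightarrow> trig (\<lambda>x. \<Sum>a\<in>A. g a x)"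
  by (induction A rule: finite_induct) (auto intro: trig_const trig_add)

lemma trig_mult: assumes "trig g" "trig h" shows "trig (\<lambda>x. g x * h x)"
proof -
  obtain F c where F: "finite F" "g = (\<lambda>x. \<Sum>\<theta>\<in>F. c \<theta> * iexp (\<theta> \<bullet> x))"
    using assms(1) unfolding trig_def by blast
  obtain G d where G: "finite G" "h = (\<lambda>x. \<Sum>\<theta>\<in>G. d \<theta> * iexp (\<theta> \<bullet> x))"
    using assms(2) unfolding trig_def by blast
  have "g x * h x = (\<Sum>\<theta>\<in>F. \<Sum>\<eta>\<in>G. (c \<theta> * d \<eta>) * iexp ((\<theta> + \<eta>) \<bullet> x))" for x
    unfolding F(2) G(2) sum_product
    by (intro sum.cong refl) (simp add: exp_add[symmetric] inner_add_left algebra_simps)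
  then have *: "(\<lambda>x. g x * h x) = (\<lambda>x. \<Sum>\<theta>\<in>F. \<Sum>\<eta>\<in>G. (c \<theta> * d \<eta>) * iexp ((\<theta> + \<eta>) \<bullet> x))"
    by auto
  show ?thesis unfolding * by (intro trig_sum F G trig_exp)
qed

lemma trig_sin: "trig (\<lambda>x :: real^'n. complex_of_real (sin (l * x $ i)))"
proof -
  have e: "complex_of_real (sin y) = (-\<i>/2) * iexp y + (\<i>/2) * iexp (- y)" for y
    by (auto simp: complex_eq_iff Re_exp Im_exp)
  have "l * x $ i = axis i l \<bullet> x" "- (l * x $ i) = axis i (-l) \<bullet> x" for x :: "real^'n"
    by (simp_all add: inner_axis' )
  then show ?thesis
    unfolding e by (simp only:) (intro trig_add trig_exp)
qed

lemma trig_real_polynomial: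
  fixes p :: "real^'n \<Rightarrow> real"
  assumes "real_polynomial_function p"
  shows "trig (\<lambda>x. complex_of_real (p (\<chi> i. sin (l * x $ i))))"
  using assms
proof (induction rule: real_polynomial_function.induct)
  case (linear f)
  interpret bounded_linear f by fact
  have "f y = (\<Sum>i\<in>UNIV. y $ i * f (axis i 1))" for y
  proof -
    have "y = (\<Sum>i\<in>UNIV. (y $ i) *\<^sub>R axis i 1)"
      using basis_expansion[of y] by (simp add: scalar_mult_eq_scaleR)
    then have "f y = f (\<Sum>i\<in>UNIV. (y $ i) *\<^sub>R axis i 1)" by (rule arg_cong)
    then show ?thesis by (simp only: sum scaleR real_scaleR_def)
  qed
  from this[of "\<chi> i. sin (l * x $ i)" for x]
  have eq: "complex_of_real (f (\<chi> i. sin (l * x $ i))) =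
     (\<Sum>i\<in>UNIV. complex_of_real (sin (l * x $ i)) * complex_of_real (f (axis i 1)))" for x :: "real^'n"
    by (simp only: of_real_sum of_real_mult vec_lambda_beta)
  show ?case unfolding eq by (auto intro!: trig_sum trig_mult trig_sin trig_const)
qed (auto intro: trig_const trig_add trig_mult)

lemma trig_continuous: "trig h \<Longrightarrow> continuous_on UNIV h"
  unfolding trig_def by (auto intro!: continuous_intros)

lemma trig_bounded: assumes "trig h" shows "\<exists>B. \<forall>x. norm (h x) \<le> B"
proof -
  obtain F c where F: "finite F" "h = (\<lambda>x. \<Sum>\<theta>\<in>F. c \<theta> * iexp (\<theta> \<bullet> x))"
    using assms(1) unfolding trig_def by blast
  have "norm (h x) \<le> (\<Sum>\<theta>\<in>F. norm (c \<theta>))" for x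
    unfolding F(2) by (rule order_trans[OF norm_sum]) (simp add: norm_mult)
  then show ?thesis by blast
qed

lemma integrable_iexp_inner:
  fixes M :: "(real^'n) measure"
  assumes "prob_space M" "sets M = sets borel"
  shows "integrable M (\<lambda>x. iexp (\<theta> \<bullet> x))"
proof -
  interpret prob_space M by fact
  show ?thesis using assms(2)
    by (intro integrable_const_bound[of _ 1]) (auto simp: measurable_cong_sets[OF assms(2) refl])
qed

lemma trig_integral_tendsto:
  fixes L :: "nat \<Rightarrow> (real^'n) measure"
  assumes L: "\<And>n. prob_space (L n)" "\<And>n. sets (L n) = sets borel"
    and L': "prob_space L'" "sets L' = sets borel"
    and char: "\<And>\<theta>. (\<lambda>n. \<integral>x. iexp (\<theta> \<bullet> x) \<partial>L n) \<longlonglongrightarrow> (\<integral>x. iexp (\<theta> \<bullet> x) \<partial>L')"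
    and "trig h"
  shows "(\<lambda>n. \<integral>x. h x \<partial>L n) \<longlonglongrightarrow> (\<integral>x. h x \<partial>L')"
proof -
  obtain F c where F: "finite F" "h = (\<lambda>x. \<Sum>\<theta>\<in>F. c \<theta> * iexp (\<theta> \<bullet> x))"
    using assms unfolding trig_def by blast
  have "(\<integral>x. h x \<partial>M) = (\<Sum>\<theta>\<in>F. c \<theta> * (\<integral>x. iexp (\<theta> \<bullet> x) \<partial>M))"
    if "prob_space M" "sets M = sets borel" for M
    unfolding F(2) using integrable_iexp_inner[OF that] by (subst Bochner_Integration.integral_sum) auto
  then show ?thesis using L L' by (auto intro!: tendsto_sum tendsto_mult char)
qed

lemma (in real_distribution) exists_tail_bound:
  assumes "e > 0" shows "\<exists>K>0. prob {x. K < \<bar>x\<bar>} < e"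
proof -
  have "(\<lambda>k. prob {x. real k < \<bar>x\<bar>}) \<longlonglongrightarrow> prob (\<Inter>k. {x. real k < \<bar>x\<bar>})"
    by (rule finite_Lim_measure_decseq) (auto simp: decseq_def intro!: borel_measurable_le)
  also have "(\<Inter>k. {x::real. real k < \<bar>x\<bar>}) = {}" using real_arch_simple not_le by blast
  finally have "(\<lambda>k. prob {x. real k < \<bar>x\<bar>}) \<longlonglongrightarrow> 0" by simp
  then have "\<forall>\<^sub>F k in sequentially. prob {x. real k < \<bar>x\<bar>} < e \<and> k > 0"
    using assms by (intro eventually_conj order_tendstoD eventually_gt_at_top) auto
  then obtain k where "prob {x. real k < \<bar>x\<bar>} < e" "k > 0"
    by (auto simp: eventually_sequentially)
  then show ?thesis by (intro exI[of _ "real k"]) auto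
qed

lemma weak_conv_m_tight:
  assumes M: "\<And>n. real_distribution (M n)" and M': "real_distribution M'" and w: "weak_conv_m M M'" and "e > 0"
  shows "\<exists>K>0. (\<forall>\<^sub>F n in sequentially. measure (M n) {x. K < \<bar>x\<bar>} < e) \<and> measure M' {x. K < \<bar>x\<bar>} < e"
proof -
  interpret M': real_distribution M' by fact
  obtain K where K: "K > 0" "measure M' {x. K < \<bar>x\<bar>} < e" using M'.exists_tail_bound[OF \<open>e > 0\<close>] by auto
  define h :: "real \<Rightarrow> real" where "h x = min 1 (max 0 (\<bar>x\<bar> - K))" for x
  have h: "isCont h x" "\<bar>h x\<bar> \<le> 1" for x unfolding h_def by (auto intro!: continuous_intros)
  have [measurable]: "h \<in> borel_measurable borel" unfolding h_def by measurable
  have conv: "(\<lambda>n. integral\<^sup>L (M n) h) \<longlonglongrightarrow> integral\<^sup>L M' h"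
    by (rule weak_conv_imp_integral_bdd_continuous_conv[OF M M' w]) (use h in auto)
  have b1: "measure N {x. K + 1 < \<bar>x\<bar>} \<le> integral\<^sup>L N h" and b2: "integral\<^sup>L N h \<le> measure N {x. K < \<bar>x\<bar>}"
    if "real_distribution N" for N
  proof -
    interpret N: real_distribution N by fact
    have hi: "integrable N h" by (rule N.integrable_const_bound[of _ 1]) (use h in auto)
    have "measure N {x. K + 1 < \<bar>x\<bar>} = (\<integral>x. indicator {x. K + 1 < \<bar>x\<bar>} x \<partial>N)" by simp
    also have "\<dots> \<le> integral\<^sup>L N h"
      by (rule integral_mono)
        (auto simp: hi h_def split: split_indicator intro!: integrable_real_indicator N.emeasure_finite[THEN less_top[THEN iffD1]])
    finally show "measure N {x. K + 1 < \<bar>x\<bar>} \<le> integral\<^sup>L N h" .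
    have "integral\<^sup>L N h \<le> (\<integral>x. indicator {x. K < \<bar>x\<bar>} x \<partial>N)"
      by (rule integral_mono)
        (auto simp: hi h_def split: split_indicator intro!: integrable_real_indicator N.emeasure_finite[THEN less_top[THEN iffD1]])
    then show "integral\<^sup>L N h \<le> measure N {x. K < \<bar>x\<bar>}" by simp
  qed
  have "\<forall>\<^sub>F n in sequentially. integral\<^sup>L (M n) h < e"
    using b2[OF M'] K(2) by (intro order_tendstoD(2)[OF conv]) auto
  then have "\<forall>\<^sub>F n in sequentially. measure (M n) {x. K + 1 < \<bar>x\<bar>} < e"
    by eventually_elim (use b1[OF M] in \<open>auto intro: le_less_trans\<close>)
  moreover have "measure M' {x. K + 1 < \<bar>x\<bar>} < e" using b1[OF M'] b2[OF M'] K(2) by linarith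
  ultimately show ?thesis using K(1) by (intro exI[of _ "K + 1"]) auto
qed

text \<open>The continuity theorem on the line, applied to the marginals, gives tightness. On a large cube a
bounded continuous \<open>f\<close> is, by the Weierstrass theorem, uniformly close to a polynomial in the
\<open>sin (l x\<^sub>i)\<close>, whose integrals converge. This polynomial is bounded on the whole space, so tightness
also controls the error outside of the cube.\<close>

theorem levy_continuity_vec:
  fixes L :: "nat \<Rightarrow> (real^'n) measure"
  assumes L: "\<And>n. prob_space (L n)" "\<And>n. sets (L n) = sets borel"
    and L': "prob_space L'" "sets L' = sets borel"
    and char: "\<And>\<theta>. (\<lambda>n. \<integral>x. iexp (\<theta> \<bullet> x) \<partial>L n) \<longlonglongrightarrow> (\<integral>x. iexp (\<theta> \<bullet> x) \<partial>L')"
  shows "weak_conv_vec L L'"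
  unfolding weak_conv_vec_def
proof (intro allI impI)
  fix f :: "real^'n \<Rightarrow> real" assume f: "continuous_on UNIV f \<and> bounded (range f)"
  then obtain B where B: "\<And>x. \<bar>f x\<bar> \<le> B" "B > 0" by (auto simp: bounded_pos)
  have fm[measurable]: "f \<in> borel_measurable borel" using f by (auto intro: borel_measurable_continuous_onI)
  have meas: "g \<in> borel_measurable (L n)" "g \<in> borel_measurable L'" if "g \<in> borel_measurable borel" for g :: "real^'n \<Rightarrow> real" and n
    using that by (simp_all add: measurable_cong_sets[OF L(2) refl] measurable_cong_sets[OF L'(2) refl])
  have proj: "(\<lambda>x. x $ i) \<in> borel_measurable (L n)" "(\<lambda>x. x $ i) \<in> borel_measurable L'" for i n
    by (rule meas, measurable)+
  define M where "M i n = distr (L n) borel (\<lambda>x. x $ i)" for i n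
  define M' where "M' i = distr L' borel (\<lambda>x. x $ i)" for i
  have rM: "real_distribution (M i n)" and rM': "real_distribution (M' i)" for i n
    unfolding M_def M'_def using L L' proj by (auto intro!: prob_space.real_distribution_distr)
  have "weak_conv_m (M i) (M' i)" for i
  proof (rule levy_continuity[OF rM rM'])
    fix t
    have *: "char (distr K borel (\<lambda>x. x $ i)) t = (\<integral>x. iexp (axis i t \<bullet> x) \<partial>K)"
      if "sets K = sets borel" for K :: "(real^'n) measure"
    proof -
      have [measurable]: "(\<lambda>x. x $ i) \<in> borel_measurable K"
        by (subst measurable_cong_sets[OF that refl]) measurable
      show ?thesis
        unfolding char_def by (subst integral_distr) (auto simp: inner_axis')
    qed
    show "(\<lambda>n. char (M i n) t) \<longlonglongrightarrow> char (M' i) t"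
      unfolding M_def M'_def *[OF L(2)] *[OF L'(2)] by (rule char)
  qed
  note tight = weak_conv_m_tight[OF rM rM' this]
  show "(\<lambda>n. integral\<^sup>L (L n) f) \<longlonglongrightarrow> integral\<^sup>L L' f"
  proof (rule tendsto_if_uniformly_approximable)
    fix e :: real assume "e > 0"
    define N where "N = real CARD('n)"
    have N: "N > 0" unfolding N_def by simp
    \<comment> \<open>\<open>d\<close> bounds the approximation error inside the cube and the tail of each of the \<open>N\<close> marginals
       outside; there \<open>f\<close> and its approximation differ by at most \<open>2 B + d\<close>.\<close>
    define d where "d = e / (1 + 2 * (2 * B) * N)"
    have d: "d > 0" unfolding d_def using \<open>e > 0\<close> B(2) N by (auto intro!: divide_pos_pos add_pos_nonneg)
    have "\<forall>i. \<exists>K. K > 0 \<and> (\<forall>\<^sub>F n in sequentially. measure (M i n) {x. K < \<bar>x\<bar>} < d) \<and> measure (M' i) {x. K < \<bar>x\<bar>} < d"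
      by (rule allI) (rule tight[OF d])
    from choice[OF this] obtain K0 where K0: "\<And>i. K0 i > 0" "\<And>i. \<forall>\<^sub>F n in sequentially. measure (M i n) {x. K0 i < \<bar>x\<bar>} < d"
       "\<And>i. measure (M' i) {x. K0 i < \<bar>x\<bar>} < d" by auto
    define K where "K = Max (range K0)"
    have K0_le: "K0 i \<le> K" for i unfolding K_def by simp
    have "K > 0" by (rule less_le_trans[OF K0(1) K0_le])
    \<comment> \<open>For \<open>|x\<^sub>i| \<le> K\<close> the phase \<open>l x\<^sub>i\<close> stays in the interval on which \<open>arcsin\<close> inverts \<open>sin\<close>.\<close>
    define l where "l = pi / 2 / K"
    have l: "l > 0" "l * K = pi / 2" using \<open>K > 0\<close> by (auto simp: l_def)
    define T where "T = {y :: real^'n. \<forall>i. \<bar>y $ i\<bar> \<le> 1}"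
    have T: "T = cbox (\<chi> i. -1) (\<chi> i. 1)"
    proof -
      have "(\<bar>a\<bar> \<le> 1) = (-1 \<le> a \<and> a \<le> 1)" for a :: real by auto
      then show ?thesis by (simp add: T_def set_eq_iff mem_box_cart)
    qed
    define F where "F y = f (\<chi> i. arcsin (y $ i) / l)" for y
    have FB: "\<bar>F y\<bar> \<le> B" for y unfolding F_def using B by auto
    have "continuous_on T (\<lambda>y. (\<chi> i. arcsin (y $ i) / l))"
    proof (rule continuous_on_vec_lambda)
      fix i
      have "continuous_on T (\<lambda>y. arcsin (y $ i))"
        by (rule continuous_on_arcsin) (auto simp: T mem_box_cart intro: continuous_on_component continuous_on_id)
      then show "continuous_on T (\<lambda>y. arcsin (y $ i) / l)"
        using l by (intro continuous_on_divide continuous_on_const) auto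
    qed
    from continuous_on_compose2[OF conjunct1[OF f] this subset_UNIV]
    have Fc: "continuous_on T F" unfolding F_def .
    have "compact T" unfolding T by (rule compact_cbox)
    from Stone_Weierstrass_real_polynomial_function[OF this Fc d]
    obtain p where p: "real_polynomial_function p" "\<And>y. y \<in> T \<Longrightarrow> \<bar>F y - p y\<bar> < d"
      by auto
    define g where "g x = p (\<chi> i. sin (l * x $ i))" for x
    have trg: "trig (\<lambda>x. complex_of_real (g x))" unfolding g_def by (rule trig_real_polynomial[OF p(1)])
    have "(\<lambda>n. \<integral>x. complex_of_real (g x) \<partial>L n) \<longlonglongrightarrow> (\<integral>x. complex_of_real (g x) \<partial>L')"
      by (rule trig_integral_tendsto[OF L L' char trg])
    then have conv: "(\<lambda>n. \<integral>x. g x \<partial>L n) \<longlonglongrightarrow> (\<integral>x. g x \<partial>L')"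
      by (simp add: tendsto_of_real_iff)
    have gc: "continuous_on UNIV g"
      using continuous_on_Re[OF trig_continuous[OF trg]] by simp
    have gm: "g \<in> borel_measurable borel" by (rule borel_measurable_continuous_onI[OF gc])
    obtain G where G: "\<And>x. \<bar>g x\<bar> \<le> G" using trig_bounded[OF trg] by auto
    have diff: "\<bar>f x - g x\<bar> \<le> d + (2 * B) * (\<Sum>i\<in>UNIV. indicator {x. K0 i < \<bar>x\<bar>} (x $ i))" for x
    proof -
      let ?s = "\<chi> i. sin (l * x $ i)"
      have "?s \<in> T" by (simp add: T_def)
      from p(2)[OF this] have 1: "\<bar>F ?s - g x\<bar> < d" unfolding g_def .
      show ?thesis
      proof (cases "\<forall>i. \<bar>x $ i\<bar> \<le> K0 i")
        case True
        have "arcsin (sin (l * x $ i)) = l * x $ i" for i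
        proof -
          have "\<bar>x $ i\<bar> \<le> K" using True K0_le[of i] by (auto intro: order_trans)
          then have "l * \<bar>x $ i\<bar> \<le> pi / 2" using l using mult_left_mono[of "\<bar>x $ i\<bar>" K l] by linarith
          then have "\<bar>l * x $ i\<bar> \<le> pi/2" using l by (simp add: abs_mult)
          then show ?thesis by (intro arcsin_sin) (auto simp: abs_le_iff)
        qed
        then have "F ?s = f x" unfolding F_def using l by simp
        with 1 show ?thesis using B(2) by (auto intro!: add_increasing2 mult_nonneg_nonneg sum_nonneg)
      next
        case False
        then obtain i where i: "K0 i < \<bar>x $ i\<bar>" by (auto simp: not_le)
        have "1 = (indicator {x. K0 i < \<bar>x\<bar>} (x $ i) :: real)" using i by auto
        also have "\<dots> \<le> (\<Sum>i\<in>UNIV. indicator {x. K0 i < \<bar>x\<bar>} (x $ i))"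
          by (rule member_le_sum) auto
        finally have "2 * B \<le> (2 * B) * (\<Sum>i\<in>UNIV. indicator {x. K0 i < \<bar>x\<bar>} (x $ i))"
          using B(2) by simp
        then show ?thesis using 1 FB[of ?s] B(1)[of x] by linarith
      qed
    qed
    have key: "\<bar>integral\<^sup>L Q f - integral\<^sup>L Q g\<bar> \<le> d + (2 * B) * (\<Sum>i\<in>UNIV. measure (distr Q borel (\<lambda>x. x $ i)) {x. K0 i < \<bar>x\<bar>})"
      if Q: "prob_space Q" "sets Q = sets borel" for Q
    proof -
      interpret Q: prob_space Q by fact
      have [measurable]: "f \<in> borel_measurable Q" "g \<in> borel_measurable Q" "\<And>i. (\<lambda>x. x $ i) \<in> borel_measurable Q"
        using fm gm by (auto simp: measurable_cong_sets[OF Q(2) refl])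
      have i: "integrable Q f" "integrable Q g"
        by (rule Q.integrable_const_bound[of _ B], use B in auto) (rule Q.integrable_const_bound[of _ G], use G in auto)
      have ii: "integrable Q (\<lambda>x. indicator {x. K0 i < \<bar>x\<bar>} (x $ i) :: real)" for i
        by (rule Q.integrable_const_bound[of _ 1]) (auto simp: indicator_def)
      have m: "(\<integral>x. indicator {x. K0 i < \<bar>x\<bar>} (x $ i) \<partial>Q) = measure (distr Q borel (\<lambda>x. x $ i)) {x. K0 i < \<bar>x\<bar>}" for i
      proof -
        have "(\<integral>x. indicator {x. K0 i < \<bar>x\<bar>} (x $ i) \<partial>Q) =
            (\<integral>x. indicator ((\<lambda>x. x $ i) -` {x. K0 i < \<bar>x\<bar>} \<inter> space Q) x \<partial>Q)"
          by (intro Bochner_Integration.integral_cong) (auto simp: indicator_def)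
        also have "\<dots> = measure Q ((\<lambda>x. x $ i) -` {x. K0 i < \<bar>x\<bar>} \<inter> space Q)"
          by simp
        also have "\<dots> = measure (distr Q borel (\<lambda>x. x $ i)) {x. K0 i < \<bar>x\<bar>}"
          by (subst measure_distr) auto
        finally show ?thesis .
      qed
      have "\<bar>integral\<^sup>L Q f - integral\<^sup>L Q g\<bar> = \<bar>\<integral>x. f x - g x \<partial>Q\<bar>" using i by simp
      also have "\<dots> \<le> (\<integral>x. \<bar>f x - g x\<bar> \<partial>Q)" by (rule integral_abs_bound)
      also have "\<dots> \<le> (\<integral>x. d + (2 * B) * (\<Sum>i\<in>UNIV. indicator {x. K0 i < \<bar>x\<bar>} (x $ i)) \<partial>Q)"
        by (rule integral_mono) (use diff i ii in auto)
      also have "\<dots> = d + (2 * B) * (\<Sum>i\<in>UNIV. measure (distr Q borel (\<lambda>x. x $ i)) {x. K0 i < \<bar>x\<bar>})"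
        using ii by (simp add: m Q.prob_space)
      finally show ?thesis .
    qed
    have small: "d + (2 * B) * s \<le> e" if "s \<le> N * d" for s
    proof -
      have "d + (2 * B) * s \<le> d + (2 * B) * (N * d)" using that B(2) by (intro add_left_mono mult_left_mono) auto
      also have "\<dots> = d * (1 + (2 * B) * N)" by (simp add: algebra_simps)
      also have "\<dots> \<le> d * (1 + 2 * (2 * B) * N)" using d B(2) N by (intro mult_left_mono) auto
      also have "\<dots> = e"
      proof -
        have "0 < 1 + 2 * (2 * B) * N" using B(2) N by (intro add_pos_nonneg) auto
        then show ?thesis by (simp add: d_def)
      qed
      finally show ?thesis .
    qed
    have "\<forall>\<^sub>F n in sequentially. \<forall>i\<in>UNIV. measure (M i n) {x. K0 i < \<bar>x\<bar>} < d"
      using K0(2) by (intro eventually_ball_finite) auto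
    then have ev: "\<forall>\<^sub>F n in sequentially. \<bar>integral\<^sup>L (L n) f - integral\<^sup>L (L n) g\<bar> \<le> e"
    proof eventually_elim
      case (elim n)
      have "(\<Sum>i\<in>UNIV. measure (M i n) {x. K0 i < \<bar>x\<bar>}) \<le> (\<Sum>i\<in>(UNIV::'n set). d)"
        using elim by (intro sum_mono) (auto intro: less_imp_le)
      then have "(\<Sum>i\<in>UNIV. measure (M i n) {x. K0 i < \<bar>x\<bar>}) \<le> N * d" by (simp add: N_def)
      from small[OF this] key[OF L, of n] show ?case unfolding M_def by linarith
    qed
    have "(\<Sum>i\<in>UNIV. measure (M' i) {x. K0 i < \<bar>x\<bar>}) \<le> (\<Sum>i\<in>(UNIV::'n set). d)"
      using K0(3) by (intro sum_mono) (auto intro: less_imp_le)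
    then have "(\<Sum>i\<in>UNIV. measure (M' i) {x. K0 i < \<bar>x\<bar>}) \<le> N * d" by (simp add: N_def)
    from small[OF this] key[OF L'] have "\<bar>integral\<^sup>L L' f - integral\<^sup>L L' g\<bar> \<le> e" unfolding M'_def by linarith
    with conv ev show "\<exists>v v'. v \<longlonglongrightarrow> v' \<and>
         (\<forall>\<^sub>F n in sequentially. \<bar>integral\<^sup>L (L n) f - v n\<bar> \<le> e) \<and> \<bar>integral\<^sup>L L' f - v'\<bar> \<le> e" by blast
  qed
qed

section \<open>Normal laws and the function \<open>\<Psi>\<close>\<close>

text \<open>This form includes the degenerate case \<open>s = 0\<close> and reduces moments and characteristic functions to those of
the standard normal law.\<close>

lemma normal_law_eq_distr:
  assumes "0 \<le> s" shows "normal_law m s = distr std_normal_distribution borel (\<lambda>x. m + s * x)"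
proof (cases "s = 0")
  case True
  interpret real_distribution std_normal_distribution by (rule real_dist_normal_dist)
  show ?thesis using True by (simp add: normal_law_def distr_const)
next
  case False
  interpret real_distribution std_normal_distribution by (rule real_dist_normal_dist)
  have "distributed std_normal_distribution lborel (\<lambda>x. x) std_normal_density"
    unfolding distributed_def by (auto simp: distr_id2)
  from normal_density_affine[OF this, of s m]
  have "distributed std_normal_distribution lborel (\<lambda>x. m + s * x) (normal_density m s)"
    using False assms by simp
  then have "distr std_normal_distribution lborel (\<lambda>x. m + s * x) = density lborel (normal_density m s)"
    unfolding distributed_def by simp
  moreover have "distr std_normal_distribution lborel (\<lambda>x. m + s * x) = distr std_normal_distribution borel (\<lambda>x. m + s * x)"
    by (rule distr_cong) auto
  ultimately show ?thesis using False by (simp add: normal_law_def)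
qed

lemma normal_law_moments:
  assumes "0 \<le> s"
  shows "integrable (normal_law m s) (\<lambda>x. x)" "(\<integral>x. x \<partial>normal_law m s) = m"
    "integrable (normal_law m s) (\<lambda>x. x\<^sup>2)" "(\<integral>x. x\<^sup>2 \<partial>normal_law m s) = m\<^sup>2 + s\<^sup>2"
    "(\<integral>x. iexp x \<partial>normal_law 0 s) = complex_of_real (exp (- s\<^sup>2 / 2))"
proof -
  interpret N: real_distribution std_normal_distribution by (rule real_dist_normal_dist)
  note k1 = integrable_std_normal_distribution_moment[of 1, simplified]
    and k2 = integrable_std_normal_distribution_moment[of 2]
  have e1: "(\<integral>x. x \<partial>std_normal_distribution) = 0"
    using integral_std_normal_distribution_moment_odd[of 1] by simp
  have e2: "(\<integral>x. x\<^sup>2 \<partial>std_normal_distribution) = 1"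
    using std_normal_distribution_even_moments(1)[of 1] by (simp add: fact_numeral)
  have sq: "(m + s * x)\<^sup>2 = m\<^sup>2 + 2 * m * s * x + s\<^sup>2 * x\<^sup>2" for x :: real
    by (simp add: power2_eq_square algebra_simps)
  let ?N = "std_normal_distribution"
  have c: "integrable ?N (\<lambda>x. a)" "(\<integral>x. a \<partial>?N) = a" for a :: real
    using N.prob_space by (simp_all only: N.integrable_const lebesgue_integral_const) simp
  have l: "integrable ?N (\<lambda>x. a * x)" "(\<integral>x. a * x \<partial>?N) = 0" for a :: real
    using integrable_mult_right[OF k1, of a] e1 by (simp_all only: integral_mult_right_zero mult_zero_right)
  have sq': "integrable ?N (\<lambda>x. a * x\<^sup>2)" "(\<integral>x. a * x\<^sup>2 \<partial>?N) = a" for a :: real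
    using integrable_mult_right[OF k2, of a] e2 by (simp_all only: integral_mult_right_zero mult_1_right)
  have m1: "integrable ?N (\<lambda>x. m + s * x)" "(\<integral>x. m + s * x \<partial>?N) = m"
    using c l by (simp_all only: Bochner_Integration.integral_add Bochner_Integration.integrable_add add_0_right)
  have m2: "integrable ?N (\<lambda>x. (m + s * x)\<^sup>2)" "(\<integral>x. (m + s * x)\<^sup>2 \<partial>?N) = m\<^sup>2 + s\<^sup>2"
    unfolding sq using c l sq'
    by (simp_all only: Bochner_Integration.integral_add Bochner_Integration.integrable_add add_0_right)
  have f: "(\<lambda>x. m + s * x) \<in> borel_measurable ?N" by simp
  show "integrable (normal_law m s) (\<lambda>x. x)" "(\<integral>x. x \<partial>normal_law m s) = m"
    "integrable (normal_law m s) (\<lambda>x. x\<^sup>2)" "(\<integral>x. x\<^sup>2 \<partial>normal_law m s) = m\<^sup>2 + s\<^sup>2"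
    unfolding normal_law_eq_distr[OF assms] using m1 m2
    by (simp_all only: integrable_distr_eq[OF f] integral_distr[OF f] measurable_ident_sets[OF refl] borel_measurable_power)
  have "(\<integral>x. iexp x \<partial>normal_law 0 s) = char std_normal_distribution s"
    unfolding normal_law_eq_distr[OF assms] char_def by (subst integral_distr) auto
  then show "(\<integral>x. iexp x \<partial>normal_law 0 s) = complex_of_real (exp (- s\<^sup>2 / 2))"
    by (simp add: char_std_normal_distribution)
qed

lemma real_distribution_normal_law: "0 \<le> s \<Longrightarrow> real_distribution (normal_law m s)"
  unfolding normal_law_eq_distr
  by (rule prob_space.real_distribution_distr[OF real_distribution.axioms(1)[OF real_dist_normal_dist]]) simp

abbreviation centered_normal :: "real \<Rightarrow> real measure" where
  "centered_normal a \<equiv> normal_law 0 (sqrt a)"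

lemma char_centered_normal:
  assumes "0 \<le> a" shows "char (centered_normal a) t = exp (- complex_of_real (a * t^2 / 2))"
proof -
  have "char (centered_normal a) t = char std_normal_distribution (sqrt a * t)"
    unfolding normal_law_eq_distr[OF real_sqrt_ge_zero[OF assms]] char_def
    by (subst integral_distr) (auto simp: mult_ac)
  also have "\<dots> = complex_of_real (exp (- ((sqrt a * t)\<^sup>2) / 2))"
    by (simp add: char_std_normal_distribution)
  also have "- ((sqrt a * t)\<^sup>2) / 2 = - (a * t^2 / 2)" using assms by (simp add: power_mult_distrib)
  finally show ?thesis by (simp add: exp_of_real[symmetric])
qed

lemma centered_normal_density: "a > 0 \<Longrightarrow> centered_normal a = density lborel (gphi a)"
  by (simp add: normal_law_def gphi_def[abs_def])

lemma centered_normal_square: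
  assumes "0 \<le> a"
  shows "integrable (centered_normal a) (\<lambda>x. x\<^sup>2)" "(\<integral>x. x\<^sup>2 \<partial>centered_normal a) = a"
  using normal_law_moments(3,4)[of "sqrt a" 0] assms by simp_all

lemma gphi_tail_integral:
  assumes "a > 0"
  shows "(LBINT x:{c<..}. x * gphi a x) = a * gphi a c"
proof -
  have s: "sqrt a > 0" using assms by simp
  have g: "gphi a x = exp (- x\<^sup>2 / (2 * a)) / sqrt (2 * pi * a)" for x
    using assms by (simp add: gphi_def normal_density_def)
  have int: "integrable lborel (\<lambda>x. x * gphi a x)"
    using integrable_normal_moment[OF s, of 0 1] by (simp add: gphi_def mult.commute)
  have "(LBINT x=ereal c..\<infinity>. x * gphi a x) = 0 - (- a * gphi a c)"
  proof (rule interval_integral_FTC_integrable)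
    show "((\<lambda>x. - a * gphi a x) has_vector_derivative x * gphi a x) (at x)" for x
      unfolding g has_real_derivative_iff_has_vector_derivative[symmetric] using assms
      by (auto intro!: derivative_eq_intros simp: field_simps)
    show "isCont (\<lambda>x. x * gphi a x) x" for x unfolding g using assms by (auto intro!: continuous_intros)
    show "set_integrable lborel (einterval (ereal c) \<infinity>) (\<lambda>x. x * gphi a x)"
      unfolding set_integrable_def by (rule integrable_mult_indicator[OF _ int]) simp
    have "isCont (\<lambda>x. - a * gphi a x) c" unfolding g using assms by (auto intro!: continuous_intros)
    then have "((\<lambda>x. - a * gphi a x) \<longlongrightarrow> - a * gphi a c) (at_right c)"
      unfolding isCont_def by (rule filterlim_mono) (auto simp: at_within_le_at)
    then show "(((\<lambda>x. - a * gphi a x) \<circ> real_of_ereal) \<longlongrightarrow> - a * gphi a c) (at_right (ereal c))"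
      by (simp add: ereal_tendsto_simps)
    have "((\<lambda>x. - a * (exp (- x\<^sup>2 / (2 * a)) / sqrt (2 * pi * a))) \<longlongrightarrow> 0) at_top"
      using assms by real_asymp
    then have "((\<lambda>x. - a * gphi a x) \<longlongrightarrow> 0) at_top" unfolding g .
    then show "(((\<lambda>x. - a * gphi a x) \<circ> real_of_ereal) \<longlongrightarrow> 0) (at_left \<infinity>)"
      by (simp add: ereal_tendsto_simps)
  qed simp
  then show ?thesis by (simp add: interval_lebesgue_integral_def einterval_def greaterThan_def)
qed

text \<open>The function \<open>\<Psi>\<close> enters the covariance because it is the expected positive part of a shifted normal
variable.\<close>

lemma gPsi_eq_plus_part:
  assumes "0 \<le> a"
  shows "(\<integral>x. max (x - c) 0 \<partial>centered_normal a) = gPsi a c"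
proof (cases "a = 0")
  case True
  then show ?thesis by (simp add: normal_law_def gPsi_def integral_return)
next
  case False
  then have a: "a > 0" using assms by simp
  then have s: "sqrt a > 0" by simp
  have int: "integrable lborel (\<lambda>x. x * gphi a x)"
    using integrable_normal_moment[OF s, of 0 1] by (simp add: gphi_def mult.commute)
  have int0: "integrable lborel (gphi a)"
    unfolding gphi_def using s by simp
  have si: "set_integrable lborel A (\<lambda>x. x * gphi a x)" "set_integrable lborel A (gphi a)" if "A \<in> sets borel" for A
    unfolding set_integrable_def
    by (rule integrable_mult_indicator[OF _ int], simp add: that)
      (rule integrable_mult_indicator[OF _ int0], simp add: that)
  have nn: "0 \<le> gphi a x" for x unfolding gphi_def by simp
  have [measurable]: "gphi a \<in> borel_measurable borel" unfolding gphi_def by measurable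
  have "(LBINT x. gphi a x) = 1" unfolding gphi_def using s by simp
  moreover have "(LBINT x. gphi a x) = (LBINT x:{..c} \<union> {c<..}. gphi a x)"
  proof -
    have "{..c} \<union> {c<..} = UNIV" by auto
    then show ?thesis by (simp add: set_lebesgue_integral_def)
  qed
  moreover have "\<dots> = (LBINT x:{..c}. gphi a x) + (LBINT x:{c<..}. gphi a x)"
    by (rule set_integral_Un) (auto intro: si)
  ultimately have Phi: "(LBINT x:{c<..}. gphi a x) = 1 - gPhi a c" unfolding gPhi_def by simp
  have "(\<integral>x. max (x - c) 0 \<partial>centered_normal a) = (LBINT x. gphi a x * max (x - c) 0)"
    unfolding centered_normal_density[OF a] by (subst integral_density) (auto simp: nn)
  also have "\<dots> = (LBINT x:{c<..}. x * gphi a x - c * gphi a x)"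
    unfolding set_lebesgue_integral_def by (intro Bochner_Integration.integral_cong) (auto simp: indicator_def algebra_simps max_def)
  also have "\<dots> = (LBINT x:{c<..}. x * gphi a x) - (LBINT x:{c<..}. c * gphi a x)"
    by (intro set_integral_diff si set_integrable_mult_right impI) auto
  also have "\<dots> = a * gphi a c - c * (1 - gPhi a c)"
    by (simp add: gphi_tail_integral[OF a] Phi)
  finally show ?thesis using False by (simp add: gPsi_def)
qed

text \<open>The positive part is unbounded, so weak convergence is applied to its truncation at a level \<open>K\<close>; by the
bound on the second moments, the truncation changes the integrals by \<open>O(1/K)\<close>, uniformly in \<open>n\<close>.\<close>

lemma plus_part_tendsto_gPsi:
  fixes M :: "nat \<Rightarrow> real measure"
  assumes M: "\<And>n. real_distribution (M n)" and a: "0 \<le> a"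
    and char: "\<And>t. (\<lambda>n. char (M n) t) \<longlonglongrightarrow> exp (- complex_of_real (a * t^2 / 2))"
    and sq: "\<And>n. integrable (M n) (\<lambda>x. x\<^sup>2)" "\<And>n. (\<integral>x. x\<^sup>2 \<partial>M n) \<le> C"
    and c: "c \<longlonglongrightarrow> c'"
  shows "(\<lambda>n. \<integral>x. max (x - c n) 0 \<partial>M n) \<longlonglongrightarrow> gPsi a c'"
proof -
  let ?G = "centered_normal a"
  have G: "real_distribution ?G" using a by (simp add: real_distribution_normal_law)
  have w: "weak_conv_m M ?G"
    by (rule levy_continuity[OF M G]) (simp only: char_centered_normal[OF a] char)
  define D where "D = max C a"
  have D: "D \<ge> 0" using a by (simp add: D_def)
  define h where "h K x = min K (max (x - c') 0)" for K x :: real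
  have cont: "isCont (h K) x" for K x unfolding h_def by (intro continuous_intros)
  have bound: "\<bar>(\<integral>x. max (x - d) 0 \<partial>Q) - (\<integral>x. h K x \<partial>Q)\<bar> \<le> \<bar>d - c'\<bar> + (2 * D + 2 * c'\<^sup>2) / K"
    if Q: "real_distribution Q" "integrable Q (\<lambda>x. x\<^sup>2)" "(\<integral>x. x\<^sup>2 \<partial>Q) \<le> D" and K: "K > 0" for Q d K
  proof -
    interpret Q: real_distribution Q by fact
    have i1: "integrable Q (\<lambda>x. x)" using Q.square_integrable_imp_integrable[of "\<lambda>x. x"] Q(2) by simp
    have i2: "integrable Q (\<lambda>x. max (x - d) 0)" using i1 by (intro integrable_max) auto
    have i3: "integrable Q (h K)"
    proof (rule Q.integrable_const_bound[of _ K])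
      show "h K \<in> borel_measurable Q" unfolding h_def by measurable
    qed (use K in \<open>auto simp: h_def\<close>)
    have p: "\<bar>max (x - d) 0 - h K x\<bar> \<le> \<bar>d - c'\<bar> + (2 * x\<^sup>2 + 2 * c'\<^sup>2) / K" for x
    proof -
      define y where "y = max (x - c') 0"
      have "y \<ge> 0" by (simp add: y_def)
      have 1: "\<bar>max (x - d) 0 - y\<bar> \<le> \<bar>d - c'\<bar>" unfolding y_def by (auto simp: max_def abs_if)
      have "y - h K x \<le> y\<^sup>2 / K" and 0: "0 \<le> y - h K x"
      proof -
        show "0 \<le> y - h K x" by (simp add: h_def y_def)
        show "y - h K x \<le> y\<^sup>2 / K"
        proof (cases "y \<le> K")
          case True then show ?thesis using K by (simp add: h_def y_def[symmetric])
        next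
          case False
          then have "y * K \<le> y * y" using \<open>y \<ge> 0\<close> by (intro mult_left_mono) auto
          then have "y \<le> y\<^sup>2 / K" using K by (simp add: field_simps power2_eq_square)
          then show ?thesis using K False by (simp add: h_def y_def[symmetric])
        qed
      qed
      moreover have "y\<^sup>2 \<le> 2 * x\<^sup>2 + 2 * c'\<^sup>2"
      proof -
        have "y\<^sup>2 \<le> (x - c')\<^sup>2" unfolding y_def by (auto simp: max_def)
        also have "\<dots> \<le> 2 * x\<^sup>2 + 2 * c'\<^sup>2" using zero_le_power2[of "x + c'"] by (simp add: power2_eq_square algebra_simps)
        finally show ?thesis .
      qed
      then have "y\<^sup>2 / K \<le> (2 * x\<^sup>2 + 2 * c'\<^sup>2) / K" using K by (intro divide_right_mono) auto
      ultimately show ?thesis using 1 0 by linarith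
    qed
    have "\<bar>(\<integral>x. max (x - d) 0 \<partial>Q) - (\<integral>x. h K x \<partial>Q)\<bar> = \<bar>\<integral>x. max (x - d) 0 - h K x \<partial>Q\<bar>"
      using i2 i3 by simp
    also have "\<dots> \<le> (\<integral>x. \<bar>max (x - d) 0 - h K x\<bar> \<partial>Q)" by (rule integral_abs_bound)
    also have "\<dots> \<le> (\<integral>x. \<bar>d - c'\<bar> + (2 * x\<^sup>2 + 2 * c'\<^sup>2) / K \<partial>Q)"
      by (rule integral_mono) (use p i2 i3 Q(2) in auto)
    also have "\<dots> = \<bar>d - c'\<bar> + (2 * (\<integral>x. x\<^sup>2 \<partial>Q) + 2 * c'\<^sup>2) / K"
      using Q(2) Q.prob_space by simp
    also have "\<dots> \<le> \<bar>d - c'\<bar> + (2 * D + 2 * c'\<^sup>2) / K"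
      using Q(3) K by (intro add_left_mono divide_right_mono) auto
    finally show ?thesis .
  qed
  have "(\<lambda>n. \<integral>x. max (x - c n) 0 \<partial>M n) \<longlonglongrightarrow> (\<integral>x. max (x - c') 0 \<partial>?G)"
  proof (rule tendsto_if_uniformly_approximable)
    fix e :: real assume e: "e > 0"
    define K where "K = (2 * D + 2 * c'\<^sup>2 + 1) / (e / 2)"
    have K: "K > 0" using e D by (auto simp: K_def intro!: divide_pos_pos add_nonneg_pos)
    have "(2 * D + 2 * c'\<^sup>2) / K \<le> (2 * D + 2 * c'\<^sup>2 + 1) / K" using K by (intro divide_right_mono) auto
    also have "\<dots> = e / 2"
    proof -
      have "0 < 2 * D + 2 * c'\<^sup>2 + 1" using D by (intro add_nonneg_pos add_nonneg_nonneg) auto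
      then show ?thesis using e unfolding K_def by (simp add: divide_simps)
    qed
    finally have Ke: "(2 * D + 2 * c'\<^sup>2) / K \<le> e / 2" .
    have "(\<lambda>n. integral\<^sup>L (M n) (h K)) \<longlonglongrightarrow> integral\<^sup>L ?G (h K)"
      by (rule weak_conv_imp_integral_bdd_continuous_conv[OF M G w, of _ K]) (use K cont in \<open>auto simp: h_def\<close>)
    moreover have "\<forall>\<^sub>F n in sequentially. dist (c n) c' < e / 2" using c e by (intro tendstoD) auto
    then have "\<forall>\<^sub>F n in sequentially. \<bar>(\<integral>x. max (x - c n) 0 \<partial>M n) - integral\<^sup>L (M n) (h K)\<bar> \<le> e"
    proof eventually_elim
      case (elim n)
      then have "\<bar>c n - c'\<bar> \<le> e / 2" by (simp add: dist_real_def)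
      moreover have "(\<integral>x. x\<^sup>2 \<partial>M n) \<le> D" using sq(2)[of n] unfolding D_def by simp
      ultimately show ?case using bound[OF M sq(1) _ K, of n "c n"] Ke by linarith
    qed
    moreover have "\<bar>(\<integral>x. max (x - c') 0 \<partial>?G) - integral\<^sup>L ?G (h K)\<bar> \<le> e"
    proof -
      have "(\<integral>x. x\<^sup>2 \<partial>?G) \<le> D" using centered_normal_square(2)[OF a] by (simp add: D_def)
      from bound[OF G centered_normal_square(1)[OF a] this K, of c'] show ?thesis using Ke e by linarith
    qed
    ultimately show "\<exists>v v'. v \<longlonglongrightarrow> v' \<and>
       (\<forall>\<^sub>F n in sequentially. \<bar>(\<integral>x. max (x - c n) 0 \<partial>M n) - v n\<bar> \<le> e) \<and> \<bar>(\<integral>x. max (x - c') 0 \<partial>?G) - v'\<bar> \<le> e"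
      by blast
  qed
  then show ?thesis by (simp add: gPsi_eq_plus_part[OF a])
qed

section \<open>Paths in a fixed environment\<close>

abbreviation jumps :: "nat \<Rightarrow> int set" where "jumps R \<equiv> {- int R..int R}"

lemma jump_spaceD:
  assumes "w \<in> space (jump_space R)"
  shows "0 \<le> w z" "z \<notin> jumps R \<Longrightarrow> w z = 0" "(\<Sum>z\<in>jumps R. w z) = 1"
  using assms by (auto simp: jump_space_def space_restrict_space)

lemma jump_spaceI:
  assumes "\<And>z. 0 \<le> w z" "\<And>z. z \<notin> jumps R \<Longrightarrow> w z = 0" "(\<Sum>z\<in>jumps R. w z) = 1"
  shows "w \<in> space (jump_space R)"
proof -
  have "w z = 0" if "\<bar>z\<bar> > int R" for z by (rule assms(2)) (use that in auto)
  then show ?thesis using assms(1,3) by (auto simp: jump_space_def space_restrict_space space_PiM)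
qed

lemma const_env_space: "p \<in> space (jump_space R) \<Longrightarrow> (\<lambda>_. p) \<in> space (env_space R)"
  by (auto simp: env_space_def space_PiM)

lemma pmf_jump:
  assumes "\<omega> \<in> space (env_space R)" shows "pmf (embed_pmf (\<omega> i)) z = \<omega> i z"
  using pmf_walk_kernel[OF assms, of i 0 z] by simp

lemma set_pmf_jump:
  assumes "\<omega> \<in> space (env_space R)" shows "set_pmf (embed_pmf (\<omega> i)) \<subseteq> jumps R"
proof
  fix z assume "z \<in> set_pmf (embed_pmf (\<omega> i))"
  then have "\<omega> i z \<noteq> 0" using pmf_jump[OF assms, of i z] by (simp add: set_pmf_iff)
  then show "z \<in> jumps R" using jump_spaceD(2)[OF env_spaceD[OF assms, of i]] by blast
qed

text \<open>The law of the list of the first \<open>n\<close> increments of the walk that starts in the space-time point \<open>(x, s)\<close>.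
Increments rather than positions make a change of a single step a change of a single list entry, and
a discrete law with finite support removes all questions of integrability.\<close>

primrec path_pmf :: "env \<Rightarrow> nat \<Rightarrow> int \<Rightarrow> int \<Rightarrow> int list pmf" where
  "path_pmf \<omega> 0 x s = return_pmf []"
| "path_pmf \<omega> (Suc n) x s =
     embed_pmf (\<omega> (x, s)) \<bind> (\<lambda>z. map_pmf ((#) z) (path_pmf \<omega> n (x + z) (s + 1)))"

abbreviation EP :: "env \<Rightarrow> nat \<Rightarrow> int \<Rightarrow> int \<Rightarrow> (int list \<Rightarrow> 'b::{banach,second_countable_topology}) \<Rightarrow> 'b" where
  "EP \<omega> n x s \<equiv> measure_pmf.expectation (path_pmf \<omega> n x s)"

lemma set_path_pmf:
  assumes "\<omega> \<in> space (env_space R)" "l \<in> set_pmf (path_pmf \<omega> n x s)"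
  shows "length l = n" "set l \<subseteq> jumps R"
  using assms(2)
proof (induction n arbitrary: l x s)
  case 0
  { case 1 then show ?case by simp }
  { case 2 then show ?case by simp }
next
  case (Suc n)
  { case 1 then show ?case using Suc by auto }
  { case 2 then show ?case using Suc set_pmf_jump[OF assms(1)] by fastforce }
qed

lemma finite_paths: "finite {l. set l \<subseteq> jumps R \<and> length l = n}"
  by (rule finite_lists_length_eq) simp

lemma finite_set_path_pmf:
  assumes "\<omega> \<in> space (env_space R)" shows "finite (set_pmf (path_pmf \<omega> n x s))"
  by (rule finite_subset[OF _ finite_paths[of R n]]) (use set_path_pmf[OF assms] in blast)

lemma integrable_path_pmf:
  fixes f :: "int list \<Rightarrow> 'b::{banach,second_countable_topology}"
  assumes "\<omega> \<in> space (env_space R)" shows "integrable (path_pmf \<omega> n x s) f"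
  by (rule integrable_measure_pmf_finite[OF finite_set_path_pmf[OF assms]])

lemma EP_Suc:
  fixes f :: "int list \<Rightarrow> 'b::{banach,second_countable_topology}"
  assumes "\<omega> \<in> space (env_space R)"
  shows "EP \<omega> (Suc n) x s f = (\<Sum>z\<in>jumps R. \<omega> (x, s) z *\<^sub>R EP \<omega> n (x + z) (s + 1) (\<lambda>l. f (z # l)))"
proof -
  have "EP \<omega> (Suc n) x s f = (\<Sum>z\<in>jumps R. pmf (embed_pmf (\<omega> (x, s))) z *\<^sub>R
      measure_pmf.expectation (map_pmf ((#) z) (path_pmf \<omega> n (x + z) (s + 1))) f)"
    unfolding path_pmf.simps
    by (rule pmf_expectation_bind) (use finite_set_path_pmf[OF assms] set_pmf_jump[OF assms] in auto)
  then show ?thesis by (simp add: pmf_jump[OF assms])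
qed

lemma path_pmf_cong:
  assumes "\<And>y t. s \<le> t \<Longrightarrow> \<omega> (y, t) = \<omega>' (y, t)"
  shows "path_pmf \<omega> n x s = path_pmf \<omega>' n x s"
  using assms by (induction n arbitrary: x s) auto

lemma path_pmf_const: "path_pmf (\<lambda>_. p) n x s = path_pmf (\<lambda>_. p) n 0 0"
proof (induction n arbitrary: x s)
  case (Suc n)
  show ?case unfolding path_pmf.simps by (subst (1 2) Suc) simp
qed simp

lemma EP_mono:
  fixes f g :: "int list \<Rightarrow> real"
  assumes "\<omega> \<in> space (env_space R)" "\<And>l. length l = n \<Longrightarrow> set l \<subseteq> jumps R \<Longrightarrow> f l \<le> g l"
  shows "EP \<omega> n x s f \<le> EP \<omega> n x s g"
  by (rule integral_mono_AE[OF integrable_path_pmf[OF assms(1)] integrable_path_pmf[OF assms(1)]])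
     (use assms(2) set_path_pmf[OF assms(1)] in \<open>auto intro!: AE_pmfI\<close>)

lemma EP_cong:
  fixes f g :: "int list \<Rightarrow> 'b::{banach,second_countable_topology}"
  assumes "\<omega> \<in> space (env_space R)" "\<And>l. length l = n \<Longrightarrow> set l \<subseteq> jumps R \<Longrightarrow> f l = g l"
  shows "EP \<omega> n x s f = EP \<omega> n x s g"
  by (rule integral_cong_AE) (use assms(2) set_path_pmf[OF assms(1)] in \<open>auto intro!: AE_pmfI\<close>)

lemma EP_bounded:
  fixes f :: "int list \<Rightarrow> real"
  shows "\<exists>B. \<forall>\<omega>\<in>space (env_space R). \<forall>x s. \<bar>EP \<omega> n x s f\<bar> \<le> B"
proof -
  let ?S = "{l. set l \<subseteq> jumps R \<and> length l = n}"
  define B where "B = (\<Sum>l\<in>?S. \<bar>f l\<bar>)"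
  have B: "\<bar>f l\<bar> \<le> B" if "length l = n" "set l \<subseteq> jumps R" for l
    unfolding B_def using that by (intro member_le_sum[of l ?S "\<lambda>l. \<bar>f l\<bar>"] finite_paths) auto
  have "\<bar>EP \<omega> n x s f\<bar> \<le> B" if w: "\<omega> \<in> space (env_space R)" for \<omega> x s
  proof -
    have "\<bar>EP \<omega> n x s f\<bar> \<le> EP \<omega> n x s (\<lambda>l. \<bar>f l\<bar>)" by (rule integral_abs_bound)
    also have "\<dots> \<le> EP \<omega> n x s (\<lambda>l. B)" by (rule EP_mono[OF w B])
    finally show ?thesis by simp
  qed
  then show ?thesis by blast
qed

lemma measurable_env_component[measurable]: "(\<lambda>\<omega>. \<omega> i z) \<in> borel_measurable (env_space R)"
proof -
  have "(\<lambda>\<omega>. \<omega> i) \<in> env_space R \<rightarrow>\<^sub>M jump_space R"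
    unfolding env_space_def by (rule measurable_component_singleton) simp
  moreover have "(\<lambda>w. w z) \<in> borel_measurable (jump_space R)"
    unfolding jump_space_def by (rule measurable_restrict_space1, rule measurable_component_singleton) simp
  ultimately show ?thesis by (rule measurable_compose)
qed

lemma measurable_EP[measurable]:
  fixes f :: "int list \<Rightarrow> real"
  shows "(\<lambda>\<omega>. EP \<omega> n x s f) \<in> borel_measurable (env_space R)"
proof (induction n arbitrary: x s f)
  case (Suc n)
  note [measurable] = Suc
  have "(\<lambda>\<omega>. EP \<omega> (Suc n) x s f) \<in> borel_measurable (env_space R) \<longleftrightarrow>
     (\<lambda>\<omega>. \<Sum>z\<in>jumps R. \<omega> (x, s) z *\<^sub>R EP \<omega> n (x + z) (s + 1) (\<lambda>l. f (z # l))) \<in> borel_measurable (env_space R)"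
    by (rule measurable_cong) (rule EP_Suc)
  then show ?case by simp
qed simp

definition bounded_diff :: "nat \<Rightarrow> nat \<Rightarrow> real \<Rightarrow> (int list \<Rightarrow> real) \<Rightarrow> bool" where
  "bounded_diff R n c f \<longleftrightarrow> (\<forall>l1 z z' l2. length l1 + length l2 + 1 = n \<and> set l1 \<subseteq> jumps R \<and> set l2 \<subseteq> jumps R \<and>
     z \<in> jumps R \<and> z' \<in> jumps R \<longrightarrow> \<bar>f (l1 @ z # l2) - f (l1 @ z' # l2)\<bar> \<le> c)"

lemma bounded_diffD:
  assumes "bounded_diff R n c f" "length l1 + length l2 + 1 = n" "set l1 \<subseteq> jumps R" "set l2 \<subseteq> jumps R"
    "z \<in> jumps R" "z' \<in> jumps R"
  shows "\<bar>f (l1 @ z # l2) - f (l1 @ z' # l2)\<bar> \<le> c"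
  using assms unfolding bounded_diff_def by blast

lemma bounded_diff_Cons:
  assumes "bounded_diff R (Suc n) c f" "z \<in> jumps R" shows "bounded_diff R n c (\<lambda>l. f (z # l))"
  unfolding bounded_diff_def
proof (intro allI impI, elim conjE)
  fix l1 z1 z' l2
  assume "length l1 + length l2 + 1 = n" "set l1 \<subseteq> jumps R" "set l2 \<subseteq> jumps R" "z1 \<in> jumps R" "z' \<in> jumps R"
  then show "\<bar>f (z # l1 @ z1 # l2) - f (z # l1 @ z' # l2)\<bar> \<le> c"
    using bounded_diffD[OF assms(1), of "z # l1" l2 z1 z'] assms(2) by simp
qed

lemma bounded_diff_EP:
  assumes "bounded_diff R (Suc n) c f" "z \<in> jumps R" "z' \<in> jumps R" and w: "\<omega> \<in> space (env_space R)"
  shows "\<bar>EP \<omega> n x s (\<lambda>l. f (z # l)) - EP \<omega> n x s (\<lambda>l. f (z' # l))\<bar> \<le> c"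
proof -
  have "\<bar>EP \<omega> n x s (\<lambda>l. f (z # l)) - EP \<omega> n x s (\<lambda>l. f (z' # l))\<bar> = \<bar>EP \<omega> n x s (\<lambda>l. f (z # l) - f (z' # l))\<bar>"
    by (subst Bochner_Integration.integral_diff) (rule integrable_path_pmf[OF w] refl)+
  also have "\<dots> \<le> EP \<omega> n x s (\<lambda>l. \<bar>f (z # l) - f (z' # l)\<bar>)" by (rule integral_abs_bound)
  also have "\<dots> \<le> EP \<omega> n x s (\<lambda>l. c)"
  proof (rule EP_mono[OF w])
    fix l :: "int list" assume "length l = n" "set l \<subseteq> jumps R"
    then show "\<bar>f (z # l) - f (z' # l)\<bar> \<le> c"
      using bounded_diffD[OF assms(1), of "[]" l z z'] assms(2,3) by simp
  qed
  finally show ?thesis by simp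
qed

section \<open>The path law as the law of the increments\<close>

lemma sets_walk_law[measurable_cong]: "sets (walk_law \<omega> x) = sets (\<Pi>\<^sub>M s\<in>UNIV. count_space UNIV)"
proof -
  interpret Ionescu_Tulcea "walk_step \<omega> x" "\<lambda>_. count_space UNIV" by (rule Ionescu_Tulcea_walk_step)
  show ?thesis unfolding walk_law_def by simp
qed

lemma space_walk_law[simp]: "space (walk_law \<omega> x) = UNIV"
  using sets_eq_imp_space_eq[OF sets_walk_law] by (auto simp: space_PiM)

lemma prob_space_walk_law: "prob_space (walk_law \<omega> x)"
proof
  let ?M = "\<lambda>_::nat. count_space (UNIV :: int set)"
  interpret Ionescu_Tulcea "walk_step \<omega> x" ?M by (rule Ionescu_Tulcea_walk_step)
  have s: "{\<lambda>_. undefined} \<in> sets (PiM {} ?M)" by (simp add: PiM_empty)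
  have "emeasure (walk_law \<omega> x) (prod_emb UNIV ?M {} {\<lambda>_. undefined}) = emeasure (CI {}) {\<lambda>_. undefined}"
    unfolding walk_law_def by (rule lim[OF _ s]) simp
  also have "\<dots> = emeasure (C 0 0 (\<lambda>_. undefined)) (prod_emb {0..<0} ?M {} {\<lambda>_. undefined})"
    by (rule emeasure_CI[OF _ s]) simp
  also have "\<dots> = 1" by (simp add: prod_emb_def PiM_empty)
  also have "prod_emb UNIV ?M {} {\<lambda>_. undefined} = space (walk_law \<omega> x)"
    by (auto simp: prod_emb_def restrict_def)
  finally show "emeasure (walk_law \<omega> x) (space (walk_law \<omega> x)) = 1" .
qed

lemma measurable_walk_component[measurable]: "(\<lambda>X. X k) \<in> walk_law \<omega> x \<rightarrow>\<^sub>M count_space UNIV"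
  by (subst measurable_cong_sets[OF sets_walk_law refl]) (rule measurable_component_singleton, simp)

lemma AE_walk_start:
  assumes "\<omega> \<in> space (env_space R)" shows "AE X in walk_law \<omega> x. X 0 = x"
proof -
  interpret prob_space "walk_law \<omega> x" by (rule prob_space_walk_law)
  have e: "emeasure (walk_law \<omega> x) {X. X 0 = x} = 1"
    using emeasure_walk_law[OF assms, of x 0 "\<lambda>_. x"] by simp
  have "{X \<in> space (walk_law \<omega> x). X 0 = x} \<in> sets (walk_law \<omega> x)" by measurable
  then show ?thesis using e by (intro AE_I_eq_1) (auto simp: emeasure_eq_measure)
qed

lemma pmf_bind_Cons:
  fixes p :: "'a pmf"
  shows "pmf (p \<bind> (\<lambda>z. map_pmf ((#) z) (q z))) (z # l) = pmf p z * pmf (q z) l"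
proof -
  have "pmf (map_pmf ((#) z') (q z')) (z # l) = pmf (q z) l * indicator {z} z'" for z'
  proof (cases "z' = z")
    case True then show ?thesis by (simp add: pmf_map_inj' inj_on_def)
  next
    case False then show ?thesis by (auto simp: pmf_eq_0_set_pmf)
  qed
  then show ?thesis by (simp add: pmf_bind measure_pmf_single)
qed

lemma pmf_path_pmf:
  assumes "\<omega> \<in> space (env_space R)"
  shows "pmf (path_pmf \<omega> n x s) l = of_bool (length l = n) *
     (\<Prod>k<n. \<omega> (x + sum_list (take k l), s + int k) (l ! k))"
proof (induction n arbitrary: l x s)
  case 0 then show ?case by (auto simp: pmf_return)
next
  case (Suc n)
  show ?case
  proof (cases l)
    case Nil
    then have "l \<notin> set_pmf (path_pmf \<omega> (Suc n) x s)" using set_path_pmf(1)[OF assms] by force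
    then show ?thesis using Nil by (simp add: set_pmf_iff del: path_pmf.simps)
  next
    case (Cons z l')
    show ?thesis unfolding Cons path_pmf.simps pmf_bind_Cons Suc
      by (auto simp: pmf_jump[OF assms] prod.lessThan_Suc_shift add_ac simp del: prod.lessThan_Suc)
  qed
qed

definition increments :: "nat \<Rightarrow> (nat \<Rightarrow> int) \<Rightarrow> int list" where
  "increments n X = map (\<lambda>k. X (Suc k) - X k) [0..<n]"

lemma sum_list_increments: "k \<le> n \<Longrightarrow> sum_list (take k (increments n X)) = X k - X 0"
proof (induction k)
  case (Suc k)
  then have "take (Suc k) (increments n X) = take k (increments n X) @ [X (Suc k) - X k]"
    by (subst take_Suc_conv_app_nth) (auto simp: increments_def)
  then show ?case using Suc by simp
qed simp

lemma measurable_increments[measurable]: "increments n \<in> walk_law \<omega> x \<rightarrow>\<^sub>M count_space UNIV"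
proof (induction n)
  case (Suc n)
  have "increments (Suc n) X = increments n X @ [X (Suc n) - X n]" for X by (simp add: increments_def)
  moreover have "(\<lambda>X. increments n X @ [X (Suc n) - X n]) \<in> walk_law \<omega> x \<rightarrow>\<^sub>M count_space UNIV"
    using Suc by measurable
  ultimately show ?case by (simp add: measurable_cong[of _ "increments (Suc n)" "\<lambda>X. increments n X @ [X (Suc n) - X n]"])
qed (simp add: increments_def[abs_def])

text \<open>Both sides give a path the product of its transition probabilities.\<close>

lemma distr_walk_law_increments:
  assumes "\<omega> \<in> space (env_space R)"
  shows "distr (walk_law \<omega> x) (count_space UNIV) (increments n) = measure_pmf (path_pmf \<omega> n x 0)"
proof (rule measure_eqI_countable[where A=UNIV])
  fix l :: "int list"
  interpret prob_space "walk_law \<omega> x" by (rule prob_space_walk_law)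
  have nn: "0 \<le> \<omega> i z" for i z using jump_spaceD(1)[OF env_spaceD[OF assms]] .
  have "emeasure (distr (walk_law \<omega> x) (count_space UNIV) (increments n)) {l} =
      emeasure (walk_law \<omega> x) {X \<in> space (walk_law \<omega> x). increments n X = l}"
    by (subst emeasure_distr) (auto intro!: arg_cong2[of _ _ _ _ emeasure])
  also have "\<dots> = ennreal (pmf (path_pmf \<omega> n x 0) l)"
  proof (cases "length l = n")
    case False
    then have "{X \<in> space (walk_law \<omega> x). increments n X = l} = {}" by (auto simp: increments_def)
    then show ?thesis using False by (simp only: pmf_path_pmf[OF assms]) simp
  next
    case True
    define y where "y k = x + sum_list (take k l)" for k
    have y: "y (Suc k) - y k = l ! k" if "k < n" for k
      using that True by (simp add: y_def take_Suc_conv_app_nth)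
    have "emeasure (walk_law \<omega> x) {X \<in> space (walk_law \<omega> x). increments n X = l} =
        emeasure (walk_law \<omega> x) {X \<in> space (walk_law \<omega> x). \<forall>k\<le>n. X k = y k}"
    proof (rule emeasure_eq_AE)
      show "AE X in walk_law \<omega> x. (X \<in> {X \<in> space (walk_law \<omega> x). increments n X = l}) =
           (X \<in> {X \<in> space (walk_law \<omega> x). \<forall>k\<le>n. X k = y k})"
        using AE_walk_start[OF assms, of x]
      proof eventually_elim
        case (elim X)
        have "increments n X = l \<longleftrightarrow> (\<forall>k\<le>n. X k = y k)"
        proof
          assume "increments n X = l"
          then show "\<forall>k\<le>n. X k = y k" using sum_list_increments[of _ n X] elim by (auto simp: y_def)
        next
          assume h: "\<forall>k\<le>n. X k = y k"
          show "increments n X = l"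
            by (rule nth_equalityI) (use True h y in \<open>auto simp: increments_def\<close>)
        qed
        then show ?case by simp
      qed
    qed measurable
    also have "\<dots> = ennreal (\<Prod>k<n. \<omega> (y k, int k) (y (Suc k) - y k))"
      using emeasure_walk_law[OF assms, of x n y] by (simp add: y_def)
    also have "(\<Prod>k<n. \<omega> (y k, int k) (y (Suc k) - y k)) = pmf (path_pmf \<omega> n x 0) l"
      using True y by (simp add: pmf_path_pmf[OF assms]) (simp add: y_def)
    finally show ?thesis .
  qed
  finally show "emeasure (distr (walk_law \<omega> x) (count_space UNIV) (increments n)) {l} = emeasure (path_pmf \<omega> n x 0) {l}"
    by (simp add: emeasure_pmf_single)
qed auto

text \<open>The bridge from the path measure to finite sums: every functional used below depends on finitely many
positions and is thus a function of the increments.\<close>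

lemma walk_law_integral:
  fixes f :: "(nat \<Rightarrow> int) \<Rightarrow> 'b::{banach,second_countable_topology}"
  assumes w: "\<omega> \<in> space (env_space R)" and fm: "f \<in> borel_measurable (\<Pi>\<^sub>M s\<in>UNIV. count_space UNIV)"
    and f: "\<And>X. X 0 = x \<Longrightarrow> f X = g (increments n X)"
  shows "(\<integral>X. f X \<partial>walk_law \<omega> x) = EP \<omega> n x 0 g"
proof -
  have fm': "f \<in> borel_measurable (walk_law \<omega> x)"
    using fm by (simp add: measurable_cong_sets[OF sets_walk_law refl])
  have gm: "(\<lambda>X. g (increments n X)) \<in> borel_measurable (walk_law \<omega> x)"
    by (rule measurable_compose[OF measurable_increments]) simp
  have "EP \<omega> n x 0 g = (\<integral>l. g l \<partial>distr (walk_law \<omega> x) (count_space UNIV) (increments n))"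
    unfolding distr_walk_law_increments[OF w] ..
  also have "\<dots> = (\<integral>X. g (increments n X) \<partial>walk_law \<omega> x)"
    by (rule integral_distr) (rule measurable_increments, simp)
  also have "\<dots> = (\<integral>X. f X \<partial>walk_law \<omega> x)"
    by (rule integral_cong_AE[OF gm fm'])
       (use AE_walk_start[OF w, of x] in eventually_elim, simp add: f)
  finally show ?thesis ..
qed

lemma AE_walk_range:
  assumes w: "\<omega> \<in> space (env_space R)"
  shows "AE X in walk_law \<omega> x. \<bar>X k - x\<bar> \<le> int R * int k"
proof -
  have "AE l in distr (walk_law \<omega> x) (count_space UNIV) (increments k). set l \<subseteq> jumps R"
    unfolding distr_walk_law_increments[OF w] by (rule AE_pmfI) (rule set_path_pmf(2)[OF w])
  then have "AE X in walk_law \<omega> x. set (increments k X) \<subseteq> jumps R"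
    by (subst (asm) AE_distr_iff) auto
  then show ?thesis using AE_walk_start[OF w, of x]
  proof eventually_elim
    case (elim X)
    have "\<bar>sum_list l\<bar> \<le> int R * int (length l)" if "set l \<subseteq> jumps R" for l
      using that by (induction l) (auto simp: algebra_simps)
    from this[OF elim(1)] show ?case
      using sum_list_increments[of k k X] elim(2) by (simp add: increments_def)
  qed
qed

section \<open>Independence and stationarity of the environment\<close>

text \<open>The values of \<open>F\<close> depend on the jump vectors at the sites in \<open>A\<close> only. For a measurable \<open>F\<close> this
replaces measurability with respect to the sub-sigma-algebra that \<open>A\<close> generates, and it is preserved by
arbitrary compositions.\<close>

definition determined_by :: "nat \<Rightarrow> (int \<times> int) set \<Rightarrow> (env \<Rightarrow> 'b) \<Rightarrow> bool" where
  "determined_by R A F \<longleftrightarrow> (\<forall>\<omega>\<in>space (env_space R). \<forall>\<omega>'\<in>space (env_space R).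
     (\<forall>i\<in>A. \<omega> i = \<omega>' i) \<longrightarrow> F \<omega> = F \<omega>')"

lemma determined_byI:
  "(\<And>\<omega> \<omega>'. \<omega> \<in> space (env_space R) \<Longrightarrow> \<omega>' \<in> space (env_space R) \<Longrightarrow> (\<And>i. i \<in> A \<Longrightarrow> \<omega> i = \<omega>' i) \<Longrightarrow> F \<omega> = F \<omega>')
   \<Longrightarrow> determined_by R A F"
  unfolding determined_by_def by blast

lemma determined_byD:
  "determined_by R A F \<Longrightarrow> \<omega> \<in> space (env_space R) \<Longrightarrow> \<omega>' \<in> space (env_space R) \<Longrightarrow> (\<And>i. i \<in> A \<Longrightarrow> \<omega> i = \<omega>' i) \<Longrightarrow> F \<omega> = F \<omega>'"
  unfolding determined_by_def by blast

lemma determined_by_mono: "determined_by R A F \<Longrightarrow> A \<subseteq> B \<Longrightarrow> determined_by R B F"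
  unfolding determined_by_def by blast

lemma determined_by_comp2:
  "determined_by R A F \<Longrightarrow> determined_by R A G \<Longrightarrow> determined_by R A (\<lambda>\<omega>. h (F \<omega>) (G \<omega>))"
  unfolding determined_by_def by metis

lemma determined_by_comp:
  "determined_by R A F \<Longrightarrow> determined_by R A (\<lambda>\<omega>. h (F \<omega>))"
  unfolding determined_by_def by metis

lemma determined_by_EP: "determined_by R {(y, t). s \<le> t} (\<lambda>\<omega>. EP \<omega> n x s f)"
proof (rule determined_byI)
  fix \<omega> \<omega>' :: env assume "\<And>i. i \<in> {(y, t). s \<le> t} \<Longrightarrow> \<omega> i = \<omega>' i"
  then have "path_pmf \<omega> n x s = path_pmf \<omega>' n x s" by (intro path_pmf_cong) auto
  then show "EP \<omega> n x s f = EP \<omega>' n x s f" by simp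
qed

lemma shift_in_space: "\<omega> \<in> space (env_space R) \<Longrightarrow> shift x s \<omega> \<in> space (env_space R)"
  using env_spaceD[of \<omega> R] by (auto simp: env_space_def space_PiM shift_def split: prod.split)

lemma measurable_shift[measurable]: "shift x s \<in> env_space R \<rightarrow>\<^sub>M env_space R"
proof -
  have "(\<lambda>\<omega> i. \<omega> (x + fst i, s + snd i)) \<in> env_space R \<rightarrow>\<^sub>M env_space R"
    unfolding env_space_def by (rule measurable_PiM_single') (auto simp: space_PiM)
  moreover have "shift x s = (\<lambda>\<omega> i. \<omega> (x + fst i, s + snd i))" by (auto simp: shift_def fun_eq_iff)
  ultimately show ?thesis by simp
qed

lemma determined_by_shift:
  assumes "determined_by R A F" shows "determined_by R ((\<lambda>(y, t). (x + y, s + t)) ` A) (\<lambda>\<omega>. F (shift x s \<omega>))"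
proof (rule determined_byI)
  fix \<omega> \<omega>' :: env assume w: "\<omega> \<in> space (env_space R)" "\<omega>' \<in> space (env_space R)"
    and eq: "\<And>i. i \<in> (\<lambda>(y, t). (x + y, s + t)) ` A \<Longrightarrow> \<omega> i = \<omega>' i"
  have "shift x s \<omega> i = shift x s \<omega>' i" if "i \<in> A" for i
    using eq[of "(x + fst i, s + snd i)"] that by (force simp: shift_def split: prod.split)
  then show "F (shift x s \<omega>) = F (shift x s \<omega>')"
    by (intro determined_byD[OF assms] shift_in_space w)
qed

lemma (in prob_space) expectation_abs_le_sqrt:
  fixes Y :: "'a \<Rightarrow> real"
  assumes "Y \<in> borel_measurable M" "integrable M (\<lambda>x. (Y x)\<^sup>2)"
  shows "expectation (\<lambda>x. \<bar>Y x\<bar>) \<le> sqrt (expectation (\<lambda>x. (Y x)\<^sup>2))"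
proof -
  have i: "integrable M Y" by (rule square_integrable_imp_integrable[OF assms])
  have "0 \<le> variance (\<lambda>x. \<bar>Y x\<bar>)" by (rule variance_positive)
  also have "\<dots> = expectation (\<lambda>x. \<bar>Y x\<bar>\<^sup>2) - (expectation (\<lambda>x. \<bar>Y x\<bar>))\<^sup>2"
    by (rule variance_eq) (use i assms in auto)
  finally show ?thesis by (intro real_le_rsqrt) simp
qed

locale iid_environment = prob_space P for P :: "env measure" +
  fixes R :: nat
  assumes sets_P: "sets P = sets (env_space R)" and A1: "A1 R P"
begin

lemma space_P: "space P = space (env_space R)"
  by (rule sets_eq_imp_space_eq[OF sets_P])

lemma measurable_P: "measurable P N = measurable (env_space R) N"
  by (rule measurable_cong_sets[OF sets_P refl])

lemma indep_jumps: "indep_vars (\<lambda>_. jump_space R) (\<lambda>i \<omega>. \<omega> i) UNIV"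
  using A1 unfolding A1_def by blast

text \<open>Filling up the coordinates outside of \<open>A\<close> with those of a fixed environment turns \<open>F\<close> into a measurable
function of the restriction to \<open>A\<close>, and restrictions to disjoint sets are independent.\<close>

lemma indep_determined:
  fixes F G :: "env \<Rightarrow> real"
  assumes F: "F \<in> borel_measurable P" "determined_by R A F"
    and G: "G \<in> borel_measurable P" "determined_by R B G" and AB: "A \<inter> B = {}"
  shows "indep_var borel F borel G"
proof -
  obtain \<omega>0 where w0: "\<omega>0 \<in> space (env_space R)" using not_empty space_P by blast
  define fill where "fill A \<rho> = (\<lambda>i. if i \<in> A then \<rho> i else \<omega>0 i)" for A and \<rho> :: env
  have fm: "fill A \<in> (\<Pi>\<^sub>M i\<in>A. jump_space R) \<rightarrow>\<^sub>M env_space R" for A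
    unfolding env_space_def
  proof (rule measurable_PiM_single')
    fix i show "(\<lambda>\<rho>. fill A \<rho> i) \<in> (\<Pi>\<^sub>M i\<in>A. jump_space R) \<rightarrow>\<^sub>M jump_space R"
      using env_spaceD[OF w0] by (cases "i \<in> A") (auto simp: fill_def)
  qed (use env_spaceD[OF w0] in \<open>auto simp: fill_def space_PiM PiE_iff\<close>)
  have eq: "F (fill A (restrict \<omega> A)) = F \<omega>" if "\<omega> \<in> space P" "determined_by R A F" for F :: "env \<Rightarrow> real" and A \<omega>
  proof (rule determined_byD[OF that(2)])
    show "fill A (restrict \<omega> A) \<in> space (env_space R)"
      using env_spaceD[OF w0] env_spaceD[of \<omega> R] that(1) space_P by (auto simp: fill_def env_space_def space_PiM)
  qed (use that space_P in \<open>auto simp: fill_def\<close>)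
  have "indep_var (PiM A (\<lambda>_. jump_space R)) (\<lambda>\<omega>. restrict (\<lambda>i. \<omega> i) A) (PiM B (\<lambda>_. jump_space R)) (\<lambda>\<omega>. restrict (\<lambda>i. \<omega> i) B)"
    by (rule indep_var_restrict[OF indep_jumps AB]) auto
  then have "indep_var borel ((F \<circ> fill A) \<circ> (\<lambda>\<omega>. restrict (\<lambda>i. \<omega> i) A)) borel ((G \<circ> fill B) \<circ> (\<lambda>\<omega>. restrict (\<lambda>i. \<omega> i) B))"
    by (rule indep_var_compose) (use F(1) G(1) fm in \<open>auto simp: measurable_P intro: measurable_comp\<close>)
  moreover have "distr P borel ((F \<circ> fill A) \<circ> (\<lambda>\<omega>. restrict (\<lambda>i. \<omega> i) A)) = distr P borel F"
    "distr P borel ((G \<circ> fill B) \<circ> (\<lambda>\<omega>. restrict (\<lambda>i. \<omega> i) B)) = distr P borel G"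
    by (rule distr_cong; use eq F(2) G(2) in simp)+
  moreover have "distr P (borel \<Otimes>\<^sub>M borel) (\<lambda>\<omega>. (((F \<circ> fill A) \<circ> (\<lambda>\<omega>. restrict (\<lambda>i. \<omega> i) A)) \<omega>,
      ((G \<circ> fill B) \<circ> (\<lambda>\<omega>. restrict (\<lambda>i. \<omega> i) B)) \<omega>)) = distr P (borel \<Otimes>\<^sub>M borel) (\<lambda>\<omega>. (F \<omega>, G \<omega>))"
    by (rule distr_cong) (use eq F(2) G(2) in auto)
  ultimately show ?thesis
    unfolding indep_var_distribution_eq using F(1) G(1) by simp
qed

lemma
  fixes F G :: "env \<Rightarrow> real"
  assumes "integrable P F" "determined_by R A F" "integrable P G" "determined_by R B G" "A \<inter> B = {}"
  shows expectation_mult_determined: "expectation (\<lambda>\<omega>. F \<omega> * G \<omega>) = expectation F * expectation G"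
    and integrable_mult_determined: "integrable P (\<lambda>\<omega>. F \<omega> * G \<omega>)"
  using indep_var_lebesgue_integral[OF indep_determined assms(1,3)] indep_var_integrable[OF indep_determined assms(1,3)] assms
  by auto

text \<open>The law of the environment is a product of identical factors, which a bijective relabelling of the
sites preserves.\<close>

lemma distr_shift: "distr P P (shift x s) = P"
proof -
  let ?f = "\<lambda>(y, t). (x + y, s + t)"
  define \<nu> where "\<nu> = distr P (jump_space R) (\<lambda>\<omega>. \<omega> (0, 0))"
  have rv: "(\<lambda>\<omega>. \<omega> i) \<in> P \<rightarrow>\<^sub>M jump_space R" for i
    unfolding measurable_P env_space_def by (rule measurable_component_singleton) simp
  have nu: "distr P (jump_space R) (\<lambda>\<omega>. \<omega> i) = \<nu>" for i
    using A1 unfolding A1_def \<nu>_def by blast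
  have "distr P (\<Pi>\<^sub>M i\<in>UNIV. jump_space R) (\<lambda>\<omega>. \<lambda>i\<in>UNIV. \<omega> i) = (\<Pi>\<^sub>M i\<in>UNIV. \<nu>)"
    using indep_vars_iff_distr_eq_PiM'[of UNIV "\<lambda>i \<omega>. \<omega> i" "\<lambda>_. jump_space R"] rv indep_jumps by (simp add: nu)
  moreover have "(\<lambda>\<omega>::env. restrict \<omega> UNIV) = (\<lambda>\<omega>. \<omega>)" by (auto simp: restrict_def)
  moreover have "distr P (\<Pi>\<^sub>M i\<in>UNIV. jump_space R) (\<lambda>\<omega>. \<omega>) = P"
    using sets_P by (intro distr_id2) (simp add: env_space_def)
  ultimately have P: "P = (\<Pi>\<^sub>M i\<in>UNIV. \<nu>)" by simp
  have "prob_space \<nu>" unfolding \<nu>_def by (rule prob_space_distr[OF rv])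
  then have "distr (PiM UNIV (\<lambda>_. \<nu>)) (\<Pi>\<^sub>M i\<in>UNIV. \<nu>) (\<lambda>\<omega>. \<lambda>n\<in>UNIV. \<omega> (?f n)) = (\<Pi>\<^sub>M i\<in>UNIV. \<nu>)"
    by (intro distr_PiM_reindex) (auto simp: inj_on_def)
  moreover have "shift x s = (\<lambda>\<omega>. \<lambda>n\<in>UNIV. \<omega> (?f n))"
    by (auto simp: shift_def fun_eq_iff)
  ultimately show ?thesis unfolding P[symmetric] by simp
qed

lemma measurable_shift_P: "shift x s \<in> P \<rightarrow>\<^sub>M P"
  using measurable_shift by (simp add: measurable_cong_sets[OF sets_P sets_P])

lemma integral_shift:
  fixes F :: "env \<Rightarrow> real" assumes "F \<in> borel_measurable P"
  shows "expectation (\<lambda>\<omega>. F (shift x s \<omega>)) = expectation F"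
  using integral_distr[OF measurable_shift_P assms, of x s] distr_shift by simp

lemma integrable_shift:
  fixes F :: "env \<Rightarrow> real" assumes "integrable P F"
  shows "integrable P (\<lambda>\<omega>. F (shift x s \<omega>))"
  using integrable_distr[OF measurable_shift_P, of x s F] distr_shift assms by simp

section \<open>Concentration of quenched expectations\<close>

abbreviation "p \<equiv> mean_jump P"

lemma measurable_component_P[measurable]: "(\<lambda>\<omega>. \<omega> i z) \<in> borel_measurable P"
  unfolding measurable_P by (rule measurable_env_component)

lemma component_nonneg: "\<omega> \<in> space P \<Longrightarrow> 0 \<le> \<omega> i z"
  using env_spaceD jump_spaceD(1) space_P by metis

lemma component_sum: "\<omega> \<in> space P \<Longrightarrow> (\<Sum>z\<in>jumps R. \<omega> i z) = 1"
  using env_spaceD jump_spaceD(3) space_P by metis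

lemma component_out: "\<omega> \<in> space P \<Longrightarrow> z \<notin> jumps R \<Longrightarrow> \<omega> i z = 0"
  using env_spaceD jump_spaceD(2) space_P by metis

lemma component_le1: assumes "\<omega> \<in> space P" shows "\<omega> i z \<le> 1"
proof (cases "z \<in> jumps R")
  case True
  then have "\<omega> i z \<le> (\<Sum>z\<in>jumps R. \<omega> i z)" using component_nonneg[OF assms] by (intro member_le_sum) auto
  then show ?thesis using component_sum[OF assms] by simp
qed (use component_out[OF assms] in simp)

lemma integrable_bounded:
  fixes F :: "env \<Rightarrow> real"
  assumes "F \<in> borel_measurable P" "\<And>\<omega>. \<omega> \<in> space P \<Longrightarrow> \<bar>F \<omega>\<bar> \<le> B"
  shows "integrable P F"
  by (rule integrable_const_bound[of _ B]) (use assms in auto)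

lemma integrable_component: "integrable P (\<lambda>\<omega>. \<omega> i z)"
  by (rule integrable_bounded[of _ 1]) (use component_nonneg component_le1 in auto)

lemma integrable_component2: "integrable P (\<lambda>\<omega>. \<omega> i z * \<omega> i' z')"
proof (rule integrable_bounded[of _ 1])
  fix \<omega> assume "\<omega> \<in> space P"
  then show "\<bar>\<omega> i z * \<omega> i' z'\<bar> \<le> 1"
    using component_nonneg component_le1 by (simp add: abs_mult mult_le_one)
qed simp

lemma expectation_component: "expectation (\<lambda>\<omega>. \<omega> i z) = p z"
proof -
  have "expectation (\<lambda>\<omega>. shift (fst i) (snd i) \<omega> (0, 0) z) = p z"
    unfolding mean_jump_def by (rule integral_shift) simp
  then show ?thesis by (simp add: shift_def)
qed

lemma p_space: "p \<in> space (jump_space R)"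
proof (rule jump_spaceI)
  show "0 \<le> p z" for z unfolding mean_jump_def by (rule Bochner_Integration.integral_nonneg) (simp add: component_nonneg)
  show "p z = 0" if "z \<notin> jumps R" for z
  proof -
    have "p z = expectation (\<lambda>\<omega>. 0)"
      unfolding mean_jump_def by (rule Bochner_Integration.integral_cong) (use component_out that in auto)
    then show ?thesis by simp
  qed
  have "(\<Sum>z\<in>jumps R. p z) = expectation (\<lambda>\<omega>. \<Sum>z\<in>jumps R. \<omega> (0,0) z)"
    unfolding mean_jump_def using integrable_component by simp
  also have "\<dots> = expectation (\<lambda>\<omega>. 1)"
    by (rule Bochner_Integration.integral_cong) (use component_sum in auto)
  finally show "(\<Sum>z\<in>jumps R. p z) = 1" by (simp add: prob_space)
qed

lemmas p_nonneg = jump_spaceD(1)[OF p_space] and p_sum = jump_spaceD(3)[OF p_space]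

text \<open>The averaged walk: at every site the jump law is the mean jump law. Since a walk visits each time
level once, its law under the averaged measure is that of this random walk (\<open>expectation_EP\<close> below).\<close>

abbreviation AP :: "nat \<Rightarrow> (int list \<Rightarrow> 'b::{banach,second_countable_topology}) \<Rightarrow> 'b" where
  "AP n \<equiv> EP (\<lambda>_. p) n 0 0"

lemmas const_p_space = const_env_space[OF p_space]

lemma AP_Suc:
  fixes f :: "int list \<Rightarrow> 'b::{banach,second_countable_topology}"
  shows "AP (Suc n) f = (\<Sum>z\<in>jumps R. p z *\<^sub>R AP n (\<lambda>l. f (z # l)))"
  unfolding EP_Suc[OF const_p_space] by (subst path_pmf_const) simp

lemma measurable_EP_P[measurable]: "(\<lambda>\<omega>. EP \<omega> n x s (f :: int list \<Rightarrow> real)) \<in> borel_measurable P"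
  unfolding measurable_P by (rule measurable_EP)

lemma integrable_EP: "integrable P (\<lambda>\<omega>. EP \<omega> n x s (f :: int list \<Rightarrow> real))"
proof -
  obtain B where "\<forall>\<omega>\<in>space (env_space R). \<forall>x s. \<bar>EP \<omega> n x s f\<bar> \<le> B" using EP_bounded by blast
  then show ?thesis by (intro integrable_bounded[of _ B]) (auto simp: space_P)
qed

lemma integrable_EP2: "integrable P (\<lambda>\<omega>. EP \<omega> n x s (f :: int list \<Rightarrow> real) * EP \<omega> n' x' s' (g :: int list \<Rightarrow> real))"
proof -
  obtain B where B: "\<forall>\<omega>\<in>space (env_space R). \<forall>x s. \<bar>EP \<omega> n x s f\<bar> \<le> B" using EP_bounded by blast
  obtain C where C: "\<forall>\<omega>\<in>space (env_space R). \<forall>x s. \<bar>EP \<omega> n' x s g\<bar> \<le> C" using EP_bounded by blast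
  show ?thesis
  proof (rule integrable_bounded[of _ "B * C"])
    fix \<omega> assume "\<omega> \<in> space P"
    then have "\<bar>EP \<omega> n x s f\<bar> \<le> B" "\<bar>EP \<omega> n' x' s' g\<bar> \<le> C" using B C space_P by auto
    then show "\<bar>EP \<omega> n x s f * EP \<omega> n' x' s' g\<bar> \<le> B * C"
      unfolding abs_mult by (intro mult_mono) auto
  qed simp
qed

lemma expectation_EP: "expectation (\<lambda>\<omega>. EP \<omega> n x s (f :: int list \<Rightarrow> real)) = AP n f"
proof (induction n arbitrary: x s f)
  case (Suc n)
  have ind: "expectation (\<lambda>\<omega>. \<omega> (x, s) z * EP \<omega> n (x + z) (s + 1) (\<lambda>l. f (z # l))) = p z * AP n (\<lambda>l. f (z # l))"
    and int: "integrable P (\<lambda>\<omega>. \<omega> (x, s) z * EP \<omega> n (x + z) (s + 1) (\<lambda>l. f (z # l)))" for z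
  proof -
    have d: "determined_by R {(x, s)} (\<lambda>\<omega>. \<omega> (x, s) z)" by (rule determined_byI) simp
    note a = integrable_component d integrable_EP determined_by_EP
    show "integrable P (\<lambda>\<omega>. \<omega> (x, s) z * EP \<omega> n (x + z) (s + 1) (\<lambda>l. f (z # l)))"
      by (rule integrable_mult_determined[OF a]) auto
    show "expectation (\<lambda>\<omega>. \<omega> (x, s) z * EP \<omega> n (x + z) (s + 1) (\<lambda>l. f (z # l))) = p z * AP n (\<lambda>l. f (z # l))"
      unfolding Suc[symmetric, of "\<lambda>l. f (z # l)" "x + z" "s + 1"] expectation_component[symmetric, of z "(x, s)"]
      by (rule expectation_mult_determined[OF a]) auto
  qed
  have "expectation (\<lambda>\<omega>. EP \<omega> (Suc n) x s f) =
      expectation (\<lambda>\<omega>. \<Sum>z\<in>jumps R. \<omega> (x, s) z * EP \<omega> n (x + z) (s + 1) (\<lambda>l. f (z # l)))"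
    by (rule Bochner_Integration.integral_cong) (auto simp: EP_Suc space_P simp del: path_pmf.simps)
  also have "\<dots> = (\<Sum>z\<in>jumps R. p z * AP n (\<lambda>l. f (z # l)))"
    using int ind by simp
  finally show ?case by (simp add: AP_Suc del: path_pmf.simps)
qed (simp add: prob_space)

text \<open>The averaged law of the next jumps of two walks that sit at \<open>x\<close> and \<open>x'\<close> at the same time in a common
environment. It is a product unless \<open>x = x'\<close>.\<close>

definition pair_jump :: "int \<Rightarrow> int \<Rightarrow> int \<Rightarrow> int \<Rightarrow> int \<Rightarrow> real" where
  "pair_jump s x x' z z' = expectation (\<lambda>\<omega>. \<omega> (x, s) z * \<omega> (x', s) z')"

text \<open>The mean distance, after one step, of two walks that start from the same site.\<close>

definition spread :: real where
  "spread = (\<Sum>z\<in>jumps R. \<Sum>z'\<in>jumps R. pair_jump 0 0 0 z z' * \<bar>z - z'\<bar>)"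

lemma pair_jump_nonneg: "0 \<le> pair_jump s x x' z z'"
  unfolding pair_jump_def by (rule Bochner_Integration.integral_nonneg) (simp add: component_nonneg)

lemma pair_jump_sum: "(\<Sum>z'\<in>jumps R. pair_jump s x x' z z') = p z"
proof -
  have "(\<Sum>z'\<in>jumps R. pair_jump s x x' z z') = expectation (\<lambda>\<omega>. \<omega> (x, s) z * (\<Sum>z'\<in>jumps R. \<omega> (x', s) z'))"
    unfolding pair_jump_def sum_distrib_left using integrable_component2 by simp
  also have "\<dots> = expectation (\<lambda>\<omega>. \<omega> (x, s) z)"
    by (rule Bochner_Integration.integral_cong) (use component_sum in auto)
  finally show ?thesis by (simp add: expectation_component)
qed

lemma pair_jump_sym: "pair_jump s x x' z z' = pair_jump s x' x z' z"
  unfolding pair_jump_def by (simp add: mult.commute)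

lemma pair_jump_sum': "(\<Sum>z\<in>jumps R. pair_jump s x x' z z') = p z'"
  by (subst pair_jump_sym) (rule pair_jump_sum)

lemma pair_jump_indep: assumes "x \<noteq> x'" shows "pair_jump s x x' z z' = p z * p z'"
proof -
  have d: "determined_by R {(x, s)} (\<lambda>\<omega>. \<omega> (x, s) z)" for x z by (rule determined_byI) simp
  show ?thesis unfolding pair_jump_def
    by (subst expectation_mult_determined[OF integrable_component d integrable_component d])
       (use assms in \<open>auto simp: expectation_component\<close>)
qed

lemma pair_jump_same: "pair_jump s x x z z' = pair_jump 0 0 0 z z'"
proof -
  have "expectation (\<lambda>\<omega>. shift x s \<omega> (0, 0) z * shift x s \<omega> (0, 0) z') = pair_jump 0 0 0 z z'"
    unfolding pair_jump_def by (rule integral_shift) simp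
  then show ?thesis by (simp add: shift_def pair_jump_def)
qed

text \<open>If the mean distance vanished, almost every jump vector would be a point mass.\<close>

lemma spread_pos: assumes "A2 P" shows "spread > 0"
proof (rule ccontr)
  let ?D = "\<lambda>\<omega>::env. \<Sum>z\<in>jumps R. \<Sum>z'\<in>jumps R. \<omega> (0,0) z * \<omega> (0,0) z' * real_of_int \<bar>z - z'\<bar>"
  have sp: "spread = expectation ?D"
    unfolding spread_def pair_jump_def using integrable_component2 by simp
  have intD: "integrable P ?D" using integrable_component2 by auto
  have nn: "0 \<le> ?D \<omega>" if "\<omega> \<in> space P" for \<omega>
    using component_nonneg[OF that] by (intro sum_nonneg mult_nonneg_nonneg) auto
  assume "\<not> spread > 0"
  moreover have "0 \<le> expectation ?D" by (rule Bochner_Integration.integral_nonneg) (rule nn)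
  ultimately have "expectation ?D = 0" using sp by linarith
  then have "AE \<omega> in P. ?D \<omega> = 0"
    using integral_nonneg_eq_0_iff_AE[OF intD] nn by (auto intro: AE_I2)
  then have "AE \<omega> in P. \<omega> \<notin> {\<omega> \<in> space P. \<exists>z. 0 < \<omega> (0, 0) z \<and> \<omega> (0, 0) z < 1}"
  proof (rule AE_mp, intro AE_I2 impI)
    fix \<omega> assume w: "\<omega> \<in> space P" and D0: "?D \<omega> = 0"
    have z0: "\<omega> (0,0) z * \<omega> (0,0) z' * real_of_int \<bar>z - z'\<bar> = 0" if "z \<in> jumps R" "z' \<in> jumps R" for z z'
    proof -
      have "\<forall>z\<in>jumps R. (\<Sum>z'\<in>jumps R. \<omega> (0,0) z * \<omega> (0,0) z' * real_of_int \<bar>z - z'\<bar>) = 0"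
        using D0 component_nonneg[OF w] by (subst (asm) sum_nonneg_eq_0_iff) (auto intro!: sum_nonneg mult_nonneg_nonneg)
      then have "(\<Sum>z'\<in>jumps R. \<omega> (0,0) z * \<omega> (0,0) z' * real_of_int \<bar>z - z'\<bar>) = 0" using that by blast
      then have "\<forall>z'\<in>jumps R. \<omega> (0,0) z * \<omega> (0,0) z' * real_of_int \<bar>z - z'\<bar> = 0"
        using component_nonneg[OF w] by (subst (asm) sum_nonneg_eq_0_iff) (auto intro!: mult_nonneg_nonneg)
      then show ?thesis using that by blast
    qed
    show "\<omega> \<notin> {\<omega> \<in> space P. \<exists>z. 0 < \<omega> (0, 0) z \<and> \<omega> (0, 0) z < 1}"
    proof
      assume "\<omega> \<in> {\<omega> \<in> space P. \<exists>z. 0 < \<omega> (0, 0) z \<and> \<omega> (0, 0) z < 1}"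
      then obtain z where z: "0 < \<omega> (0, 0) z" "\<omega> (0, 0) z < 1" by blast
      then have zJ: "z \<in> jumps R" using component_out[OF w, of z "(0,0)"] by force
      have "(\<Sum>z'\<in>jumps R. \<omega> (0,0) z') = \<omega> (0,0) z + (\<Sum>z'\<in>jumps R - {z}. \<omega> (0,0) z')"
        using zJ by (simp add: sum.remove)
      also have "(\<Sum>z'\<in>jumps R - {z}. \<omega> (0,0) z') = 0"
        using z0[OF zJ] z by (intro sum.neutral) fastforce
      finally show False using component_sum[OF w, of "(0,0)"] z by simp
    qed
  qed
  moreover have "{\<omega> \<in> space P. \<exists>z. 0 < \<omega> (0, 0) z \<and> \<omega> (0, 0) z < 1} \<in> events" by measurable
  ultimately have "prob {\<omega> \<in> space P. \<exists>z. 0 < \<omega> (0, 0) z \<and> \<omega> (0, 0) z < 1} = 0"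
    by (subst prob_eq_0) auto
  then show False using assms unfolding A2_def by simp
qed

lemma weighted_jensen:
  fixes w f :: "'i \<Rightarrow> real"
  assumes "\<And>i. i \<in> A \<Longrightarrow> 0 \<le> w i" "sum w A = 1"
  shows "(\<Sum>i\<in>A. w i * f i)\<^sup>2 \<le> (\<Sum>i\<in>A. w i * (f i)\<^sup>2)"
proof -
  let ?m = "\<Sum>i\<in>A. w i * f i"
  have "0 \<le> (\<Sum>i\<in>A. w i * (f i - ?m)\<^sup>2)" using assms by (intro sum_nonneg mult_nonneg_nonneg) auto
  also have "\<dots> = (\<Sum>i\<in>A. w i * (f i)\<^sup>2 - 2 * ?m * (w i * f i) + ?m\<^sup>2 * w i)"
    by (intro sum.cong refl) (simp add: power2_eq_square algebra_simps)
  also have "\<dots> = (\<Sum>i\<in>A. w i * (f i)\<^sup>2) - 2 * ?m * ?m + ?m\<^sup>2 * 1"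
    by (simp only: sum.distrib sum_subtractf sum_distrib_left[symmetric] assms(2))
  finally show ?thesis by (simp add: power2_eq_square)
qed

text \<open>A bound, up to the factor \<open>spread\<close>, for the expected number of times at which two walks in a common
environment meet during \<open>n\<close> steps if their initial distance is \<open>|y|\<close>.\<close>

definition potential :: "nat \<Rightarrow> int \<Rightarrow> real" where
  "potential n y = sqrt ((real_of_int y)\<^sup>2 + 4 * (real R)\<^sup>2 * real n) - \<bar>real_of_int y\<bar>"

text \<open>The difference of the two walks is a martingale with increments bounded by \<open>2 R\<close>. By Jensen's inequality
the expected square root is at most \<open>\<surd>(y\<^sup>2 + 4 R\<^sup>2 (n + 1))\<close>, while the expectation of the modulus does not
decrease, and increases by \<open>spread\<close> if the walks are at the same site.\<close>

lemma potential_step: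
  "(\<Sum>z\<in>jumps R. \<Sum>z'\<in>jumps R. pair_jump s x x' z z' * potential n (x + z - (x' + z')))
     \<le> potential (Suc n) (x - x') - (if x = x' then spread else 0)"
proof -
  let ?A = "jumps R \<times> jumps R"
  define w where "w = (\<lambda>(z, z'). pair_jump s x x' z z')"
  define d where "d = (\<lambda>(z, z'). real_of_int (z - z'))"
  define y where "y = real_of_int (x - x')"
  have w0: "0 \<le> w i" for i unfolding w_def by (auto simp: pair_jump_nonneg split: prod.split)
  have ws: "sum w ?A = 1" unfolding w_def
    by (subst sum.cartesian_product[symmetric]) (simp add: pair_jump_sum p_sum)
  have wd: "(\<Sum>i\<in>?A. w i * d i) = 0"
  proof -
    have "(\<Sum>i\<in>?A. w i * d i) = (\<Sum>z\<in>jumps R. \<Sum>z'\<in>jumps R. pair_jump s x x' z z' * z) - (\<Sum>z\<in>jumps R. \<Sum>z'\<in>jumps R. pair_jump s x x' z z' * z')"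
      unfolding w_def d_def
      by (simp add: sum.cartesian_product' case_prod_unfold right_diff_distrib sum_subtractf)
    also have "(\<Sum>z\<in>jumps R. \<Sum>z'\<in>jumps R. pair_jump s x x' z z' * z) = (\<Sum>z\<in>jumps R. p z * z)"
      by (simp add: sum_distrib_right[symmetric] pair_jump_sum)
    also have "(\<Sum>z\<in>jumps R. \<Sum>z'\<in>jumps R. pair_jump s x x' z z' * z') = (\<Sum>z\<in>jumps R. p z * z)"
      by (subst sum.swap) (simp add: sum_distrib_right[symmetric] pair_jump_sum')
    finally show ?thesis by simp
  qed
  have dR: "(d i)\<^sup>2 \<le> 4 * (real R)\<^sup>2" if "i \<in> ?A" for i
  proof -
    have "\<bar>d i\<bar> \<le> 2 * real R" using that unfolding d_def by (auto split: prod.split)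
    then have "(d i)\<^sup>2 \<le> (2 * real R)\<^sup>2" by (metis abs_ge_zero power2_abs power_mono)
    then show ?thesis by (simp add: power_mult_distrib)
  qed
  have "(\<Sum>i\<in>?A. w i * sqrt ((y + d i)\<^sup>2 + 4 * (real R)\<^sup>2 * n)) \<le> sqrt (y\<^sup>2 + 4 * (real R)\<^sup>2 * real (Suc n))"
  proof (rule real_le_rsqrt)
    have "(\<Sum>i\<in>?A. w i * sqrt ((y + d i)\<^sup>2 + 4 * (real R)\<^sup>2 * n))\<^sup>2 \<le> (\<Sum>i\<in>?A. w i * (sqrt ((y + d i)\<^sup>2 + 4 * (real R)\<^sup>2 * n))\<^sup>2)"
      by (rule weighted_jensen) (auto simp: w0 ws)
    also have "\<dots> = (\<Sum>i\<in>?A. w i * y\<^sup>2 + 2 * y * (w i * d i) + w i * (d i)\<^sup>2 + w i * (4 * (real R)\<^sup>2 * n))"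
    proof (intro sum.cong refl)
      fix i
      have "(sqrt ((y + d i)\<^sup>2 + 4 * (real R)\<^sup>2 * n))\<^sup>2 = (y + d i)\<^sup>2 + 4 * (real R)\<^sup>2 * n" by simp
      then show "w i * (sqrt ((y + d i)\<^sup>2 + 4 * (real R)\<^sup>2 * n))\<^sup>2 =
          w i * y\<^sup>2 + 2 * y * (w i * d i) + w i * (d i)\<^sup>2 + w i * (4 * (real R)\<^sup>2 * n)"
        by (simp add: power2_eq_square algebra_simps)
    qed
    also have "\<dots> = y\<^sup>2 + 2 * y * 0 + (\<Sum>i\<in>?A. w i * (d i)\<^sup>2) + (4 * (real R)\<^sup>2 * n)"
      by (simp only: sum.distrib sum_distrib_left[symmetric] sum_distrib_right[symmetric] ws wd mult_1)
    also have "(\<Sum>i\<in>?A. w i * (d i)\<^sup>2) \<le> (\<Sum>i\<in>?A. w i * (4 * (real R)\<^sup>2))"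
      by (intro sum_mono mult_left_mono dR w0)
    also have "\<dots> = 4 * (real R)\<^sup>2" by (simp only: sum_distrib_right[symmetric] ws mult_1)
    finally show "(\<Sum>i\<in>?A. w i * sqrt ((y + d i)\<^sup>2 + 4 * (real R)\<^sup>2 * n))\<^sup>2 \<le> y\<^sup>2 + 4 * (real R)\<^sup>2 * real (Suc n)"
      by (simp add: algebra_simps)
  qed
  moreover have "\<bar>y\<bar> + (if x = x' then spread else 0) \<le> (\<Sum>i\<in>?A. w i * \<bar>y + d i\<bar>)"
  proof (cases "x = x'")
    case True
    then have "(\<Sum>i\<in>?A. w i * \<bar>y + d i\<bar>) = spread"
      unfolding spread_def w_def d_def y_def pair_jump_same[of s x, symmetric]
      by (simp add: sum.cartesian_product' case_prod_unfold)
    then show ?thesis using True by (simp add: y_def)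
  next
    case False
    have "\<bar>y\<bar> = \<bar>\<Sum>i\<in>?A. w i * y + w i * d i\<bar>" by (simp only: sum.distrib sum_distrib_right[symmetric] ws wd mult_1 add_0_right)
    also have "\<dots> \<le> (\<Sum>i\<in>?A. \<bar>w i * y + w i * d i\<bar>)" by (rule sum_abs)
    also have "\<dots> = (\<Sum>i\<in>?A. w i * \<bar>y + d i\<bar>)"
      by (intro sum.cong refl) (simp add: distrib_left[symmetric] abs_mult w0)
    finally show ?thesis using False by simp
  qed
  moreover have "(\<Sum>z\<in>jumps R. \<Sum>z'\<in>jumps R. pair_jump s x x' z z' * potential n (x + z - (x' + z')))
     = (\<Sum>i\<in>?A. w i * sqrt ((y + d i)\<^sup>2 + 4 * (real R)\<^sup>2 * n)) - (\<Sum>i\<in>?A. w i * \<bar>y + d i\<bar>)"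
    unfolding w_def d_def y_def potential_def sum_subtractf[symmetric]
    by (simp add: sum.cartesian_product' case_prod_unfold right_diff_distrib algebra_simps)
  ultimately show ?thesis unfolding potential_def y_def by simp
qed

text \<open>The marginals of \<open>pair_jump\<close> are \<open>p\<close>, so constants may be subtracted from \<open>a\<close> and \<open>b\<close>; afterwards both are
bounded by \<open>c\<close>.\<close>

lemma covariance_same_site:
  assumes a: "\<And>z z'. z \<in> jumps R \<Longrightarrow> z' \<in> jumps R \<Longrightarrow> \<bar>a z - a z'\<bar> \<le> c"
    and b: "\<And>z z'. z \<in> jumps R \<Longrightarrow> z' \<in> jumps R \<Longrightarrow> \<bar>b z - b z'\<bar> \<le> c" and c: "0 \<le> c"
  shows "\<bar>(\<Sum>z\<in>jumps R. \<Sum>z'\<in>jumps R. pair_jump s x x' z z' * (a z * b z')) - (\<Sum>z\<in>jumps R. p z * a z) * (\<Sum>z\<in>jumps R. p z * b z)\<bar>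
     \<le> 2 * c\<^sup>2"
proof -
  let ?w = "\<lambda>z z'. pair_jump s x x' z z'"
  define \<alpha> \<beta> where "\<alpha> z = a z - a 0" and "\<beta> z = b z - b 0" for z
  have \<alpha>: "\<bar>\<alpha> z\<bar> \<le> c" "\<bar>\<beta> z\<bar> \<le> c" if "z \<in> jumps R" for z using a[OF that, of 0] b[OF that, of 0] by (auto simp: \<alpha>_def \<beta>_def)
  have ab: "\<bar>\<alpha> z * \<beta> z'\<bar> \<le> c\<^sup>2" if "z \<in> jumps R" "z' \<in> jumps R" for z z'
    unfolding abs_mult power2_eq_square using \<alpha> that c by (intro mult_mono) auto
  have 1: "(\<Sum>z\<in>jumps R. \<Sum>z'\<in>jumps R. ?w z z' * (a z * b z')) =
     (\<Sum>z\<in>jumps R. \<Sum>z'\<in>jumps R. ?w z z' * (\<alpha> z * \<beta> z')) + b 0 * (\<Sum>z\<in>jumps R. p z * \<alpha> z) + a 0 * (\<Sum>z'\<in>jumps R. p z' * \<beta> z') + a 0 * b 0"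
  proof -
    have "(\<Sum>z\<in>jumps R. \<Sum>z'\<in>jumps R. ?w z z' * (a z * b z')) =
      (\<Sum>z\<in>jumps R. \<Sum>z'\<in>jumps R. ?w z z' * (\<alpha> z * \<beta> z') + b 0 * (?w z z' * \<alpha> z) + a 0 * (?w z z' * \<beta> z') + a 0 * b 0 * ?w z z')"
      by (intro sum.cong refl) (simp add: \<alpha>_def \<beta>_def algebra_simps)
    also have "\<dots> = (\<Sum>z\<in>jumps R. \<Sum>z'\<in>jumps R. ?w z z' * (\<alpha> z * \<beta> z')) + b 0 * (\<Sum>z\<in>jumps R. \<Sum>z'\<in>jumps R. ?w z z' * \<alpha> z)
       + a 0 * (\<Sum>z\<in>jumps R. \<Sum>z'\<in>jumps R. ?w z z' * \<beta> z') + a 0 * b 0 * (\<Sum>z\<in>jumps R. \<Sum>z'\<in>jumps R. ?w z z')"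
      by (simp only: sum.distrib sum_distrib_left[symmetric])
    also have "(\<Sum>z\<in>jumps R. \<Sum>z'\<in>jumps R. ?w z z' * \<alpha> z) = (\<Sum>z\<in>jumps R. p z * \<alpha> z)"
      by (simp add: sum_distrib_right[symmetric] pair_jump_sum)
    also have "(\<Sum>z\<in>jumps R. \<Sum>z'\<in>jumps R. ?w z z' * \<beta> z') = (\<Sum>z'\<in>jumps R. p z' * \<beta> z')"
      by (subst sum.swap) (simp add: sum_distrib_right[symmetric] pair_jump_sum')
    also have "(\<Sum>z\<in>jumps R. \<Sum>z'\<in>jumps R. ?w z z') = 1"
      by (simp add: pair_jump_sum p_sum)
    finally show ?thesis by simp
  qed
  have 2: "(\<Sum>z\<in>jumps R. p z * a z) = (\<Sum>z\<in>jumps R. p z * \<alpha> z) + a 0" "(\<Sum>z\<in>jumps R. p z * b z) = (\<Sum>z\<in>jumps R. p z * \<beta> z) + b 0"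
    by (simp_all add: \<alpha>_def \<beta>_def right_diff_distrib sum_subtractf sum_distrib_right[symmetric] p_sum)
  have 3: "\<bar>\<Sum>z\<in>jumps R. \<Sum>z'\<in>jumps R. ?w z z' * (\<alpha> z * \<beta> z')\<bar> \<le> c\<^sup>2"
  proof -
    have "\<bar>\<Sum>z\<in>jumps R. \<Sum>z'\<in>jumps R. ?w z z' * (\<alpha> z * \<beta> z')\<bar> \<le> (\<Sum>z\<in>jumps R. \<Sum>z'\<in>jumps R. \<bar>?w z z' * (\<alpha> z * \<beta> z')\<bar>)"
      by (rule order_trans[OF sum_abs]) (intro sum_mono sum_abs)
    also have "\<dots> \<le> (\<Sum>z\<in>jumps R. \<Sum>z'\<in>jumps R. ?w z z' * c\<^sup>2)"
      unfolding abs_mult[of "pair_jump s x x' z z'" for z z'] using ab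
      by (intro sum_mono mult_mono) (auto simp: pair_jump_nonneg)
    also have "\<dots> = c\<^sup>2" by (simp add: sum_distrib_right[symmetric] pair_jump_sum p_sum)
    finally show ?thesis .
  qed
  have mean: "\<bar>\<Sum>z\<in>jumps R. p z * g z\<bar> \<le> c" if "\<And>z. z \<in> jumps R \<Longrightarrow> \<bar>g z\<bar> \<le> c" for g
  proof -
    have "\<bar>\<Sum>z\<in>jumps R. p z * g z\<bar> \<le> (\<Sum>z\<in>jumps R. \<bar>p z * g z\<bar>)" by (rule sum_abs)
    also have "\<dots> \<le> (\<Sum>z\<in>jumps R. p z * c)" using that p_nonneg by (intro sum_mono) (auto simp: abs_mult intro!: mult_left_mono)
    also have "\<dots> = c" by (simp add: sum_distrib_right[symmetric] p_sum)
    finally show ?thesis .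
  qed
  have 4: "\<bar>(\<Sum>z\<in>jumps R. p z * \<alpha> z) * (\<Sum>z\<in>jumps R. p z * \<beta> z)\<bar> \<le> c\<^sup>2"
    unfolding abs_mult power2_eq_square using mean[of \<alpha>] mean[of \<beta>] \<alpha> c by (intro mult_mono) auto
  have "(\<Sum>z\<in>jumps R. \<Sum>z'\<in>jumps R. ?w z z' * (a z * b z')) - (\<Sum>z\<in>jumps R. p z * a z) * (\<Sum>z\<in>jumps R. p z * b z)
     = (\<Sum>z\<in>jumps R. \<Sum>z'\<in>jumps R. ?w z z' * (\<alpha> z * \<beta> z')) - (\<Sum>z\<in>jumps R. p z * \<alpha> z) * (\<Sum>z\<in>jumps R. p z * \<beta> z)"
    unfolding 1 2 by (simp add: algebra_simps)
  then show ?thesis using 3 4 by linarith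
qed

text \<open>Induction on the number of steps. The first step of the two walks is independent of the later environment, so the
induction hypothesis applies to the remaining paths. Replacing \<open>pair_jump\<close> by the product law in the first
step costs at most \<open>2 c\<^sup>2\<close>, and only if the walks start from the same site; this is exactly what the
potential loses there.\<close>

lemma covariance_bound:
  assumes sp: "spread > 0" and c: "0 \<le> c" and "bounded_diff R n c f" "bounded_diff R n c g"
  shows "\<bar>expectation (\<lambda>\<omega>. EP \<omega> n x s f * EP \<omega> n x' s g) - AP n f * AP n g\<bar> \<le> c\<^sup>2 * (2 / spread) * potential n (x - x')"
  using assms(3,4)
proof (induction n arbitrary: f g x x' s)
  case 0
  show ?case by (simp add: potential_def prob_space)
next
  case (Suc n)
  let ?f = "\<lambda>z l. f (z # l)" and ?g = "\<lambda>z l. g (z # l)"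
  let ?w = "pair_jump s x x'"
  let ?E = "\<lambda>z z'. expectation (\<lambda>\<omega>. EP \<omega> n (x + z) (s + 1) (?f z) * EP \<omega> n (x' + z') (s + 1) (?g z'))"
  let ?a = "\<lambda>z. AP n (?f z)" and ?b = "\<lambda>z. AP n (?g z)"
  have ind: "expectation (\<lambda>\<omega>. (\<omega> (x, s) z * \<omega> (x', s) z') * (EP \<omega> n (x + z) (s + 1) (?f z) * EP \<omega> n (x' + z') (s + 1) (?g z'))) = ?w z z' * ?E z z'"
    and int: "integrable P (\<lambda>\<omega>. (\<omega> (x, s) z * \<omega> (x', s) z') * (EP \<omega> n (x + z) (s + 1) (?f z) * EP \<omega> n (x' + z') (s + 1) (?g z')))" for z z'
  proof -
    have d: "determined_by R {(x, s), (x', s)} (\<lambda>\<omega>. \<omega> (x, s) z * \<omega> (x', s) z')" by (rule determined_byI) simp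
    have d2: "determined_by R {(y, t). s + 1 \<le> t} (\<lambda>\<omega>. EP \<omega> n (x + z) (s + 1) (?f z) * EP \<omega> n (x' + z') (s + 1) (?g z'))"
      by (rule determined_by_comp2[where h = "(*)"]) (rule determined_by_EP)+
    note a = integrable_component2 d integrable_EP2 d2
    show "expectation (\<lambda>\<omega>. (\<omega> (x, s) z * \<omega> (x', s) z') * (EP \<omega> n (x + z) (s + 1) (?f z) * EP \<omega> n (x' + z') (s + 1) (?g z'))) = ?w z z' * ?E z z'"
      unfolding pair_jump_def by (rule expectation_mult_determined[OF a]) auto
    show "integrable P (\<lambda>\<omega>. (\<omega> (x, s) z * \<omega> (x', s) z') * (EP \<omega> n (x + z) (s + 1) (?f z) * EP \<omega> n (x' + z') (s + 1) (?g z')))"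
      by (rule integrable_mult_determined[OF a]) auto
  qed
  have "expectation (\<lambda>\<omega>. EP \<omega> (Suc n) x s f * EP \<omega> (Suc n) x' s g) =
     expectation (\<lambda>\<omega>. \<Sum>z\<in>jumps R. \<Sum>z'\<in>jumps R. (\<omega> (x, s) z * \<omega> (x', s) z') * (EP \<omega> n (x + z) (s + 1) (?f z) * EP \<omega> n (x' + z') (s + 1) (?g z')))"
    by (rule Bochner_Integration.integral_cong)
       (simp_all only: EP_Suc space_P sum_product real_scaleR_def, simp add: mult_ac)
  also have "\<dots> = (\<Sum>z\<in>jumps R. \<Sum>z'\<in>jumps R. ?w z z' * ?E z z')"
    using int ind by simp
  finally have E: "expectation (\<lambda>\<omega>. EP \<omega> (Suc n) x s f * EP \<omega> (Suc n) x' s g) = (\<Sum>z\<in>jumps R. \<Sum>z'\<in>jumps R. ?w z z' * ?E z z')" .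
  have IH: "\<bar>?E z z' - ?a z * ?b z'\<bar> \<le> c\<^sup>2 * (2 / spread) * potential n (x + z - (x' + z'))" if "z \<in> jumps R" "z' \<in> jumps R" for z z'
    by (rule Suc.IH) (use Suc.prems that in \<open>auto intro: bounded_diff_Cons\<close>)
  have 1: "\<bar>(\<Sum>z\<in>jumps R. \<Sum>z'\<in>jumps R. ?w z z' * ?E z z') - (\<Sum>z\<in>jumps R. \<Sum>z'\<in>jumps R. ?w z z' * (?a z * ?b z'))\<bar>
     \<le> c\<^sup>2 * (2 / spread) * (potential (Suc n) (x - x') - (if x = x' then spread else 0))"
  proof -
    have "\<bar>(\<Sum>z\<in>jumps R. \<Sum>z'\<in>jumps R. ?w z z' * ?E z z') - (\<Sum>z\<in>jumps R. \<Sum>z'\<in>jumps R. ?w z z' * (?a z * ?b z'))\<bar>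
       = \<bar>\<Sum>z\<in>jumps R. \<Sum>z'\<in>jumps R. ?w z z' * (?E z z' - ?a z * ?b z')\<bar>"
      by (simp add: sum_subtractf right_diff_distrib)
    also have "\<dots> \<le> (\<Sum>z\<in>jumps R. \<Sum>z'\<in>jumps R. \<bar>?w z z' * (?E z z' - ?a z * ?b z')\<bar>)"
      by (rule order_trans[OF sum_abs]) (intro sum_mono sum_abs)
    also have "\<dots> \<le> (\<Sum>z\<in>jumps R. \<Sum>z'\<in>jumps R. ?w z z' * (c\<^sup>2 * (2 / spread) * potential n (x + z - (x' + z'))))"
      unfolding abs_mult[of "pair_jump s x x' z z'" for z z'] using IH
      by (intro sum_mono mult_mono) (auto simp: pair_jump_nonneg)
    also have "\<dots> = c\<^sup>2 * (2 / spread) * (\<Sum>z\<in>jumps R. \<Sum>z'\<in>jumps R. ?w z z' * potential n (x + z - (x' + z')))"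
      by (simp add: sum_distrib_left mult_ac)
    also have "\<dots> \<le> c\<^sup>2 * (2 / spread) * (potential (Suc n) (x - x') - (if x = x' then spread else 0))"
      by (rule mult_left_mono[OF potential_step]) (use sp in auto)
    finally show ?thesis .
  qed
  have 2: "\<bar>(\<Sum>z\<in>jumps R. \<Sum>z'\<in>jumps R. ?w z z' * (?a z * ?b z')) - AP (Suc n) f * AP (Suc n) g\<bar> \<le> (if x = x' then 2 * c\<^sup>2 else 0)"
  proof (cases "x = x'")
    case True
    have "\<bar>(\<Sum>z\<in>jumps R. \<Sum>z'\<in>jumps R. ?w z z' * (?a z * ?b z')) - (\<Sum>z\<in>jumps R. p z * ?a z) * (\<Sum>z\<in>jumps R. p z * ?b z)\<bar> \<le> 2 * c\<^sup>2"
      by (rule covariance_same_site) (use Suc.prems c const_p_space in \<open>auto intro!: bounded_diff_EP\<close>)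
    then show ?thesis using True by (simp add: AP_Suc del: path_pmf.simps)
  next
    case False
    then show ?thesis
      by (simp add: AP_Suc pair_jump_indep sum_product mult_ac del: path_pmf.simps)
  qed
  have "c\<^sup>2 * (2 / spread) * (potential (Suc n) (x - x') - (if x = x' then spread else 0)) + (if x = x' then 2 * c\<^sup>2 else 0)
      = c\<^sup>2 * (2 / spread) * potential (Suc n) (x - x')"
    using sp by (simp add: field_simps)
  then show ?case unfolding E using 1 2 by linarith
qed

text \<open>The variance of the quenched expectation is the covariance of two walks that start from the same site, and
\<open>potential n 0 = 2 R \<surd>n\<close>. The fluctuations are thus of order \<open>c n\<^sup>1\<^sup>/\<^sup>4\<close>, and not \<open>c n\<^sup>1\<^sup>/\<^sup>2\<close> as for the path
itself.\<close>

theorem quenched_concentration: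
  assumes sp: "spread > 0" and c: "0 \<le> c" and f: "bounded_diff R n c f"
  shows "expectation (\<lambda>\<omega>. \<bar>EP \<omega> n x s f - AP n f\<bar>) \<le> c * sqrt (4 * real R / spread * sqrt n)"
proof -
  have "expectation (\<lambda>\<omega>. \<bar>EP \<omega> n x s f - AP n f\<bar>) \<le> sqrt (expectation (\<lambda>\<omega>. (EP \<omega> n x s f - AP n f)\<^sup>2))"
    by (rule expectation_abs_le_sqrt)
       (use integrable_EP integrable_EP2 in \<open>auto simp: power2_eq_square algebra_simps intro!: Bochner_Integration.integrable_diff Bochner_Integration.integrable_add\<close>)
  also have "expectation (\<lambda>\<omega>. (EP \<omega> n x s f - AP n f)\<^sup>2) =
    expectation (\<lambda>\<omega>. EP \<omega> n x s f * EP \<omega> n x s f - 2 * AP n f * EP \<omega> n x s f + AP n f * AP n f)"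
    by (intro Bochner_Integration.integral_cong) (auto simp: power2_eq_square algebra_simps)
  also have "\<dots> = expectation (\<lambda>\<omega>. EP \<omega> n x s f * EP \<omega> n x s f) - AP n f * AP n f"
    using integrable_EP integrable_EP2 by (simp add: expectation_EP prob_space)
  also have "\<dots> \<le> c\<^sup>2 * (2 / spread) * potential n 0"
    using covariance_bound[OF sp c f f, of x s x] by simp
  also have "\<dots> = c\<^sup>2 * (4 * real R / spread * sqrt n)"
    by (simp add: potential_def real_sqrt_mult)
  finally have "expectation (\<lambda>\<omega>. \<bar>EP \<omega> n x s f - AP n f\<bar>) \<le> sqrt (c\<^sup>2 * (4 * real R / spread * sqrt n))" by simp
  also have "\<dots> = c * sqrt (4 * real R / spread * sqrt n)"
    unfolding real_sqrt_mult[of "c\<^sup>2"] using c by simp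
  finally show ?thesis .
qed

end

section \<open>A weighted law of large numbers over space shifts\<close>

context iid_environment
begin

definition cylinder_approximable :: "env set \<Rightarrow> bool" where
  "cylinder_approximable A \<longleftrightarrow> A \<in> sets P \<and> (\<forall>e>0. \<exists>J B. finite J \<and> B \<in> sets P \<and>
     determined_by R J (\<lambda>\<omega>. \<omega> \<in> B) \<and> prob (sym_diff A B) < e)"

text \<open>The approximable events form a sigma-algebra that contains the generating cylinders.\<close>

lemma cylinder_approximable: assumes "A \<in> sets P" shows "cylinder_approximable A"
proof -
  let ?G = "{{f \<in> (\<Pi>\<^sub>E i\<in>UNIV. space (jump_space R)). f i \<in> A} | i A. i \<in> (UNIV :: (int \<times> int) set) \<and> A \<in> sets (jump_space R)}"
  have Gs: "sets P = sigma_sets (space P) ?G"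
    unfolding sets_P space_P env_space_def sets_PiM_single space_PiM ..
  have "A \<in> sigma_sets (space P) ?G" using assms unfolding Gs .
  then show ?thesis
  proof (induction rule: sigma_sets.induct)
    case (Basic a)
    then obtain i B where a: "a = {f \<in> (\<Pi>\<^sub>E i\<in>UNIV. space (jump_space R)). f i \<in> B}" by blast
    have "a \<in> sets P" using Basic unfolding Gs by (rule sigma_sets.Basic)
    moreover have "determined_by R {i} (\<lambda>\<omega>. \<omega> \<in> a)"
      by (rule determined_byI) (auto simp: a env_space_def space_PiM)
    ultimately show ?case unfolding cylinder_approximable_def
      by (intro conjI allI impI exI[of _ "{i}"] exI[of _ a]) auto
  next
    case Empty
    show ?case unfolding cylinder_approximable_def
      by (intro conjI allI impI exI[of _ "{}"]) (auto simp: determined_by_def)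
  next
    case (Compl a)
    show ?case unfolding cylinder_approximable_def
    proof (intro conjI allI impI)
      show "space P - a \<in> sets P" using Compl.IH unfolding cylinder_approximable_def by auto
      fix e :: real assume "e > 0"
      then obtain J B where JB: "finite J" "B \<in> sets P" "determined_by R J (\<lambda>\<omega>. \<omega> \<in> B)" "prob (sym_diff a B) < e"
        using Compl.IH unfolding cylinder_approximable_def by blast
      have "determined_by R J (\<lambda>\<omega>. \<omega> \<in> space P - B)"
        using JB(3) unfolding determined_by_def space_P by blast
      moreover have "sym_diff (space P - a) (space P - B) = sym_diff a B"
        using sets.sets_into_space[OF JB(2)] sets.sets_into_space[of a P] Compl.IH
        unfolding cylinder_approximable_def by blast
      ultimately show "\<exists>J B. finite J \<and> B \<in> sets P \<and> determined_by R J (\<lambda>\<omega>. \<omega> \<in> B) \<and> prob (sym_diff (space P - a) B) < e"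
        using JB by (intro exI[of _ J] exI[of _ "space P - B"]) auto
    qed
  next
    case (Union a)
    have aP: "a i \<in> sets P" for i using Union.IH unfolding cylinder_approximable_def by blast
    show ?case unfolding cylinder_approximable_def
    proof (intro conjI allI impI)
      show "(\<Union>i. a i) \<in> sets P" using aP by blast
      fix e :: real assume e: "e > 0"
      have "(\<lambda>n. prob (\<Union>i<n. a i)) \<longlonglongrightarrow> prob (\<Union>n. \<Union>i<n. a i)"
        proof (rule finite_Lim_measure_incseq)
        show "range (\<lambda>n. \<Union>i<n. a i) \<subseteq> sets P" using aP by auto
        show "incseq (\<lambda>n. \<Union>i<n. a i)" unfolding incseq_def by (intro allI impI UN_mono) auto
      qed
      also have "(\<Union>n. \<Union>i<n. a i) = (\<Union>i. a i)" by auto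
      finally have "\<forall>\<^sub>F n in sequentially. prob (\<Union>i. a i) - e/2 < prob (\<Union>i<n. a i)"
        using e by (intro order_tendstoD) auto
      then obtain n where n: "prob (\<Union>i. a i) - e/2 < prob (\<Union>i<n. a i)" by (auto simp: eventually_sequentially)
      define e' where "e' = e / 2 / (real n + 1)"
      have e': "e' > 0" "real n * e' \<le> e / 2" using e by (auto simp: e'_def field_simps)
      have "\<exists>J B. finite J \<and> B \<in> sets P \<and> determined_by R J (\<lambda>\<omega>. \<omega> \<in> B) \<and> prob (sym_diff (a i) B) < e'" for i
        using Union.IH e' unfolding cylinder_approximable_def by blast
      from choice[OF allI[OF this]] obtain J where "\<forall>i. \<exists>B. finite (J i) \<and> B \<in> sets P \<and>
          determined_by R (J i) (\<lambda>\<omega>. \<omega> \<in> B) \<and> prob (sym_diff (a i) B) < e'" ..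
      from choice[OF this] obtain B where JB: "\<And>i. finite (J i)" "\<And>i. B i \<in> sets P" "\<And>i. determined_by R (J i) (\<lambda>\<omega>. \<omega> \<in> B i)"
        "\<And>i. prob (sym_diff (a i) (B i)) < e'" by auto
      have d: "determined_by R (\<Union>i<n. J i) (\<lambda>\<omega>. \<omega> \<in> (\<Union>i<n. B i))"
      proof (rule determined_byI)
        fix \<omega> \<omega>' :: env assume w: "\<omega> \<in> space (env_space R)" "\<omega>' \<in> space (env_space R)"
          and eq: "\<And>i. i \<in> (\<Union>i<n. J i) \<Longrightarrow> \<omega> i = \<omega>' i"
        have "(\<omega> \<in> B i) = (\<omega>' \<in> B i)" if "i < n" for i
          by (rule determined_byD[OF JB(3)[of i] w]) (use eq that in blast)
        then show "(\<omega> \<in> (\<Union>i<n. B i)) = (\<omega>' \<in> (\<Union>i<n. B i))" by simp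
      qed
      have s1: "((\<Union>i. a i) - (\<Union>i<n. a i)) \<union> (\<Union>i<n. sym_diff (a i) (B i)) \<in> sets P"
        using aP JB(2) by auto
      have "prob (sym_diff (\<Union>i. a i) (\<Union>i<n. B i)) \<le> prob (((\<Union>i. a i) - (\<Union>i<n. a i)) \<union> (\<Union>i<n. sym_diff (a i) (B i)))"
        by (rule finite_measure_mono[OF _ s1]) auto
      also have "\<dots> \<le> prob ((\<Union>i. a i) - (\<Union>i<n. a i)) + prob (\<Union>i<n. sym_diff (a i) (B i))"
        using aP JB(2) by (intro measure_Un_le) auto
      also have "prob ((\<Union>i. a i) - (\<Union>i<n. a i)) = prob (\<Union>i. a i) - prob (\<Union>i<n. a i)"
        using aP by (intro finite_measure_Diff) auto
      also have "prob (\<Union>i<n. sym_diff (a i) (B i)) \<le> (\<Sum>i<n. prob (sym_diff (a i) (B i)))"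
        using aP JB(2) by (intro finite_measure_subadditive_finite) auto
      also have "\<dots> \<le> (\<Sum>i<n. e')" using JB(4) by (intro sum_mono less_imp_le)
      finally have "prob (sym_diff (\<Union>i. a i) (\<Union>i<n. B i)) < e" using n e'(2) by simp
      then show "\<exists>J B. finite J \<and> B \<in> sets P \<and> determined_by R J (\<lambda>\<omega>. \<omega> \<in> B) \<and> prob (sym_diff (\<Union>i. a i) B) < e"
        using JB(1,2) d by (intro exI[of _ "\<Union>i<n. J i"] exI[of _ "\<Union>i<n. B i"]) auto
    qed
  qed
qed

lemma integrable_cylinder_approximable:
  fixes F :: "env \<Rightarrow> real"
  assumes "integrable P F" "e > 0"
  shows "\<exists>J g B. finite J \<and> g \<in> borel_measurable P \<and> determined_by R J g \<and> (\<forall>\<omega>. \<bar>g \<omega>\<bar> \<le> B) \<and>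
     expectation (\<lambda>\<omega>. \<bar>F \<omega> - g \<omega>\<bar>) < e"
  using assms
proof (induction arbitrary: e rule: integrable_induct)
  case (base A c)
  have "e / (\<bar>c\<bar> + 1) > 0" using base by simp
  then obtain J B where JB: "finite J" "B \<in> sets P" "determined_by R J (\<lambda>\<omega>. \<omega> \<in> B)" "prob (sym_diff A B) < e / (\<bar>c\<bar> + 1)"
    using cylinder_approximable[OF base(1)] unfolding cylinder_approximable_def by blast
  have "expectation (\<lambda>\<omega>. \<bar>indicator A \<omega> *\<^sub>R c - indicator B \<omega> *\<^sub>R c\<bar>) = expectation (\<lambda>\<omega>. indicator (sym_diff A B) \<omega> * \<bar>c\<bar>)"
    by (rule Bochner_Integration.integral_cong) (auto simp: indicator_def)
  also have "\<dots> = prob (sym_diff A B) * \<bar>c\<bar>"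
    using base(1) JB(2) by simp
  also have "\<dots> \<le> prob (sym_diff A B) * (\<bar>c\<bar> + 1)" by (intro mult_left_mono) auto
  also have "\<dots> < e" using JB(4) by (simp add: field_simps)
  finally have "expectation (\<lambda>\<omega>. \<bar>indicator A \<omega> *\<^sub>R c - indicator B \<omega> *\<^sub>R c\<bar>) < e" .
  moreover have "determined_by R J (\<lambda>\<omega>. indicator B \<omega> *\<^sub>R c)"
    using determined_by_comp[OF JB(3), of "\<lambda>b. of_bool b *\<^sub>R c"] by (simp add: indicator_def of_bool_def)
  ultimately show ?case using JB(1,2)
    by (intro exI[of _ J] exI[of _ "\<lambda>\<omega>. indicator B \<omega> *\<^sub>R c"] exI[of _ "\<bar>c\<bar>"]) (auto simp: indicator_def)
next
  case (add f g)
  have "e / 2 > 0" using add by simp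
  then obtain J f' B where f: "finite J" "f' \<in> borel_measurable P" "determined_by R J f'" "\<forall>\<omega>. \<bar>f' \<omega>\<bar> \<le> B"
     "expectation (\<lambda>\<omega>. \<bar>f \<omega> - f' \<omega>\<bar>) < e / 2" using add.IH(1) by blast
  obtain K g' C where g: "finite K" "g' \<in> borel_measurable P" "determined_by R K g'" "\<forall>\<omega>. \<bar>g' \<omega>\<bar> \<le> C"
     "expectation (\<lambda>\<omega>. \<bar>g \<omega> - g' \<omega>\<bar>) < e / 2" using add.IH(2) \<open>e / 2 > 0\<close> by blast
  have i: "integrable P f'" "integrable P g'"
    using integrable_bounded[OF f(2), of B] integrable_bounded[OF g(2), of C] f(4) g(4) by auto
  have "expectation (\<lambda>\<omega>. \<bar>f \<omega> + g \<omega> - (f' \<omega> + g' \<omega>)\<bar>) \<le> expectation (\<lambda>\<omega>. \<bar>f \<omega> - f' \<omega>\<bar> + \<bar>g \<omega> - g' \<omega>\<bar>)"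
    using add i by (intro integral_mono) auto
  also have "\<dots> = expectation (\<lambda>\<omega>. \<bar>f \<omega> - f' \<omega>\<bar>) + expectation (\<lambda>\<omega>. \<bar>g \<omega> - g' \<omega>\<bar>)"
    using add i by simp
  finally have "expectation (\<lambda>\<omega>. \<bar>f \<omega> + g \<omega> - (f' \<omega> + g' \<omega>)\<bar>) < e" using f(5) g(5) by simp
  moreover have "determined_by R (J \<union> K) (\<lambda>\<omega>. f' \<omega> + g' \<omega>)"
    by (rule determined_by_comp2[where h="(+)"]) (use f(3) g(3) in \<open>auto intro: determined_by_mono\<close>)
  moreover have "\<bar>f' \<omega> + g' \<omega>\<bar> \<le> B + C" for \<omega>
    by (rule order_trans[OF abs_triangle_ineq]) (use f(4) g(4) in \<open>auto intro: add_mono\<close>)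
  ultimately show ?case using f(1,2) g(1,2)
    by (intro exI[of _ "J \<union> K"] exI[of _ "\<lambda>\<omega>. f' \<omega> + g' \<omega>"] exI[of _ "B + C"]) auto
next
  case (lim f s)
  have "(\<lambda>i. expectation (\<lambda>\<omega>. \<bar>f \<omega> - s i \<omega>\<bar>)) \<longlonglongrightarrow> expectation (\<lambda>\<omega>. 0)"
  proof (rule integral_dominated_convergence)
    show "integrable P (\<lambda>\<omega>. 3 * \<bar>f \<omega>\<bar>)" using lim.hyps(4) by auto
    show "AE \<omega> in P. (\<lambda>i. \<bar>f \<omega> - s i \<omega>\<bar>) \<longlonglongrightarrow> 0"
    proof (rule AE_I2)
      fix \<omega> assume "\<omega> \<in> space P"
      from lim.hyps(2)[OF this] have "(\<lambda>i. f \<omega> - s i \<omega>) \<longlonglongrightarrow> 0"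
        using tendsto_diff[OF tendsto_const, of "\<lambda>i. s i \<omega>" "f \<omega>" _ "f \<omega>"] by simp
      then show "(\<lambda>i. \<bar>f \<omega> - s i \<omega>\<bar>) \<longlonglongrightarrow> 0" by (rule tendsto_rabs_zero)
    qed
    show "AE \<omega> in P. norm \<bar>f \<omega> - s i \<omega>\<bar> \<le> 3 * \<bar>f \<omega>\<bar>" for i
    proof (rule AE_I2)
      fix \<omega> assume "\<omega> \<in> space P"
      from lim.hyps(3)[OF this, of i] show "norm \<bar>f \<omega> - s i \<omega>\<bar> \<le> 3 * \<bar>f \<omega>\<bar>" by (simp add: abs_if split: if_splits)
    qed
  qed (use lim.hyps(1,4) in auto)
  then have "\<forall>\<^sub>F i in sequentially. expectation (\<lambda>\<omega>. \<bar>f \<omega> - s i \<omega>\<bar>) < e / 2"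
    using lim.prems by (intro order_tendstoD) auto
  then obtain i where i: "expectation (\<lambda>\<omega>. \<bar>f \<omega> - s i \<omega>\<bar>) < e / 2" by (auto simp: eventually_sequentially)
  obtain J g B where g: "finite J" "g \<in> borel_measurable P" "determined_by R J g" "\<forall>\<omega>. \<bar>g \<omega>\<bar> \<le> B"
     "expectation (\<lambda>\<omega>. \<bar>s i \<omega> - g \<omega>\<bar>) < e / 2" using lim.IH[of "e / 2" i] lim.prems by auto
  have ig: "integrable P g" using integrable_bounded[OF g(2), of B] g(4) by auto
  have "expectation (\<lambda>\<omega>. \<bar>f \<omega> - g \<omega>\<bar>) \<le> expectation (\<lambda>\<omega>. \<bar>f \<omega> - s i \<omega>\<bar> + \<bar>s i \<omega> - g \<omega>\<bar>)"
    using lim.hyps(1,4) ig by (intro integral_mono) auto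
  also have "\<dots> = expectation (\<lambda>\<omega>. \<bar>f \<omega> - s i \<omega>\<bar>) + expectation (\<lambda>\<omega>. \<bar>s i \<omega> - g \<omega>\<bar>)"
    using lim.hyps(1,4) ig by simp
  finally have "expectation (\<lambda>\<omega>. \<bar>f \<omega> - g \<omega>\<bar>) < e" using i g(5) by simp
  then show ?case using g by blast
qed

text \<open>Approximate \<open>F\<close> in \<open>L\<^sup>1\<close> by a bounded function of finitely many sites. Distant shifts of the
approximation are uncorrelated, so the variance of its weighted sum is of order \<open>K \<Sum>|c\<^sub>x| = O(\<surd>n)\<close>, of smaller order than \<open>n\<close>. The
approximation error is multiplied by \<open>\<Sum>|c\<^sub>x| \<le> K \<surd>n\<close> and so remains small after division by \<open>\<surd>n\<close>.\<close>

theorem weighted_LLN: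
  fixes F :: "env \<Rightarrow> real" and c :: "nat \<Rightarrow> int \<Rightarrow> real"
  assumes F: "integrable P F" and I: "\<And>n. finite (I n)"
    and cK: "\<And>n x. x \<in> I n \<Longrightarrow> \<bar>c n x\<bar> \<le> K" "\<And>n. (\<Sum>x\<in>I n. \<bar>c n x\<bar>) \<le> K * sqrt n"
  shows "(\<lambda>n. expectation (\<lambda>\<omega>. \<bar>\<Sum>x\<in>I n. c n x * (F (shift x 0 \<omega>) - expectation F)\<bar>) / sqrt n) \<longlonglongrightarrow> 0"
proof (rule tendsto_zero_if_small)
  fix e :: real assume e: "e > 0"
  have K: "K \<ge> 0" using order_trans[OF sum_nonneg cK(2)[of 1]] by simp
  define e' where "e' = e / (2 * K + 1)"
  have e': "e' > 0" "2 * K * e' \<le> e" using e K by (auto simp: e'_def field_simps add_pos_nonneg)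
  obtain J g B where g: "finite J" "g \<in> borel_measurable P" "determined_by R J g" "\<forall>\<omega>. \<bar>g \<omega>\<bar> \<le> B"
     "expectation (\<lambda>\<omega>. \<bar>F \<omega> - g \<omega>\<bar>) < e'" using integrable_cylinder_approximable[OF F e'(1)] by blast
  have B: "B \<ge> 0" using g(4) abs_ge_zero order_trans by blast
  have ig: "integrable P g" using integrable_bounded[OF g(2), of B] g(4) by auto
  define m where "m = expectation g"
  have m: "\<bar>m\<bar> \<le> B"
  proof -
    have "\<bar>m\<bar> \<le> expectation (\<lambda>\<omega>. \<bar>g \<omega>\<bar>)" unfolding m_def by (rule integral_abs_bound)
    also have "\<dots> \<le> expectation (\<lambda>\<omega>. B)" using ig g(4) by (intro integral_mono) auto
    finally show ?thesis by (simp add: prob_space)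
  qed
  define G where "G x \<omega> = g (shift x 0 \<omega>) - m" for x \<omega>
  have Gm[measurable]: "G x \<in> borel_measurable P" for x
    unfolding G_def using measurable_compose[OF measurable_shift_P g(2)] by simp
  have GB: "\<bar>G x \<omega>\<bar> \<le> 2 * B" for x \<omega> using g(4)[rule_format, of "shift x 0 \<omega>"] m unfolding G_def by linarith
  have Gi: "integrable P (G x)" for x by (rule integrable_bounded[OF Gm GB])
  have GG: "\<bar>G x \<omega> * G y \<omega>\<bar> \<le> 4 * B\<^sup>2" for x y \<omega>
    using mult_mono[OF GB[of x \<omega>] GB[of y \<omega>]] B by (simp add: abs_mult power2_eq_square)
  have GGi: "integrable P (\<lambda>\<omega>. G x \<omega> * G y \<omega>)" for x y
    by (rule integrable_bounded[of _ "4 * B\<^sup>2"]) (use GG in auto)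
  have G0: "expectation (G x) = 0" for x
    unfolding G_def using integrable_shift[OF ig] integral_shift[OF g(2), of x 0] by (simp add: m_def prob_space)
  \<comment> \<open>Shifts by more than \<open>2 D\<close> move the spatial range of \<open>J\<close> off itself.\<close>
  define D where "D = (\<Sum>i\<in>J. \<bar>fst i\<bar>)"
  have D: "\<bar>fst i\<bar> \<le> D" if "i \<in> J" for i
    unfolding D_def using that g(1) by (intro member_le_sum) auto
  have D0: "D \<ge> 0" unfolding D_def by (simp add: sum_nonneg)
  have far: "expectation (\<lambda>\<omega>. G x \<omega> * G y \<omega>) = 0" if "\<bar>x - y\<bar> > 2 * D" for x y
  proof -
    let ?S = "\<lambda>x. (\<lambda>(y, t). (x + y, 0 + t)) ` J"
    have d: "determined_by R (?S x) (G x)" for x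
      unfolding G_def by (rule determined_by_comp[where h="\<lambda>u. u - m"], rule determined_by_shift[OF g(3)])
    have "?S x \<inter> ?S y = {}"
    proof (rule ccontr)
      assume "?S x \<inter> ?S y \<noteq> {}"
      then obtain i j where ij: "i \<in> J" "j \<in> J" "x + fst i = y + fst j" by (auto split: prod.splits) (metis fst_conv)
      then have "\<bar>x - y\<bar> \<le> 2 * D" using D[OF ij(1)] D[OF ij(2)] by linarith
      then show False using that by simp
    qed
    from expectation_mult_determined[OF Gi d Gi d this] show ?thesis by (simp add: G0)
  qed
  define C where "C = K * (4 * B\<^sup>2) * (K * (4 * real_of_int D + 1))"
  have var: "expectation (\<lambda>\<omega>. (\<Sum>x\<in>I n. c n x * G x \<omega>)\<^sup>2) \<le> C * sqrt n" for n
  proof -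
    have "expectation (\<lambda>\<omega>. (\<Sum>x\<in>I n. c n x * G x \<omega>)\<^sup>2) = expectation (\<lambda>\<omega>. \<Sum>x\<in>I n. \<Sum>y\<in>I n. c n x * c n y * (G x \<omega> * G y \<omega>))"
      unfolding power2_eq_square sum_product by (intro Bochner_Integration.integral_cong sum.cong refl) (simp add: mult_ac)
    also have "\<dots> = (\<Sum>x\<in>I n. \<Sum>y\<in>I n. c n x * c n y * expectation (\<lambda>\<omega>. G x \<omega> * G y \<omega>))"
      using GGi by simp
    also have "\<dots> \<le> (\<Sum>x\<in>I n. \<Sum>y\<in>I n. if \<bar>x - y\<bar> \<le> 2 * D then \<bar>c n x\<bar> * (K * (4 * B\<^sup>2)) else 0)"
    proof (intro sum_mono)
      fix x y assume xy: "x \<in> I n" "y \<in> I n"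
      show "c n x * c n y * expectation (\<lambda>\<omega>. G x \<omega> * G y \<omega>) \<le> (if \<bar>x - y\<bar> \<le> 2 * D then \<bar>c n x\<bar> * (K * (4 * B\<^sup>2)) else 0)"
      proof (cases "\<bar>x - y\<bar> \<le> 2 * D")
        case True
        have "\<bar>expectation (\<lambda>\<omega>. G x \<omega> * G y \<omega>)\<bar> \<le> expectation (\<lambda>\<omega>. \<bar>G x \<omega> * G y \<omega>\<bar>)" by (rule integral_abs_bound)
        also have "\<dots> \<le> expectation (\<lambda>\<omega>. 4 * B\<^sup>2)" using GGi GG by (intro integral_mono) auto
        finally have 1: "\<bar>expectation (\<lambda>\<omega>. G x \<omega> * G y \<omega>)\<bar> \<le> 4 * B\<^sup>2" by (simp add: prob_space)
        have "c n x * c n y * expectation (\<lambda>\<omega>. G x \<omega> * G y \<omega>) \<le> \<bar>c n x * c n y * expectation (\<lambda>\<omega>. G x \<omega> * G y \<omega>)\<bar>" by simp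
        also have "\<dots> \<le> \<bar>c n x\<bar> * (K * (4 * B\<^sup>2))"
          unfolding abs_mult mult.assoc using 1 cK(1)[OF xy(2)] K by (intro mult_left_mono mult_mono) (auto simp: abs_mult)
        finally show ?thesis using True by simp
      qed (use far in auto)
    qed
    also have "\<dots> \<le> (\<Sum>x\<in>I n. \<bar>c n x\<bar> * (K * (4 * B\<^sup>2)) * (4 * real_of_int D + 1))"
    proof (intro sum_mono)
      fix x assume "x \<in> I n"
      have "(\<Sum>y\<in>I n. if \<bar>x - y\<bar> \<le> 2 * D then \<bar>c n x\<bar> * (K * (4 * B\<^sup>2)) else 0) =
         (\<Sum>y\<in>{y\<in>I n. \<bar>x - y\<bar> \<le> 2 * D}. \<bar>c n x\<bar> * (K * (4 * B\<^sup>2)))"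
        by (rule sum.inter_filter[OF I, symmetric])
      also have "\<dots> \<le> (\<Sum>y\<in>{x - 2 * D..x + 2 * D}. \<bar>c n x\<bar> * (K * (4 * B\<^sup>2)))"
        using K by (intro sum_mono2) auto
      also have "\<dots> = \<bar>c n x\<bar> * (K * (4 * B\<^sup>2)) * (4 * real_of_int D + 1)" using D0 by simp
      finally show "(\<Sum>y\<in>I n. if \<bar>x - y\<bar> \<le> 2 * D then \<bar>c n x\<bar> * (K * (4 * B\<^sup>2)) else 0) \<le> \<bar>c n x\<bar> * (K * (4 * B\<^sup>2)) * (4 * real_of_int D + 1)" .
    qed
    also have "\<dots> = (\<Sum>x\<in>I n. \<bar>c n x\<bar>) * ((K * (4 * B\<^sup>2)) * (4 * real_of_int D + 1))"
      unfolding sum_distrib_right by (simp add: mult.assoc)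
    also have "\<dots> \<le> (K * sqrt n) * ((K * (4 * B\<^sup>2)) * (4 * real_of_int D + 1))"
      using cK(2)[of n] K D0 by (intro mult_right_mono) auto
    also have "\<dots> = C * sqrt n" by (simp add: C_def mult_ac)
    finally show ?thesis .
  qed
  have main: "expectation (\<lambda>\<omega>. \<bar>\<Sum>x\<in>I n. c n x * (F (shift x 0 \<omega>) - expectation F)\<bar>) \<le> sqrt (C * sqrt n) + 2 * K * e' * sqrt n" for n
  proof -
    have Fi: "integrable P (\<lambda>\<omega>. F (shift x 0 \<omega>))" "integrable P (\<lambda>\<omega>. g (shift x 0 \<omega>))" for x
      using integrable_shift F ig by auto
    have b: "expectation (\<lambda>\<omega>. \<bar>F (shift x 0 \<omega>) - expectation F - G x \<omega>\<bar>) \<le> 2 * e'" for x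
    proof -
      have "\<bar>m - expectation F\<bar> \<le> e'"
      proof -
        have "\<bar>m - expectation F\<bar> = \<bar>expectation (\<lambda>\<omega>. F \<omega> - g \<omega>)\<bar>" using F ig by (simp add: m_def)
        also have "\<dots> \<le> expectation (\<lambda>\<omega>. \<bar>F \<omega> - g \<omega>\<bar>)" by (rule integral_abs_bound)
        finally show ?thesis using g(5) by simp
      qed
      moreover have "expectation (\<lambda>\<omega>. \<bar>F (shift x 0 \<omega>) - g (shift x 0 \<omega>)\<bar>) = expectation (\<lambda>\<omega>. \<bar>F \<omega> - g \<omega>\<bar>)"
        using F g(2) by (intro integral_shift) auto
      moreover have "expectation (\<lambda>\<omega>. \<bar>F (shift x 0 \<omega>) - expectation F - G x \<omega>\<bar>) \<le>
          expectation (\<lambda>\<omega>. \<bar>F (shift x 0 \<omega>) - g (shift x 0 \<omega>)\<bar> + \<bar>m - expectation F\<bar>)"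
        using Fi Gi by (intro integral_mono) (auto simp: G_def)
      moreover have "\<dots> = expectation (\<lambda>\<omega>. \<bar>F (shift x 0 \<omega>) - g (shift x 0 \<omega>)\<bar>) + \<bar>m - expectation F\<bar>"
        using Fi by (simp add: prob_space)
      ultimately show ?thesis using g(5) by linarith
    qed
    have si: "integrable P (\<lambda>\<omega>. \<Sum>x\<in>I n. c n x * G x \<omega>)" using Gi by auto
    have si2: "integrable P (\<lambda>\<omega>. (\<Sum>x\<in>I n. c n x * G x \<omega>)\<^sup>2)"
    proof -
      have "(\<lambda>\<omega>. (\<Sum>x\<in>I n. c n x * G x \<omega>)\<^sup>2) = (\<lambda>\<omega>. \<Sum>x\<in>I n. \<Sum>y\<in>I n. c n x * c n y * (G x \<omega> * G y \<omega>))"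
        unfolding power2_eq_square sum_product by (intro ext sum.cong refl) (simp add: mult_ac)
      then show ?thesis using GGi by simp
    qed
    have "expectation (\<lambda>\<omega>. \<bar>\<Sum>x\<in>I n. c n x * (F (shift x 0 \<omega>) - expectation F)\<bar>) \<le>
       expectation (\<lambda>\<omega>. \<bar>\<Sum>x\<in>I n. c n x * G x \<omega>\<bar> + (\<Sum>x\<in>I n. \<bar>c n x\<bar> * \<bar>F (shift x 0 \<omega>) - expectation F - G x \<omega>\<bar>))"
    proof (rule integral_mono)
      fix \<omega>
      have "(\<Sum>x\<in>I n. c n x * (F (shift x 0 \<omega>) - expectation F)) =
         (\<Sum>x\<in>I n. c n x * G x \<omega>) + (\<Sum>x\<in>I n. c n x * (F (shift x 0 \<omega>) - expectation F - G x \<omega>))"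
        by (simp add: sum.distrib[symmetric] algebra_simps)
      moreover have "\<bar>\<Sum>x\<in>I n. c n x * (F (shift x 0 \<omega>) - expectation F - G x \<omega>)\<bar> \<le> (\<Sum>x\<in>I n. \<bar>c n x\<bar> * \<bar>F (shift x 0 \<omega>) - expectation F - G x \<omega>\<bar>)"
        unfolding abs_mult[symmetric] by (rule sum_abs)
      ultimately show "\<bar>\<Sum>x\<in>I n. c n x * (F (shift x 0 \<omega>) - expectation F)\<bar> \<le>
         \<bar>\<Sum>x\<in>I n. c n x * G x \<omega>\<bar> + (\<Sum>x\<in>I n. \<bar>c n x\<bar> * \<bar>F (shift x 0 \<omega>) - expectation F - G x \<omega>\<bar>)" by linarith
    qed (use Fi Gi in auto)
    also have "\<dots> = expectation (\<lambda>\<omega>. \<bar>\<Sum>x\<in>I n. c n x * G x \<omega>\<bar>) + (\<Sum>x\<in>I n. \<bar>c n x\<bar> * expectation (\<lambda>\<omega>. \<bar>F (shift x 0 \<omega>) - expectation F - G x \<omega>\<bar>))"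
      using Fi Gi by simp
    also have "expectation (\<lambda>\<omega>. \<bar>\<Sum>x\<in>I n. c n x * G x \<omega>\<bar>) \<le> sqrt (expectation (\<lambda>\<omega>. (\<Sum>x\<in>I n. c n x * G x \<omega>)\<^sup>2))"
      by (rule expectation_abs_le_sqrt) (use si2 in auto)
    also have "\<dots> \<le> sqrt (C * sqrt n)" using var by (rule real_sqrt_le_mono)
    also have "(\<Sum>x\<in>I n. \<bar>c n x\<bar> * expectation (\<lambda>\<omega>. \<bar>F (shift x 0 \<omega>) - expectation F - G x \<omega>\<bar>)) \<le> (\<Sum>x\<in>I n. \<bar>c n x\<bar> * (2 * e'))"
      using b by (intro sum_mono mult_left_mono) auto
    also have "\<dots> = (\<Sum>x\<in>I n. \<bar>c n x\<bar>) * (2 * e')" by (simp add: sum_distrib_right)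
    also have "\<dots> \<le> (K * sqrt n) * (2 * e')" using cK(2)[of n] e'(1) by (intro mult_right_mono) auto
    finally show ?thesis by (simp add: mult_ac)
  qed
  define v where "v n = sqrt (C * sqrt n) / sqrt n" for n :: nat
  have "(\<lambda>n. sqrt C * (sqrt (sqrt n) / sqrt n)) \<longlonglongrightarrow> sqrt C * 0"
  proof (rule tendsto_mult_left)
    show "(\<lambda>n. sqrt (sqrt (real n)) / sqrt (real n)) \<longlonglongrightarrow> 0" by real_asymp
  qed
  then have v: "v \<longlonglongrightarrow> 0" unfolding v_def by (simp add: real_sqrt_mult)
  have "expectation (\<lambda>\<omega>. \<bar>\<Sum>x\<in>I n. c n x * (F (shift x 0 \<omega>) - expectation F)\<bar>) / sqrt n \<le> v n + e" if "n > 0" for n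
  proof -
    have "expectation (\<lambda>\<omega>. \<bar>\<Sum>x\<in>I n. c n x * (F (shift x 0 \<omega>) - expectation F)\<bar>) / sqrt n \<le> (sqrt (C * sqrt n) + 2 * K * e' * sqrt n) / sqrt n"
      by (intro divide_right_mono main) simp
    also have "\<dots> = v n + 2 * K * e'" using that by (simp add: v_def add_divide_distrib)
    finally show ?thesis using e'(2) by linarith
  qed
  then have "\<forall>\<^sub>F n in sequentially. expectation (\<lambda>\<omega>. \<bar>\<Sum>x\<in>I n. c n x * (F (shift x 0 \<omega>) - expectation F)\<bar>) / sqrt n \<le> v n + e"
    using eventually_gt_at_top[of 0] by (rule eventually_mono[rotated])
  with v show "\<exists>w. w \<longlonglongrightarrow> 0 \<and> (\<forall>\<^sub>F n in sequentially.
      expectation (\<lambda>\<omega>. \<bar>\<Sum>x\<in>I n. c n x * (F (shift x 0 \<omega>) - expectation F)\<bar>) / sqrt n \<le> w n + e)" by blast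
qed (intro divide_nonneg_nonneg Bochner_Integration.integral_nonneg, auto)

end

section \<open>Measurability of the quenched laws\<close>

lemma measurable_PiM_kernel:
  fixes K :: "'a \<Rightarrow> 'i \<Rightarrow> 'b measure"
  assumes K: "\<And>i. (\<lambda>\<omega>. K \<omega> i) \<in> N \<rightarrow>\<^sub>M prob_algebra (M i)"
  shows "(\<lambda>\<omega>. PiM UNIV (K \<omega>)) \<in> N \<rightarrow>\<^sub>M prob_algebra (PiM UNIV M)"
proof (rule measurable_prob_algebra_generated[OF sets_PiM Int_stable_prod_algebra prod_algebra_sets_into_space])
  have Ks: "prob_space (K \<omega> i)" "sets (K \<omega> i) = sets (M i)" if "\<omega> \<in> space N" for \<omega> i
    using measurable_space[OF K that, of i] by (auto simp: space_prob_algebra)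
  show "prob_space (PiM UNIV (K \<omega>))" if "\<omega> \<in> space N" for \<omega>
    using Ks[OF that] by (intro prob_space_PiM) auto
  show "sets (PiM UNIV (K \<omega>)) = sets (PiM UNIV M)" if "\<omega> \<in> space N" for \<omega>
    using Ks[OF that] by (intro sets_PiM_cong) auto
  fix A assume "A \<in> prod_algebra UNIV M"
  then obtain J E where A: "A = prod_emb UNIV M J (Pi\<^sub>E J E)" "finite J" "\<And>i. i \<in> J \<Longrightarrow> E i \<in> sets (M i)"
    by (elim prod_algebraE) auto
  have "emeasure (PiM UNIV (K \<omega>)) A = (\<Prod>i\<in>J. emeasure (K \<omega> i) (E i))" if w: "\<omega> \<in> space N" for \<omega>
  proof -
    have "A = prod_emb UNIV (K \<omega>) J (Pi\<^sub>E J E)"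
      unfolding A(1) prod_emb_def using sets_eq_imp_space_eq[OF Ks(2)[OF w]] by simp
    then show ?thesis using A(2,3) Ks[OF w] by (simp add: emeasure_PiM_emb)
  qed
  moreover have "(\<lambda>\<omega>. \<Prod>i\<in>J. emeasure (K \<omega> i) (E i)) \<in> borel_measurable N"
  proof (rule borel_measurable_prod_ennreal)
    fix i assume "i \<in> J"
    then show "(\<lambda>\<omega>. emeasure (K \<omega> i) (E i)) \<in> borel_measurable N"
      by (intro measurable_compose[OF measurable_prob_algebraD[OF K] measurable_emeasure_subprob_algebra] A(3))
  qed
  ultimately show "(\<lambda>\<omega>. emeasure (PiM UNIV (K \<omega>)) A) \<in> borel_measurable N"
    by (simp cong: measurable_cong)
qed

text \<open>The probability of a cylinder event is an expectation under \<open>path_pmf\<close>, which is a polynomial in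
finitely many entries of \<open>\<omega>\<close>.\<close>

lemma measurable_walk_law: "(\<lambda>\<omega>. walk_law \<omega> x) \<in> env_space R \<rightarrow>\<^sub>M prob_algebra (\<Pi>\<^sub>M s\<in>UNIV. count_space UNIV)"
proof (rule measurable_prob_algebra_generated[OF sets_PiM Int_stable_prod_algebra prod_algebra_sets_into_space])
  let ?M = "\<lambda>_::nat. count_space (UNIV :: int set)"
  show "prob_space (walk_law \<omega> x)" for \<omega> by (rule prob_space_walk_law)
  show "sets (walk_law \<omega> x) = sets (PiM UNIV ?M)" for \<omega> by (rule sets_walk_law)
  fix A assume A0: "A \<in> prod_algebra UNIV ?M"
  then obtain J E where A: "A = prod_emb UNIV ?M J (Pi\<^sub>E J E)" "finite J"
    by (elim prod_algebraE) auto
  have As: "A \<in> sets (PiM UNIV ?M)" using A0 unfolding sets_PiM by (rule sigma_sets.Basic)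
  define m where "m = Max (insert 0 J)"
  have m: "k \<le> m" if "k \<in> J" for k unfolding m_def using that A(2) by (intro Max_ge) auto
  have mem: "X \<in> A \<longleftrightarrow> (\<forall>k\<in>J. X k \<in> E k)" for X
    unfolding A(1) by (auto simp: prod_emb_def PiE_iff)
  define g where "g l = (indicator A (\<lambda>k. x + sum_list (take k l)) :: real)" for l
  have "emeasure (walk_law \<omega> x) A = ennreal (EP \<omega> m x 0 g)" if w: "\<omega> \<in> space (env_space R)" for \<omega>
  proof -
    interpret prob_space "walk_law \<omega> x" by (rule prob_space_walk_law)
    have "(\<integral>X. indicator A X \<partial>walk_law \<omega> x) = EP \<omega> m x 0 g"
    proof (rule walk_law_integral[OF w])
      show "(indicator A :: _ \<Rightarrow> real) \<in> borel_measurable (PiM UNIV ?M)" using As by simp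
      fix X :: "nat \<Rightarrow> int" assume "X 0 = x"
      then have "X k = x + sum_list (take k (increments m X))" if "k \<in> J" for k
        using sum_list_increments[OF m[OF that], of X] by simp
      then show "indicator A X = g (increments m X)"
        unfolding g_def indicator_def mem by auto
    qed
    moreover have "(\<integral>X. indicator A X \<partial>walk_law \<omega> x) = measure (walk_law \<omega> x) A" by simp
    ultimately show ?thesis by (simp add: emeasure_eq_measure)
  qed
  then show "(\<lambda>\<omega>. emeasure (walk_law \<omega> x) A) \<in> borel_measurable (env_space R)"
    by (subst measurable_cong[where g = "\<lambda>\<omega>. ennreal (EP \<omega> m x 0 g)"]) auto
qed

section \<open>Integrals over infinite products\<close>

lemma integral_prod_PiM_components:
  fixes f :: "'i \<Rightarrow> 'b \<Rightarrow> 'c::{real_normed_field, banach, second_countable_topology}"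
  assumes M: "\<And>i. prob_space (M i)" and J: "finite J" and f: "\<And>i. i \<in> J \<Longrightarrow> integrable (M i) (f i)"
  shows "(\<integral>X. (\<Prod>i\<in>J. f i (X i)) \<partial>PiM UNIV M) = (\<Prod>i\<in>J. \<integral>y. f i y \<partial>M i)"
    and "integrable (PiM UNIV M) (\<lambda>X. \<Prod>i\<in>J. f i (X i))"
proof -
  interpret prob_space "PiM UNIV M" by (rule prob_space_PiM[OF M])
  have comp: "distr (PiM UNIV M) (M i) (\<lambda>X. X i) = M i" for i
    by (rule distr_PiM_component[OF M]) simp
  have rv: "random_variable (M i) (\<lambda>X. X i)" for i by simp
  have "indep_vars M (\<lambda>i X. X i) UNIV"
    by (subst indep_vars_iff_distr_eq_PiM') (auto simp: comp restrict_UNIV distr_id2)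
  then have "indep_vars M (\<lambda>i X. X i) J" by (rule indep_vars_subset) auto
  then have ind: "indep_vars (\<lambda>_. borel) (\<lambda>i X. f i (X i)) J"
    by (rule indep_vars_compose2) (use f in auto)
  have int: "integrable (PiM UNIV M) (\<lambda>X. f i (X i))" if "i \<in> J" for i
    using integrable_distr[OF rv, of i "f i"] f[OF that] by (simp add: comp)
  have e: "(\<integral>X. f i (X i) \<partial>PiM UNIV M) = (\<integral>y. f i y \<partial>M i)" if "i \<in> J" for i
    using integral_distr[OF rv, of "f i" i] f[OF that] by (simp add: comp)
  show "(\<integral>X. (\<Prod>i\<in>J. f i (X i)) \<partial>PiM UNIV M) = (\<Prod>i\<in>J. \<integral>y. f i y \<partial>M i)"
    using indep_vars_lebesgue_integral[OF J ind int] e by simp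
  show "integrable (PiM UNIV M) (\<lambda>X. \<Prod>i\<in>J. f i (X i))"
    by (rule indep_vars_integrable[OF J ind int])
qed

lemma integral_PiM_component:
  fixes f :: "'b \<Rightarrow> 'c::{banach, second_countable_topology}"
  assumes M: "\<And>i. prob_space (M i)" and f: "f \<in> borel_measurable (M i)"
  shows "(\<integral>X. f (X i) \<partial>PiM UNIV M) = (\<integral>y. f y \<partial>M i)"
    and "integrable (PiM UNIV M) (\<lambda>X. f (X i)) \<longleftrightarrow> integrable (M i) f"
proof -
  have comp: "distr (PiM UNIV M) (M i) (\<lambda>X. X i) = M i" by (rule distr_PiM_component[OF M]) simp
  have rv: "(\<lambda>X. X i) \<in> PiM UNIV M \<rightarrow>\<^sub>M M i" by simp
  show "(\<integral>X. f (X i) \<partial>PiM UNIV M) = (\<integral>y. f y \<partial>M i)"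
    using integral_distr[OF rv f] by (simp add: comp)
  show "integrable (PiM UNIV M) (\<lambda>X. f (X i)) \<longleftrightarrow> integrable (M i) f"
    using integrable_distr_eq[OF rv f] by (simp add: comp)
qed

lemma nn_integral_PiM_component:
  assumes M: "\<And>i. prob_space (M i)" and f: "f \<in> borel_measurable (M i)"
  shows "(\<integral>\<^sup>+X. f (X i) \<partial>PiM UNIV M) = (\<integral>\<^sup>+y. f y \<partial>M i)"
proof -
  have comp: "distr (PiM UNIV M) (M i) (\<lambda>X. X i) = M i" by (rule distr_PiM_component[OF M]) simp
  have rv: "(\<lambda>X. X i) \<in> PiM UNIV M \<rightarrow>\<^sub>M M i" by simp
  show ?thesis using nn_integral_distr[OF rv, of f] f by (simp add: comp)
qed

lemma integral_square_sum_PiM: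
  fixes w :: "'b \<Rightarrow> real"
  assumes M: "\<And>i. prob_space (M i)" and J: "finite J" and MJ: "\<And>i. i \<in> J \<Longrightarrow> M i = K"
    and w: "w \<in> borel_measurable K" "\<And>y. \<bar>w y\<bar> \<le> C" and w0: "(\<integral>y. w y \<partial>K) = 0"
  shows "(\<integral>X. ((\<Sum>i\<in>J. w (X i)) + c)\<^sup>2 \<partial>PiM UNIV M) = card J * (\<integral>y. (w y)\<^sup>2 \<partial>K) + c\<^sup>2"
    and "integrable (PiM UNIV M) (\<lambda>X. ((\<Sum>i\<in>J. w (X i)) + c)\<^sup>2)"
    and "(\<integral>X. (\<Sum>i\<in>J. w (X i)) \<partial>PiM UNIV M) = 0" and "integrable (PiM UNIV M) (\<lambda>X. \<Sum>i\<in>J. w (X i))"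
proof -
  interpret prob_space "PiM UNIV M" by (rule prob_space_PiM[OF M])
  have wi: "integrable (M i) w" if "i \<in> J" for i
    using finite_measure.integrable_const_bound[OF prob_space.finite_measure[OF M[of i]], of w C] w MJ[OF that] by auto
  have w2: "integrable (M i) (\<lambda>y. (w y)\<^sup>2)" if "i \<in> J" for i
  proof (rule finite_measure.integrable_const_bound[where B = "C\<^sup>2"])
    show "finite_measure (M i)" using M[of i] by (rule prob_space.finite_measure)
    have "(w y)\<^sup>2 \<le> C\<^sup>2" for y using power_mono[OF w(2)[of y] abs_ge_zero, of 2] by (simp add: power2_abs)
    then show "AE y in M i. norm ((w y)\<^sup>2) \<le> C\<^sup>2" by simp
    show "(\<lambda>y. (w y)\<^sup>2) \<in> borel_measurable (M i)" using w(1) MJ[OF that] by simp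
  qed
  have i1: "integrable (PiM UNIV M) (\<lambda>X. w (X i))" "(\<integral>X. w (X i) \<partial>PiM UNIV M) = 0" if "i \<in> J" for i
    using integral_PiM_component[where M = M and f = w and i = i, OF M] wi[OF that] MJ[OF that] w0 by auto
  have i2: "integrable (PiM UNIV M) (\<lambda>X. w (X i) * w (X j))"
       "(\<integral>X. w (X i) * w (X j) \<partial>PiM UNIV M) = (if i = j then (\<integral>y. (w y)\<^sup>2 \<partial>K) else 0)" if "i \<in> J" "j \<in> J" for i j
  proof -
    have "integrable (PiM UNIV M) (\<lambda>X. w (X i) * w (X j)) \<and>
       (\<integral>X. w (X i) * w (X j) \<partial>PiM UNIV M) = (if i = j then (\<integral>y. (w y)\<^sup>2 \<partial>K) else 0)"
    proof (cases "i = j")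
      case True
      then show ?thesis using integral_PiM_component[where M = M and f = "\<lambda>y. (w y)\<^sup>2" and i = i, OF M] w2[OF that(1)] MJ[OF that(1)]
        by (auto simp: power2_eq_square)
    next
      case False
      have eq: "(\<Prod>k\<in>{i, j}. w (X k)) = w (X i) * w (X j)" for X using False by simp
      have "integrable (PiM UNIV M) (\<lambda>X. \<Prod>k\<in>{i, j}. w (X k))"
        by (rule integral_prod_PiM_components[OF M]) (use wi that in auto)
      moreover have "(\<integral>X. (\<Prod>k\<in>{i, j}. w (X k)) \<partial>PiM UNIV M) = (\<Prod>k\<in>{i, j}. \<integral>y. w y \<partial>M k)"
        by (rule integral_prod_PiM_components[OF M]) (use wi that in auto)
      moreover have "\<dots> = 0" using MJ[OF that(1)] w0 by simp
      ultimately show ?thesis using False unfolding eq by simp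
    qed
    then show "integrable (PiM UNIV M) (\<lambda>X. w (X i) * w (X j))"
       "(\<integral>X. w (X i) * w (X j) \<partial>PiM UNIV M) = (if i = j then (\<integral>y. (w y)\<^sup>2 \<partial>K) else 0)" by blast+
  qed
  have exp: "((\<Sum>i\<in>J. w (X i)) + c)\<^sup>2 = (\<Sum>i\<in>J. \<Sum>j\<in>J. w (X i) * w (X j)) + 2 * c * (\<Sum>i\<in>J. w (X i)) + c\<^sup>2" for X
    by (simp add: power2_eq_square sum_product[symmetric] algebra_simps)
  show "integrable (PiM UNIV M) (\<lambda>X. ((\<Sum>i\<in>J. w (X i)) + c)\<^sup>2)"
    unfolding exp using i1 i2 by simp
  show "(\<integral>X. ((\<Sum>i\<in>J. w (X i)) + c)\<^sup>2 \<partial>PiM UNIV M) = card J * (\<integral>y. (w y)\<^sup>2 \<partial>K) + c\<^sup>2"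
    unfolding exp using i1 i2 J by (simp add: prob_space sum.delta)
  show "(\<integral>X. (\<Sum>i\<in>J. w (X i)) \<partial>PiM UNIV M) = 0" "integrable (PiM UNIV M) (\<lambda>X. \<Sum>i\<in>J. w (X i))"
    using i1 by auto
qed

section \<open>Compound sums at independent sites\<close>

definition site_sum :: "(int \<Rightarrow> (nat \<Rightarrow> int) \<Rightarrow> real) \<Rightarrow> int \<Rightarrow> conf \<Rightarrow> real" where
  "site_sum w x = (\<lambda>(\<eta>, X). \<Sum>j\<in>{1..\<eta> x}. w x (X (x, j)))"

text \<open>The quenched law with its environment forgotten: independent occupation numbers with laws \<open>\<nu> x\<close> and
independent walks, where the law \<open>K x\<close> of a walk depends on its starting site only.\<close>

locale compound_system =
  fixes \<nu> :: "int \<Rightarrow> nat measure" and K :: "int \<Rightarrow> (nat \<Rightarrow> int) measure"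
  assumes nu: "\<And>x. prob_space (\<nu> x)" "\<And>x. sets (\<nu> x) = sets (count_space UNIV)"
    and K: "\<And>x. prob_space (K x)" "\<And>x. sets (K x) = sets (\<Pi>\<^sub>M s\<in>UNIV. count_space UNIV)"
begin

abbreviation "occ \<equiv> \<Pi>\<^sub>M x\<in>UNIV. \<nu> x"
abbreviation "walks \<equiv> \<Pi>\<^sub>M (x, j)\<in>(UNIV :: (int \<times> nat) set). K x"
abbreviation "Q \<equiv> occ \<Otimes>\<^sub>M walks"

lemma walks_eq: "walks = PiM UNIV (\<lambda>i. K (fst i))"
  by (simp add: case_prod_unfold)

sublocale occ: prob_space occ by (rule prob_space_PiM[OF nu(1)])
sublocale walks: prob_space walks unfolding walks_eq by (rule prob_space_PiM[OF K(1)])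
sublocale Q: pair_prob_space occ walks ..

lemma sets_Q: "sets Q = sets conf_space"
  unfolding conf_space_def walks_eq
  by (intro sets_pair_measure_cong sets_PiM_cong nu K refl)

lemma measurable_eta[measurable]: "(\<lambda>c. fst c x) \<in> Q \<rightarrow>\<^sub>M count_space UNIV"
proof -
  have "(\<lambda>\<eta>. \<eta> x) \<in> occ \<rightarrow>\<^sub>M count_space UNIV"
    using measurable_component_singleton[of x UNIV \<nu>] by (simp add: measurable_cong_sets[OF refl nu(2)])
  then show ?thesis by (rule measurable_compose[OF measurable_fst])
qed

lemma measurable_walk[measurable]: "(\<lambda>c. snd c i) \<in> Q \<rightarrow>\<^sub>M (\<Pi>\<^sub>M s\<in>UNIV. count_space UNIV)"
proof -
  have "(\<lambda>X. X i) \<in> walks \<rightarrow>\<^sub>M (\<Pi>\<^sub>M s\<in>UNIV. count_space UNIV)"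
    unfolding walks_eq using measurable_component_singleton[of i UNIV "\<lambda>i. K (fst i)"]
    by (simp add: measurable_cong_sets[OF refl K(2)])
  then show ?thesis by (rule measurable_compose[OF measurable_snd])
qed

lemma measurable_site_sum:
  assumes "\<And>x. w x \<in> borel_measurable (\<Pi>\<^sub>M s\<in>UNIV. count_space UNIV)"
  shows "site_sum w x \<in> borel_measurable Q"
proof -
  have "(\<lambda>c. \<Sum>j\<in>{1..fst c x}. w x (snd c (x, j))) \<in> borel_measurable Q"
    by (rule measurable_compose_countable[OF _ measurable_eta, where f = "\<lambda>k c. \<Sum>j\<in>{1..k}. w x (snd c (x, j))"])
       (intro borel_measurable_sum measurable_compose[OF measurable_walk assms])
  then show ?thesis unfolding site_sum_def by (simp add: case_prod_unfold)
qed

text \<open>Given the occupation numbers, the site \<open>x\<close> contributes the \<open>\<eta>(x)\<close>-th power of one characteristic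
function.\<close>

lemma integral_exp_site_sums:
  assumes I: "finite I" and w: "\<And>x. w x \<in> borel_measurable (\<Pi>\<^sub>M s\<in>UNIV. count_space UNIV)"
  shows "(\<integral>c. iexp (\<Sum>x\<in>I. site_sum w x c - d x) \<partial>Q) =
    (\<Prod>x\<in>I. \<integral>k. exp (- \<i> * complex_of_real (d x)) * (\<integral>X. iexp (w x X) \<partial>K x) ^ k \<partial>\<nu> x)"
proof -
  define \<psi> where "\<psi> x = (\<integral>X. iexp (w x X) \<partial>K x)" for x
  have wK: "w x \<in> borel_measurable (K y)" for x y using w by (simp add: measurable_cong_sets[OF K(2) refl])
  have ewi: "integrable (K x) (\<lambda>X. iexp (w y X))" for x y
    using wK by (intro finite_measure.integrable_const_bound[where B = 1] prob_space.finite_measure K(1)) auto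
  have psi1: "cmod (\<psi> x) \<le> 1" for x
  proof -
    interpret prob_space "K x" by (rule K(1))
    have "cmod (\<psi> x) \<le> (\<integral>X. cmod (iexp (w x X)) \<partial>K x)" unfolding \<psi>_def by (rule integral_norm_bound)
    then show ?thesis by (simp add: prob_space)
  qed
  have m: "(\<lambda>c. iexp (\<Sum>x\<in>I. site_sum w x c - d x)) \<in> borel_measurable Q"
    using measurable_site_sum[OF w] by simp
  have int: "integrable Q (\<lambda>c. iexp (\<Sum>x\<in>I. site_sum w x c - d x))"
    by (rule Q.integrable_const_bound[of _ 1]) (use m in auto)
  have inner: "(\<integral>X. iexp (\<Sum>x\<in>I. site_sum w x (\<eta>, X) - d x) \<partial>walks) =
      (\<Prod>x\<in>I. exp (- \<i> * complex_of_real (d x)) * \<psi> x ^ \<eta> x)" for \<eta>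
  proof -
    define J where "J = (SIGMA x:I. {1..\<eta> x})"
    have J: "finite J" unfolding J_def using I by auto
    have "iexp (\<Sum>x\<in>I. site_sum w x (\<eta>, X) - d x) =
       (\<Prod>x\<in>I. exp (- \<i> * complex_of_real (d x))) * (\<Prod>i\<in>J. iexp (w (fst i) (X i)))" for X
    proof -
      have "(\<Sum>x\<in>I. site_sum w x (\<eta>, X) - d x) = (\<Sum>x\<in>I. - d x) + (\<Sum>x\<in>I. \<Sum>j\<in>{1..\<eta> x}. w x (X (x, j)))"
        by (simp add: site_sum_def sum_subtractf sum_negf)
      also have "(\<Sum>x\<in>I. \<Sum>j\<in>{1..\<eta> x}. w x (X (x, j))) = (\<Sum>i\<in>J. w (fst i) (X i))"
        unfolding J_def using I by (subst sum.Sigma) (auto simp: case_prod_unfold)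
      finally show ?thesis using I J
        by (simp add: exp_add distrib_left exp_sum sum_distrib_left)
    qed
    then have "(\<integral>X. iexp (\<Sum>x\<in>I. site_sum w x (\<eta>, X) - d x) \<partial>walks) =
      (\<Prod>x\<in>I. exp (- \<i> * complex_of_real (d x))) * (\<integral>X. (\<Prod>i\<in>J. iexp (w (fst i) (X i))) \<partial>walks)"
      by simp
    also have "(\<integral>X. (\<Prod>i\<in>J. iexp (w (fst i) (X i))) \<partial>walks) = (\<Prod>i\<in>J. \<psi> (fst i))"
      unfolding walks_eq \<psi>_def by (rule integral_prod_PiM_components[OF K(1) J ewi])
    also have "\<dots> = (\<Prod>x\<in>I. \<Prod>j\<in>{1..\<eta> x}. \<psi> x)"
      unfolding J_def using I by (subst prod.Sigma) (auto simp: case_prod_unfold)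
    finally show ?thesis by (simp add: prod.distrib)
  qed
  have "(\<integral>c. iexp (\<Sum>x\<in>I. site_sum w x c - d x) \<partial>Q) =
     (\<integral>\<eta>. (\<integral>X. iexp (\<Sum>x\<in>I. site_sum w x (\<eta>, X) - d x) \<partial>walks) \<partial>occ)"
    by (rule Q.integral_fst'[OF int, symmetric])
  also have "\<dots> = (\<integral>\<eta>. (\<Prod>x\<in>I. exp (- \<i> * complex_of_real (d x)) * \<psi> x ^ \<eta> x) \<partial>occ)"
    unfolding inner ..
  also have "\<dots> = (\<Prod>x\<in>I. \<integral>k. exp (- \<i> * complex_of_real (d x)) * \<psi> x ^ k \<partial>\<nu> x)"
  proof (rule integral_prod_PiM_components[OF nu(1) I])
    fix x
    show "integrable (\<nu> x) (\<lambda>k. exp (- \<i> * complex_of_real (d x)) * \<psi> x ^ k)"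
    proof (rule finite_measure.integrable_const_bound[where B = 1])
      show "finite_measure (\<nu> x)" by (rule prob_space.finite_measure[OF nu(1)])
      show "AE k in \<nu> x. norm (exp (- \<i> * complex_of_real (d x)) * \<psi> x ^ k) \<le> 1"
        using psi1 by (auto simp: norm_mult norm_power power_le_one)
      show "(\<lambda>k. exp (- \<i> * complex_of_real (d x)) * \<psi> x ^ k) \<in> borel_measurable (\<nu> x)"
        by (simp add: measurable_cong_sets[OF nu(2) refl])
    qed
  qed
  finally show ?thesis unfolding \<psi>_def .
qed

text \<open>The site contributions are independent; the formula above for a single site identifies the factors.\<close>

corollary integral_exp_site_sums_prod:
  assumes I: "finite I" and w: "\<And>x. w x \<in> borel_measurable (\<Pi>\<^sub>M s\<in>UNIV. count_space UNIV)"
  shows "(\<integral>c. iexp (\<Sum>x\<in>I. site_sum w x c - d x) \<partial>Q) =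
    (\<Prod>x\<in>I. \<integral>c. iexp (site_sum w x c - d x) \<partial>Q)"
proof -
  have "(\<integral>c. iexp (site_sum w x c - d x) \<partial>Q) =
    (\<integral>k. exp (- \<i> * complex_of_real (d x)) * (\<integral>X. iexp (w x X) \<partial>K x) ^ k \<partial>\<nu> x)" for x
    using integral_exp_site_sums[of "{x}" w d, OF _ w] by simp
  then show ?thesis unfolding integral_exp_site_sums[OF I w] by simp
qed

lemma integral_eta:
  fixes f :: "nat \<Rightarrow> real"
  shows "(\<integral>c. f (fst c x) \<partial>Q) = (\<integral>k. f k \<partial>\<nu> x)" "integrable Q (\<lambda>c. f (fst c x)) \<longleftrightarrow> integrable (\<nu> x) f"
proof -
  have fm: "f \<in> borel_measurable (\<nu> x)" by (simp add: measurable_cong_sets[OF nu(2) refl])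
  have d: "distr Q occ fst = occ" by (rule walks.distr_pair_fst)
  have m: "(\<lambda>\<eta>. f (\<eta> x)) \<in> borel_measurable occ"
    by (rule measurable_compose[OF measurable_component_singleton[of x UNIV \<nu>] fm]) simp
  show "(\<integral>c. f (fst c x) \<partial>Q) = (\<integral>k. f k \<partial>\<nu> x)"
  proof -
    have "(\<integral>c. f (fst c x) \<partial>Q) = (\<integral>\<eta>. f (\<eta> x) \<partial>distr Q occ fst)"
      by (rule integral_distr[OF measurable_fst m, symmetric])
    then show ?thesis unfolding d by (simp only: integral_PiM_component(1)[where M = \<nu> and i = x, OF nu(1) fm])
  qed
  show "integrable Q (\<lambda>c. f (fst c x)) \<longleftrightarrow> integrable (\<nu> x) f"
    using integrable_distr_eq[OF measurable_fst[of occ walks] m] integral_PiM_component(2)[where M = \<nu> and i = x, OF nu(1) fm] by (simp add: d)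
qed

text \<open>The formula for the variance of a compound sum: with \<open>m\<close> and \<open>b\<close> the means of the number and of
the summands, the centred sum is \<open>\<Sum>j \<le> \<eta>(x). (w(X\<^sup>j) - b)\<close> plus \<open>(\<eta>(x) - m) b\<close>, and given \<open>\<eta>\<close> the first
part is a sum of centred independent variables.\<close>

lemma site_sum_moments:
  assumes w: "\<And>x. w x \<in> borel_measurable (\<Pi>\<^sub>M s\<in>UNIV. count_space UNIV)" and C: "\<And>x X. \<bar>w x X\<bar> \<le> C"
    and sq: "integrable (\<nu> x) (\<lambda>k. (real k)\<^sup>2)"
  defines "m \<equiv> (\<integral>k. real k \<partial>\<nu> x)" and "b \<equiv> (\<integral>X. w x X \<partial>K x)"
  shows "integrable Q (\<lambda>c. (site_sum w x c - m * b)\<^sup>2)"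
    and "(\<integral>c. (site_sum w x c - m * b)\<^sup>2 \<partial>Q) = m * ((\<integral>X. (w x X)\<^sup>2 \<partial>K x) - b\<^sup>2) + ((\<integral>k. (real k)\<^sup>2 \<partial>\<nu> x) - m\<^sup>2) * b\<^sup>2"
    and "integrable Q (site_sum w x)" and "(\<integral>c. site_sum w x c \<partial>Q) = m * b"
proof -
  interpret N: prob_space "\<nu> x" by (rule nu(1))
  interpret Kx: prob_space "K x" by (rule K(1))
  have anym: "f \<in> borel_measurable (\<nu> x)" for f :: "nat \<Rightarrow> real" by (simp add: measurable_cong_sets[OF nu(2) refl])
  have anym': "f \<in> borel_measurable (\<nu> x)" for f :: "nat \<Rightarrow> ennreal" by (simp add: measurable_cong_sets[OF nu(2) refl])
  have i1: "integrable (\<nu> x) real" by (rule N.square_integrable_imp_integrable[OF anym sq])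
  have wK: "w x \<in> borel_measurable (K x)" using w by (simp add: measurable_cong_sets[OF K(2) refl])
  have wi: "integrable (K x) (w x)" by (rule Kx.integrable_const_bound[of _ C]) (use C wK in auto)
  have w2: "integrable (K x) (\<lambda>X. (w x X)\<^sup>2)"
  proof (rule Kx.integrable_const_bound[of _ "C\<^sup>2"])
    have "(w x X)\<^sup>2 \<le> C\<^sup>2" for X using power_mono[OF C[of x X] abs_ge_zero, of 2] by (simp add: power2_abs)
    then show "AE X in K x. norm ((w x X)\<^sup>2) \<le> C\<^sup>2" by simp
  qed (use wK in simp)
  define V where "V = (\<integral>X. (w x X)\<^sup>2 \<partial>K x) - b\<^sup>2"
  define v where "v X = w x X - b" for X
  have vm: "v \<in> borel_measurable (K x)" unfolding v_def using wK by simp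
  have b: "\<bar>b\<bar> \<le> C"
  proof -
    have "\<bar>b\<bar> \<le> (\<integral>X. \<bar>w x X\<bar> \<partial>K x)" unfolding b_def by (rule integral_abs_bound)
    also have "\<dots> \<le> (\<integral>X. C \<partial>K x)" using wi C by (intro integral_mono) auto
    finally show ?thesis by (simp add: Kx.prob_space)
  qed
  have vC: "\<bar>v X\<bar> \<le> 2 * C" for X unfolding v_def using C[of x X] b by linarith
  have v0: "(\<integral>X. v X \<partial>K x) = 0" unfolding v_def using wi by (simp add: Kx.prob_space b_def)
  have vV: "(\<integral>X. (v X)\<^sup>2 \<partial>K x) = V"
    unfolding v_def V_def b_def using Kx.variance_eq[OF wi w2] by simp
  have V0: "V \<ge> 0" unfolding vV[symmetric] by simp
  have Ueq: "site_sum w x (\<eta>, X) - m * b = (\<Sum>i\<in>{x} \<times> {1..\<eta> x}. v (X i)) + (real (\<eta> x) - m) * b" for \<eta> X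
  proof -
    have "(\<Sum>i\<in>{x} \<times> {1..\<eta> x}. v (X i)) = (\<Sum>j\<in>{1..\<eta> x}. v (X (x, j)))"
      by (rule sum.reindex_cong[of "\<lambda>j. (x, j)"]) (auto simp: inj_on_def)
    then show ?thesis by (simp add: site_sum_def v_def sum_subtractf algebra_simps)
  qed
  have inner: "(\<integral>X. (site_sum w x (\<eta>, X) - m * b)\<^sup>2 \<partial>walks) = real (\<eta> x) * V + ((real (\<eta> x) - m) * b)\<^sup>2"
    and innerI: "integrable walks (\<lambda>X. (site_sum w x (\<eta>, X) - m * b)\<^sup>2)"
    and inner1: "(\<integral>X. site_sum w x (\<eta>, X) - m * b \<partial>walks) = (real (\<eta> x) - m) * b" for \<eta>
  proof -
    let ?J = "{x} \<times> {1..\<eta> x}"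
    have MJ: "K (fst i) = K x" if "i \<in> ?J" for i using that by auto
    note r34 = integral_square_sum_PiM(3,4)[where M = "\<lambda>i. K (fst i)" and J = ?J and K = "K x" and w = v and C = "2 * C", OF K(1) _ MJ vm vC v0]
    note r = integral_square_sum_PiM(1,2)[where M = "\<lambda>i. K (fst i)" and J = ?J and K = "K x" and w = v and C = "2 * C" and c = "(real (\<eta> x) - m) * b", OF K(1) _ MJ vm vC v0]
    show "(\<integral>X. (site_sum w x (\<eta>, X) - m * b)\<^sup>2 \<partial>walks) = real (\<eta> x) * V + ((real (\<eta> x) - m) * b)\<^sup>2"
      unfolding Ueq walks_eq using r(1) vV by (simp add: card_cartesian_product)
    show "integrable walks (\<lambda>X. (site_sum w x (\<eta>, X) - m * b)\<^sup>2)"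
      unfolding Ueq walks_eq using r(2) by simp
    show "(\<integral>X. site_sum w x (\<eta>, X) - m * b \<partial>walks) = (real (\<eta> x) - m) * b"
      unfolding Ueq using r34 unfolding walks_eq[symmetric] by (simp add: walks.prob_space)
  qed
  have km: "integrable (\<nu> x) (\<lambda>k. real k * V + ((real k - m) * b)\<^sup>2)"
    using i1 sq by (simp add: power2_eq_square algebra_simps)
  have kmv: "(\<integral>k. real k * V + ((real k - m) * b)\<^sup>2 \<partial>\<nu> x) = m * V + ((\<integral>k. (real k)\<^sup>2 \<partial>\<nu> x) - m\<^sup>2) * b\<^sup>2"
  proof -
    have "(\<integral>k. (real k - m)\<^sup>2 \<partial>\<nu> x) = (\<integral>k. (real k)\<^sup>2 \<partial>\<nu> x) - m\<^sup>2"
      unfolding m_def by (rule N.variance_eq[OF i1 sq])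
    moreover have "integrable (\<nu> x) (\<lambda>k. (real k - m)\<^sup>2)" using i1 sq by (simp add: power2_eq_square algebra_simps)
    ultimately show ?thesis using i1 by (simp add: power_mult_distrib m_def)
  qed
  have Um[measurable]: "site_sum w x \<in> borel_measurable Q" by (rule measurable_site_sum[OF w])
  have nn: "(\<integral>\<^sup>+c. ennreal ((site_sum w x c - m * b)\<^sup>2) \<partial>Q) = ennreal (m * V + ((\<integral>k. (real k)\<^sup>2 \<partial>\<nu> x) - m\<^sup>2) * b\<^sup>2)"
  proof -
    have "(\<integral>\<^sup>+c. ennreal ((site_sum w x c - m * b)\<^sup>2) \<partial>Q) = (\<integral>\<^sup>+\<eta>. \<integral>\<^sup>+X. ennreal ((site_sum w x (\<eta>, X) - m * b)\<^sup>2) \<partial>walks \<partial>occ)"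
      by (rule walks.nn_integral_fst[symmetric]) measurable
    also have "\<dots> = (\<integral>\<^sup>+\<eta>. ennreal (real (\<eta> x) * V + ((real (\<eta> x) - m) * b)\<^sup>2) \<partial>occ)"
      using inner innerI by (subst nn_integral_eq_integral) auto
    also have "\<dots> = (\<integral>\<^sup>+k. ennreal (real k * V + ((real k - m) * b)\<^sup>2) \<partial>\<nu> x)"
      by (rule nn_integral_PiM_component[where M = \<nu> and i = x and f = "\<lambda>k. ennreal (real k * V + ((real k - m) * b)\<^sup>2)", OF nu(1) anym'])
    also have "\<dots> = ennreal (m * V + ((\<integral>k. (real k)\<^sup>2 \<partial>\<nu> x) - m\<^sup>2) * b\<^sup>2)"
      unfolding kmv[symmetric] by (rule nn_integral_eq_integral[OF km]) (use V0 in auto)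
    finally show ?thesis .
  qed
  have nonneg: "0 \<le> m * V + ((\<integral>k. (real k)\<^sup>2 \<partial>\<nu> x) - m\<^sup>2) * b\<^sup>2"
    unfolding kmv[symmetric] using V0 by (intro Bochner_Integration.integral_nonneg) auto
  show I: "integrable Q (\<lambda>c. (site_sum w x c - m * b)\<^sup>2)"
    by (rule integrableI_nonneg) (auto simp: nn)
  show "(\<integral>c. (site_sum w x c - m * b)\<^sup>2 \<partial>Q) = m * ((\<integral>X. (w x X)\<^sup>2 \<partial>K x) - b\<^sup>2) + ((\<integral>k. (real k)\<^sup>2 \<partial>\<nu> x) - m\<^sup>2) * b\<^sup>2"
    unfolding V_def[symmetric] using nonneg by (subst integral_eq_nn_integral) (auto simp: nn)
  have I1: "integrable Q (\<lambda>c. site_sum w x c - m * b)"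
    by (rule Q.square_integrable_imp_integrable[OF _ I]) measurable
  then have "integrable Q (\<lambda>c. (site_sum w x c - m * b) + m * b)" by (intro Bochner_Integration.integrable_add) auto
  then show I2: "integrable Q (site_sum w x)" by simp
  have "(\<integral>c. site_sum w x c - m * b \<partial>Q) = (\<integral>\<eta>. (\<integral>X. site_sum w x (\<eta>, X) - m * b \<partial>walks) \<partial>occ)"
    by (rule Q.integral_fst'[OF I1, symmetric])
  also have "\<dots> = (\<integral>k. (real k - m) * b \<partial>\<nu> x)"
    unfolding inner1 by (rule integral_PiM_component(1)[where M = \<nu> and i = x and f = "\<lambda>k. (real k - m) * b", OF nu(1) anym])
  also have "\<dots> = 0" using i1 by (simp add: m_def N.prob_space)
  finally show "(\<integral>c. site_sum w x c \<partial>Q) = m * b" using I2 by (simp add: Q.prob_space)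
qed

end

section \<open>The quenched and the averaged law\<close>

lemma (in compound_system) nn_integral_eta:
  shows "(\<integral>\<^sup>+c. f (fst c x) \<partial>Q) = (\<integral>\<^sup>+k. f k \<partial>\<nu> x)"
proof -
  have fm: "f \<in> borel_measurable (\<nu> x)" by (simp add: measurable_cong_sets[OF nu(2) refl])
  have d: "distr Q occ fst = occ" by (rule walks.distr_pair_fst)
  have m: "(\<lambda>\<eta>. f (\<eta> x)) \<in> borel_measurable occ"
    by (rule measurable_compose[OF measurable_component_singleton[of x UNIV \<nu>] fm]) simp
  have "(\<integral>\<^sup>+c. f (fst c x) \<partial>Q) = (\<integral>\<^sup>+\<eta>. f (\<eta> x) \<partial>distr Q occ fst)"
    by (rule nn_integral_distr[symmetric]) (use m in auto)
  then show ?thesis unfolding d by (simp only: nn_integral_PiM_component[where M = \<nu> and i = x, OF nu(1) fm])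
qed

abbreviation past_sites :: "(int \<times> int) set" where "past_sites \<equiv> {(y, s). s \<le> -1}"

lemma sets_past_space_le: "sets (past_space R) \<subseteq> sets (env_space R)"
proof -
  have r: "(\<lambda>\<omega>. restrict \<omega> past_sites) \<in> env_space R \<rightarrow>\<^sub>M (\<Pi>\<^sub>M i\<in>past_sites. jump_space R)"
    unfolding env_space_def by (rule measurable_restrict_subset) auto
  show ?thesis unfolding past_space_def
    by (subst sets_vimage_algebra2) (use r measurable_space[OF r] in \<open>auto simp: measurable_def\<close>)
qed

lemma space_past_space: "space (past_space R) = space (env_space R)"
  unfolding past_space_def by simp

text \<open>A set in the past sigma-algebra is a preimage under the restriction to the past, so a level set of \<open>h\<close> cannot
separate two environments with the same past.\<close>

lemma past_measurable_determined:
  fixes h :: "env \<Rightarrow> ennreal"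
  assumes "h \<in> borel_measurable (past_space R)" shows "determined_by R past_sites h"
proof (rule determined_byI)
  fix \<omega> \<omega>' :: env assume w: "\<omega> \<in> space (env_space R)" "\<omega>' \<in> space (env_space R)"
    and eq: "\<And>i. i \<in> past_sites \<Longrightarrow> \<omega> i = \<omega>' i"
  have re: "restrict \<omega> past_sites = restrict \<omega>' past_sites" using eq by (intro restrict_ext) auto
  have r: "(\<lambda>\<omega>. restrict \<omega> past_sites) \<in> space (env_space R) \<rightarrow> space (\<Pi>\<^sub>M i\<in>past_sites. jump_space R)"
    using env_spaceD[of _ R] by (auto simp: space_PiM)
  have "h -` {h \<omega>} \<inter> space (past_space R) \<in> sets (past_space R)"
    by (rule measurable_sets[OF assms]) simp
  then obtain B where B: "h -` {h \<omega>} \<inter> space (env_space R) = (\<lambda>\<omega>. restrict \<omega> past_sites) -` B \<inter> space (env_space R)"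
    unfolding space_past_space unfolding past_space_def sets_vimage_algebra2[OF r] by auto
  have "\<omega> \<in> h -` {h \<omega>} \<inter> space (env_space R)" using w by simp
  then have "restrict \<omega> past_sites \<in> B" unfolding B by simp
  then have "\<omega>' \<in> (\<lambda>\<omega>. restrict \<omega> past_sites) -` B \<inter> space (env_space R)" using re w by simp
  then show "h \<omega> = h \<omega>'" unfolding B[symmetric] by simp
qed

locale particle_system = iid_environment P R for P R +
  fixes \<mu> :: "env \<Rightarrow> int \<Rightarrow> nat measure"
  assumes B1: "B1 R \<mu>" and B2: "B2 P \<mu>"
begin

lemma mu_past: "(\<lambda>\<omega>. \<mu> \<omega> x) \<in> past_space R \<rightarrow>\<^sub>M prob_algebra (count_space UNIV)"
  using B1 unfolding B1_def by blast

lemma mu_shift: "\<omega> \<in> space P \<Longrightarrow> \<mu> \<omega> x = \<mu> (shift x 0 \<omega>) 0"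
  using B1 unfolding B1_def space_P by blast

lemma mu_env: "(\<lambda>\<omega>. \<mu> \<omega> x) \<in> env_space R \<rightarrow>\<^sub>M prob_algebra (count_space UNIV)"
  using mu_past measurable_mono[OF order_refl refl sets_past_space_le space_past_space] by blast

lemma mu_P: "(\<lambda>\<omega>. \<mu> \<omega> x) \<in> P \<rightarrow>\<^sub>M prob_algebra (count_space UNIV)"
  unfolding measurable_P by (rule mu_env)

lemma mu_space:
  assumes "\<omega> \<in> space P" shows "prob_space (\<mu> \<omega> x)" "sets (\<mu> \<omega> x) = sets (count_space UNIV)"
  using measurable_space[OF mu_P assms, of x] by (auto simp: space_prob_algebra)

lemma mu_determined: "determined_by R past_sites (\<lambda>\<omega>. \<mu> \<omega> x)"
proof (rule determined_byI)
  fix \<omega> \<omega>' :: env assume w: "\<omega> \<in> space (env_space R)" "\<omega>' \<in> space (env_space R)"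
    and eq: "\<And>i. i \<in> past_sites \<Longrightarrow> \<omega> i = \<omega>' i"
  have s: "sets (\<mu> \<omega> x) = UNIV" "sets (\<mu> \<omega>' x) = UNIV" using mu_space(2) w space_P by auto
  show "\<mu> \<omega> x = \<mu> \<omega>' x"
  proof (rule measure_eqI)
    fix A assume "A \<in> sets (\<mu> \<omega> x)"
    have "(\<lambda>\<omega>. emeasure (\<mu> \<omega> x) A) \<in> borel_measurable (past_space R)"
      by (rule measurable_compose[OF measurable_prob_algebraD[OF mu_past] measurable_emeasure_subprob_algebra]) simp
    from determined_byD[OF past_measurable_determined[OF this] w eq]
    show "emeasure (\<mu> \<omega> x) A = emeasure (\<mu> \<omega>' x) A" .
  qed (simp add: s)
qed

lemma compound: assumes "\<omega> \<in> space P" shows "compound_system (\<mu> \<omega>) (walk_law \<omega>)"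
  by (rule compound_system.intro[OF mu_space[OF assms] prob_space_walk_law sets_walk_law])

lemma quenched_eq: "quenched \<mu> \<omega> = compound_system.Q (\<mu> \<omega>) (walk_law \<omega>)"
  unfolding quenched_def by simp

lemma quenched_kernel: "(\<lambda>\<omega>. quenched \<mu> \<omega>) \<in> P \<rightarrow>\<^sub>M prob_algebra conf_space"
proof -
  have w: "(\<lambda>\<omega>. PiM UNIV (\<lambda>i :: int \<times> nat. walk_law \<omega> (fst i))) \<in> P \<rightarrow>\<^sub>M prob_algebra (\<Pi>\<^sub>M i\<in>UNIV. \<Pi>\<^sub>M s\<in>UNIV. count_space UNIV)"
    by (rule measurable_PiM_kernel) (unfold measurable_P, rule measurable_walk_law)
  show ?thesis
    unfolding quenched_def[abs_def] conf_space_def case_prod_unfold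
    by (rule measurable_pair_prob[OF measurable_PiM_kernel[OF mu_P] w])
qed

lemma quenched_space:
  assumes "\<omega> \<in> space P" shows "prob_space (quenched \<mu> \<omega>)" "sets (quenched \<mu> \<omega>) = sets conf_space"
  using measurable_space[OF quenched_kernel assms] by (auto simp: space_prob_algebra)

lemma averaged_kernel:
  "(\<lambda>\<omega>. distr (quenched \<mu> \<omega>) (P \<Otimes>\<^sub>M conf_space) (Pair \<omega>)) \<in> P \<rightarrow>\<^sub>M prob_algebra (P \<Otimes>\<^sub>M conf_space)"
  by (rule measurable_distr_prob_space2[OF quenched_kernel]) simp

lemma P_in_prob_algebra: "P \<in> space (prob_algebra P)"
  by (simp add: space_prob_algebra prob_space_axioms)

lemma prob_space_averaged: "prob_space (averaged P \<mu>)"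
  unfolding averaged_def by (rule prob_space_bind'[OF P_in_prob_algebra averaged_kernel])

lemma sets_averaged: "sets (averaged P \<mu>) = sets (P \<Otimes>\<^sub>M conf_space)"
  unfolding averaged_def by (rule sets_bind'[OF P_in_prob_algebra averaged_kernel])

lemma nn_integral_averaged:
  assumes f: "f \<in> borel_measurable (P \<Otimes>\<^sub>M conf_space)"
  shows "(\<integral>\<^sup>+z. f z \<partial>averaged P \<mu>) = (\<integral>\<^sup>+\<omega>. \<integral>\<^sup>+c. f (\<omega>, c) \<partial>quenched \<mu> \<omega> \<partial>P)"
proof -
  have "(\<integral>\<^sup>+z. f z \<partial>averaged P \<mu>) = (\<integral>\<^sup>+\<omega>. \<integral>\<^sup>+z. f z \<partial>distr (quenched \<mu> \<omega>) (P \<Otimes>\<^sub>M conf_space) (Pair \<omega>) \<partial>P)"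
    unfolding averaged_def by (rule nn_integral_bind[OF f measurable_prob_algebraD[OF averaged_kernel]])
  also have "\<dots> = (\<integral>\<^sup>+\<omega>. \<integral>\<^sup>+c. f (\<omega>, c) \<partial>quenched \<mu> \<omega> \<partial>P)"
  proof (rule nn_integral_cong)
    fix \<omega> assume w: "\<omega> \<in> space P"
    have m: "Pair \<omega> \<in> quenched \<mu> \<omega> \<rightarrow>\<^sub>M P \<Otimes>\<^sub>M conf_space"
      by (subst measurable_cong_sets[OF quenched_space(2)[OF w] refl]) (use w in measurable)
    show "(\<integral>\<^sup>+z. f z \<partial>distr (quenched \<mu> \<omega>) (P \<Otimes>\<^sub>M conf_space) (Pair \<omega>)) = (\<integral>\<^sup>+c. f (\<omega>, c) \<partial>quenched \<mu> \<omega>)"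
      using nn_integral_distr[OF m, of f] f by simp
  qed
  finally show ?thesis .
qed

lemma measurable_nn_integral_quenched:
  assumes f: "f \<in> borel_measurable (P \<Otimes>\<^sub>M conf_space)"
  shows "(\<lambda>\<omega>. \<integral>\<^sup>+c. f (\<omega>, c) \<partial>quenched \<mu> \<omega>) \<in> borel_measurable P"
  by (rule nn_integral_measurable_subprob_algebra2[where N = conf_space, OF _ measurable_prob_algebraD[OF quenched_kernel]])
     (use f in \<open>simp add: case_prod_unfold\<close>)

text \<open>Disintegration of the averaged law, for the real and imaginary parts of the characteristic functions. The
shift by \<open>B\<close> reduces it to nonnegative functions.\<close>

lemma integral_averaged_bounded:
  fixes f :: "env \<times> conf \<Rightarrow> real"
  assumes f: "f \<in> borel_measurable (P \<Otimes>\<^sub>M conf_space)" and B: "\<And>z. \<bar>f z\<bar> \<le> B"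
  shows "(\<integral>z. f z \<partial>averaged P \<mu>) = (\<integral>\<omega>. \<integral>c. f (\<omega>, c) \<partial>quenched \<mu> \<omega> \<partial>P)"
    and "(\<lambda>\<omega>. \<integral>c. f (\<omega>, c) \<partial>quenched \<mu> \<omega>) \<in> borel_measurable P"
proof -
  interpret A: prob_space "averaged P \<mu>" by (rule prob_space_averaged)
  have fA: "f \<in> borel_measurable (averaged P \<mu>)" using f by (simp add: measurable_cong_sets[OF sets_averaged refl])
  have iA: "integrable (averaged P \<mu>) f" by (rule A.integrable_const_bound[of _ B]) (use fA B in auto)
  define g where "g z = f z + B" for z
  have g0: "0 \<le> g z" for z using B[of z] unfolding g_def by linarith
  have gm: "(\<lambda>z. ennreal (g z)) \<in> borel_measurable (P \<Otimes>\<^sub>M conf_space)" unfolding g_def using f by simp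
  define h where "h \<omega> = (\<integral>c. f (\<omega>, c) \<partial>quenched \<mu> \<omega>)" for \<omega>
  have nn: "(\<integral>\<^sup>+c. ennreal (g (\<omega>, c)) \<partial>quenched \<mu> \<omega>) = ennreal (h \<omega> + B)" and hB: "\<bar>h \<omega>\<bar> \<le> B" if w: "\<omega> \<in> space P" for \<omega>
  proof -
    interpret q: prob_space "quenched \<mu> \<omega>" by (rule quenched_space(1)[OF w])
    have fm: "(\<lambda>c. f (\<omega>, c)) \<in> borel_measurable (quenched \<mu> \<omega>)"
      by (subst measurable_cong_sets[OF quenched_space(2)[OF w] refl])
         (rule measurable_compose[OF _ f], use w in measurable)
    have fi: "integrable (quenched \<mu> \<omega>) (\<lambda>c. f (\<omega>, c))"
      by (rule q.integrable_const_bound[of _ B]) (use fm B in auto)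
    have "(\<integral>\<^sup>+c. ennreal (g (\<omega>, c)) \<partial>quenched \<mu> \<omega>) = ennreal (\<integral>c. g (\<omega>, c) \<partial>quenched \<mu> \<omega>)"
      by (rule nn_integral_eq_integral) (use fi g0 in \<open>auto simp: g_def\<close>)
    also have "(\<integral>c. g (\<omega>, c) \<partial>quenched \<mu> \<omega>) = h \<omega> + B" unfolding g_def h_def using fi by (simp add: q.prob_space)
    finally show "(\<integral>\<^sup>+c. ennreal (g (\<omega>, c)) \<partial>quenched \<mu> \<omega>) = ennreal (h \<omega> + B)" .
    have "\<bar>h \<omega>\<bar> \<le> (\<integral>c. \<bar>f (\<omega>, c)\<bar> \<partial>quenched \<mu> \<omega>)" unfolding h_def by (rule integral_abs_bound)
    also have "\<dots> \<le> (\<integral>c. B \<partial>quenched \<mu> \<omega>)" using fi B by (intro integral_mono) auto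
    finally show "\<bar>h \<omega>\<bar> \<le> B" by (simp add: q.prob_space)
  qed
  have hB0: "0 \<le> h \<omega> + B" if "\<omega> \<in> space P" for \<omega> using hB[OF that] by linarith
  have "(\<lambda>\<omega>. enn2real (\<integral>\<^sup>+c. ennreal (g (\<omega>, c)) \<partial>quenched \<mu> \<omega>) - B) \<in> borel_measurable P"
    using measurable_nn_integral_quenched[OF gm] by simp
  then have hm: "h \<in> borel_measurable P"
    by (rule measurable_cong[THEN iffD1, rotated]) (simp add: nn hB0)
  then show "(\<lambda>\<omega>. \<integral>c. f (\<omega>, c) \<partial>quenched \<mu> \<omega>) \<in> borel_measurable P" unfolding h_def .
  have hi: "integrable P h" by (rule integrable_bounded[OF hm hB])
  have "ennreal ((\<integral>z. f z \<partial>averaged P \<mu>) + B) = ennreal (\<integral>z. g z \<partial>averaged P \<mu>)"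
    unfolding g_def using iA by (simp add: A.prob_space)
  also have "\<dots> = (\<integral>\<^sup>+z. ennreal (g z) \<partial>averaged P \<mu>)"
    by (rule nn_integral_eq_integral[symmetric]) (use iA g0 in \<open>auto simp: g_def\<close>)
  also have "\<dots> = (\<integral>\<^sup>+\<omega>. ennreal (h \<omega> + B) \<partial>P)"
    unfolding nn_integral_averaged[OF gm] by (rule nn_integral_cong) (rule nn)
  also have "\<dots> = ennreal (expectation (\<lambda>\<omega>. h \<omega> + B))"
    by (rule nn_integral_eq_integral) (use hi hB0 in auto)
  also have "expectation (\<lambda>\<omega>. h \<omega> + B) = expectation h + B" using hi by (simp add: prob_space)
  finally have e: "ennreal ((\<integral>z. f z \<partial>averaged P \<mu>) + B) = ennreal (expectation h + B)" .
  have "0 \<le> (\<integral>z. g z \<partial>averaged P \<mu>)" using g0 by (intro Bochner_Integration.integral_nonneg) auto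
  then have "0 \<le> (\<integral>z. f z \<partial>averaged P \<mu>) + B" unfolding g_def using iA by (simp add: A.prob_space)
  moreover have "0 \<le> expectation (\<lambda>\<omega>. h \<omega> + B)" using hB0 by (intro Bochner_Integration.integral_nonneg) auto
  then have "0 \<le> expectation h + B" using hi by (simp add: prob_space)
  ultimately have "(\<integral>z. f z \<partial>averaged P \<mu>) = expectation h" using e by (simp add: ennreal_inj)
  then show "(\<integral>z. f z \<partial>averaged P \<mu>) = (\<integral>\<omega>. \<integral>c. f (\<omega>, c) \<partial>quenched \<mu> \<omega> \<partial>P)" unfolding h_def .
qed

section \<open>Moments of the occupation variables\<close>

definition occ_mean :: "env \<Rightarrow> real" where "occ_mean \<omega> = (\<integral>k. real k \<partial>\<mu> \<omega> 0)"
definition occ_sq :: "env \<Rightarrow> real" where "occ_sq \<omega> = (\<integral>k. (real k)\<^sup>2 \<partial>\<mu> \<omega> 0)"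
definition occ_var :: "env \<Rightarrow> real" where "occ_var \<omega> = (\<integral>k. (real k - occ_mean \<omega>)\<^sup>2 \<partial>\<mu> \<omega> 0)"

lemma mu_borel: "\<omega> \<in> space P \<Longrightarrow> f \<in> measurable (\<mu> \<omega> x) N \<longleftrightarrow> f \<in> UNIV \<rightarrow> space N"
  by (simp add: measurable_cong_sets[OF mu_space(2) refl])

lemma measurable_nn_integral_mu:
  fixes f :: "nat \<Rightarrow> env \<Rightarrow> ennreal"
  assumes "\<And>k. f k \<in> borel_measurable P"
  shows "(\<lambda>\<omega>. \<integral>\<^sup>+k. f k \<omega> \<partial>\<mu> \<omega> x) \<in> borel_measurable P"
proof -
  have "(\<lambda>z. f (snd z) (fst z)) \<in> borel_measurable (P \<Otimes>\<^sub>M count_space UNIV)"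
    by (rule measurable_compose_countable[OF measurable_compose[OF measurable_fst assms] measurable_snd])
  then show ?thesis
    by (intro nn_integral_measurable_subprob_algebra2[where N = "count_space UNIV", OF _ measurable_prob_algebraD[OF mu_P]])
       (simp add: case_prod_unfold)
qed

lemma measurable_integral_mu:
  fixes f :: "nat \<Rightarrow> env \<Rightarrow> real"
  assumes "\<And>k. f k \<in> borel_measurable P" "\<And>k \<omega>. 0 \<le> f k \<omega>"
  shows "(\<lambda>\<omega>. \<integral>k. f k \<omega> \<partial>\<mu> \<omega> x) \<in> borel_measurable P"
proof -
  have "(\<lambda>\<omega>. enn2real (\<integral>\<^sup>+k. ennreal (f k \<omega>) \<partial>\<mu> \<omega> x)) \<in> borel_measurable P"
    by (intro measurable_compose[OF measurable_nn_integral_mu]) (use assms in auto)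
  then show ?thesis
    by (rule measurable_cong[THEN iffD1, rotated]) (auto simp: mu_borel assms integral_eq_nn_integral)
qed

lemma measurable_occ[measurable]:
  "occ_mean \<in> borel_measurable P" "occ_sq \<in> borel_measurable P" "occ_var \<in> borel_measurable P"
proof -
  show m: "occ_mean \<in> borel_measurable P" unfolding occ_mean_def[abs_def] by (rule measurable_integral_mu) auto
  show "occ_sq \<in> borel_measurable P" unfolding occ_sq_def[abs_def] by (rule measurable_integral_mu) auto
  show "occ_var \<in> borel_measurable P" unfolding occ_var_def[abs_def] by (rule measurable_integral_mu) (use m in auto)
qed

lemma nn_integral_averaged_eta:
  fixes f :: "nat \<Rightarrow> ennreal"
  shows "(\<integral>\<^sup>+z. f (fst (snd z) 0) \<partial>averaged P \<mu>) = (\<integral>\<^sup>+\<omega>. \<integral>\<^sup>+k. f k \<partial>\<mu> \<omega> 0 \<partial>P)"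
    and "(\<lambda>z. f (fst (snd z) 0)) \<in> borel_measurable (P \<Otimes>\<^sub>M conf_space)"
proof -
  have "(\<lambda>z. fst (snd z) 0) \<in> P \<Otimes>\<^sub>M conf_space \<rightarrow>\<^sub>M count_space UNIV"
    unfolding conf_space_def by measurable
  then show m: "(\<lambda>z. f (fst (snd z) 0)) \<in> borel_measurable (P \<Otimes>\<^sub>M conf_space)"
    by (rule measurable_compose) simp
  show "(\<integral>\<^sup>+z. f (fst (snd z) 0) \<partial>averaged P \<mu>) = (\<integral>\<^sup>+\<omega>. \<integral>\<^sup>+k. f k \<partial>\<mu> \<omega> 0 \<partial>P)"
    unfolding nn_integral_averaged[OF m]
  proof (rule nn_integral_cong)
    fix \<omega> assume "\<omega> \<in> space P"
    then interpret compound_system "\<mu> \<omega>" "walk_law \<omega>" by (rule compound)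
    show "(\<integral>\<^sup>+c. f (fst (snd (\<omega>, c)) 0) \<partial>quenched \<mu> \<omega>) = (\<integral>\<^sup>+k. f k \<partial>\<mu> \<omega> 0)"
      unfolding quenched_eq using nn_integral_eta[of f 0] by simp
  qed
qed

lemma sq_finite: "(\<integral>\<^sup>+\<omega>. \<integral>\<^sup>+k. ennreal ((real k)\<^sup>2) \<partial>\<mu> \<omega> 0 \<partial>P) < \<infinity>"
proof -
  have "integrable (averaged P \<mu>) (\<lambda>z. (real (fst (snd z) 0))\<^sup>2)"
    using B2 unfolding B2_def by (simp add: case_prod_unfold)
  then have "(\<integral>\<^sup>+z. ennreal (norm ((real (fst (snd z) 0))\<^sup>2)) \<partial>averaged P \<mu>) < \<infinity>"
    unfolding integrable_iff_bounded by blast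
  then show ?thesis using nn_integral_averaged_eta(1)[of "\<lambda>k. ennreal ((real k)\<^sup>2)"] by simp
qed

lemma AE_sq_integrable0: "AE \<omega> in P. integrable (\<mu> \<omega> 0) (\<lambda>k. (real k)\<^sup>2)"
proof -
  have "(\<lambda>\<omega>. \<integral>\<^sup>+k. ennreal ((real k)\<^sup>2) \<partial>\<mu> \<omega> 0) \<in> borel_measurable P"
    by (rule measurable_nn_integral_mu) simp
  then have "AE \<omega> in P. (\<integral>\<^sup>+k. ennreal ((real k)\<^sup>2) \<partial>\<mu> \<omega> 0) \<noteq> \<infinity>"
    using sq_finite by (intro nn_integral_PInf_AE) auto
  then show ?thesis
  proof (rule AE_mp, intro AE_I2 impI)
    fix \<omega> assume "\<omega> \<in> space P" "(\<integral>\<^sup>+k. ennreal ((real k)\<^sup>2) \<partial>\<mu> \<omega> 0) \<noteq> \<infinity>"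
    then show "integrable (\<mu> \<omega> 0) (\<lambda>k. (real k)\<^sup>2)"
      by (intro integrableI_nonneg) (auto simp: mu_borel top.not_eq_extremum)
  qed
qed

lemma AE_sq_integrable: "AE \<omega> in P. \<forall>x. integrable (\<mu> \<omega> x) (\<lambda>k. (real k)\<^sup>2)"
  unfolding AE_all_countable
proof
  fix x
  have "AE \<omega> in distr P P (shift x 0). integrable (\<mu> \<omega> 0) (\<lambda>k. (real k)\<^sup>2)"
    unfolding distr_shift by (rule AE_sq_integrable0)
  then have "AE \<omega> in P. integrable (\<mu> (shift x 0 \<omega>) 0) (\<lambda>k. (real k)\<^sup>2)"
    by (rule AE_distrD[OF measurable_shift_P])
  then show "AE \<omega> in P. integrable (\<mu> \<omega> x) (\<lambda>k. (real k)\<^sup>2)"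
    by (rule AE_mp) (auto intro!: AE_I2 simp: mu_shift[symmetric])
qed

lemma occ_pointwise:
  assumes w: "\<omega> \<in> space P" and sq: "integrable (\<mu> \<omega> 0) (\<lambda>k. (real k)\<^sup>2)"
  shows "integrable (\<mu> \<omega> 0) real" "0 \<le> occ_mean \<omega>" "occ_mean \<omega> \<le> occ_sq \<omega>" "(occ_mean \<omega>)\<^sup>2 \<le> occ_sq \<omega>"
    "occ_var \<omega> = occ_sq \<omega> - (occ_mean \<omega>)\<^sup>2" "0 \<le> occ_var \<omega>" "occ_var \<omega> \<le> occ_sq \<omega>"
proof -
  interpret N: prob_space "\<mu> \<omega> 0" by (rule mu_space(1)[OF w])
  show i1: "integrable (\<mu> \<omega> 0) real" by (rule N.square_integrable_imp_integrable[OF _ sq]) (simp add: mu_borel[OF w])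
  show "0 \<le> occ_mean \<omega>" unfolding occ_mean_def by simp
  show "occ_mean \<omega> \<le> occ_sq \<omega>" unfolding occ_mean_def occ_sq_def
  proof (rule integral_mono[OF i1 sq])
    fix k :: nat show "real k \<le> (real k)\<^sup>2" by (cases k) (auto simp: power2_eq_square)
  qed
  show v: "occ_var \<omega> = occ_sq \<omega> - (occ_mean \<omega>)\<^sup>2" unfolding occ_var_def occ_sq_def occ_mean_def
    by (rule N.variance_eq[OF i1 sq])
  show "0 \<le> occ_var \<omega>" unfolding occ_var_def by simp
  then show "(occ_mean \<omega>)\<^sup>2 \<le> occ_sq \<omega>" using v by simp
  show "occ_var \<omega> \<le> occ_sq \<omega>" using v by simp
qed

lemma occ_sq_nonneg: "0 \<le> occ_sq \<omega>" unfolding occ_sq_def by simp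
lemma occ_mean_nonneg: "0 \<le> occ_mean \<omega>" unfolding occ_mean_def by simp
lemma occ_var_nonneg: "0 \<le> occ_var \<omega>" unfolding occ_var_def by simp

lemma integrable_occ: "integrable P occ_sq" "integrable P occ_mean" "integrable P occ_var"
proof -
  have ae: "AE \<omega> in P. (\<integral>\<^sup>+k. ennreal ((real k)\<^sup>2) \<partial>\<mu> \<omega> 0) = ennreal (occ_sq \<omega>)"
    using AE_sq_integrable0
  proof (rule AE_mp, intro AE_I2 impI)
    fix \<omega> assume "\<omega> \<in> space P" "integrable (\<mu> \<omega> 0) (\<lambda>k. (real k)\<^sup>2)"
    then show "(\<integral>\<^sup>+k. ennreal ((real k)\<^sup>2) \<partial>\<mu> \<omega> 0) = ennreal (occ_sq \<omega>)"
      unfolding occ_sq_def by (intro nn_integral_eq_integral) auto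
  qed
  have "(\<integral>\<^sup>+\<omega>. ennreal (occ_sq \<omega>) \<partial>P) < \<infinity>"
    using sq_finite nn_integral_cong_AE[OF ae] by simp
  then show q: "integrable P occ_sq" by (intro integrableI_nonneg) (auto simp: occ_sq_nonneg)
  show "integrable P occ_mean"
  proof (rule Bochner_Integration.integrable_bound[OF q])
    show "AE \<omega> in P. norm (occ_mean \<omega>) \<le> norm (occ_sq \<omega>)"
      using AE_sq_integrable0
      by (rule AE_mp) (auto intro!: AE_I2 simp: occ_pointwise occ_sq_nonneg)
  qed simp
  show "integrable P occ_var"
  proof (rule Bochner_Integration.integrable_bound[OF q])
    show "AE \<omega> in P. norm (occ_var \<omega>) \<le> norm (occ_sq \<omega>)"
      using AE_sq_integrable0
      by (rule AE_mp) (auto intro!: AE_I2 simp: occ_pointwise occ_sq_nonneg)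
  qed simp
qed

lemma rho0_eq: "rho0 P \<mu> = expectation occ_mean"
proof -
  have m: "(\<lambda>z. real (fst (snd z) 0)) \<in> borel_measurable (averaged P \<mu>)"
  proof -
    have "(\<lambda>z. fst (snd z) 0) \<in> P \<Otimes>\<^sub>M conf_space \<rightarrow>\<^sub>M count_space UNIV"
      unfolding conf_space_def by measurable
    then have "(\<lambda>z. real (fst (snd z) 0)) \<in> borel_measurable (P \<Otimes>\<^sub>M conf_space)"
      by (rule measurable_compose) simp
    then show ?thesis by (simp add: measurable_cong_sets[OF sets_averaged refl])
  qed
  have ae: "AE \<omega> in P. (\<integral>\<^sup>+k. ennreal (real k) \<partial>\<mu> \<omega> 0) = ennreal (occ_mean \<omega>)"
    using AE_sq_integrable0
  proof (rule AE_mp, intro AE_I2 impI)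
    fix \<omega> assume "\<omega> \<in> space P" "integrable (\<mu> \<omega> 0) (\<lambda>k. (real k)\<^sup>2)"
    then show "(\<integral>\<^sup>+k. ennreal (real k) \<partial>\<mu> \<omega> 0) = ennreal (occ_mean \<omega>)"
      unfolding occ_mean_def using occ_pointwise(1) by (intro nn_integral_eq_integral) auto
  qed
  have "rho0 P \<mu> = (\<integral>z. real (fst (snd z) 0) \<partial>averaged P \<mu>)"
    unfolding rho0_def by (simp add: case_prod_unfold)
  also have "\<dots> = enn2real (\<integral>\<^sup>+z. ennreal (real (fst (snd z) 0)) \<partial>averaged P \<mu>)"
    by (rule integral_eq_nn_integral[OF m]) simp
  also have "(\<integral>\<^sup>+z. ennreal (real (fst (snd z) 0)) \<partial>averaged P \<mu>) = (\<integral>\<^sup>+\<omega>. ennreal (occ_mean \<omega>) \<partial>P)"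
    using nn_integral_averaged_eta(1)[of "\<lambda>k. ennreal (real k)"] nn_integral_cong_AE[OF ae] by simp
  also have "enn2real \<dots> = expectation occ_mean"
    by (rule integral_eq_nn_integral[symmetric]) (simp_all add: occ_mean_nonneg)
  finally show ?thesis .
qed

lemma init_var_eq: "init_var P \<mu> = expectation occ_var"
  unfolding init_var_def
proof (rule Bochner_Integration.integral_cong[OF refl])
  fix \<omega> assume "\<omega> \<in> space P"
  then interpret compound_system "\<mu> \<omega>" "walk_law \<omega>" by (rule compound)
  show "quenched_var \<mu> \<omega> (\<lambda>(\<eta>, X). real (\<eta> 0)) = occ_var \<omega>"
  proof -
    have e: "(\<lambda>(\<eta> :: int \<Rightarrow> nat, X :: int \<times> nat \<Rightarrow> nat \<Rightarrow> int). real (\<eta> 0)) = (\<lambda>c. real (fst c 0))" by auto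
    show ?thesis unfolding quenched_var_def quenched_eq occ_var_def occ_mean_def e
    using integral_eta(1)[of real 0] integral_eta(1)[of "\<lambda>k. (real k - (\<integral>k. real k \<partial>\<mu> \<omega> 0))\<^sup>2" 0] by simp
  qed
qed

lemma rho0_nonneg: "0 \<le> rho0 P \<mu>" unfolding rho0_eq occ_mean_def by simp
lemma init_var_nonneg: "0 \<le> init_var P \<mu>" unfolding init_var_eq occ_var_def by simp

text \<open>The space shift does not move the time levels, so the quenched moments of \<open>\<eta>(x)\<close> depend on the past only.\<close>

lemma occ_shift_determined:
  "determined_by R past_sites (\<lambda>\<omega>. occ_mean (shift x 0 \<omega>))" "determined_by R past_sites (\<lambda>\<omega>. occ_var (shift x 0 \<omega>))"
proof -
  have *: "\<mu> (shift x 0 \<omega>) 0 = \<mu> (shift x 0 \<omega>') 0"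
    if "\<omega> \<in> space (env_space R)" "\<omega>' \<in> space (env_space R)" "\<And>i. i \<in> past_sites \<Longrightarrow> \<omega> i = \<omega>' i" for \<omega> \<omega>'
    using determined_byD[OF mu_determined that, of x] mu_shift that(1,2) space_P by simp
  show "determined_by R past_sites (\<lambda>\<omega>. occ_mean (shift x 0 \<omega>))"
  proof (rule determined_byI)
    fix \<omega> \<omega>' :: env assume w: "\<omega> \<in> space (env_space R)" "\<omega>' \<in> space (env_space R)" "\<And>i. i \<in> past_sites \<Longrightarrow> \<omega> i = \<omega>' i"
    show "occ_mean (shift x 0 \<omega>) = occ_mean (shift x 0 \<omega>')" using *[OF w] unfolding occ_mean_def by simp
  qed
  show "determined_by R past_sites (\<lambda>\<omega>. occ_var (shift x 0 \<omega>))"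
  proof (rule determined_byI)
    fix \<omega> \<omega>' :: env assume w: "\<omega> \<in> space (env_space R)" "\<omega>' \<in> space (env_space R)" "\<And>i. i \<in> past_sites \<Longrightarrow> \<omega> i = \<omega>' i"
    show "occ_var (shift x 0 \<omega>) = occ_var (shift x 0 \<omega>')" using *[OF w] unfolding occ_var_def occ_mean_def by simp
  qed
qed

section \<open>Uniform integrability of the squared occupation variables\<close>

text \<open>For a bounded path functional, this controls the Lindeberg term of one site if \<open>a\<close> is the order of
the contribution of a single particle.\<close>

definition occ_trunc :: "real \<Rightarrow> env \<Rightarrow> real" where
  "occ_trunc a \<omega> = (\<integral>k. (real k)\<^sup>2 * min 1 (a * real k) \<partial>\<mu> \<omega> 0)"

lemma min_one_tendsto:
  assumes "a \<longlonglongrightarrow> (0 :: real)" shows "(\<lambda>n. min 1 (a n * y)) \<longlonglongrightarrow> 0"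
proof -
  have "(\<lambda>n. min 1 (a n * y)) \<longlonglongrightarrow> min 1 (0 * y)" using assms by (intro tendsto_intros)
  then show ?thesis by simp
qed

lemma occ_trunc_bounds:
  assumes w: "\<omega> \<in> space P" and sq: "integrable (\<mu> \<omega> 0) (\<lambda>k. (real k)\<^sup>2)" and "0 \<le> a"
  shows "integrable (\<mu> \<omega> 0) (\<lambda>k. (real k)\<^sup>2 * min 1 (a * real k))" "0 \<le> occ_trunc a \<omega>" "occ_trunc a \<omega> \<le> occ_sq \<omega>"
proof -
  have b: "0 \<le> (real k)\<^sup>2 * min 1 (a * real k)" "(real k)\<^sup>2 * min 1 (a * real k) \<le> (real k)\<^sup>2" for k
    using \<open>0 \<le> a\<close> by (auto intro!: mult_left_le)
  show i: "integrable (\<mu> \<omega> 0) (\<lambda>k. (real k)\<^sup>2 * min 1 (a * real k))"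
    by (rule Bochner_Integration.integrable_bound[OF sq]) (use b in \<open>auto simp: mu_borel[OF w]\<close>)
  show "0 \<le> occ_trunc a \<omega>" unfolding occ_trunc_def using b by (intro Bochner_Integration.integral_nonneg)
  show "occ_trunc a \<omega> \<le> occ_sq \<omega>" unfolding occ_trunc_def occ_sq_def by (rule integral_mono[OF i sq b(2)])
qed

lemma measurable_occ_trunc: "0 \<le> a \<Longrightarrow> occ_trunc a \<in> borel_measurable P"
  unfolding occ_trunc_def[abs_def] by (rule measurable_integral_mu) auto

lemma integrable_occ_trunc: assumes "0 \<le> a" shows "integrable P (occ_trunc a)"
proof (rule Bochner_Integration.integrable_bound[OF integrable_occ(1) measurable_occ_trunc[OF assms]])
  show "AE \<omega> in P. norm (occ_trunc a \<omega>) \<le> norm (occ_sq \<omega>)"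
    using AE_sq_integrable0
    by (rule AE_mp) (auto intro!: AE_I2 simp: occ_trunc_bounds assms occ_sq_nonneg)
qed

lemma expectation_occ_trunc_tendsto:
  assumes a: "a \<longlonglongrightarrow> 0" "\<And>n. 0 \<le> a n"
  shows "(\<lambda>n. expectation (occ_trunc (a n))) \<longlonglongrightarrow> 0"
proof -
  have "(\<lambda>n. expectation (occ_trunc (a n))) \<longlonglongrightarrow> expectation (\<lambda>_. 0)"
  proof (rule integral_dominated_convergence[where w = occ_sq])
    show "AE \<omega> in P. (\<lambda>n. occ_trunc (a n) \<omega>) \<longlonglongrightarrow> 0"
      using AE_sq_integrable0
    proof (rule AE_mp, intro AE_I2 impI)
      fix \<omega> assume w: "\<omega> \<in> space P" and sq: "integrable (\<mu> \<omega> 0) (\<lambda>k. (real k)\<^sup>2)"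
      have "(\<lambda>n. \<integral>k. (real k)\<^sup>2 * min 1 (a n * real k) \<partial>\<mu> \<omega> 0) \<longlonglongrightarrow> (\<integral>k. 0 \<partial>\<mu> \<omega> 0)"
      proof (rule integral_dominated_convergence[OF _ _ sq])
        show "AE k in \<mu> \<omega> 0. (\<lambda>n. (real k)\<^sup>2 * min 1 (a n * real k)) \<longlonglongrightarrow> 0"
          using tendsto_mult[OF tendsto_const min_one_tendsto[OF a(1)]] by (intro AE_I2) fastforce
        show "AE k in \<mu> \<omega> 0. norm ((real k)\<^sup>2 * min 1 (a n * real k)) \<le> (real k)\<^sup>2" for n
          using a(2) by (intro AE_I2) (auto simp: abs_mult intro!: mult_left_le)
      qed (auto simp: mu_borel[OF w])
      then show "(\<lambda>n. occ_trunc (a n) \<omega>) \<longlonglongrightarrow> 0" unfolding occ_trunc_def by simp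
    qed
    show "AE \<omega> in P. norm (occ_trunc (a n) \<omega>) \<le> occ_sq \<omega>" for n
      using AE_sq_integrable0 by (rule AE_mp) (auto intro!: AE_I2 simp: occ_trunc_bounds a)
  qed (auto intro: integrable_occ measurable_occ_trunc a)
  then show ?thesis by simp
qed

lemma expectation_occ_sq_min_tendsto:
  assumes a: "a \<longlonglongrightarrow> 0" "\<And>n. 0 \<le> a n"
  shows "(\<lambda>n. expectation (\<lambda>\<omega>. occ_sq \<omega> * min 1 (a n * occ_sq \<omega>))) \<longlonglongrightarrow> 0"
proof -
  have "(\<lambda>n. expectation (\<lambda>\<omega>. occ_sq \<omega> * min 1 (a n * occ_sq \<omega>))) \<longlonglongrightarrow> expectation (\<lambda>_. 0)"
  proof (rule integral_dominated_convergence[where w = occ_sq])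
    show "AE \<omega> in P. (\<lambda>n. occ_sq \<omega> * min 1 (a n * occ_sq \<omega>)) \<longlonglongrightarrow> 0"
      using tendsto_mult[OF tendsto_const min_one_tendsto[OF a(1)]] by (intro AE_I2) fastforce
    show "AE \<omega> in P. norm (occ_sq \<omega> * min 1 (a n * occ_sq \<omega>)) \<le> occ_sq \<omega>" for n
      using a(2) occ_sq_nonneg by (intro AE_I2) (auto simp: abs_mult intro!: mult_left_le)
  qed (auto intro: integrable_occ)
  then show ?thesis by simp
qed

lemma integrable_occ_sq_min: "0 \<le> a \<Longrightarrow> integrable P (\<lambda>\<omega>. occ_sq \<omega> * min 1 (a * occ_sq \<omega>))"
  by (rule Bochner_Integration.integrable_bound[OF integrable_occ(1)])
     (use occ_sq_nonneg in \<open>auto simp: abs_mult intro!: mult_left_le\<close>)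

end

section \<open>Central limit theorem for the averaged walk\<close>

text \<open>Positions, and differences of positions at two times, are linear functionals of the increments; one central
limit theorem for such functionals covers all the cases below.\<close>

definition lin :: "(nat \<Rightarrow> real) \<Rightarrow> int list \<Rightarrow> real" where
  "lin c l = (\<Sum>k<length l. c k * real_of_int (l ! k))"

lemma lin_Nil[simp]: "lin c [] = 0" by (simp add: lin_def)

lemma lin_Cons[simp]: "lin c (z # l) = c 0 * real_of_int z + lin (\<lambda>k. c (Suc k)) l"
  unfolding lin_def by (simp add: sum.lessThan_Suc_shift del: sum.lessThan_Suc)

lemma lin_of_bool:
  assumes "k \<le> length l" shows "lin (\<lambda>j. of_bool (j < k)) l = real_of_int (sum_list (take k l))"
proof -
  have "lin (\<lambda>j. of_bool (j < k)) l = (\<Sum>j<k. real_of_int (l ! j))"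
    unfolding lin_def using assms by (intro sum.mono_neutral_cong_right) auto
  also have "\<dots> = real_of_int (\<Sum>j<k. take k l ! j)" by simp
  also have "(\<Sum>j<k. take k l ! j) = sum_list (take k l)"
    using assms by (simp add: sum_list_sum_nth atLeast0LessThan)
  finally show ?thesis .
qed

lemma lin_cmult: "lin (\<lambda>k. a * c k) l = a * lin c l"
  unfolding lin_def by (simp add: sum_distrib_left mult_ac)

lemma lin_diff: "lin (\<lambda>k. c k - d k) l = lin c l - lin d l"
  unfolding lin_def by (simp add: sum_subtractf algebra_simps)

lemma lin_append: "lin c (l1 @ l2) = lin c l1 + lin (\<lambda>k. c (length l1 + k)) l2"
proof (induction l1 arbitrary: c)
  case (Cons z l1)
  show ?case using Cons[of "\<lambda>k. c (Suc k)"] by simp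
qed simp

lemma lin_cong: "(\<And>k. k < length l \<Longrightarrow> c k = d k) \<Longrightarrow> lin c l = lin d l"
  unfolding lin_def by (intro sum.cong) auto

lemma iexp_taylor3: "cmod (iexp x - (1 + \<i> * complex_of_real x - (complex_of_real x)\<^sup>2 / 2)) \<le> \<bar>x\<bar> ^ 3 / 6"
proof -
  have "cmod (iexp x - (\<Sum>k\<le>2. (\<i> * x) ^ k / fact k)) \<le> \<bar>x\<bar> ^ Suc 2 / fact (Suc 2)"
    using iexp_approx1[of x 2] by simp
  moreover have "(\<Sum>k\<le>2. (\<i> * complex_of_real x) ^ k / fact k) = 1 + \<i> * x - x\<^sup>2 / 2"
    by (simp add: numeral_2_eq_2 power_mult_distrib)
  ultimately show ?thesis by (simp add: fact_numeral numeral_3_eq_3)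
qed

lemma exp_minus_taylor:
  assumes "0 \<le> (y::real)" shows "\<bar>exp (- y) - (1 - y)\<bar> \<le> y\<^sup>2 / 2"
proof -
  have 1: "0 \<le> exp (- y) - (1 - y)" using exp_ge_add_one_self[of "- y"] by simp
  have "exp (- y) \<le> 1 - y + y\<^sup>2 / 2"
  proof (cases "y = 0")
    case False
    then have "0 < y" using assms by simp
    define h where "h x = 1 - x + x\<^sup>2 / 2 - exp (- x)" for x :: real
    have "h 0 \<le> h y"
    proof (rule DERIV_nonneg_imp_nondecreasing[OF assms])
      fix x :: real assume "0 \<le> x" "x \<le> y"
      have "(h has_real_derivative (- 1 + x + exp (- x))) (at x)"
        unfolding h_def by (auto intro!: derivative_eq_intros)
      moreover have "0 \<le> - 1 + x + exp (- x)" using exp_ge_add_one_self[of "- x"] by simp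
      ultimately show "\<exists>z. (h has_real_derivative z) (at x) \<and> 0 \<le> z" by blast
    qed
    then show ?thesis by (simp add: h_def)
  qed simp
  with 1 show ?thesis by simp
qed

context iid_environment
begin

abbreviation "v \<equiv> velocity P"
abbreviation "\<sigma>2 \<equiv> jump_var P"

lemma infsum_jumps:
  fixes f :: "int \<Rightarrow> real" shows "(\<Sum>\<^sub>\<infinity>z. f z * p z) = (\<Sum>z\<in>jumps R. f z * p z)"
proof -
  have "(\<Sum>\<^sub>\<infinity>z. f z * p z) = (\<Sum>\<^sub>\<infinity>z\<in>jumps R. f z * p z)"
    using jump_spaceD(2)[OF p_space] by (intro infsum_cong_neutral) auto
  then show ?thesis by simp
qed

lemma velocity_eq: "v = (\<Sum>z\<in>jumps R. p z * real_of_int z)"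
  unfolding velocity_def infsum_jumps by (simp add: mult.commute)

lemma jump_var_eq: "\<sigma>2 = (\<Sum>z\<in>jumps R. p z * (real_of_int z - v)\<^sup>2)"
proof -
  have "(\<Sum>z\<in>jumps R. p z * (real_of_int z - v)\<^sup>2) =
     (\<Sum>z\<in>jumps R. (real_of_int z)\<^sup>2 * p z - 2 * v * (p z * real_of_int z) + v\<^sup>2 * p z)"
    by (intro sum.cong refl) (simp add: power2_eq_square algebra_simps)
  also have "\<dots> = (\<Sum>z\<in>jumps R. (real_of_int z)\<^sup>2 * p z) - 2 * v * v + v\<^sup>2 * 1"
    by (simp only: sum.distrib sum_subtractf sum_distrib_left[symmetric] p_sum velocity_eq[symmetric])
  finally show ?thesis unfolding jump_var_def infsum_jumps by (simp add: power2_eq_square)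
qed

lemma jump_var_nonneg: "0 \<le> \<sigma>2"
  unfolding jump_var_eq using p_nonneg by (intro sum_nonneg mult_nonneg_nonneg) auto

lemma AP_const[simp]: "AP n (\<lambda>l. (c :: 'b::{banach,second_countable_topology})) = c"
  by simp

lemma AP_add:
  fixes f g :: "int list \<Rightarrow> 'b::{banach,second_countable_topology}"
  shows "AP n (\<lambda>l. f l + g l) = AP n f + AP n g"
  by (rule Bochner_Integration.integral_add) (rule integrable_path_pmf[OF const_p_space])+

lemma AP_diff:
  fixes f g :: "int list \<Rightarrow> 'b::{banach,second_countable_topology}"
  shows "AP n (\<lambda>l. f l - g l) = AP n f - AP n g"
  by (rule Bochner_Integration.integral_diff) (rule integrable_path_pmf[OF const_p_space])+

lemma AP_sum:
  fixes f :: "'i \<Rightarrow> int list \<Rightarrow> 'b::{banach,second_countable_topology}"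
  shows "AP n (\<lambda>l. \<Sum>i\<in>I. f i l) = (\<Sum>i\<in>I. AP n (f i))"
  by (rule Bochner_Integration.integral_sum) (rule integrable_path_pmf[OF const_p_space])

lemma AP_cmult: "AP n (\<lambda>l. c * f l) = c * AP n (f :: int list \<Rightarrow> real)"
  by simp

lemmas AP_mono = EP_mono[OF const_p_space]
lemmas AP_cong = EP_cong[OF const_p_space]

lemma AP_append:
  fixes f :: "int list \<Rightarrow> 'b::{banach,second_countable_topology}"
  shows "AP n1 (\<lambda>l1. AP n2 (\<lambda>l2. f (l1 @ l2))) = AP (n1 + n2) f"
proof (induction n1 arbitrary: f)
  case (Suc n1)
  show ?case unfolding AP_Suc add_Suc by (simp add: Suc[symmetric])
qed simp

text \<open>The characteristic function of a centred mean jump.\<close>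

definition cf :: "real \<Rightarrow> complex" where
  "cf t = (\<Sum>z\<in>jumps R. p z *\<^sub>R iexp (t * (real_of_int z - v)))"

lemma AP_exp_lin:
  "AP n (\<lambda>l. iexp (lin c l - v * (\<Sum>k<n. c k))) = (\<Prod>k<n. cf (c k))"
proof (induction n arbitrary: c)
  case (Suc n)
  have "AP (Suc n) (\<lambda>l. iexp (lin c l - v * (\<Sum>k<Suc n. c k))) =
     (\<Sum>z\<in>jumps R. p z *\<^sub>R AP n (\<lambda>l. iexp (c 0 * (real_of_int z - v)) *
        iexp (lin (\<lambda>k. c (Suc k)) l - v * (\<Sum>k<n. c (Suc k)))))"
    unfolding AP_Suc by (simp add: sum.lessThan_Suc_shift exp_add[symmetric] algebra_simps del: sum.lessThan_Suc)
  also have "\<dots> = (\<Sum>z\<in>jumps R. (p z *\<^sub>R iexp (c 0 * (real_of_int z - v))) * (\<Prod>k<n. cf (c (Suc k))))"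
    by (simp only: integral_mult_right_zero Suc) simp
  also have "\<dots> = cf (c 0) * (\<Prod>k<n. cf (c (Suc k)))" unfolding cf_def by (simp add: sum_distrib_right)
  finally show ?case by (simp add: prod.lessThan_Suc_shift del: prod.lessThan_Suc)
qed simp

lemma AP_lin: "AP n (lin c) = v * (\<Sum>k<n. c k)"
proof (induction n arbitrary: c)
  case (Suc n)
  define S where "S = v * (\<Sum>k<n. c (Suc k))"
  have "AP (Suc n) (lin c) = (\<Sum>z\<in>jumps R. p z * AP n (\<lambda>l. c 0 * real_of_int z + lin (\<lambda>k. c (Suc k)) l))"
    unfolding AP_Suc by simp
  also have "\<dots> = (\<Sum>z\<in>jumps R. p z * (c 0 * real_of_int z + S))"
    unfolding AP_add Suc S_def by simp
  also have "\<dots> = c 0 * (\<Sum>z\<in>jumps R. p z * real_of_int z) + (\<Sum>z\<in>jumps R. p z) * S"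
    by (simp add: distrib_left sum.distrib sum_distrib_left sum_distrib_right mult_ac)
  finally show ?case unfolding velocity_eq[symmetric] p_sum S_def
    by (simp add: sum.lessThan_Suc_shift distrib_left mult_ac del: sum.lessThan_Suc)
qed simp

lemma AP_lin_square: "AP n (\<lambda>l. (lin c l - v * (\<Sum>k<n. c k))\<^sup>2) = \<sigma>2 * (\<Sum>k<n. (c k)\<^sup>2)"
proof (induction n arbitrary: c)
  case (Suc n)
  let ?c = "\<lambda>k. c (Suc k)"
  define X where "X l = lin ?c l - v * (\<Sum>k<n. ?c k)" for l
  define S where "S = \<sigma>2 * (\<Sum>k<n. (?c k)\<^sup>2)"
  have X: "AP n X = 0" unfolding X_def AP_diff AP_lin by simp
  have X2: "AP n (\<lambda>l. (X l)\<^sup>2) = \<sigma>2 * (\<Sum>k<n. (?c k)\<^sup>2)" unfolding X_def by (rule Suc)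
  have eq: "lin c (z # l) - v * (\<Sum>k<Suc n. c k) = c 0 * (real_of_int z - v) + X l" for z l
    unfolding X_def by (simp add: sum.lessThan_Suc_shift algebra_simps del: sum.lessThan_Suc)
  have "AP n (\<lambda>l. (c 0 * (real_of_int z - v) + X l)\<^sup>2) = (c 0 * (real_of_int z - v))\<^sup>2 + \<sigma>2 * (\<Sum>k<n. (?c k)\<^sup>2)" for z
  proof -
    have "AP n (\<lambda>l. (c 0 * (real_of_int z - v) + X l)\<^sup>2) =
      AP n (\<lambda>l. (c 0 * (real_of_int z - v))\<^sup>2 + (2 * (c 0 * (real_of_int z - v)) * X l + (X l)\<^sup>2))"
      unfolding power2_sum by (simp only: add.assoc add.commute add.left_commute)
    then show ?thesis unfolding AP_add AP_cmult X X2 by simp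
  qed
  then have "AP (Suc n) (\<lambda>l. (lin c l - v * (\<Sum>k<Suc n. c k))\<^sup>2) =
    (\<Sum>z\<in>jumps R. p z * ((c 0 * (real_of_int z - v))\<^sup>2 + S))"
    unfolding AP_Suc eq S_def by simp
  also have "\<dots> = (c 0)\<^sup>2 * (\<Sum>z\<in>jumps R. p z * (real_of_int z - v)\<^sup>2) + (\<Sum>z\<in>jumps R. p z) * S"
    by (simp add: distrib_left sum.distrib sum_distrib_left sum_distrib_right mult_ac power_mult_distrib)
  finally show ?case unfolding jump_var_eq[symmetric] p_sum S_def
    by (simp add: sum.lessThan_Suc_shift distrib_left mult_ac del: sum.lessThan_Suc)
qed simp

lemma cf_norm: "cmod (cf t) \<le> 1"
proof -
  have "cmod (cf t) \<le> (\<Sum>z\<in>jumps R. p z)" unfolding cf_def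
    by (rule order_trans[OF norm_sum]) (simp add: p_nonneg)
  then show ?thesis by (simp add: p_sum)
qed

lemma cf_taylor:
  "\<exists>C\<ge>0. \<forall>t. \<bar>t\<bar> \<le> 1 \<longrightarrow> cmod (cf t - complex_of_real (exp (- (\<sigma>2 * t\<^sup>2 / 2)))) \<le> C * \<bar>t\<bar> ^ 3"
proof -
  define C where "C = (\<Sum>z\<in>jumps R. p z * (\<bar>real_of_int z - v\<bar> ^ 3 / 6)) + \<sigma>2\<^sup>2 / 8"
  have C: "C \<ge> 0" unfolding C_def using p_nonneg by (intro add_nonneg_nonneg sum_nonneg mult_nonneg_nonneg) auto
  have "cmod (cf t - complex_of_real (exp (- (\<sigma>2 * t\<^sup>2 / 2)))) \<le> C * \<bar>t\<bar> ^ 3" if t: "\<bar>t\<bar> \<le> 1" for t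
  proof -
    let ?y = "\<lambda>z. t * (real_of_int z - v)"
    have "(\<Sum>z\<in>jumps R. p z *\<^sub>R (1 + \<i> * complex_of_real (?y z) - (complex_of_real (?y z))\<^sup>2 / 2)) =
       complex_of_real (\<Sum>z\<in>jumps R. p z) + \<i> * complex_of_real (\<Sum>z\<in>jumps R. p z * ?y z) - complex_of_real (\<Sum>z\<in>jumps R. p z * (?y z)\<^sup>2) / 2"
      by (simp add: scaleR_conv_of_real sum.distrib sum_subtractf distrib_left right_diff_distrib sum_distrib_left sum_divide_distrib mult_ac)
    also have "(\<Sum>z\<in>jumps R. p z * ?y z) = t * ((\<Sum>z\<in>jumps R. p z * real_of_int z) - (\<Sum>z\<in>jumps R. p z) * v)"
      by (simp add: sum_distrib_left sum_distrib_right sum_subtractf right_diff_distrib mult_ac)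
    also have "\<dots> = 0" unfolding velocity_eq[symmetric] p_sum by simp
    also have "(\<Sum>z\<in>jumps R. p z * (?y z)\<^sup>2) = t\<^sup>2 * \<sigma>2"
      unfolding jump_var_eq by (simp add: sum_distrib_left power_mult_distrib mult_ac)
    finally have m: "(\<Sum>z\<in>jumps R. p z *\<^sub>R (1 + \<i> * complex_of_real (?y z) - (complex_of_real (?y z))\<^sup>2 / 2)) =
        complex_of_real (1 - \<sigma>2 * t\<^sup>2 / 2)" by (simp add: p_sum mult.commute)
    have "cmod (cf t - complex_of_real (1 - \<sigma>2 * t\<^sup>2 / 2)) =
      cmod (\<Sum>z\<in>jumps R. p z *\<^sub>R (iexp (?y z) - (1 + \<i> * complex_of_real (?y z) - (complex_of_real (?y z))\<^sup>2 / 2)))"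
      unfolding m[symmetric] cf_def by (simp add: sum_subtractf scaleR_diff_right)
    also have "\<dots> \<le> (\<Sum>z\<in>jumps R. p z * (\<bar>?y z\<bar> ^ 3 / 6))"
    proof (rule order_trans[OF norm_sum], rule sum_mono)
      fix z
      show "norm (p z *\<^sub>R (iexp (?y z) - (1 + \<i> * complex_of_real (?y z) - (complex_of_real (?y z))\<^sup>2 / 2))) \<le> p z * (\<bar>?y z\<bar> ^ 3 / 6)"
        unfolding norm_scaleR abs_of_nonneg[OF p_nonneg] by (rule mult_left_mono[OF iexp_taylor3 p_nonneg])
    qed
    also have "\<dots> = (\<Sum>z\<in>jumps R. p z * (\<bar>real_of_int z - v\<bar> ^ 3 / 6)) * \<bar>t\<bar> ^ 3"
      unfolding sum_distrib_right by (intro sum.cong refl) (simp add: abs_mult power_mult_distrib)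
    finally have 1: "cmod (cf t - complex_of_real (1 - \<sigma>2 * t\<^sup>2 / 2)) \<le> (\<Sum>z\<in>jumps R. p z * (\<bar>real_of_int z - v\<bar> ^ 3 / 6)) * \<bar>t\<bar> ^ 3" .
    have "cmod (complex_of_real (exp (- (\<sigma>2 * t\<^sup>2 / 2))) - complex_of_real (1 - \<sigma>2 * t\<^sup>2 / 2)) = \<bar>exp (- (\<sigma>2 * t\<^sup>2 / 2)) - (1 - \<sigma>2 * t\<^sup>2 / 2)\<bar>"
      by (metis norm_of_real of_real_diff real_norm_def)
    also have "\<dots> \<le> (\<sigma>2 * t\<^sup>2 / 2)\<^sup>2 / 2" by (rule exp_minus_taylor) (simp add: jump_var_nonneg)
    also have "\<dots> = \<sigma>2\<^sup>2 / 8 * \<bar>t\<bar> ^ 4" by (simp add: power_mult_distrib power_divide)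
    also have "\<dots> \<le> \<sigma>2\<^sup>2 / 8 * \<bar>t\<bar> ^ 3" using t by (intro mult_left_mono power_decreasing) auto
    finally have 2: "cmod (complex_of_real (exp (- (\<sigma>2 * t\<^sup>2 / 2))) - complex_of_real (1 - \<sigma>2 * t\<^sup>2 / 2)) \<le> \<sigma>2\<^sup>2 / 8 * \<bar>t\<bar> ^ 3" .
    have "cmod (cf t - complex_of_real (exp (- (\<sigma>2 * t\<^sup>2 / 2)))) \<le>
      cmod (cf t - complex_of_real (1 - \<sigma>2 * t\<^sup>2 / 2)) + cmod (complex_of_real (exp (- (\<sigma>2 * t\<^sup>2 / 2))) - complex_of_real (1 - \<sigma>2 * t\<^sup>2 / 2))"
      using norm_triangle_ineq4[of "cf t - complex_of_real (1 - \<sigma>2 * t\<^sup>2 / 2)"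
        "complex_of_real (exp (- (\<sigma>2 * t\<^sup>2 / 2))) - complex_of_real (1 - \<sigma>2 * t\<^sup>2 / 2)"] by simp
    then show ?thesis using 1 2 unfolding C_def by (simp add: distrib_right)
  qed
  then show ?thesis using C by blast
qed

text \<open>Lindeberg's product comparison. For coefficients in \<open>{-1, 0, 1}\<close> one has \<open>|c|\<^sup>3 = c\<^sup>2\<close>, so the sum of the
third-order errors is of order \<open>n \<cdot> n\<^sup>-\<^sup>3\<^sup>/\<^sup>2\<close>.\<close>

lemma char_lin_tendsto:
  fixes c :: "nat \<Rightarrow> nat \<Rightarrow> real" and N :: "nat \<Rightarrow> nat"
  assumes c: "\<And>n k. c n k \<in> {-1, 0, 1}"
    and lim: "(\<lambda>n. (\<Sum>k<N n. (c n k)\<^sup>2) / n) \<longlonglongrightarrow> \<tau>"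
  shows "(\<lambda>n. AP (N n) (\<lambda>l. iexp (t * ((lin (c n) l - v * (\<Sum>k<N n. c n k)) / sqrt n))))
     \<longlonglongrightarrow> exp (- complex_of_real (\<sigma>2 * \<tau> * t\<^sup>2 / 2))"
proof -
  obtain C where C: "C \<ge> 0" "\<And>t. \<bar>t\<bar> \<le> 1 \<Longrightarrow> cmod (cf t - complex_of_real (exp (- (\<sigma>2 * t\<^sup>2 / 2)))) \<le> C * \<bar>t\<bar> ^ 3"
    using cf_taylor by blast
  define S where "S n = (\<Sum>k<N n. (c n k)\<^sup>2)" for n
  have S0: "S n \<ge> 0" for n unfolding S_def by (simp add: sum_nonneg)
  define g where "g n = (\<Prod>k<N n. complex_of_real (exp (- (\<sigma>2 * (t / sqrt n * c n k)\<^sup>2 / 2))))" for n :: nat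
  have g: "g n = complex_of_real (exp (- (\<sigma>2 * t\<^sup>2 / 2 * (S n / n))))" for n
  proof -
    have "(\<Sum>k<N n. - (\<sigma>2 * (t / sqrt n * c n k)\<^sup>2 / 2)) = - (\<sigma>2 * t\<^sup>2 / 2 * (S n / n))"
      unfolding S_def by (simp add: sum_negf sum_distrib_left sum_divide_distrib power_mult_distrib power_divide mult_ac)
    then have "g n = complex_of_real (exp (\<Sum>k<N n. - (\<sigma>2 * (t / sqrt n * c n k)\<^sup>2 / 2)))"
      unfolding g_def by (subst exp_sum) auto
    then show ?thesis using \<open>(\<Sum>k<N n. - (\<sigma>2 * (t / sqrt n * c n k)\<^sup>2 / 2)) = - (\<sigma>2 * t\<^sup>2 / 2 * (S n / n))\<close> by simp
  qed
  define f where "f n = AP (N n) (\<lambda>l. iexp (t * ((lin (c n) l - v * (\<Sum>k<N n. c n k)) / sqrt n)))" for n :: nat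
  have f: "f n = (\<Prod>k<N n. cf (t / sqrt n * c n k))" for n
  proof -
    have "t * ((lin (c n) l - v * (\<Sum>k<N n. c n k)) / sqrt n) = lin (\<lambda>k. t / sqrt n * c n k) l - v * (\<Sum>k<N n. t / sqrt n * c n k)" for l
      unfolding lin_cmult sum_distrib_left[symmetric] by (simp add: right_diff_distrib diff_divide_distrib)
    then show ?thesis unfolding f_def using AP_exp_lin[of "N n" "\<lambda>k. t / sqrt n * c n k"] by simp
  qed
  have lim_g: "g \<longlonglongrightarrow> complex_of_real (exp (- (\<sigma>2 * t\<^sup>2 / 2 * \<tau>)))"
    unfolding g using lim unfolding S_def[symmetric] by (intro tendsto_intros)
  have "(\<lambda>n. f n - g n) \<longlonglongrightarrow> 0"
  proof (rule tendsto_norm_zero_cancel, rule tendsto_sandwich[of "\<lambda>_. 0"])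
    show "\<forall>\<^sub>F n in sequentially. norm (f n - g n) \<le> C * \<bar>t\<bar> ^ 3 * (S n / n) * (1 / sqrt n)"
      using eventually_ge_at_top[of "nat \<lceil>t\<^sup>2\<rceil> + 1"]
    proof eventually_elim
      case (elim n)
      then have n: "n > 0" "t\<^sup>2 \<le> n" by linarith+
      then have ts: "\<bar>t / sqrt n\<bar> \<le> 1" by (simp add: abs_le_square_iff divide_le_eq real_le_rsqrt)
      have "norm (f n - g n) \<le> (\<Sum>k<N n. cmod (cf (t / sqrt n * c n k) - complex_of_real (exp (- (\<sigma>2 * (t / sqrt n * c n k)\<^sup>2 / 2)))))"
        unfolding f g_def by (rule norm_prod_diff) (auto simp: cf_norm jump_var_nonneg)
      also have "\<dots> \<le> (\<Sum>k<N n. C * (\<bar>t\<bar> ^ 3 / (n * sqrt n)) * (c n k)\<^sup>2)"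
      proof (rule sum_mono)
        fix k assume "k \<in> {..<N n}"
        have ck: "\<bar>c n k\<bar> \<le> 1" "\<bar>c n k\<bar> ^ 3 = (c n k)\<^sup>2" using c[of n k] by auto
        have "\<bar>t / sqrt n * c n k\<bar> \<le> 1" using mult_mono[OF ts ck(1)] by (simp add: abs_mult)
        from C(2)[OF this]
        have "cmod (cf (t / sqrt n * c n k) - complex_of_real (exp (- (\<sigma>2 * (t / sqrt n * c n k)\<^sup>2 / 2)))) \<le> C * \<bar>t / sqrt n * c n k\<bar> ^ 3" .
        also have "\<dots> = C * (\<bar>t\<bar> ^ 3 / (n * sqrt n)) * (c n k)\<^sup>2"
        proof -
          have s3: "(sqrt (real n)) ^ 3 = n * sqrt n" by (simp add: power3_eq_cube)
          have "\<bar>t / sqrt n * c n k\<bar> ^ 3 = \<bar>t\<bar> ^ 3 / (sqrt n) ^ 3 * \<bar>c n k\<bar> ^ 3"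
            by (simp add: abs_mult power_mult_distrib power_divide)
          then show ?thesis unfolding ck(2) s3 by (simp only: mult.assoc)
        qed
        finally show "cmod (cf (t / sqrt n * c n k) - complex_of_real (exp (- (\<sigma>2 * (t / sqrt n * c n k)\<^sup>2 / 2)))) \<le> C * (\<bar>t\<bar> ^ 3 / (n * sqrt n)) * (c n k)\<^sup>2" .
      qed
      also have "\<dots> = C * \<bar>t\<bar> ^ 3 * (S n / n) * (1 / sqrt n)"
        unfolding S_def sum_distrib_left[symmetric] by simp
      finally show ?case .
    qed
    have "(\<lambda>n. 1 / sqrt (real n)) \<longlonglongrightarrow> 0" by real_asymp
    then have "(\<lambda>n. C * \<bar>t\<bar> ^ 3 * (S n / n) * (1 / sqrt n)) \<longlonglongrightarrow> C * \<bar>t\<bar> ^ 3 * \<tau> * 0"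
      using lim unfolding S_def[symmetric] by (intro tendsto_intros)
    then show "(\<lambda>n. C * \<bar>t\<bar> ^ 3 * (S n / n) * (1 / sqrt n)) \<longlonglongrightarrow> 0" by simp
  qed auto
  from tendsto_add[OF this lim_g] have "f \<longlonglongrightarrow> complex_of_real (exp (- (\<sigma>2 * t\<^sup>2 / 2 * \<tau>)))" by simp
  then show ?thesis unfolding f_def by (simp add: exp_of_real[symmetric] mult_ac)
qed

text \<open>The coefficients select the time intervals during which the functional records a step; \<open>\<tau>\<close> is their
total rescaled length.\<close>

theorem plus_part_lin_tendsto:
  fixes c :: "nat \<Rightarrow> nat \<Rightarrow> real" and N :: "nat \<Rightarrow> nat"
  assumes c: "\<And>n k. c n k \<in> {-1, 0, 1}"
    and lim: "(\<lambda>n. (\<Sum>k<N n. (c n k)\<^sup>2) / n) \<longlonglongrightarrow> \<tau>"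
    and d: "d \<longlonglongrightarrow> d'"
  shows "(\<lambda>n. AP (N n) (\<lambda>l. max ((lin (c n) l - v * (\<Sum>k<N n. c n k)) / sqrt n - d n) 0)) \<longlonglongrightarrow> gPsi (\<sigma>2 * \<tau>) d'"
proof -
  define X where "X n l = (lin (c n) l - v * (\<Sum>k<N n. c n k)) / sqrt n" for n l
  define M where "M n = distr (path_pmf (\<lambda>_. p) (N n) 0 0) borel (X n)" for n
  have Xm: "X n \<in> borel_measurable (measure_pmf q)" for n q by simp
  have M: "real_distribution (M n)" for n
    unfolding M_def by (rule prob_space.real_distribution_distr[OF prob_space_measure_pmf]) simp
  have "(\<integral>x. x\<^sup>2 \<partial>M n) = \<sigma>2 * ((\<Sum>k<N n. (c n k)\<^sup>2) / n)" for n
  proof -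
    have "(\<integral>x. x\<^sup>2 \<partial>M n) = AP (N n) (\<lambda>l. (X n l)\<^sup>2)" unfolding M_def by (rule integral_distr) auto
    also have "\<dots> = AP (N n) (\<lambda>l. (1 / n) * (lin (c n) l - v * (\<Sum>k<N n. c n k))\<^sup>2)"
      unfolding X_def by (simp add: power_divide)
    finally show ?thesis unfolding AP_cmult AP_lin_square by simp
  qed
  moreover obtain B where "\<And>n. (\<Sum>k<N n. (c n k)\<^sup>2) / n \<le> B"
  proof -
    obtain K where "\<And>n. \<bar>(\<Sum>k<N n. (c n k)\<^sup>2) / real n\<bar> \<le> K"
      using convergent_imp_Bseq[OF convergentI[OF lim]] unfolding Bseq_def real_norm_def by blast
    from that[OF order_trans[OF abs_ge_self this]] show ?thesis .
  qed
  ultimately have sq: "(\<integral>x. x\<^sup>2 \<partial>M n) \<le> \<sigma>2 * B" for n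
    using mult_left_mono[OF _ jump_var_nonneg] by metis
  have sqi: "integrable (M n) (\<lambda>x. x\<^sup>2)" for n
    unfolding M_def by (subst integrable_distr_eq) (auto intro: integrable_path_pmf[OF const_p_space])
  have ch: "(\<lambda>n. char (M n) t) \<longlonglongrightarrow> exp (- complex_of_real (\<sigma>2 * \<tau> * t\<^sup>2 / 2))" for t
  proof -
    have "char (M n) t = AP (N n) (\<lambda>l. iexp (t * X n l))" for n
      unfolding M_def char_def by (rule integral_distr) auto
    then show ?thesis using char_lin_tendsto[OF c lim, of t] unfolding X_def by simp
  qed
  have tau: "0 \<le> \<tau>" by (rule LIMSEQ_le_const[OF lim]) (auto intro!: exI[of _ 0] divide_nonneg_nonneg sum_nonneg)
  have "(\<lambda>n. \<integral>x. max (x - d n) 0 \<partial>M n) \<longlonglongrightarrow> gPsi (\<sigma>2 * \<tau>) d'"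
    by (rule plus_part_tendsto_gPsi[OF M _ ch sqi sq d]) (simp add: tau jump_var_nonneg)
  moreover have "(\<integral>x. max (x - d n) 0 \<partial>M n) = AP (N n) (\<lambda>l. max (X n l - d n) 0)" for n
    unfolding M_def by (rule integral_distr) auto
  ultimately show ?thesis unfolding X_def by simp
qed

end

section \<open>Counting crossings over all starting sites\<close>

text \<open>The contribution to the current through the level \<open>a\<close> of a particle that starts at \<open>x\<close> and is at \<open>y\<close>: it
is \<open>1\<close> if \<open>x > 0\<close> and \<open>y \<le> a\<close>, it is \<open>-1\<close> if \<open>x \<le> 0\<close> and \<open>y > a\<close>, and it vanishes otherwise.\<close>

definition side :: "int \<Rightarrow> int \<Rightarrow> int \<Rightarrow> real" where
  "side a x y = of_bool (0 < x) - of_bool (a < y)"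

lemma sum_of_bool_greater:
  fixes M N :: int assumes "- N \<le> M" "M \<le> N" shows "(\<Sum>x\<in>{- N..N}. of_bool (M < x)) = real_of_int (N - M)"
proof -
  have "(\<Sum>x\<in>{- N..N}. of_bool (M < x)) = (\<Sum>x\<in>{M<..N}. (1 :: real))"
    using assms by (intro sum.mono_neutral_cong_right) auto
  then show ?thesis using assms by simp
qed

text \<open>With \<open>A = a - u\<close> and \<open>B = b - w\<close>, each factor is a difference of indicators of half-lines in \<open>x\<close>, and
products of such indicators are indicators of half-lines again, starting from \<open>0\<close>, \<open>max 0 A\<close>, \<open>max 0 B\<close> and
\<open>max A B\<close>. This identity is the source of the three terms in \<open>\<Gamma>\<^sub>2\<close>.\<close>

lemma sum_side_product:
  assumes "\<bar>a - u\<bar> \<le> N" "\<bar>b - w\<bar> \<le> N"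
  shows "(\<Sum>x\<in>{- N..N}. side a x (x + u) * side b x (x + w)) =
     max (real_of_int (a - u)) 0 + max (real_of_int (w - b)) 0 - max (real_of_int (a - u) - real_of_int (b - w)) 0"
proof -
  define A B where "A = a - u" and "B = b - w"
  have AB: "\<bar>A\<bar> \<le> N" "\<bar>B\<bar> \<le> N" using assms by (auto simp: A_def B_def)
  have "side a x (x + u) * side b x (x + w) =
      of_bool (0 < x) - of_bool (max 0 A < x) - of_bool (max 0 B < x) + of_bool (max A B < x)" for x
    by (auto simp: side_def A_def B_def)
  then have "(\<Sum>x\<in>{- N..N}. side a x (x + u) * side b x (x + w)) =
    (\<Sum>x\<in>{- N..N}. of_bool (0 < x)) - (\<Sum>x\<in>{- N..N}. of_bool (max 0 A < x)) - (\<Sum>x\<in>{- N..N}. of_bool (max 0 B < x))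
      + (\<Sum>x\<in>{- N..N}. of_bool (max A B < x))"
    by (simp add: sum.distrib sum_subtractf)
  also have "\<dots> = real_of_int (N - 0) - real_of_int (N - max 0 A) - real_of_int (N - max 0 B) + real_of_int (N - max A B)"
    using AB by (subst (1 2 3 4) sum_of_bool_greater) auto
  also have "\<dots> = max (real_of_int A) 0 + max (real_of_int (- B)) 0 - max (real_of_int A - real_of_int B) 0"
    by (simp add: max_def)
  finally show ?thesis by (simp add: A_def B_def)
qed

lemma abs_side_le_1: "\<bar>side a x y\<bar> \<le> 1" by (simp add: side_def)

lemma side_square: "side a x y * side a x y = \<bar>side a x y\<bar>" by (simp add: side_def)

lemma sum_abs_side:
  assumes "\<bar>a - u\<bar> \<le> N" shows "(\<Sum>x\<in>{- N..N}. \<bar>side a x (x + u)\<bar>) = \<bar>real_of_int (a - u)\<bar>"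
  using sum_side_product[OF assms assms] unfolding side_square by (simp add: max_def abs_if)

lemma side_nonzero: "side a x (x + u) \<noteq> 0 \<Longrightarrow> \<bar>x\<bar> \<le> \<bar>a - u\<bar>"
  by (auto simp: side_def of_bool_def split: if_splits)

text \<open>If \<open>side\<close> does not vanish, then \<open>|x| \<le> |a - u|\<close>, so beyond \<open>H\<close> the sum is zero unless \<open>|a - u| > H\<close>.\<close>

lemma sum_abs_side_tail:
  assumes "\<bar>a - u\<bar> \<le> N" "H > 0"
  shows "(\<Sum>x\<in>{- N..N}. if H < \<bar>real_of_int x\<bar> then \<bar>side a x (x + u)\<bar> else 0) \<le> (real_of_int (a - u))\<^sup>2 / H"
proof -
  have "(if H < \<bar>real_of_int x\<bar> then \<bar>side a x (x + u)\<bar> else 0) \<le> \<bar>side a x (x + u)\<bar> * (\<bar>real_of_int (a - u)\<bar> / H)" for x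
  proof (cases "H < \<bar>real_of_int x\<bar> \<and> side a x (x + u) \<noteq> 0")
    case True
    then have "\<bar>real_of_int x\<bar> \<le> \<bar>real_of_int (a - u)\<bar>" using side_nonzero by (metis of_int_abs of_int_le_iff)
    then have "1 \<le> \<bar>real_of_int (a - u)\<bar> / H" using True \<open>H > 0\<close> by simp
    then show ?thesis using True mult_left_mono[of 1 "\<bar>real_of_int (a - u)\<bar> / H" "\<bar>side a x (x + u)\<bar>"] by simp
  qed (use \<open>H > 0\<close> in auto)
  then have "(\<Sum>x\<in>{- N..N}. if H < \<bar>real_of_int x\<bar> then \<bar>side a x (x + u)\<bar> else 0) \<le>
     (\<Sum>x\<in>{- N..N}. \<bar>side a x (x + u)\<bar> * (\<bar>real_of_int (a - u)\<bar> / H))" by (rule sum_mono)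
  also have "\<dots> = \<bar>real_of_int (a - u)\<bar> * (\<bar>real_of_int (a - u)\<bar> / H)"
    unfolding sum_distrib_right[symmetric] sum_abs_side[OF assms(1)] ..
  finally show ?thesis by (simp add: power2_eq_square)
qed

text \<open>Only \<open>h\<close> many starting sites put the end point into a given interval of length \<open>h\<close>.\<close>

lemma sum_window_le:
  fixes a u :: int
  assumes "0 \<le> h" "finite A"
  shows "(\<Sum>x\<in>A. of_bool (a < x + u \<and> real_of_int (x + u) < real_of_int a + h)) \<le> h"
proof -
  have "(\<Sum>x\<in>A. of_bool (a < x + u \<and> real_of_int (x + u) < real_of_int a + h)) =
     real (card {x\<in>A. a < x + u \<and> real_of_int (x + u) < real_of_int a + h})"
    using assms(2) by (simp add: sum.inter_filter[symmetric] of_bool_def)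
  also have "\<dots> \<le> real (card {a - u + 1..a - u + \<lfloor>h\<rfloor>})"
  proof (intro of_nat_mono card_mono subsetI)
    fix x assume "x \<in> {x\<in>A. a < x + u \<and> real_of_int (x + u) < real_of_int a + h}"
    then have "x + u - a \<le> \<lfloor>h\<rfloor>" "a < x + u" by (auto simp: le_floor_iff)
    then show "x \<in> {a - u + 1..a - u + \<lfloor>h\<rfloor>}" by auto
  qed simp
  also have "\<dots> = real_of_int \<lfloor>h\<rfloor>" using assms(1) by simp
  finally show ?thesis by linarith
qed

section \<open>Limits of crossing counts for the averaged walk\<close>

text \<open>The weights \<open>\<theta>\<close> are part of the locale, so that the second assertion of the main result uses one
interpretation for each \<open>\<theta>\<close>.\<close>

locale space_time_points = iid_environment P R for P R +
  fixes t r \<theta> :: "real ^ 'n :: finite"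
  assumes A2: "A2 P" and t_pos: "\<And>i. 0 < t $ i"
begin

definition steps :: "nat \<Rightarrow> 'n \<Rightarrow> nat" where "steps n i = nat \<lfloor>real n * t $ i\<rfloor>"
definition level :: "nat \<Rightarrow> 'n \<Rightarrow> int" where "level n i = \<lfloor>real n * v * t $ i\<rfloor> + \<lfloor>r $ i * sqrt (real n)\<rfloor>"
text \<open>One path length for all the time points: the sum is a simple upper bound for each of them.\<close>

definition horizon :: "nat \<Rightarrow> nat" where "horizon n = (\<Sum>i\<in>UNIV. steps n i)"
definition T :: real where "T = (\<Sum>i\<in>UNIV. t $ i)"
definition \<rho> :: real where "\<rho> = (\<Sum>i\<in>UNIV. \<bar>r $ i\<bar>)"
text \<open>Particles that start outside of \<open>{-n radius..n radius}\<close> cannot reach the levels from the other side.\<close>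

definition radius :: nat where "radius = nat \<lceil>real R * T + \<bar>v\<bar> * T + \<rho> + 2\<rceil>"
definition window :: "nat \<Rightarrow> int set" where "window n = {- int (n * radius)..int (n * radius)}"
abbreviation pos :: "nat \<Rightarrow> 'n \<Rightarrow> int list \<Rightarrow> int" where "pos n i l \<equiv> sum_list (take (steps n i) l)"
abbreviation cross :: "nat \<Rightarrow> 'n \<Rightarrow> int \<Rightarrow> int list \<Rightarrow> real" where "cross n i x l \<equiv> side (level n i) x (x + pos n i l)"
abbreviation HP :: "nat \<Rightarrow> (int list \<Rightarrow> real) \<Rightarrow> real" where "HP n \<equiv> AP (horizon n)"

lemma t_le_T: "t $ i \<le> T" unfolding T_def using t_pos by (intro member_le_sum) (auto intro: less_imp_le)
lemma r_le_\<rho>: "\<bar>r $ i\<bar> \<le> \<rho>" unfolding \<rho>_def by (intro member_le_sum) auto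
lemma T_nonneg: "0 \<le> T" unfolding T_def using t_pos by (intro sum_nonneg) (auto intro: less_imp_le)
lemma \<rho>_nonneg: "0 \<le> \<rho>" unfolding \<rho>_def by (intro sum_nonneg) auto

lemma steps_le_horizon: "steps n i \<le> horizon n" unfolding horizon_def by (intro member_le_sum) auto

lemma steps_bounds: "real (steps n i) \<le> real n * t $ i" "real n * t $ i < real (steps n i) + 1"
proof -
  have "0 \<le> real n * t $ i" using t_pos[of i] by simp
  then show "real (steps n i) \<le> real n * t $ i" "real n * t $ i < real (steps n i) + 1"
    unfolding steps_def by linarith+
qed

lemma horizon_le: "real (horizon n) \<le> real n * T"
  unfolding horizon_def T_def of_nat_sum sum_distrib_left by (intro sum_mono steps_bounds)

lemma level_bounds: "\<bar>real_of_int (level n i) - v * real (steps n i) - r $ i * sqrt n\<bar> \<le> \<bar>v\<bar> + 2"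
proof -
  have "\<bar>real n * v * t $ i - v * real (steps n i)\<bar> = \<bar>v\<bar> * \<bar>real n * t $ i - real (steps n i)\<bar>"
    by (simp add: abs_mult[symmetric] algebra_simps)
  also have "\<dots> \<le> \<bar>v\<bar> * 1" using steps_bounds[of n i] by (intro mult_left_mono) auto
  finally have "\<bar>real n * v * t $ i - v * real (steps n i)\<bar> \<le> \<bar>v\<bar>" by simp
  then show ?thesis unfolding level_def by (simp only: of_int_add) linarith
qed

lemma pos_bound:
  assumes "set l \<subseteq> jumps R" "length l = horizon n" shows "\<bar>pos n i l\<bar> \<le> int (R * steps n i)"
proof -
  have "\<bar>sum_list l\<bar> \<le> int R * int (length l)" if "set l \<subseteq> jumps R" for l
    using that by (induction l) (auto simp: algebra_simps)
  from this[of "take (steps n i) l"] show ?thesis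
    using assms steps_le_horizon[of n i] set_take_subset[of "steps n i" l] by auto
qed

lemma level_pos_bound:
  assumes "\<bar>y\<bar> \<le> int (R * steps n i)"
  shows "\<bar>level n i - y\<bar> \<le> int (n * radius)"
proof (cases "n = 0")
  case True
  then show ?thesis using assms by (simp add: level_def steps_def)
next
  case False
  then have n: "1 \<le> real n" by simp
  have sn: "sqrt n \<le> n" using n by (intro real_le_lsqrt) (auto simp: power2_eq_square)
  have nT: "real n * t $ i \<le> real n * T" using t_le_T by (intro mult_left_mono) auto
  have 1: "\<bar>real_of_int y\<bar> \<le> real R * (real n * T)"
  proof -
    have "real_of_int \<bar>y\<bar> \<le> real R * real (steps n i)" using assms by (metis of_int_le_iff of_int_of_nat_eq of_nat_mult)
    also have "\<dots> \<le> real R * (real n * T)" using steps_bounds(1)[of n i] nT by (intro mult_left_mono) auto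
    finally show ?thesis by simp
  qed
  have 2: "\<bar>real n * v * t $ i\<bar> \<le> \<bar>v\<bar> * (real n * T)"
  proof -
    have "\<bar>real n * v * t $ i\<bar> = \<bar>v\<bar> * (real n * t $ i)" using t_pos[of i] by (simp add: abs_mult)
    then show ?thesis using nT by (simp add: mult_left_mono)
  qed
  have 3: "\<bar>r $ i * sqrt n\<bar> \<le> \<rho> * n"
    unfolding abs_mult using r_le_\<rho>[of i] sn \<rho>_nonneg by (intro mult_mono) auto
  have "\<bar>real_of_int (level n i - y)\<bar> \<le> \<bar>v\<bar> * (real n * T) + \<rho> * n + 2 + real R * (real n * T)"
    using 1 2 3 unfolding level_def by (simp only: of_int_add of_int_diff) linarith
  also have "\<dots> \<le> real n * (real R * T + \<bar>v\<bar> * T + \<rho> + 2)" using n by (simp add: algebra_simps)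
  also have "\<dots> \<le> real n * real radius"
    unfolding radius_def by (intro mult_left_mono) linarith+
  finally show ?thesis by (metis of_int_abs of_int_le_iff of_int_of_nat_eq of_nat_mult)
qed

lemma path_level_bound:
  "set l \<subseteq> jumps R \<Longrightarrow> length l = horizon n \<Longrightarrow> \<bar>level n i - pos n i l\<bar> \<le> int (n * radius)"
  by (rule level_pos_bound) (rule pos_bound)

lemma steps_over_n: "(\<lambda>n. real (steps n i) / n) \<longlonglongrightarrow> t $ i"
proof (rule tendsto_sandwich[of "\<lambda>n. t $ i - 1 / real n" _ _ "\<lambda>_. t $ i"])
  show "\<forall>\<^sub>F n in sequentially. t $ i - 1 / real n \<le> real (steps n i) / n"
    using eventually_gt_at_top[of 0]
  proof eventually_elim
    case (elim n)
    then have "t $ i - 1 / real n = (real n * t $ i - 1) / n" by (simp add: field_simps)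
    also have "\<dots> \<le> real (steps n i) / n" using steps_bounds(2)[of n i] by (intro divide_right_mono) auto
    finally show ?case .
  qed
  show "\<forall>\<^sub>F n in sequentially. real (steps n i) / n \<le> t $ i"
    using eventually_gt_at_top[of 0]
    by eventually_elim (use steps_bounds in \<open>simp add: field_simps\<close>)
  have "(\<lambda>n. 1 / real n) \<longlonglongrightarrow> 0" by real_asymp
  then show "(\<lambda>n. t $ i - 1 / real n) \<longlonglongrightarrow> t $ i" using tendsto_diff[OF tendsto_const] by fastforce
qed simp

lemma level_scaled: "(\<lambda>n. (real_of_int (level n i) - v * real (steps n i)) / sqrt n) \<longlonglongrightarrow> r $ i"
proof (rule LIM_zero_cancel, rule tendsto_rabs_zero_cancel, rule tendsto_sandwich[of "\<lambda>_. 0"])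
  show "\<forall>\<^sub>F n in sequentially. \<bar>(real_of_int (level n i) - v * real (steps n i)) / sqrt n - r $ i\<bar> \<le> (\<bar>v\<bar> + 2) * (1 / sqrt n)"
    using eventually_gt_at_top[of 0]
  proof eventually_elim
    case (elim n)
    then have "(real_of_int (level n i) - v * real (steps n i)) / sqrt n - r $ i = (real_of_int (level n i) - v * real (steps n i) - r $ i * sqrt n) / sqrt n"
      by (simp add: field_simps)
    then show ?case using level_bounds[of n i] elim by (simp add: abs_divide divide_right_mono)
  qed
  have "(\<lambda>n. 1 / sqrt (real n)) \<longlonglongrightarrow> 0" by real_asymp
  then show "(\<lambda>n. (\<bar>v\<bar> + 2) * (1 / sqrt n)) \<longlonglongrightarrow> 0" by (rule tendsto_mult_right_zero)
qed auto

lemma sum_lt: "k \<le> L \<Longrightarrow> (\<Sum>j<L. of_bool (j < k)) = real k"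
proof -
  assume "k \<le> L"
  then have "(\<Sum>j<L. of_bool (j < k)) = (\<Sum>j<k. (1::real))" by (intro sum.mono_neutral_cong_right) auto
  then show ?thesis by simp
qed

lemma sum_lt_sq: "k \<le> L \<Longrightarrow> (\<Sum>j<L. (of_bool (j < k))\<^sup>2) = real k"
proof -
  assume k: "k \<le> L"
  have "(of_bool b :: real)\<^sup>2 = of_bool b" for b by (cases b) auto
  then show ?thesis using sum_lt[OF k] by simp
qed

lemma plus_lin_scaled:
  assumes c: "\<And>n k. c n k \<in> {-1, 0, 1}"
    and lim: "(\<lambda>n. (\<Sum>k<N n. (c n k)\<^sup>2) / n) \<longlonglongrightarrow> \<tau>"
    and e: "(\<lambda>n. (e n - v * (\<Sum>k<N n. c n k)) / sqrt n) \<longlonglongrightarrow> d"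
  shows "(\<lambda>n. AP (N n) (\<lambda>l. max (lin (c n) l - e n) 0) / sqrt n) \<longlonglongrightarrow> gPsi (\<sigma>2 * \<tau>) d"
proof -
  have "max ((lin (c n) l - v * (\<Sum>k<N n. c n k)) / sqrt n - (e n - v * (\<Sum>k<N n. c n k)) / sqrt n) 0 = max (lin (c n) l - e n) 0 / sqrt n" for n l
    unfolding diff_divide_distrib[symmetric] by (simp add: max_def divide_le_0_iff)
  then show ?thesis using plus_part_lin_tendsto[OF c lim e] by simp
qed

lemma real_pos_lin:
  "length l = horizon n \<Longrightarrow> real_of_int (pos n i l) = lin (\<lambda>j. of_bool (j < steps n i)) l"
  by (rule lin_of_bool[symmetric]) (simp add: steps_le_horizon)

lemma plus_below: "(\<lambda>n. HP n (\<lambda>l. max (real_of_int (level n i - pos n i l)) 0) / sqrt n) \<longlonglongrightarrow> gPsi (\<sigma>2 * t $ i) (- r $ i)"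
proof -
  let ?c = "\<lambda>n j. - 1 * of_bool (j < steps n i) :: real"
  have s: "(\<Sum>k<horizon n. ?c n k) = - real (steps n i)" "(\<Sum>k<horizon n. (?c n k)\<^sup>2) = real (steps n i)" for n
    using sum_lt[OF steps_le_horizon[of n i]] sum_lt_sq[OF steps_le_horizon[of n i]] by (simp_all add: sum_negf)
  have "(\<lambda>n. HP n (\<lambda>l. max (lin (?c n) l - (- real_of_int (level n i))) 0) / sqrt n) \<longlonglongrightarrow> gPsi (\<sigma>2 * t $ i) (- r $ i)"
  proof (rule plus_lin_scaled)
    show "(\<lambda>n. (- real_of_int (level n i) - v * (\<Sum>k<horizon n. ?c n k)) / sqrt n) \<longlonglongrightarrow> - r $ i"
      unfolding s using tendsto_minus[OF level_scaled[of i]] by (simp add: minus_divide_left)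
  qed (unfold s, auto intro: steps_over_n)
  moreover have "HP n (\<lambda>l. max (lin (?c n) l - (- real_of_int (level n i))) 0) = HP n (\<lambda>l. max (real_of_int (level n i - pos n i l)) 0)" for n
  proof (rule AP_cong)
    fix l :: "int list" assume l: "length l = horizon n"
    have "lin (?c n) l = - real_of_int (pos n i l)" unfolding lin_cmult by (simp add: real_pos_lin[OF l])
    then show "max (lin (?c n) l - (- real_of_int (level n i))) 0 = max (real_of_int (level n i - pos n i l)) 0"
      by (simp only: of_int_diff minus_minus diff_minus_eq_add add.commute uminus_add_conv_diff)
  qed
  ultimately show ?thesis by simp
qed

lemma plus_above: "(\<lambda>n. HP n (\<lambda>l. max (real_of_int (pos n i l - level n i)) 0) / sqrt n) \<longlonglongrightarrow> gPsi (\<sigma>2 * t $ i) (r $ i)"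
proof -
  let ?c = "\<lambda>n j. of_bool (j < steps n i) :: real"
  have s: "(\<Sum>k<horizon n. ?c n k) = real (steps n i)" "(\<Sum>k<horizon n. (?c n k)\<^sup>2) = real (steps n i)" for n
    by (rule sum_lt[OF steps_le_horizon], rule sum_lt_sq[OF steps_le_horizon])
  have "(\<lambda>n. HP n (\<lambda>l. max (lin (?c n) l - real_of_int (level n i)) 0) / sqrt n) \<longlonglongrightarrow> gPsi (\<sigma>2 * t $ i) (r $ i)"
    by (rule plus_lin_scaled) (unfold s, auto intro: steps_over_n level_scaled)
  moreover have "HP n (\<lambda>l. max (lin (?c n) l - real_of_int (level n i)) 0) = HP n (\<lambda>l. max (real_of_int (pos n i l - level n i)) 0)" for n
    by (rule AP_cong) (simp add: real_pos_lin)
  ultimately show ?thesis by simp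
qed

lemma level_diff_scaled:
  "(\<lambda>n. (real_of_int (level n j) - real_of_int (level n i) - v * (real (steps n j) - real (steps n i))) / sqrt n) \<longlonglongrightarrow> r $ j - r $ i"
proof -
  have "(real_of_int (level n j) - real_of_int (level n i) - v * (real (steps n j) - real (steps n i))) / sqrt n =
    (real_of_int (level n j) - v * real (steps n j)) / sqrt n - (real_of_int (level n i) - v * real (steps n i)) / sqrt n" for n
    unfolding diff_divide_distrib[symmetric] by (rule arg_cong[where f = "\<lambda>x. x / sqrt n"]) (simp add: algebra_simps)
  then show ?thesis using tendsto_diff[OF level_scaled[of j] level_scaled[of i]] by simp
qed

text \<open>Along one walk the increments up to the earlier of the two times cancel, which leaves the time \<open>|t\<^sub>j - t\<^sub>i|\<close>.\<close>

lemma plus_same: "(\<lambda>n. HP n (\<lambda>l. max (real_of_int (level n i - pos n i l) - real_of_int (level n j - pos n j l)) 0) / sqrt n)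
   \<longlonglongrightarrow> gPsi (\<sigma>2 * \<bar>t $ j - t $ i\<bar>) (r $ j - r $ i)"
proof -
  let ?c = "\<lambda>n k. of_bool (k < steps n j) - of_bool (k < steps n i) :: real"
  have s: "(\<Sum>k<horizon n. ?c n k) = real (steps n j) - real (steps n i)" for n
    using sum_lt[OF steps_le_horizon[of n i]] sum_lt[OF steps_le_horizon[of n j]] by (simp add: sum_subtractf)
  have s2: "(\<Sum>k<horizon n. (?c n k)\<^sup>2) = \<bar>real (steps n j) - real (steps n i)\<bar>" for n
  proof -
    have "(?c n k)\<^sup>2 = of_bool (k < max (steps n j) (steps n i)) - of_bool (k < min (steps n j) (steps n i))" for k by auto
    then have "(\<Sum>k<horizon n. (?c n k)\<^sup>2) = real (max (steps n j) (steps n i)) - real (min (steps n j) (steps n i))"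
      using sum_lt[of "max (steps n j) (steps n i)" "horizon n"] sum_lt[of "min (steps n j) (steps n i)" "horizon n"]
        steps_le_horizon[of n i] steps_le_horizon[of n j] by (simp only: sum_subtractf)
    then show ?thesis by simp
  qed
  have "(\<lambda>n. HP n (\<lambda>l. max (lin (?c n) l - (real_of_int (level n j) - real_of_int (level n i))) 0) / sqrt n) \<longlonglongrightarrow> gPsi (\<sigma>2 * \<bar>t $ j - t $ i\<bar>) (r $ j - r $ i)"
  proof (rule plus_lin_scaled)
    have "(\<lambda>n. \<bar>real (steps n j) / n - real (steps n i) / n\<bar>) \<longlonglongrightarrow> \<bar>t $ j - t $ i\<bar>"
      by (intro tendsto_intros steps_over_n)
    then show "(\<lambda>n. (\<Sum>k<horizon n. (?c n k)\<^sup>2) / n) \<longlonglongrightarrow> \<bar>t $ j - t $ i\<bar>"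
      unfolding s2 by (simp add: diff_divide_distrib[symmetric])
  qed (unfold s, auto intro: level_diff_scaled)
  moreover have "HP n (\<lambda>l. max (lin (?c n) l - (real_of_int (level n j) - real_of_int (level n i))) 0) =
      HP n (\<lambda>l. max (real_of_int (level n i - pos n i l) - real_of_int (level n j - pos n j l)) 0)" for n
    by (rule AP_cong) (simp add: lin_diff real_pos_lin algebra_simps)
  ultimately show ?thesis by simp
qed

text \<open>Two independent walks of length \<open>horizon n\<close> are one walk of twice that length. Nothing cancels, so the
total time is \<open>t\<^sub>i + t\<^sub>j\<close>.\<close>

lemma plus_indep: "(\<lambda>n. HP n (\<lambda>l. HP n (\<lambda>l'. max (real_of_int (level n i - pos n i l) - real_of_int (level n j - pos n j l')) 0)) / sqrt n)
   \<longlonglongrightarrow> gPsi (\<sigma>2 * (t $ j + t $ i)) (r $ j - r $ i)"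
proof -
  let ?c = "\<lambda>n k. of_bool (horizon n \<le> k \<and> k < horizon n + steps n j) - of_bool (k < steps n i) :: real"
  have s1: "(\<Sum>k<horizon n + horizon n. of_bool (horizon n \<le> k \<and> k < horizon n + steps n j)) = real (steps n j)" for n
  proof -
    have "(\<Sum>k<horizon n + horizon n. of_bool (horizon n \<le> k \<and> k < horizon n + steps n j)) = (\<Sum>k\<in>{horizon n..<horizon n + steps n j}. 1 :: real)"
      using steps_le_horizon[of n j] by (intro sum.mono_neutral_cong_right) auto
    then show ?thesis by simp
  qed
  have s: "(\<Sum>k<horizon n + horizon n. ?c n k) = real (steps n j) - real (steps n i)" for n
    using sum_lt[of "steps n i" "horizon n + horizon n"] steps_le_horizon[of n i] s1 by (simp add: sum_subtractf)
  have s2: "(\<Sum>k<horizon n + horizon n. (?c n k)\<^sup>2) = real (steps n j) + real (steps n i)" for n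
  proof -
    have "(?c n k)\<^sup>2 = of_bool (horizon n \<le> k \<and> k < horizon n + steps n j) + of_bool (k < steps n i)" for k
      using steps_le_horizon[of n i] by auto
    then show ?thesis using sum_lt[of "steps n i" "horizon n + horizon n"] steps_le_horizon[of n i] s1 by (simp add: sum.distrib)
  qed
  have "(\<lambda>n. AP (horizon n + horizon n) (\<lambda>l. max (lin (?c n) l - (real_of_int (level n j) - real_of_int (level n i))) 0) / sqrt n) \<longlonglongrightarrow> gPsi (\<sigma>2 * (t $ j + t $ i)) (r $ j - r $ i)"
  proof (rule plus_lin_scaled)
    have "(\<lambda>n. real (steps n j) / n + real (steps n i) / n) \<longlonglongrightarrow> t $ j + t $ i"
      by (intro tendsto_intros steps_over_n)
    then show "(\<lambda>n. (\<Sum>k<horizon n + horizon n. (?c n k)\<^sup>2) / n) \<longlonglongrightarrow> t $ j + t $ i"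
      unfolding s2 by (simp add: add_divide_distrib)
  qed (unfold s, auto intro: level_diff_scaled)
  moreover have "AP (horizon n + horizon n) (\<lambda>l. max (lin (?c n) l - (real_of_int (level n j) - real_of_int (level n i))) 0) =
      HP n (\<lambda>l. HP n (\<lambda>l'. max (real_of_int (level n i - pos n i l) - real_of_int (level n j - pos n j l')) 0))" for n
    unfolding AP_append[symmetric]
  proof (intro AP_cong)
    fix l l' :: "int list" assume l: "length l = horizon n" and l': "length l' = horizon n"
    have "lin (?c n) l = lin (\<lambda>k. - 1 * of_bool (k < steps n i)) l" using l by (intro lin_cong) auto
    also have "\<dots> = - real_of_int (pos n i l)" unfolding lin_cmult by (simp add: real_pos_lin l)
    finally have 1: "lin (?c n) l = - real_of_int (pos n i l)" .
    have "lin (\<lambda>k. ?c n (length l + k)) l' = lin (\<lambda>k. of_bool (k < steps n j)) l'"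
      using l steps_le_horizon[of n i] by (intro lin_cong) auto
    also have "\<dots> = real_of_int (pos n j l')" by (simp add: real_pos_lin l')
    finally have 2: "lin (\<lambda>k. ?c n (length l + k)) l' = real_of_int (pos n j l')" .
    show "max (lin (?c n) (l @ l') - (real_of_int (level n j) - real_of_int (level n i))) 0 =
       max (real_of_int (level n i - pos n i l) - real_of_int (level n j - pos n j l')) 0"
      unfolding lin_append 1 2 by (simp add: algebra_simps)
  qed
  ultimately show ?thesis by simp
qed

lemma sum_cross_same:
  "(\<lambda>n. (\<Sum>x\<in>window n. HP n (\<lambda>l. cross n i x l * cross n j x l)) / sqrt n)
     \<longlonglongrightarrow> gPsi (\<sigma>2 * t $ i) (- r $ i) + gPsi (\<sigma>2 * t $ j) (r $ j) - gPsi (\<sigma>2 * \<bar>t $ j - t $ i\<bar>) (r $ j - r $ i)"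
proof -
  have "(\<Sum>x\<in>window n. HP n (\<lambda>l. cross n i x l * cross n j x l)) =
    HP n (\<lambda>l. max (real_of_int (level n i - pos n i l)) 0) + HP n (\<lambda>l. max (real_of_int (pos n j l - level n j)) 0) -
    HP n (\<lambda>l. max (real_of_int (level n i - pos n i l) - real_of_int (level n j - pos n j l)) 0)" for n
    unfolding AP_sum[symmetric] AP_add[symmetric] AP_diff[symmetric] window_def
    by (rule AP_cong, rule sum_side_product) (rule path_level_bound, assumption+)+
  then show ?thesis
    using tendsto_diff[OF tendsto_add[OF plus_below[of i] plus_above[of j]] plus_same[of i j]]
    by (simp add: add_divide_distrib diff_divide_distrib)
qed

lemma sum_cross_indep:
  "(\<lambda>n. (\<Sum>x\<in>window n. HP n (cross n i x) * HP n (cross n j x)) / sqrt n)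
     \<longlonglongrightarrow> Gamma2 \<sigma>2 (t $ i, r $ i) (t $ j, r $ j)"
proof -
  have "(\<Sum>x\<in>window n. HP n (cross n i x) * HP n (cross n j x)) =
    HP n (\<lambda>l. max (real_of_int (level n i - pos n i l)) 0) + HP n (\<lambda>l. max (real_of_int (pos n j l - level n j)) 0) -
    HP n (\<lambda>l. HP n (\<lambda>l'. max (real_of_int (level n i - pos n i l) - real_of_int (level n j - pos n j l')) 0))" for n
  proof -
    have "(\<Sum>x\<in>window n. HP n (cross n i x) * HP n (cross n j x)) =
      HP n (\<lambda>l. HP n (\<lambda>l'. \<Sum>x\<in>window n. cross n i x l * cross n j x l'))"
      unfolding AP_sum by simp
    also have "\<dots> = HP n (\<lambda>l. HP n (\<lambda>l'. max (real_of_int (level n i - pos n i l)) 0 + max (real_of_int (pos n j l' - level n j)) 0 -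
        max (real_of_int (level n i - pos n i l) - real_of_int (level n j - pos n j l')) 0))"
      unfolding window_def
      by (intro AP_cong sum_side_product) (rule path_level_bound, assumption+)+
    also have "\<dots> = HP n (\<lambda>l. max (real_of_int (level n i - pos n i l)) 0 + HP n (\<lambda>l'. max (real_of_int (pos n j l' - level n j)) 0) -
        HP n (\<lambda>l'. max (real_of_int (level n i - pos n i l) - real_of_int (level n j - pos n j l')) 0))"
      unfolding AP_diff[of "horizon n" "\<lambda>l'. max (real_of_int (level n i - pos n i l)) 0 + max (real_of_int (pos n j l' - level n j)) 0" for l]
        AP_add[of "horizon n" "\<lambda>l'. max (real_of_int (level n i - pos n i l)) 0" for l] by simp
    finally show ?thesis unfolding AP_diff AP_add by simp
  qed
  then show ?thesis
    using tendsto_diff[OF tendsto_add[OF plus_below[of i] plus_above[of j]] plus_indep[of i j]]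
    by (simp add: add_divide_distrib diff_divide_distrib Gamma2_def)
qed

text \<open>A constant such that \<open>D n\<close> bounds the second moment of the distance between the averaged walk and each level; it bounds the
number of starting sites that contribute to the current and their tails.\<close>

definition D :: real where "D = 2 * \<sigma>2 * T + 2 * (\<bar>v\<bar> + 2 + \<rho>)\<^sup>2"

lemma D_nonneg: "0 \<le> D" unfolding D_def using jump_var_nonneg T_nonneg by (intro add_nonneg_nonneg mult_nonneg_nonneg) auto

lemma HP_level_square:
  "HP n (\<lambda>l. (real_of_int (level n i - pos n i l))\<^sup>2) \<le> D * n"
proof (cases "n = 0")
  case True
  then show ?thesis by (simp add: level_def steps_def)
next
  case False
  let ?c = "\<lambda>j. of_bool (j < steps n i) :: real"
  have n: "1 \<le> real n" using False by simp
  have s: "(\<Sum>k<horizon n. ?c k) = real (steps n i)" "(\<Sum>k<horizon n. (?c k)\<^sup>2) = real (steps n i)"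
    by (rule sum_lt[OF steps_le_horizon], rule sum_lt_sq[OF steps_le_horizon])
  define E where "E = real_of_int (level n i) - v * real (steps n i)"
  have E: "E\<^sup>2 \<le> (\<bar>v\<bar> + 2 + \<rho>)\<^sup>2 * n"
  proof -
    have "\<bar>E\<bar> \<le> (\<bar>v\<bar> + 2) + \<bar>r $ i * sqrt n\<bar>" using level_bounds[of n i] unfolding E_def by linarith
    also have "\<bar>r $ i * sqrt n\<bar> \<le> \<rho> * sqrt n" unfolding abs_mult using r_le_\<rho>[of i] by (intro mult_mono) auto
    also have "(\<bar>v\<bar> + 2) + \<rho> * sqrt n \<le> (\<bar>v\<bar> + 2) * sqrt n + \<rho> * sqrt n"
      using n mult_left_mono[of 1 "sqrt n" "\<bar>v\<bar> + 2"] by (intro add_right_mono) simp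
    finally have "\<bar>E\<bar> \<le> (\<bar>v\<bar> + 2 + \<rho>) * sqrt n" by (simp add: distrib_right)
    then have "\<bar>E\<bar>\<^sup>2 \<le> ((\<bar>v\<bar> + 2 + \<rho>) * sqrt n)\<^sup>2" by (rule power_mono) simp
    then show ?thesis by (simp add: power_mult_distrib)
  qed
  have "HP n (\<lambda>l. (real_of_int (level n i - pos n i l))\<^sup>2) \<le> HP n (\<lambda>l. 2 * (lin ?c l - v * (\<Sum>k<horizon n. ?c k))\<^sup>2 + 2 * E\<^sup>2)"
  proof (rule AP_mono)
    fix l :: "int list" assume l: "length l = horizon n"
    have "real_of_int (level n i - pos n i l) = E - (lin ?c l - v * (\<Sum>k<horizon n. ?c k))"
      unfolding s E_def by (simp add: real_pos_lin[OF l])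
    moreover have "(a - b)\<^sup>2 \<le> 2 * b\<^sup>2 + 2 * a\<^sup>2" for a b :: real
      using zero_le_power2[of "a + b"] by (simp add: power2_eq_square algebra_simps)
    ultimately show "(real_of_int (level n i - pos n i l))\<^sup>2 \<le> 2 * (lin ?c l - v * (\<Sum>k<horizon n. ?c k))\<^sup>2 + 2 * E\<^sup>2"
      by (simp only:)
  qed
  also have "\<dots> = 2 * (\<sigma>2 * real (steps n i)) + 2 * E\<^sup>2"
    unfolding AP_add AP_cmult AP_lin_square unfolding s by simp
  also have "\<dots> \<le> 2 * (\<sigma>2 * (T * n)) + 2 * ((\<bar>v\<bar> + 2 + \<rho>)\<^sup>2 * n)"
  proof -
    have "real (steps n i) \<le> T * n"
      using steps_bounds(1)[of n i] mult_left_mono[OF t_le_T[of i], of "real n"] by (simp add: mult.commute)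
    then show ?thesis using E jump_var_nonneg by (intro add_mono mult_left_mono) auto
  qed
  also have "\<dots> = D * n" unfolding D_def by (simp add: algebra_simps)
  finally show ?thesis .
qed

lemma sum_HP_cross:
  "(\<Sum>x\<in>window n. HP n (\<lambda>l. \<bar>cross n i x l\<bar>)) \<le> sqrt D * sqrt n"
proof -
  have "(\<Sum>x\<in>window n. HP n (\<lambda>l. \<bar>cross n i x l\<bar>)) = HP n (\<lambda>l. \<bar>real_of_int (level n i - pos n i l)\<bar>)"
    unfolding AP_sum[symmetric] window_def by (rule AP_cong, rule sum_abs_side) (rule path_level_bound, assumption+)
  also have "\<dots> \<le> sqrt (HP n (\<lambda>l. (real_of_int (level n i - pos n i l))\<^sup>2))"
    by (rule prob_space.expectation_abs_le_sqrt[OF prob_space_measure_pmf]) (auto intro: integrable_path_pmf[OF const_p_space])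
  also have "\<dots> \<le> sqrt (D * n)" by (rule real_sqrt_le_mono[OF HP_level_square])
  finally show ?thesis by (simp add: real_sqrt_mult)
qed

lemma sum_HP_cross_tail:
  assumes "H > 0"
  shows "(\<Sum>x\<in>window n. if H < \<bar>real_of_int x\<bar> then HP n (\<lambda>l. \<bar>cross n i x l\<bar>) else 0) \<le> D * n / H"
proof -
  have "(\<Sum>x\<in>window n. if H < \<bar>real_of_int x\<bar> then HP n (\<lambda>l. \<bar>cross n i x l\<bar>) else 0) =
     HP n (\<lambda>l. \<Sum>x\<in>window n. if H < \<bar>real_of_int x\<bar> then \<bar>cross n i x l\<bar> else 0)"
    unfolding AP_sum by (intro sum.cong refl) simp
  also have "\<dots> \<le> HP n (\<lambda>l. (1 / H) * (real_of_int (level n i - pos n i l))\<^sup>2)"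
    using sum_abs_side_tail[OF path_level_bound assms] unfolding window_def by (intro AP_mono) auto
  also have "\<dots> \<le> (1 / H) * (D * n)"
    unfolding AP_cmult using HP_level_square assms by (intro mult_left_mono) auto
  finally show ?thesis by simp
qed

end

section \<open>Smoothing of the crossing functional\<close>

text \<open>The indicator of \<open>{a<..}\<close>, replaced on an interval of length \<open>h\<close> by a linear function.\<close>

definition ramp :: "real \<Rightarrow> int \<Rightarrow> int \<Rightarrow> real" where
  "ramp h a y = min 1 (max 0 (real_of_int (y - a) / h))"

lemma ramp_bounds: "0 \<le> ramp h a y" "ramp h a y \<le> 1" unfolding ramp_def by auto

lemma ramp_error:
  assumes "h > 0" shows "\<bar>of_bool (a < y) - ramp h a y\<bar> \<le> of_bool (a < y \<and> real_of_int y < real_of_int a + h)"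
proof (cases "a < y")
  case False
  then have "real_of_int (y - a) / h \<le> 0" using assms by (simp add: divide_nonpos_pos)
  then show ?thesis using False by (simp add: ramp_def max_def)
next
  case True
  show ?thesis
  proof (cases "real_of_int y < real_of_int a + h")
    case False
    then have "1 \<le> real_of_int (y - a) / h" using assms by (simp add: le_divide_eq)
    then show ?thesis using True by (simp add: ramp_def)
  next
    case True': True
    then show ?thesis using True ramp_bounds[of h a y] by simp
  qed
qed

lemma ramp_lipschitz:
  assumes "h > 0" shows "\<bar>ramp h a y - ramp h a y'\<bar> \<le> \<bar>real_of_int (y - y')\<bar> / h"
proof -
  have "\<bar>min 1 (max 0 A) - min 1 (max 0 B)\<bar> \<le> \<bar>A - B\<bar>" for A B :: real by (auto simp: min_def max_def)
  then have "\<bar>ramp h a y - ramp h a y'\<bar> \<le> \<bar>real_of_int (y - a) / h - real_of_int (y' - a) / h\<bar>" unfolding ramp_def .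
  also have "real_of_int (y - a) / h - real_of_int (y' - a) / h = real_of_int (y - y') / h" by (simp add: diff_divide_distrib)
  finally show ?thesis using assms by (simp add: abs_divide)
qed

lemma position_change:
  fixes z z' :: int
  assumes "z \<in> jumps R" "z' \<in> jumps R"
  shows "\<bar>real_of_int ((x + sum_list (take k (l1 @ z # l2))) - (x + sum_list (take k (l1 @ z' # l2))))\<bar> \<le> 2 * real R"
proof (cases "k \<le> length l1")
  case False
  then obtain j where "k - length l1 = Suc j" by (metis Suc_diff_Suc not_le)
  then have "(x + sum_list (take k (l1 @ z # l2))) - (x + sum_list (take k (l1 @ z' # l2))) = z - z'" by simp
  then show ?thesis using assms by auto
qed simp

context space_time_points
begin

definition \<Theta> :: real where "\<Theta> = (\<Sum>i\<in>UNIV. \<bar>\<theta> $ i\<bar>)"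

lemma \<Theta>_nonneg: "0 \<le> \<Theta>" unfolding \<Theta>_def by (rule sum_nonneg) simp
lemma \<theta>_le: "\<bar>\<theta> $ i\<bar> \<le> \<Theta>" unfolding \<Theta>_def by (rule member_le_sum) auto

text \<open>The contribution of one particle from \<open>x\<close> to \<open>\<Sum>\<^sub>i \<theta>\<^sub>i Y\<^sub>n(t\<^sub>i, r\<^sub>i)\<close>.\<close>

definition W :: "nat \<Rightarrow> int \<Rightarrow> int list \<Rightarrow> real" where
  "W n x l = (\<Sum>i\<in>UNIV. \<theta> $ i * cross n i x l)"

definition smoothW :: "nat \<Rightarrow> real \<Rightarrow> int \<Rightarrow> int list \<Rightarrow> real" where
  "smoothW n h x l = (\<Sum>i\<in>UNIV. \<theta> $ i * (of_bool (0 < x) - ramp h (level n i) (x + pos n i l)))"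

abbreviation near :: "nat \<Rightarrow> real \<Rightarrow> 'n \<Rightarrow> int \<Rightarrow> int list \<Rightarrow> real" where
  "near n h i x l \<equiv> of_bool (level n i < x + pos n i l \<and> real_of_int (x + pos n i l) < real_of_int (level n i) + h)"

lemma weighted_abs_le:
  assumes "\<And>i. \<bar>f i\<bar> \<le> g i" shows "\<bar>\<Sum>i\<in>UNIV. \<theta> $ i * f i\<bar> \<le> \<Theta> * (\<Sum>i\<in>UNIV. g i)"
proof -
  have "\<bar>\<Sum>i\<in>UNIV. \<theta> $ i * f i\<bar> \<le> (\<Sum>i\<in>UNIV. \<bar>\<theta> $ i * f i\<bar>)" by (rule sum_abs)
  also have "\<dots> \<le> (\<Sum>i\<in>UNIV. \<Theta> * g i)"
    unfolding abs_mult using \<theta>_le assms \<Theta>_nonneg by (intro sum_mono mult_mono) auto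
  finally show ?thesis by (simp add: sum_distrib_left)
qed

lemma weighted_abs_le_const:
  assumes "\<And>i. \<bar>f i\<bar> \<le> c" shows "\<bar>\<Sum>i\<in>UNIV. \<theta> $ i * f i\<bar> \<le> \<Theta> * c"
proof -
  have "\<bar>\<Sum>i\<in>UNIV. \<theta> $ i * f i\<bar> \<le> (\<Sum>i\<in>UNIV. \<bar>\<theta> $ i * f i\<bar>)" by (rule sum_abs)
  also have "\<dots> \<le> (\<Sum>i\<in>UNIV. \<bar>\<theta> $ i\<bar> * c)"
    unfolding abs_mult using assms by (intro sum_mono mult_left_mono) auto
  finally show ?thesis by (simp add: sum_distrib_right \<Theta>_def)
qed

lemma W_bound: "\<bar>W n x l\<bar> \<le> \<Theta>"
  unfolding W_def using weighted_abs_le_const[of "\<lambda>i. cross n i x l" 1] abs_side_le_1 by simp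

lemma smoothW_bound: "\<bar>smoothW n h x l\<bar> \<le> \<Theta>"
proof -
  have "\<bar>of_bool (0 < x) - ramp h (level n i) (x + pos n i l)\<bar> \<le> 1" for i
    using ramp_bounds[of h "level n i" "x + pos n i l"] by auto
  then show ?thesis unfolding smoothW_def using weighted_abs_le_const[of _ 1] by simp
qed

lemma W_cross: "\<bar>W n x l\<bar> \<le> \<Theta> * (\<Sum>i\<in>UNIV. \<bar>cross n i x l\<bar>)"
  unfolding W_def by (rule weighted_abs_le) simp

lemma W_smoothW: assumes "h > 0" shows "\<bar>W n x l - smoothW n h x l\<bar> \<le> \<Theta> * (\<Sum>i\<in>UNIV. near n h i x l)"
proof -
  have "W n x l - smoothW n h x l = (\<Sum>i\<in>UNIV. \<theta> $ i * (ramp h (level n i) (x + pos n i l) - of_bool (level n i < x + pos n i l)))"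
    unfolding W_def smoothW_def side_def by (simp add: sum_subtractf right_diff_distrib)
  also have "\<bar>\<dots>\<bar> \<le> \<Theta> * (\<Sum>i\<in>UNIV. near n h i x l)"
    by (rule weighted_abs_le) (subst abs_minus_commute, rule ramp_error[OF assms])
  finally show ?thesis .
qed

lemma smoothW_change:
  assumes "h > 0" "z \<in> jumps R" "z' \<in> jumps R"
  shows "\<bar>smoothW n h x (l1 @ z # l2) - smoothW n h x (l1 @ z' # l2)\<bar> \<le> \<Theta> * (2 * real R / h)"
proof -
  have "smoothW n h x (l1 @ z # l2) - smoothW n h x (l1 @ z' # l2) =
    (\<Sum>i\<in>UNIV. \<theta> $ i * (ramp h (level n i) (x + pos n i (l1 @ z' # l2)) - ramp h (level n i) (x + pos n i (l1 @ z # l2))))"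
    unfolding smoothW_def by (simp add: sum_subtractf[symmetric] right_diff_distrib[symmetric])
  also have "\<bar>\<dots>\<bar> \<le> \<Theta> * (2 * real R / h)"
    by (rule weighted_abs_le_const, rule order_trans[OF ramp_lipschitz[OF assms(1)]])
       (rule divide_right_mono[OF position_change[OF assms(3,2)]], use assms in simp)
  finally show ?thesis .
qed

lemma EP_W_bound: assumes w: "\<omega> \<in> space (env_space R)" shows "\<bar>EP \<omega> m x s (W n y)\<bar> \<le> \<Theta>"
proof -
  have "\<bar>EP \<omega> m x s (W n y)\<bar> \<le> EP \<omega> m x s (\<lambda>l. \<bar>W n y l\<bar>)" by (rule integral_abs_bound)
  also have "\<dots> \<le> EP \<omega> m x s (\<lambda>l. \<Theta>)" by (rule EP_mono[OF w W_bound])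
  finally show ?thesis by simp
qed

text \<open>Concentration applies to \<open>g\<close>; the replacement of \<open>f\<close> by \<open>g\<close> costs the same under the quenched law in
mean and under the averaged law.\<close>

lemma quenched_vs_averaged_le:
  assumes "bounded_diff R m c g" "0 \<le> c"
  shows "expectation (\<lambda>\<omega>. \<bar>EP \<omega> m x s f - AP m f\<bar>) \<le> 2 * AP m (\<lambda>l. \<bar>f l - g l\<bar>) + c * sqrt (4 * real R / spread * sqrt m)"
proof -
  have d: "\<bar>EP \<omega> m x s f - EP \<omega> m x s g\<bar> \<le> EP \<omega> m x s (\<lambda>l. \<bar>f l - g l\<bar>)" if "\<omega> \<in> space (env_space R)" for \<omega> x s
  proof -
    have "EP \<omega> m x s f - EP \<omega> m x s g = EP \<omega> m x s (\<lambda>l. f l - g l)"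
      by (rule Bochner_Integration.integral_diff[symmetric]) (rule integrable_path_pmf[OF that])+
    then show ?thesis using integral_abs_bound[of "measure_pmf (path_pmf \<omega> m x s)" "\<lambda>l. f l - g l"] by simp
  qed
  have "expectation (\<lambda>\<omega>. \<bar>EP \<omega> m x s f - AP m f\<bar>) \<le>
    expectation (\<lambda>\<omega>. EP \<omega> m x s (\<lambda>l. \<bar>f l - g l\<bar>) + \<bar>EP \<omega> m x s g - AP m g\<bar> + AP m (\<lambda>l. \<bar>f l - g l\<bar>))"
  proof (rule integral_mono)
    fix \<omega> assume "\<omega> \<in> space P"
    then show "\<bar>EP \<omega> m x s f - AP m f\<bar> \<le> EP \<omega> m x s (\<lambda>l. \<bar>f l - g l\<bar>) + \<bar>EP \<omega> m x s g - AP m g\<bar> + AP m (\<lambda>l. \<bar>f l - g l\<bar>)"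
      using d[of \<omega> x s] d[OF const_p_space, of 0 0] space_P by fastforce
  qed (auto intro!: Bochner_Integration.integrable_add Bochner_Integration.integrable_diff integrable_abs integrable_EP)
  also have "\<dots> = 2 * AP m (\<lambda>l. \<bar>f l - g l\<bar>) + expectation (\<lambda>\<omega>. \<bar>EP \<omega> m x s g - AP m g\<bar>)"
    using integrable_EP by (simp add: expectation_EP prob_space)
  also have "expectation (\<lambda>\<omega>. \<bar>EP \<omega> m x s g - AP m g\<bar>) \<le> c * sqrt (4 * real R / spread * sqrt m)"
    by (rule quenched_concentration[OF spread_pos[OF A2] assms(2,1)])
  finally show ?thesis by simp
qed

definition \<kappa> :: real where "\<kappa> = sqrt (4 * real R / spread * sqrt T)"

lemma \<kappa>_nonneg: "0 \<le> \<kappa>" unfolding \<kappa>_def using spread_pos[OF A2] T_nonneg by simp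

lemma card_window_le:
  assumes "0 \<le> H" shows "real (card {x\<in>window n. \<bar>real_of_int x\<bar> \<le> H}) \<le> 2 * H + 1"
proof -
  have "{x\<in>window n. \<bar>real_of_int x\<bar> \<le> H} \<subseteq> {-\<lfloor>H\<rfloor>..\<lfloor>H\<rfloor>}"
    by (auto simp: le_floor_iff abs_le_iff) linarith+
  then have "card {x\<in>window n. \<bar>real_of_int x\<bar> \<le> H} \<le> nat (2 * \<lfloor>H\<rfloor> + 1)"
    using card_mono[of "{-\<lfloor>H\<rfloor>..\<lfloor>H\<rfloor>}"] by fastforce
  moreover have "real (nat (2 * \<lfloor>H\<rfloor> + 1)) \<le> 2 * H + 1"
    using assms of_int_floor_le[of H] by simp
  ultimately show ?thesis by linarith
qed

text \<open>The three terms are the smoothing error, which needs no cut-off because it is summable over the starting sites;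
the concentration error, which is paid at each of the \<open>2 H + 1\<close> sites near the origin; and the
contribution of the distant sites, bounded without any cancellation.\<close>

lemma sum_quenched_vs_averaged:
  fixes h H K :: real
  assumes h: "h > 0" and H: "H > 0" and K: "K \<ge> 0"
    and FG: "\<And>x l. length l = horizon n \<Longrightarrow> set l \<subseteq> jumps R \<Longrightarrow> \<bar>F x l - G x l\<bar> \<le> K * (\<Sum>i\<in>UNIV. near n h i x l)"
    and bd: "\<And>x. bounded_diff R (horizon n) (K / h) (G x)"
    and FK: "\<And>x l. length l = horizon n \<Longrightarrow> set l \<subseteq> jumps R \<Longrightarrow> \<bar>F x l\<bar> \<le> K * (\<Sum>i\<in>UNIV. \<bar>cross n i x l\<bar>)"
  shows "(\<Sum>x\<in>window n. expectation (\<lambda>\<omega>. \<bar>EP \<omega> (horizon n) x 0 (F x) - HP n (F x)\<bar>)) \<le>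
    2 * (K * (CARD('n) * h)) + (2 * H + 1) * (K / h * (\<kappa> * sqrt (sqrt n))) + 2 * (K * (CARD('n) * (D * n / H)))"
proof -
  let ?e = "\<lambda>x. expectation (\<lambda>\<omega>. \<bar>EP \<omega> (horizon n) x 0 (F x) - HP n (F x)\<bar>)"
  define \<alpha> where "\<alpha> = K / h * (\<kappa> * sqrt (sqrt n))"
  have \<alpha>: "0 \<le> \<alpha>" unfolding \<alpha>_def using K h \<kappa>_nonneg by simp
  have cK: "K / h * sqrt (4 * real R / spread * sqrt (horizon n)) \<le> \<alpha>"
  proof -
    have "sqrt (4 * real R / spread * sqrt (horizon n)) \<le> sqrt (4 * real R / spread * sqrt (n * T))"
      using horizon_le[of n] spread_pos[OF A2] by (intro real_sqrt_le_mono mult_left_mono) auto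
    also have "\<dots> = \<kappa> * sqrt (sqrt n)" unfolding \<kappa>_def by (simp add: real_sqrt_mult real_sqrt_divide)
    finally show ?thesis unfolding \<alpha>_def using K h by (intro mult_left_mono) auto
  qed
  have fin: "finite (window n)" unfolding window_def by simp
  have each: "?e x \<le> 2 * HP n (\<lambda>l. \<bar>F x l - G x l\<bar>) + (if \<bar>real_of_int x\<bar> \<le> H then \<alpha> else 0)
      + (if H < \<bar>real_of_int x\<bar> then 2 * HP n (\<lambda>l. \<bar>F x l\<bar>) else 0)" for x
  proof (cases "\<bar>real_of_int x\<bar> \<le> H")
    case True
    have "?e x \<le> 2 * HP n (\<lambda>l. \<bar>F x l - G x l\<bar>) + K / h * sqrt (4 * real R / spread * sqrt (horizon n))"
      by (rule quenched_vs_averaged_le[OF bd]) (use K h in simp)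
    then show ?thesis using True cK by simp
  next
    case False
    \<comment> \<open>For distant sites the approximation by zero is good enough.\<close>
    have "bounded_diff R (horizon n) 0 (\<lambda>_. 0)" unfolding bounded_diff_def by simp
    from quenched_vs_averaged_le[OF this order_refl, of x 0 "F x"]
    have e: "?e x \<le> 2 * HP n (\<lambda>l. \<bar>F x l\<bar>)" by simp
    have nn: "0 \<le> HP n (\<lambda>l. \<bar>F x l - G x l\<bar>)" by simp
    from False have "H < \<bar>real_of_int x\<bar>" by simp
    then show ?thesis unfolding if_not_P[OF False] using e nn by (simp only: if_True)
  qed
  have "(\<Sum>x\<in>window n. ?e x) \<le> (\<Sum>x\<in>window n. 2 * HP n (\<lambda>l. \<bar>F x l - G x l\<bar>) + (if \<bar>real_of_int x\<bar> \<le> H then \<alpha> else 0)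
      + (if H < \<bar>real_of_int x\<bar> then 2 * HP n (\<lambda>l. \<bar>F x l\<bar>) else 0))"
    by (rule sum_mono[OF each])
  also have "\<dots> = 2 * (\<Sum>x\<in>window n. HP n (\<lambda>l. \<bar>F x l - G x l\<bar>)) + (\<Sum>x\<in>window n. if \<bar>real_of_int x\<bar> \<le> H then \<alpha> else 0)
      + 2 * (\<Sum>x\<in>window n. if H < \<bar>real_of_int x\<bar> then HP n (\<lambda>l. \<bar>F x l\<bar>) else 0)"
    unfolding sum.distrib sum_distrib_left by (intro arg_cong2[of _ _ _ _ "(+)"] sum.cong refl) auto
  also have "(\<Sum>x\<in>window n. HP n (\<lambda>l. \<bar>F x l - G x l\<bar>)) \<le> K * (CARD('n) * h)"
  proof -
    have "(\<Sum>x\<in>window n. HP n (\<lambda>l. \<bar>F x l - G x l\<bar>)) = HP n (\<lambda>l. \<Sum>x\<in>window n. \<bar>F x l - G x l\<bar>)" unfolding AP_sum ..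
    also have "\<dots> \<le> HP n (\<lambda>l. K * (CARD('n) * h))"
    proof (rule AP_mono)
      fix l :: "int list" assume l: "length l = horizon n" "set l \<subseteq> jumps R"
      have "(\<Sum>x\<in>window n. \<bar>F x l - G x l\<bar>) \<le> (\<Sum>x\<in>window n. K * (\<Sum>i\<in>UNIV. near n h i x l))"
        by (rule sum_mono) (rule FG[OF l])
      also have "\<dots> = K * (\<Sum>i\<in>UNIV. \<Sum>x\<in>window n. near n h i x l)"
        unfolding sum_distrib_left[symmetric] by (subst sum.swap) simp
      also have "\<dots> \<le> K * (\<Sum>i\<in>(UNIV :: 'n set). h)"
        using K h fin by (intro mult_left_mono sum_mono sum_window_le) auto
      finally show "(\<Sum>x\<in>window n. \<bar>F x l - G x l\<bar>) \<le> K * (CARD('n) * h)" by simp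
    qed
    finally show ?thesis by simp
  qed
  also have "(\<Sum>x\<in>window n. if \<bar>real_of_int x\<bar> \<le> H then \<alpha> else 0) \<le> (2 * H + 1) * \<alpha>"
  proof -
    have "(\<Sum>x\<in>window n. if \<bar>real_of_int x\<bar> \<le> H then \<alpha> else 0) = (\<Sum>x\<in>{x\<in>window n. \<bar>real_of_int x\<bar> \<le> H}. \<alpha>)"
      by (rule sum.inter_filter[OF fin, symmetric])
    also have "\<dots> = real (card {x\<in>window n. \<bar>real_of_int x\<bar> \<le> H}) * \<alpha>" by simp
    also have "\<dots> \<le> (2 * H + 1) * \<alpha>" using H \<alpha> by (intro mult_right_mono card_window_le) auto
    finally show ?thesis .
  qed
  also have "(\<Sum>x\<in>window n. if H < \<bar>real_of_int x\<bar> then HP n (\<lambda>l. \<bar>F x l\<bar>) else 0) \<le> K * (CARD('n) * (D * n / H))"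
  proof -
    have "(\<Sum>x\<in>window n. if H < \<bar>real_of_int x\<bar> then HP n (\<lambda>l. \<bar>F x l\<bar>) else 0) \<le>
      (\<Sum>x\<in>window n. \<Sum>i\<in>UNIV. K * (if H < \<bar>real_of_int x\<bar> then HP n (\<lambda>l. \<bar>cross n i x l\<bar>) else 0))"
    proof (rule sum_mono)
      fix x
      have "HP n (\<lambda>l. \<bar>F x l\<bar>) \<le> HP n (\<lambda>l. K * (\<Sum>i\<in>UNIV. \<bar>cross n i x l\<bar>))" by (rule AP_mono[OF FK])
      also have "\<dots> = (\<Sum>i\<in>UNIV. K * HP n (\<lambda>l. \<bar>cross n i x l\<bar>))" unfolding AP_cmult AP_sum sum_distrib_left ..
      finally show "(if H < \<bar>real_of_int x\<bar> then HP n (\<lambda>l. \<bar>F x l\<bar>) else 0) \<le>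
         (\<Sum>i\<in>UNIV. K * (if H < \<bar>real_of_int x\<bar> then HP n (\<lambda>l. \<bar>cross n i x l\<bar>) else 0))" by simp
    qed
    also have "\<dots> = K * (\<Sum>i\<in>UNIV. \<Sum>x\<in>window n. (if H < \<bar>real_of_int x\<bar> then HP n (\<lambda>l. \<bar>cross n i x l\<bar>) else 0))"
      unfolding sum_distrib_left by (rule sum.swap)
    also have "\<dots> \<le> K * (\<Sum>i\<in>(UNIV::'n set). D * n / H)"
      using K H by (intro mult_left_mono sum_mono sum_HP_cross_tail) auto
    finally show ?thesis by simp
  qed
  finally show ?thesis unfolding \<alpha>_def by simp
qed

lemma bounded_diff_smoothW:
  assumes "h > 0" shows "bounded_diff R m (\<Theta> * (2 * real R / h)) (smoothW n h x)"
  unfolding bounded_diff_def using smoothW_change[OF assms] by blast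

lemma square_diff_le: "\<bar>a\<bar> \<le> c \<Longrightarrow> \<bar>b\<bar> \<le> c \<Longrightarrow> \<bar>a * a - b * b\<bar> \<le> 2 * c * \<bar>a - b\<bar>" for a b c :: real
proof -
  assume "\<bar>a\<bar> \<le> c" "\<bar>b\<bar> \<le> c"
  then have "\<bar>a + b\<bar> \<le> 2 * c" by linarith
  then have "\<bar>a + b\<bar> * \<bar>a - b\<bar> \<le> 2 * c * \<bar>a - b\<bar>" by (intro mult_right_mono) auto
  moreover have "\<bar>a * a - b * b\<bar> = \<bar>a + b\<bar> * \<bar>a - b\<bar>" unfolding abs_mult[symmetric] by (simp add: algebra_simps)
  ultimately show ?thesis by simp
qed

lemma bounded_diff_smoothW_square:
  assumes "h > 0" shows "bounded_diff R m (2 * \<Theta> * (\<Theta> * (2 * real R / h))) (\<lambda>l. smoothW n h x l * smoothW n h x l)"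
  unfolding bounded_diff_def
proof (intro allI impI, elim conjE)
  fix l1 l2 :: "int list" and z z' assume z: "z \<in> jumps R" "z' \<in> jumps R"
  let ?a = "smoothW n h x (l1 @ z # l2)" and ?b = "smoothW n h x (l1 @ z' # l2)"
  have "\<bar>?a * ?a - ?b * ?b\<bar> \<le> 2 * \<Theta> * \<bar>?a - ?b\<bar>" by (rule square_diff_le[OF smoothW_bound smoothW_bound])
  also have "\<dots> \<le> 2 * \<Theta> * (\<Theta> * (2 * real R / h))"
    using smoothW_change[OF assms z] \<Theta>_nonneg by (intro mult_left_mono) auto
  finally show "\<bar>?a * ?a - ?b * ?b\<bar> \<le> 2 * \<Theta> * (\<Theta> * (2 * real R / h))" .
qed

lemma bounded_diff_mono: "bounded_diff R m c f \<Longrightarrow> c \<le> c' \<Longrightarrow> bounded_diff R m c' f"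
  unfolding bounded_diff_def[of R m c'] by (intro allI impI, elim conjE) (rule order_trans[OF bounded_diffD])

text \<open>After division by \<open>\<surd>n\<close> the three errors are of order \<open>h/\<surd>n\<close>, \<open>H/(h n\<^sup>1\<^sup>/\<^sup>4)\<close> and \<open>\<surd>n/H\<close>. They all vanish if
\<open>h \<lless> n\<^sup>1\<^sup>/\<^sup>2 \<lless> H \<lless> h n\<^sup>1\<^sup>/\<^sup>4\<close>; the exponents \<open>7/16\<close> and \<open>9/16\<close> satisfy this.\<close>

lemma smoothing_limit:
  fixes K :: real
  assumes K: "K \<ge> 0"
    and FG: "\<And>n h x l. h > 0 \<Longrightarrow> \<bar>F n x l - G n h x l\<bar> \<le> K * (\<Sum>i\<in>UNIV. near n h i x l)"
    and bd: "\<And>n h x. h > 0 \<Longrightarrow> bounded_diff R (horizon n) (K / h) (G n h x)"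
    and FK: "\<And>n x l. \<bar>F n x l\<bar> \<le> K * (\<Sum>i\<in>UNIV. \<bar>cross n i x l\<bar>)"
  shows "(\<lambda>n. (\<Sum>x\<in>window n. expectation (\<lambda>\<omega>. \<bar>EP \<omega> (horizon n) x 0 (F n x) - HP n (F n x)\<bar>)) / sqrt n) \<longlonglongrightarrow> 0"
proof (rule tendsto_sandwich[of "\<lambda>_. 0"])
  define N where "N = real CARD('n)"
  define bound where "bound n = 2 * K * N * real n powr (-1/16) + K * \<kappa> * ((2 * real n powr (9/16) + 1) / real n powr (7/16) * sqrt (sqrt n) / sqrt n) + 2 * K * N * D * real n powr (-1/16)" for n :: nat
  show "\<forall>\<^sub>F n in sequentially. (\<Sum>x\<in>window n. expectation (\<lambda>\<omega>. \<bar>EP \<omega> (horizon n) x 0 (F n x) - HP n (F n x)\<bar>)) / sqrt n \<le> bound n"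
    using eventually_gt_at_top[of 0]
  proof eventually_elim
    case (elim n)
    then have n: "real n > 0" by simp
    define h H where "h = real n powr (7/16)" and "H = real n powr (9/16)"
    have hH: "h > 0" "H > 0" using n by (auto simp: h_def H_def)
    have "(\<Sum>x\<in>window n. expectation (\<lambda>\<omega>. \<bar>EP \<omega> (horizon n) x 0 (F n x) - HP n (F n x)\<bar>)) / sqrt n \<le>
       (2 * (K * (CARD('n) * h)) + (2 * H + 1) * (K / h * (\<kappa> * sqrt (sqrt n))) + 2 * (K * (CARD('n) * (D * n / H)))) / sqrt n"
      by (rule divide_right_mono[OF sum_quenched_vs_averaged[where G = "G n h", OF hH K FG[OF hH(1)] bd[OF hH(1)] FK]]) simp
    also have "\<dots> = 2 * K * N * (h / sqrt n) + K * \<kappa> * ((2 * H + 1) / h * sqrt (sqrt n) / sqrt n) + 2 * K * N * D * (n / H / sqrt n)"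
      unfolding add_divide_distrib[of _ _ "sqrt n"] N_def by (simp add: mult_ac)
    also have "h / sqrt n = real n powr (-1/16)"
      unfolding h_def using n by (simp add: powr_half_sqrt[symmetric] powr_diff[symmetric])
    also have "n / H / sqrt n = real n powr (-1/16)"
    proof -
      have "n / H / sqrt n = real n powr 1 / real n powr (9/16) / real n powr (1/2)"
        unfolding H_def using n by (simp add: powr_half_sqrt)
      also have "\<dots> = real n powr (-1/16)" unfolding powr_diff[symmetric] by simp
      finally show ?thesis .
    qed
    finally show ?case unfolding bound_def h_def H_def .
  qed
  have l1: "(\<lambda>n. real n powr (-1/16)) \<longlonglongrightarrow> 0" by real_asymp
  have l2: "(\<lambda>n. (2 * real n powr (9/16) + 1) / real n powr (7/16) * sqrt (sqrt n) / sqrt n) \<longlonglongrightarrow> 0" by real_asymp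
  have "bound \<longlonglongrightarrow> 2 * K * N * 0 + K * \<kappa> * 0 + 2 * K * N * D * 0"
    unfolding bound_def by (intro tendsto_intros l1 l2)
  then show "bound \<longlonglongrightarrow> 0" by simp
qed (auto intro!: always_eventually divide_nonneg_nonneg sum_nonneg)

lemma quenched_W_limit:
  "(\<lambda>n. (\<Sum>x\<in>window n. expectation (\<lambda>\<omega>. \<bar>EP \<omega> (horizon n) x 0 (W n x) - HP n (W n x)\<bar>)) / sqrt n) \<longlonglongrightarrow> 0"
proof (rule smoothing_limit[where K = "\<Theta> * (2 * real R + 1)" and G = smoothW])
  have K: "\<Theta> \<le> \<Theta> * (2 * real R + 1)" using \<Theta>_nonneg by (simp add: algebra_simps)
  show "0 \<le> \<Theta> * (2 * real R + 1)" using \<Theta>_nonneg by simp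
  show "\<bar>W n x l - smoothW n h x l\<bar> \<le> \<Theta> * (2 * real R + 1) * (\<Sum>i\<in>UNIV. near n h i x l)" if "h > 0" for n h x l
    by (rule order_trans[OF W_smoothW[OF that] mult_right_mono[OF K]]) (simp add: sum_nonneg)
  show "bounded_diff R (horizon n) (\<Theta> * (2 * real R + 1) / h) (smoothW n h x)" if "h > 0" for n h x
    by (rule bounded_diff_mono[OF bounded_diff_smoothW[OF that]]) (use that \<Theta>_nonneg in \<open>simp add: divide_right_mono mult_left_mono\<close>)
  show "\<bar>W n x l\<bar> \<le> \<Theta> * (2 * real R + 1) * (\<Sum>i\<in>UNIV. \<bar>cross n i x l\<bar>)" for n x l
    by (rule order_trans[OF W_cross mult_right_mono[OF K]]) (simp add: sum_nonneg)
qed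

lemma quenched_W_square_limit:
  "(\<lambda>n. (\<Sum>x\<in>window n. expectation (\<lambda>\<omega>. \<bar>EP \<omega> (horizon n) x 0 (\<lambda>l. W n x l * W n x l) - HP n (\<lambda>l. W n x l * W n x l)\<bar>)) / sqrt n) \<longlonglongrightarrow> 0"
proof (rule smoothing_limit[where K = "2 * \<Theta> * (\<Theta> * (2 * real R + 1))" and G = "\<lambda>n h x l. smoothW n h x l * smoothW n h x l"])
  have K: "\<Theta> \<le> \<Theta> * (2 * real R + 1)" using \<Theta>_nonneg by (simp add: algebra_simps)
  have K2: "2 * \<Theta> * \<Theta> \<le> 2 * \<Theta> * (\<Theta> * (2 * real R + 1))" using K \<Theta>_nonneg by (intro mult_left_mono) auto
  show "0 \<le> 2 * \<Theta> * (\<Theta> * (2 * real R + 1))" using \<Theta>_nonneg by simp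
  show "\<bar>W n x l * W n x l - smoothW n h x l * smoothW n h x l\<bar> \<le> 2 * \<Theta> * (\<Theta> * (2 * real R + 1)) * (\<Sum>i\<in>UNIV. near n h i x l)" if "h > 0" for n h x l
  proof -
    have "\<bar>W n x l * W n x l - smoothW n h x l * smoothW n h x l\<bar> \<le> 2 * \<Theta> * \<bar>W n x l - smoothW n h x l\<bar>"
      by (rule square_diff_le[OF W_bound smoothW_bound])
    also have "\<dots> \<le> 2 * \<Theta> * (\<Theta> * (\<Sum>i\<in>UNIV. near n h i x l))"
      using W_smoothW[OF that] \<Theta>_nonneg by (intro mult_left_mono) auto
    also have "\<dots> = 2 * \<Theta> * \<Theta> * (\<Sum>i\<in>UNIV. near n h i x l)" by simp
    also have "\<dots> \<le> 2 * \<Theta> * (\<Theta> * (2 * real R + 1)) * (\<Sum>i\<in>UNIV. near n h i x l)"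
      by (rule mult_right_mono[OF K2]) (simp add: sum_nonneg)
    finally show ?thesis .
  qed
  show "bounded_diff R (horizon n) (2 * \<Theta> * (\<Theta> * (2 * real R + 1)) / h) (\<lambda>l. smoothW n h x l * smoothW n h x l)" if "h > 0" for n h x
  proof (rule bounded_diff_mono[OF bounded_diff_smoothW_square[OF that]])
    have "2 * \<Theta> * (\<Theta> * (2 * real R)) / h \<le> 2 * \<Theta> * (\<Theta> * (2 * real R + 1)) / h"
      using that \<Theta>_nonneg by (intro divide_right_mono mult_left_mono) auto
    then show "2 * \<Theta> * (\<Theta> * (2 * real R / h)) \<le> 2 * \<Theta> * (\<Theta> * (2 * real R + 1)) / h" by simp
  qed
  show "\<bar>W n x l * W n x l\<bar> \<le> 2 * \<Theta> * (\<Theta> * (2 * real R + 1)) * (\<Sum>i\<in>UNIV. \<bar>cross n i x l\<bar>)" for n x l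
  proof -
    have "\<bar>W n x l * W n x l\<bar> \<le> \<Theta> * (\<Theta> * (\<Sum>i\<in>UNIV. \<bar>cross n i x l\<bar>))"
      unfolding abs_mult using W_bound W_cross \<Theta>_nonneg by (intro mult_mono) auto
    also have "\<dots> \<le> 2 * \<Theta> * \<Theta> * (\<Sum>i\<in>UNIV. \<bar>cross n i x l\<bar>)" using \<Theta>_nonneg by (simp add: sum_nonneg mult_nonneg_nonneg)
    also have "\<dots> \<le> 2 * \<Theta> * (\<Theta> * (2 * real R + 1)) * (\<Sum>i\<in>UNIV. \<bar>cross n i x l\<bar>)"
      by (rule mult_right_mono[OF K2]) (simp add: sum_nonneg)
    finally show ?thesis .
  qed
qed

lemma sum_HP_abs_W: "(\<Sum>x\<in>window n. HP n (\<lambda>l. \<bar>W n x l\<bar>)) \<le> \<Theta> * (CARD('n) * sqrt D) * sqrt n"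
proof -
  have "(\<Sum>x\<in>window n. HP n (\<lambda>l. \<bar>W n x l\<bar>)) \<le> (\<Sum>x\<in>window n. HP n (\<lambda>l. \<Theta> * (\<Sum>i\<in>UNIV. \<bar>cross n i x l\<bar>)))"
    by (rule sum_mono) (rule AP_mono, rule W_cross)
  also have "\<dots> = \<Theta> * (\<Sum>i\<in>UNIV. \<Sum>x\<in>window n. HP n (\<lambda>l. \<bar>cross n i x l\<bar>))"
    unfolding AP_cmult AP_sum sum_distrib_left[symmetric] by (subst sum.swap) simp
  also have "\<dots> \<le> \<Theta> * (\<Sum>i\<in>(UNIV::'n set). sqrt D * sqrt n)"
    using \<Theta>_nonneg by (intro mult_left_mono sum_mono sum_HP_cross)
  finally show ?thesis by (simp add: mult_ac)
qed

lemma sum_HP_abs_W_tail: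
  assumes "H > 0"
  shows "(\<Sum>x\<in>window n. if H < \<bar>real_of_int x\<bar> then HP n (\<lambda>l. \<bar>W n x l\<bar>) else 0) \<le> \<Theta> * (CARD('n) * (D * n / H))"
proof -
  have "(\<Sum>x\<in>window n. if H < \<bar>real_of_int x\<bar> then HP n (\<lambda>l. \<bar>W n x l\<bar>) else 0) \<le>
      (\<Sum>x\<in>window n. \<Sum>i\<in>UNIV. \<Theta> * (if H < \<bar>real_of_int x\<bar> then HP n (\<lambda>l. \<bar>cross n i x l\<bar>) else 0))"
  proof (rule sum_mono)
    fix x
    have "HP n (\<lambda>l. \<bar>W n x l\<bar>) \<le> HP n (\<lambda>l. \<Theta> * (\<Sum>i\<in>UNIV. \<bar>cross n i x l\<bar>))" by (rule AP_mono[OF W_cross])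
    also have "\<dots> = (\<Sum>i\<in>UNIV. \<Theta> * HP n (\<lambda>l. \<bar>cross n i x l\<bar>))" unfolding AP_cmult AP_sum sum_distrib_left ..
    finally show "(if H < \<bar>real_of_int x\<bar> then HP n (\<lambda>l. \<bar>W n x l\<bar>) else 0) \<le>
         (\<Sum>i\<in>UNIV. \<Theta> * (if H < \<bar>real_of_int x\<bar> then HP n (\<lambda>l. \<bar>cross n i x l\<bar>) else 0))" by simp
  qed
  also have "\<dots> = \<Theta> * (\<Sum>i\<in>UNIV. \<Sum>x\<in>window n. (if H < \<bar>real_of_int x\<bar> then HP n (\<lambda>l. \<bar>cross n i x l\<bar>) else 0))"
    unfolding sum_distrib_left by (rule sum.swap)
  also have "\<dots> \<le> \<Theta> * (\<Sum>i\<in>(UNIV::'n set). D * n / H)"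
    using \<Theta>_nonneg assms by (intro mult_left_mono sum_mono sum_HP_cross_tail) auto
  finally show ?thesis by simp
qed

section \<open>Limits of the averaged variances\<close>

definition walk_var :: "env \<Rightarrow> nat \<Rightarrow> int \<Rightarrow> real" where
  "walk_var \<omega> n x = EP \<omega> (horizon n) x 0 (\<lambda>l. W n x l * W n x l) - (EP \<omega> (horizon n) x 0 (W n x))\<^sup>2"
definition walk_mean_sq :: "env \<Rightarrow> nat \<Rightarrow> int \<Rightarrow> real" where
  "walk_mean_sq \<omega> n x = (EP \<omega> (horizon n) x 0 (W n x))\<^sup>2"
abbreviation avg_var :: "nat \<Rightarrow> int \<Rightarrow> real" where
  "avg_var n x \<equiv> HP n (\<lambda>l. W n x l * W n x l) - (HP n (W n x))\<^sup>2"
abbreviation avg_mean_sq :: "nat \<Rightarrow> int \<Rightarrow> real" where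
  "avg_mean_sq n x \<equiv> (HP n (W n x))\<^sup>2"

text \<open>The parts of the variance of \<open>\<Sum>\<^sub>i \<theta>\<^sub>i Z(t\<^sub>i, r\<^sub>i)\<close> that belong to \<open>\<rho>\<^sub>0\<close> and to \<open>\<sigma>\<^sub>0\<^sup>2\<close>.\<close>

definition G1 :: real where "G1 = (\<Sum>i\<in>UNIV. \<Sum>j\<in>UNIV. \<theta> $ i * \<theta> $ j * Gamma1 \<sigma>2 (t $ i, r $ i) (t $ j, r $ j))"
definition G2 :: real where "G2 = (\<Sum>i\<in>UNIV. \<Sum>j\<in>UNIV. \<theta> $ i * \<theta> $ j * Gamma2 \<sigma>2 (t $ i, r $ i) (t $ j, r $ j))"

lemma sum_avg_mean_sq_limit: "(\<lambda>n. (\<Sum>x\<in>window n. avg_mean_sq n x) / sqrt n) \<longlonglongrightarrow> G2"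
proof -
  have "(\<Sum>x\<in>window n. avg_mean_sq n x) / sqrt n = (\<Sum>i\<in>UNIV. \<Sum>j\<in>UNIV. \<theta> $ i * \<theta> $ j * ((\<Sum>x\<in>window n. HP n (cross n i x) * HP n (cross n j x)) / sqrt n))" for n
  proof -
    have "HP n (W n x) = (\<Sum>i\<in>UNIV. \<theta> $ i * HP n (cross n i x))" for x
      unfolding W_def AP_sum AP_cmult ..
    then have "(\<Sum>x\<in>window n. avg_mean_sq n x) = (\<Sum>x\<in>window n. \<Sum>i\<in>UNIV. \<Sum>j\<in>UNIV. \<theta> $ i * \<theta> $ j * (HP n (cross n i x) * HP n (cross n j x)))"
      unfolding power2_eq_square by (simp add: sum_product mult_ac)
    also have "\<dots> = (\<Sum>i\<in>UNIV. \<Sum>j\<in>UNIV. \<theta> $ i * \<theta> $ j * (\<Sum>x\<in>window n. HP n (cross n i x) * HP n (cross n j x)))"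
      unfolding sum_distrib_left by (subst sum.swap, intro sum.cong refl, subst sum.swap) simp
    finally have e: "(\<Sum>x\<in>window n. avg_mean_sq n x) = (\<Sum>i\<in>UNIV. \<Sum>j\<in>UNIV. \<theta> $ i * \<theta> $ j * (\<Sum>x\<in>window n. HP n (cross n i x) * HP n (cross n j x)))" .
    show ?thesis unfolding e by (simp only: sum_divide_distrib times_divide_eq_right[symmetric])
  qed
  moreover have "(\<lambda>n. \<Sum>i\<in>UNIV. \<Sum>j\<in>UNIV. \<theta> $ i * \<theta> $ j * ((\<Sum>x\<in>window n. HP n (cross n i x) * HP n (cross n j x)) / sqrt n)) \<longlonglongrightarrow> G2"
    unfolding G2_def by (intro tendsto_sum tendsto_mult_left sum_cross_indep)
  ultimately show ?thesis by simp
qed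

lemma sum_avg_var_limit: "(\<lambda>n. (\<Sum>x\<in>window n. avg_var n x) / sqrt n) \<longlonglongrightarrow> G1"
proof -
  let ?A = "\<lambda>n i j. (\<Sum>x\<in>window n. HP n (\<lambda>l. cross n i x l * cross n j x l)) / sqrt n"
  have "(\<Sum>x\<in>window n. HP n (\<lambda>l. W n x l * W n x l)) / sqrt n = (\<Sum>i\<in>UNIV. \<Sum>j\<in>UNIV. \<theta> $ i * \<theta> $ j * ?A n i j)" for n
  proof -
    have "W n x l * W n x l = (\<Sum>i\<in>UNIV. \<Sum>j\<in>UNIV. \<theta> $ i * \<theta> $ j * (cross n i x l * cross n j x l))" for x l
      unfolding W_def by (simp add: sum_product mult_ac)
    then have "(\<Sum>x\<in>window n. HP n (\<lambda>l. W n x l * W n x l)) =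
        (\<Sum>x\<in>window n. \<Sum>i\<in>UNIV. \<Sum>j\<in>UNIV. \<theta> $ i * \<theta> $ j * HP n (\<lambda>l. cross n i x l * cross n j x l))"
      by (simp only: AP_sum AP_cmult)
    also have "\<dots> = (\<Sum>i\<in>UNIV. \<Sum>j\<in>UNIV. \<theta> $ i * \<theta> $ j * (\<Sum>x\<in>window n. HP n (\<lambda>l. cross n i x l * cross n j x l)))"
      unfolding sum_distrib_left by (subst sum.swap, intro sum.cong refl, subst sum.swap) simp
    finally have e: "(\<Sum>x\<in>window n. HP n (\<lambda>l. W n x l * W n x l)) = (\<Sum>i\<in>UNIV. \<Sum>j\<in>UNIV. \<theta> $ i * \<theta> $ j * (\<Sum>x\<in>window n. HP n (\<lambda>l. cross n i x l * cross n j x l)))" .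
    show ?thesis unfolding e by (simp only: sum_divide_distrib times_divide_eq_right[symmetric])
  qed
  moreover have "(\<lambda>n. \<Sum>i\<in>UNIV. \<Sum>j\<in>UNIV. \<theta> $ i * \<theta> $ j * ?A n i j) \<longlonglongrightarrow>
     (\<Sum>i\<in>UNIV. \<Sum>j\<in>UNIV. \<theta> $ i * \<theta> $ j * (gPsi (\<sigma>2 * t $ i) (- r $ i) + gPsi (\<sigma>2 * t $ j) (r $ j) - gPsi (\<sigma>2 * \<bar>t $ j - t $ i\<bar>) (r $ j - r $ i)))"
    by (intro tendsto_sum tendsto_mult_left sum_cross_same)
  ultimately have "(\<lambda>n. (\<Sum>x\<in>window n. HP n (\<lambda>l. W n x l * W n x l)) / sqrt n - (\<Sum>x\<in>window n. avg_mean_sq n x) / sqrt n) \<longlonglongrightarrow>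
     (\<Sum>i\<in>UNIV. \<Sum>j\<in>UNIV. \<theta> $ i * \<theta> $ j * (gPsi (\<sigma>2 * t $ i) (- r $ i) + gPsi (\<sigma>2 * t $ j) (r $ j) - gPsi (\<sigma>2 * \<bar>t $ j - t $ i\<bar>) (r $ j - r $ i))) - G2"
    by (intro tendsto_diff sum_avg_mean_sq_limit) simp
  also have "(\<Sum>i\<in>UNIV. \<Sum>j\<in>UNIV. \<theta> $ i * \<theta> $ j * (gPsi (\<sigma>2 * t $ i) (- r $ i) + gPsi (\<sigma>2 * t $ j) (r $ j) - gPsi (\<sigma>2 * \<bar>t $ j - t $ i\<bar>) (r $ j - r $ i))) - G2 = G1"
    unfolding G1_def G2_def Gamma1_def Gamma2_def sum_subtractf[symmetric] right_diff_distrib[symmetric] by simp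
  finally show ?thesis by (simp add: sum_subtractf diff_divide_distrib)
qed

end

section \<open>Convergence of the conditional variance\<close>

lemma abs_sum_divide_le:
  fixes f :: "'i \<Rightarrow> real" assumes "0 \<le> s" shows "\<bar>sum f A / s\<bar> \<le> (\<Sum>x\<in>A. \<bar>f x\<bar>) / s"
  using assms sum_abs[of f A] by (simp add: abs_divide divide_right_mono)

locale current_fluctuations = particle_system P R \<mu> + space_time_points P R t r \<theta>
  for P R \<mu> and t r \<theta> :: "real ^ 'n :: finite"
begin

abbreviation EW :: "env \<Rightarrow> nat \<Rightarrow> int \<Rightarrow> (int list \<Rightarrow> real) \<Rightarrow> real" where "EW \<omega> n x \<equiv> EP \<omega> (horizon n) x 0"
abbreviation future_sites :: "(int \<times> int) set" where "future_sites \<equiv> {(y, s). 0 \<le> s}"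

text \<open>The variance, given \<open>\<omega>\<close>, of the compound sum at the site \<open>x\<close>: the randomness of the walks comes with
the mean number of particles, and the randomness of that number with the squared mean.\<close>

definition site_var :: "env \<Rightarrow> nat \<Rightarrow> int \<Rightarrow> real" where
  "site_var \<omega> n x = occ_mean (shift x 0 \<omega>) * walk_var \<omega> n x + occ_var (shift x 0 \<omega>) * walk_mean_sq \<omega> n x"

definition total_var :: "env \<Rightarrow> nat \<Rightarrow> real" where
  "total_var \<omega> n = (\<Sum>x\<in>window n. site_var \<omega> n x) / sqrt n"

definition limit_var :: real where "limit_var = rho0 P \<mu> * G1 + init_var P \<mu> * G2"

lemma finite_window: "finite (window n)" unfolding window_def by simp

lemma EW_W_bound: assumes "\<omega> \<in> space P" shows "\<bar>EW \<omega> n x (W n x)\<bar> \<le> \<Theta>"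
  using EP_W_bound assms space_P by simp

lemma EW_abs: assumes "\<omega> \<in> space P" shows "\<bar>EW \<omega> n x (W n x)\<bar> \<le> EW \<omega> n x (\<lambda>l. \<bar>W n x l\<bar>)"
  by (rule integral_abs_bound)

lemma EW_WW: assumes "\<omega> \<in> space P"
  shows "0 \<le> EW \<omega> n x (\<lambda>l. W n x l * W n x l)" "EW \<omega> n x (\<lambda>l. W n x l * W n x l) \<le> \<Theta> * EW \<omega> n x (\<lambda>l. \<bar>W n x l\<bar>)"
    "EW \<omega> n x (\<lambda>l. W n x l * W n x l) \<le> \<Theta> * \<Theta>"
proof -
  have w: "\<omega> \<in> space (env_space R)" using assms space_P by simp
  show "0 \<le> EW \<omega> n x (\<lambda>l. W n x l * W n x l)" by simp
  have b: "W n x l * W n x l \<le> \<Theta> * \<bar>W n x l\<bar>" for l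
    using mult_right_mono[OF W_bound[of n x l], of "\<bar>W n x l\<bar>"] by simp
  have "EW \<omega> n x (\<lambda>l. W n x l * W n x l) \<le> EW \<omega> n x (\<lambda>l. \<Theta> * \<bar>W n x l\<bar>)" by (rule EP_mono[OF w b])
  then show "EW \<omega> n x (\<lambda>l. W n x l * W n x l) \<le> \<Theta> * EW \<omega> n x (\<lambda>l. \<bar>W n x l\<bar>)" by simp
  have "W n x l * W n x l \<le> \<Theta> * \<Theta>" for l
    by (rule order_trans[OF b mult_left_mono[OF W_bound \<Theta>_nonneg]])
  then have "EW \<omega> n x (\<lambda>l. W n x l * W n x l) \<le> EW \<omega> n x (\<lambda>l. \<Theta> * \<Theta>)" by (intro EP_mono[OF w])
  then show "EW \<omega> n x (\<lambda>l. W n x l * W n x l) \<le> \<Theta> * \<Theta>" by simp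
qed

lemma walk_mean_sq_bounds: assumes "\<omega> \<in> space P"
  shows "0 \<le> walk_mean_sq \<omega> n x" "walk_mean_sq \<omega> n x \<le> \<Theta> * EW \<omega> n x (\<lambda>l. \<bar>W n x l\<bar>)" "walk_mean_sq \<omega> n x \<le> \<Theta> * \<Theta>"
proof -
  have "walk_mean_sq \<omega> n x = \<bar>EW \<omega> n x (W n x)\<bar> * \<bar>EW \<omega> n x (W n x)\<bar>" by (simp add: walk_mean_sq_def power2_eq_square)
  then show "0 \<le> walk_mean_sq \<omega> n x" "walk_mean_sq \<omega> n x \<le> \<Theta> * EW \<omega> n x (\<lambda>l. \<bar>W n x l\<bar>)" "walk_mean_sq \<omega> n x \<le> \<Theta> * \<Theta>"
    using EW_W_bound[OF assms, of n x] EW_abs[OF assms, of n x] \<Theta>_nonneg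
    by (auto simp del: abs_mult_self_eq intro!: mult_mono)
qed

lemma walk_var_bounds: assumes "\<omega> \<in> space P"
  shows "0 \<le> walk_var \<omega> n x" "walk_var \<omega> n x \<le> \<Theta> * EW \<omega> n x (\<lambda>l. \<bar>W n x l\<bar>)" "walk_var \<omega> n x \<le> \<Theta> * \<Theta>"
proof -
  have w: "\<omega> \<in> space (env_space R)" using assms space_P by simp
  have "EW \<omega> n x (\<lambda>l. (W n x l - EW \<omega> n x (W n x))\<^sup>2) = walk_var \<omega> n x"
    unfolding walk_var_def power2_eq_square[of "W n x l" for l, symmetric]
    by (rule measure_pmf.variance_eq) (rule integrable_path_pmf[OF w])+
  moreover have "0 \<le> EW \<omega> n x (\<lambda>l. (W n x l - EW \<omega> n x (W n x))\<^sup>2)" by simp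
  ultimately show "0 \<le> walk_var \<omega> n x" by linarith
  show "walk_var \<omega> n x \<le> \<Theta> * EW \<omega> n x (\<lambda>l. \<bar>W n x l\<bar>)" "walk_var \<omega> n x \<le> \<Theta> * \<Theta>"
    using EW_WW(2,3)[OF assms, of n x] zero_le_power2[of "EW \<omega> n x (W n x)"] unfolding walk_var_def by linarith+
qed

lemma measurable_walk_var[measurable]: "(\<lambda>\<omega>. walk_var \<omega> n x) \<in> borel_measurable P" "(\<lambda>\<omega>. walk_mean_sq \<omega> n x) \<in> borel_measurable P"
  unfolding walk_var_def walk_mean_sq_def by measurable

lemma integrable_walk_var: "integrable P (\<lambda>\<omega>. walk_var \<omega> n x)" "integrable P (\<lambda>\<omega>. walk_mean_sq \<omega> n x)"
  by (rule integrable_bounded[of _ "\<Theta> * \<Theta>"], use walk_var_bounds walk_mean_sq_bounds in auto)+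

lemma walk_var_determined:
  "determined_by R future_sites (\<lambda>\<omega>. walk_var \<omega> n x)" "determined_by R future_sites (\<lambda>\<omega>. walk_mean_sq \<omega> n x)"
  unfolding walk_var_def walk_mean_sq_def
  by (rule determined_by_comp2[where h = "\<lambda>a b. a - b\<^sup>2"], rule determined_by_EP, rule determined_by_EP)
     (rule determined_by_comp[where h = "\<lambda>a. a\<^sup>2"], rule determined_by_EP)

lemma past_future_disjoint: "past_sites \<inter> future_sites = {}" by auto

lemma occ_shift_integrable:
  "integrable P (\<lambda>\<omega>. occ_mean (shift x 0 \<omega>))" "integrable P (\<lambda>\<omega>. occ_var (shift x 0 \<omega>))"
  by (intro integrable_shift integrable_occ)+

lemma occ_shift_expectation:
  "expectation (\<lambda>\<omega>. occ_mean (shift x 0 \<omega>)) = rho0 P \<mu>" "expectation (\<lambda>\<omega>. occ_var (shift x 0 \<omega>)) = init_var P \<mu>"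
  unfolding rho0_eq init_var_eq by (intro integral_shift measurable_occ)+

lemma measurable_occ_shift[measurable]:
  "(\<lambda>\<omega>. occ_mean (shift x 0 \<omega>)) \<in> borel_measurable P" "(\<lambda>\<omega>. occ_var (shift x 0 \<omega>)) \<in> borel_measurable P"
  by (rule measurable_compose[OF measurable_shift_P measurable_occ(1)], rule measurable_compose[OF measurable_shift_P measurable_occ(3)])

text \<open>The occupation laws depend on the past and \<open>G\<close> on the future of the environment, so they are independent.
This is what turns the bounds in mean for the walks into bounds for the products with the occupation moments, which
are merely integrable.\<close>

lemma
  assumes G: "integrable P G" "determined_by R future_sites G"
  shows occ_mean_times: "expectation (\<lambda>\<omega>. occ_mean (shift x 0 \<omega>) * G \<omega>) = rho0 P \<mu> * expectation G"
    and occ_var_times: "expectation (\<lambda>\<omega>. occ_var (shift x 0 \<omega>) * G \<omega>) = init_var P \<mu> * expectation G"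
    and integrable_occ_mean_times: "integrable P (\<lambda>\<omega>. occ_mean (shift x 0 \<omega>) * G \<omega>)"
    and integrable_occ_var_times: "integrable P (\<lambda>\<omega>. occ_var (shift x 0 \<omega>) * G \<omega>)"
  using expectation_mult_determined[OF occ_shift_integrable(1) occ_shift_determined(1) G past_future_disjoint, of x]
    expectation_mult_determined[OF occ_shift_integrable(2) occ_shift_determined(2) G past_future_disjoint, of x]
    integrable_mult_determined[OF occ_shift_integrable(1) occ_shift_determined(1) G past_future_disjoint, of x]
    integrable_mult_determined[OF occ_shift_integrable(2) occ_shift_determined(2) G past_future_disjoint, of x]
  by (simp_all add: occ_shift_expectation)

lemma integrable_site_var: "integrable P (\<lambda>\<omega>. site_var \<omega> n x)"
  unfolding site_var_def
  by (intro Bochner_Integration.integrable_add integrable_occ_mean_times integrable_occ_var_times integrable_walk_var walk_var_determined)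

lemma site_var_nonneg: "\<omega> \<in> space P \<Longrightarrow> 0 \<le> site_var \<omega> n x"
  unfolding site_var_def using walk_var_bounds walk_mean_sq_bounds occ_mean_nonneg occ_var_nonneg by simp

lemma total_var_nonneg: "\<omega> \<in> space P \<Longrightarrow> 0 \<le> total_var \<omega> n"
  unfolding total_var_def using site_var_nonneg by (intro divide_nonneg_nonneg sum_nonneg) auto

lemma integrable_total_var: "integrable P (\<lambda>\<omega>. total_var \<omega> n)"
  unfolding total_var_def using integrable_site_var by simp

lemma HP_W_bound: "\<bar>HP n (W n x)\<bar> \<le> \<Theta>"
  using EP_W_bound[OF const_p_space] .

lemma avg_bounds:
  "\<bar>avg_var n x\<bar> \<le> 2 * (\<Theta> * HP n (\<lambda>l. \<bar>W n x l\<bar>))" "\<bar>avg_mean_sq n x\<bar> \<le> 2 * (\<Theta> * HP n (\<lambda>l. \<bar>W n x l\<bar>))"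
  "HP n (\<lambda>l. \<bar>W n x l\<bar>) \<le> \<Theta>" "0 \<le> HP n (\<lambda>l. \<bar>W n x l\<bar>)"
proof -
  have b: "W n x l * W n x l \<le> \<Theta> * \<bar>W n x l\<bar>" for l
    using mult_right_mono[OF W_bound[of n x l], of "\<bar>W n x l\<bar>"] by simp
  have 1: "HP n (\<lambda>l. W n x l * W n x l) \<le> \<Theta> * HP n (\<lambda>l. \<bar>W n x l\<bar>)"
    using AP_mono[of "horizon n" "\<lambda>l. W n x l * W n x l" "\<lambda>l. \<Theta> * \<bar>W n x l\<bar>"] b by simp
  have a: "\<bar>HP n (W n x)\<bar> \<le> HP n (\<lambda>l. \<bar>W n x l\<bar>)" by (rule integral_abs_bound)
  have 2: "(HP n (W n x))\<^sup>2 \<le> \<Theta> * HP n (\<lambda>l. \<bar>W n x l\<bar>)"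
    using mult_mono[OF HP_W_bound[of n x] a \<Theta>_nonneg abs_ge_zero] by (simp add: power2_eq_square)
  have 3: "0 \<le> HP n (\<lambda>l. W n x l * W n x l)" by simp
  show "0 \<le> HP n (\<lambda>l. \<bar>W n x l\<bar>)" by simp
  show "HP n (\<lambda>l. \<bar>W n x l\<bar>) \<le> \<Theta>"
    using AP_mono[of "horizon n" "\<lambda>l. \<bar>W n x l\<bar>" "\<lambda>l. \<Theta>"] W_bound by simp
  show "\<bar>avg_var n x\<bar> \<le> 2 * (\<Theta> * HP n (\<lambda>l. \<bar>W n x l\<bar>))" "\<bar>avg_mean_sq n x\<bar> \<le> 2 * (\<Theta> * HP n (\<lambda>l. \<bar>W n x l\<bar>))"
    using 1 2 3 zero_le_power2[of "HP n (W n x)"] unfolding abs_le_iff by linarith+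
qed

text \<open>Large enough for both requirements on the weights in \<open>weighted_LLN\<close>.\<close>

definition weight_bound :: real where "weight_bound = 2 * (\<Theta> * \<Theta>) + 2 * (\<Theta> * (\<Theta> * (CARD('n) * sqrt D)))"

lemma avg_LLN_bounds:
  "\<bar>avg_var n x\<bar> \<le> weight_bound" "\<bar>avg_mean_sq n x\<bar> \<le> weight_bound"
  "(\<Sum>x\<in>window n. \<bar>avg_var n x\<bar>) \<le> weight_bound * sqrt n" "(\<Sum>x\<in>window n. \<bar>avg_mean_sq n x\<bar>) \<le> weight_bound * sqrt n"
proof -
  have p1: "0 \<le> 2 * (\<Theta> * \<Theta>)" "0 \<le> 2 * (\<Theta> * (\<Theta> * (CARD('n) * sqrt D)))" using \<Theta>_nonneg D_nonneg by auto
  have "\<Theta> * HP n (\<lambda>l. \<bar>W n x l\<bar>) \<le> \<Theta> * \<Theta>" by (rule mult_left_mono[OF avg_bounds(3) \<Theta>_nonneg])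
  then show "\<bar>avg_var n x\<bar> \<le> weight_bound" "\<bar>avg_mean_sq n x\<bar> \<le> weight_bound"
    using avg_bounds(1,2)[of n x] p1 unfolding weight_bound_def by linarith+
  have "(\<Sum>x\<in>window n. 2 * (\<Theta> * HP n (\<lambda>l. \<bar>W n x l\<bar>))) = 2 * \<Theta> * (\<Sum>x\<in>window n. HP n (\<lambda>l. \<bar>W n x l\<bar>))"
    by (simp add: sum_distrib_left mult_ac)
  also have "\<dots> \<le> 2 * \<Theta> * (\<Theta> * (CARD('n) * sqrt D) * sqrt n)"
    using \<Theta>_nonneg by (intro mult_left_mono sum_HP_abs_W) auto
  also have "\<dots> = 2 * (\<Theta> * (\<Theta> * (CARD('n) * sqrt D))) * sqrt n" by simp
  also have "\<dots> \<le> weight_bound * sqrt n" using p1 unfolding weight_bound_def by (intro mult_right_mono) auto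
  finally have s: "(\<Sum>x\<in>window n. 2 * (\<Theta> * HP n (\<lambda>l. \<bar>W n x l\<bar>))) \<le> weight_bound * sqrt n" .
  show "(\<Sum>x\<in>window n. \<bar>avg_var n x\<bar>) \<le> weight_bound * sqrt n" "(\<Sum>x\<in>window n. \<bar>avg_mean_sq n x\<bar>) \<le> weight_bound * sqrt n"
    by (rule order_trans[OF sum_mono s], rule avg_bounds)+
qed

lemma walk_var_vs_avg:
  assumes "\<omega> \<in> space P"
  shows "\<bar>walk_mean_sq \<omega> n x - avg_mean_sq n x\<bar> \<le> 2 * \<Theta> * \<bar>EW \<omega> n x (W n x) - HP n (W n x)\<bar>"
    "\<bar>walk_var \<omega> n x - avg_var n x\<bar> \<le> \<bar>EW \<omega> n x (\<lambda>l. W n x l * W n x l) - HP n (\<lambda>l. W n x l * W n x l)\<bar> + 2 * \<Theta> * \<bar>EW \<omega> n x (W n x) - HP n (W n x)\<bar>"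
proof -
  show 1: "\<bar>walk_mean_sq \<omega> n x - avg_mean_sq n x\<bar> \<le> 2 * \<Theta> * \<bar>EW \<omega> n x (W n x) - HP n (W n x)\<bar>"
    unfolding walk_mean_sq_def power2_eq_square by (rule square_diff_le[OF EW_W_bound[OF assms] HP_W_bound])
  then show "\<bar>walk_var \<omega> n x - avg_var n x\<bar> \<le> \<bar>EW \<omega> n x (\<lambda>l. W n x l * W n x l) - HP n (\<lambda>l. W n x l * W n x l)\<bar> + 2 * \<Theta> * \<bar>EW \<omega> n x (W n x) - HP n (W n x)\<bar>"
    unfolding walk_var_def walk_mean_sq_def by linarith
qed

lemma total_var_vs_averaged_walk:
  "(\<lambda>n. expectation (\<lambda>\<omega>. \<bar>total_var \<omega> n - (\<Sum>x\<in>window n. occ_mean (shift x 0 \<omega>) * avg_var n x + occ_var (shift x 0 \<omega>) * avg_mean_sq n x) / sqrt n\<bar>)) \<longlonglongrightarrow> 0"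
proof (rule tendsto_sandwich[of "\<lambda>_. 0"])
  define e1 where "e1 n x = expectation (\<lambda>\<omega>. \<bar>EW \<omega> n x (W n x) - HP n (W n x)\<bar>)" for n x
  define e2 where "e2 n x = expectation (\<lambda>\<omega>. \<bar>EW \<omega> n x (\<lambda>l. W n x l * W n x l) - HP n (\<lambda>l. W n x l * W n x l)\<bar>)" for n x
  define bound where "bound n = rho0 P \<mu> * ((\<Sum>x\<in>window n. e2 n x) / sqrt n) +
    (rho0 P \<mu> + init_var P \<mu>) * (2 * \<Theta> * ((\<Sum>x\<in>window n. e1 n x) / sqrt n))" for n :: nat
  have "bound \<longlonglongrightarrow> rho0 P \<mu> * 0 + (rho0 P \<mu> + init_var P \<mu>) * (2 * \<Theta> * 0)"
    unfolding bound_def e1_def e2_def by (intro tendsto_intros quenched_W_limit quenched_W_square_limit)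
  then show "bound \<longlonglongrightarrow> 0" by simp
  show "\<forall>\<^sub>F n in sequentially. expectation (\<lambda>\<omega>. \<bar>total_var \<omega> n - (\<Sum>x\<in>window n. occ_mean (shift x 0 \<omega>) * avg_var n x + occ_var (shift x 0 \<omega>) * avg_mean_sq n x) / sqrt n\<bar>) \<le> bound n"
  proof (rule always_eventually, rule allI)
    fix n :: nat
    let ?a = "\<lambda>x \<omega>. \<bar>walk_var \<omega> n x - avg_var n x\<bar>" and ?b = "\<lambda>x \<omega>. \<bar>walk_mean_sq \<omega> n x - avg_mean_sq n x\<bar>"
    have ia: "integrable P (?a x)" "integrable P (?b x)" for x using integrable_walk_var by simp_all
    have da: "determined_by R future_sites (?a x)" "determined_by R future_sites (?b x)" for x
      by (rule determined_by_comp[OF walk_var_determined(1)], rule determined_by_comp[OF walk_var_determined(2)])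
    note it = integrable_occ_mean_times[OF ia(1) da(1)] integrable_occ_var_times[OF ia(2) da(2)]
    have iE: "integrable P (\<lambda>\<omega>. EW \<omega> n x f)" for x f by (rule integrable_EP)
    have Ea: "expectation (?a x) \<le> e2 n x + 2 * \<Theta> * e1 n x" for x
    proof -
      have "expectation (?a x) \<le> expectation (\<lambda>\<omega>. \<bar>EW \<omega> n x (\<lambda>l. W n x l * W n x l) - HP n (\<lambda>l. W n x l * W n x l)\<bar> + 2 * \<Theta> * \<bar>EW \<omega> n x (W n x) - HP n (W n x)\<bar>)"
        using ia iE by (intro integral_mono walk_var_vs_avg(2)) auto
      then show ?thesis unfolding e1_def e2_def using iE by simp
    qed
    have Eb: "expectation (?b x) \<le> 2 * \<Theta> * e1 n x" for x
    proof -
      have "expectation (?b x) \<le> expectation (\<lambda>\<omega>. 2 * \<Theta> * \<bar>EW \<omega> n x (W n x) - HP n (W n x)\<bar>)"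
        using ia iE by (intro integral_mono walk_var_vs_avg(1)) auto
      then show ?thesis unfolding e1_def by simp
    qed
    have "expectation (\<lambda>\<omega>. \<bar>total_var \<omega> n - (\<Sum>x\<in>window n. occ_mean (shift x 0 \<omega>) * avg_var n x + occ_var (shift x 0 \<omega>) * avg_mean_sq n x) / sqrt n\<bar>) \<le>
      expectation (\<lambda>\<omega>. (\<Sum>x\<in>window n. occ_mean (shift x 0 \<omega>) * ?a x \<omega> + occ_var (shift x 0 \<omega>) * ?b x \<omega>) / sqrt n)"
    proof (rule integral_mono)
      fix \<omega> assume "\<omega> \<in> space P"
      define g where "g x = occ_mean (shift x 0 \<omega>) * (walk_var \<omega> n x - avg_var n x) + occ_var (shift x 0 \<omega>) * (walk_mean_sq \<omega> n x - avg_mean_sq n x)" for x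
      have eq: "total_var \<omega> n - (\<Sum>x\<in>window n. occ_mean (shift x 0 \<omega>) * avg_var n x + occ_var (shift x 0 \<omega>) * avg_mean_sq n x) / sqrt n =
        sum g (window n) / sqrt n"
        unfolding total_var_def site_var_def diff_divide_distrib[symmetric] sum_subtractf[symmetric] g_def
        by (rule arg_cong[where f = "\<lambda>y. y / sqrt n"], rule sum.cong[OF refl]) (simp add: algebra_simps)
      have g: "\<bar>g x\<bar> \<le> occ_mean (shift x 0 \<omega>) * ?a x \<omega> + occ_var (shift x 0 \<omega>) * ?b x \<omega>" for x
        unfolding g_def by (rule order_trans[OF abs_triangle_ineq]) (simp only: abs_mult abs_of_nonneg[OF occ_mean_nonneg] abs_of_nonneg[OF occ_var_nonneg] order_refl)
      have "\<bar>sum g (window n) / sqrt n\<bar> \<le> (\<Sum>x\<in>window n. \<bar>g x\<bar>) / sqrt n" by (rule abs_sum_divide_le) simp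
      also have "\<dots> \<le> (\<Sum>x\<in>window n. occ_mean (shift x 0 \<omega>) * ?a x \<omega> + occ_var (shift x 0 \<omega>) * ?b x \<omega>) / sqrt n"
        by (rule divide_right_mono[OF sum_mono[OF g]]) simp
      finally show "\<bar>total_var \<omega> n - (\<Sum>x\<in>window n. occ_mean (shift x 0 \<omega>) * avg_var n x + occ_var (shift x 0 \<omega>) * avg_mean_sq n x) / sqrt n\<bar>
         \<le> (\<Sum>x\<in>window n. occ_mean (shift x 0 \<omega>) * ?a x \<omega> + occ_var (shift x 0 \<omega>) * ?b x \<omega>) / sqrt n"
        unfolding eq .
    qed (use it occ_shift_integrable integrable_total_var in auto)
    also have "\<dots> = (\<Sum>x\<in>window n. rho0 P \<mu> * expectation (?a x) + init_var P \<mu> * expectation (?b x)) / sqrt n"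
      using it by (simp add: occ_mean_times[OF ia(1) da(1)] occ_var_times[OF ia(2) da(2)])
    also have "\<dots> \<le> (\<Sum>x\<in>window n. rho0 P \<mu> * (e2 n x + 2 * \<Theta> * e1 n x) + init_var P \<mu> * (2 * \<Theta> * e1 n x)) / sqrt n"
      using rho0_nonneg init_var_nonneg by (intro divide_right_mono sum_mono add_mono mult_left_mono Ea Eb) auto
    also have "(\<Sum>x\<in>window n. rho0 P \<mu> * (e2 n x + 2 * \<Theta> * e1 n x) + init_var P \<mu> * (2 * \<Theta> * e1 n x)) =
       rho0 P \<mu> * (\<Sum>x\<in>window n. e2 n x) + (rho0 P \<mu> + init_var P \<mu>) * (2 * \<Theta> * (\<Sum>x\<in>window n. e1 n x))"
      unfolding sum_distrib_left sum.distrib[symmetric] by (intro sum.cong refl) (simp add: algebra_simps)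
    also have "\<dots> / sqrt n = bound n" unfolding bound_def by (simp add: add_divide_distrib)
    finally show "expectation (\<lambda>\<omega>. \<bar>total_var \<omega> n - (\<Sum>x\<in>window n. occ_mean (shift x 0 \<omega>) * avg_var n x + occ_var (shift x 0 \<omega>) * avg_mean_sq n x) / sqrt n\<bar>) \<le> bound n" .
  qed
qed auto

text \<open>The quenched variances of the walks have been replaced by the averaged ones, which are deterministic weights,
so the law of large numbers applies to the occupation moments, and the sums of the weights have the limits
\<open>G1\<close> and \<open>G2\<close>.\<close>

theorem total_var_limit: "(\<lambda>n. expectation (\<lambda>\<omega>. \<bar>total_var \<omega> n - limit_var\<bar>)) \<longlonglongrightarrow> 0"
proof (rule tendsto_sandwich[of "\<lambda>_. 0"])
  let ?M = "\<lambda>n \<omega>. (\<Sum>x\<in>window n. occ_mean (shift x 0 \<omega>) * avg_var n x + occ_var (shift x 0 \<omega>) * avg_mean_sq n x) / sqrt n"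
  let ?A = "\<lambda>n \<omega>. \<Sum>x\<in>window n. avg_var n x * (occ_mean (shift x 0 \<omega>) - expectation occ_mean)"
  let ?B = "\<lambda>n \<omega>. \<Sum>x\<in>window n. avg_mean_sq n x * (occ_var (shift x 0 \<omega>) - expectation occ_var)"
  define d where "d n = rho0 P \<mu> * ((\<Sum>x\<in>window n. avg_var n x) / sqrt n) + init_var P \<mu> * ((\<Sum>x\<in>window n. avg_mean_sq n x) / sqrt n)" for n :: nat
  define bound where "bound n = expectation (\<lambda>\<omega>. \<bar>total_var \<omega> n - ?M n \<omega>\<bar>) + expectation (\<lambda>\<omega>. \<bar>?A n \<omega>\<bar>) / sqrt n + expectation (\<lambda>\<omega>. \<bar>?B n \<omega>\<bar>) / sqrt n + \<bar>d n - limit_var\<bar>" for n :: nat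
  have "d \<longlonglongrightarrow> rho0 P \<mu> * G1 + init_var P \<mu> * G2"
    unfolding d_def by (intro tendsto_intros sum_avg_var_limit sum_avg_mean_sq_limit)
  then have "(\<lambda>n. \<bar>d n - limit_var\<bar>) \<longlonglongrightarrow> 0" unfolding limit_var_def[symmetric] by (intro tendsto_rabs_zero LIM_zero)
  moreover have "(\<lambda>n. expectation (\<lambda>\<omega>. \<bar>?A n \<omega>\<bar>) / sqrt n) \<longlonglongrightarrow> 0"
    by (rule weighted_LLN[OF integrable_occ(2) finite_window avg_LLN_bounds(1,3)])
  moreover have "(\<lambda>n. expectation (\<lambda>\<omega>. \<bar>?B n \<omega>\<bar>) / sqrt n) \<longlonglongrightarrow> 0"
    by (rule weighted_LLN[OF integrable_occ(3) finite_window avg_LLN_bounds(2,4)])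
  ultimately have "bound \<longlonglongrightarrow> 0 + 0 + 0 + 0"
    unfolding bound_def by (intro tendsto_add total_var_vs_averaged_walk)
  then show "bound \<longlonglongrightarrow> 0" by simp
  show "\<forall>\<^sub>F n in sequentially. expectation (\<lambda>\<omega>. \<bar>total_var \<omega> n - limit_var\<bar>) \<le> bound n"
  proof (rule always_eventually, rule allI)
    fix n :: nat
    have iM: "integrable P (?M n)" using occ_shift_integrable by simp
    have iA: "integrable P (?A n)" "integrable P (?B n)" using occ_shift_integrable by simp_all
    have Md: "?M n \<omega> - d n = ?A n \<omega> / sqrt n + ?B n \<omega> / sqrt n" for \<omega>
      unfolding d_def rho0_eq init_var_eq
      by (simp add: add_divide_distrib[symmetric] diff_divide_distrib[symmetric] sum_distrib_left sum.distrib[symmetric] sum_subtractf[symmetric] algebra_simps)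
    have "expectation (\<lambda>\<omega>. \<bar>total_var \<omega> n - limit_var\<bar>) \<le>
      expectation (\<lambda>\<omega>. \<bar>total_var \<omega> n - ?M n \<omega>\<bar> + \<bar>?A n \<omega>\<bar> / sqrt n + \<bar>?B n \<omega>\<bar> / sqrt n + \<bar>d n - limit_var\<bar>)"
    proof (rule integral_mono)
      fix \<omega>
      have "\<bar>?A n \<omega> / sqrt n + ?B n \<omega> / sqrt n\<bar> \<le> \<bar>?A n \<omega>\<bar> / sqrt n + \<bar>?B n \<omega>\<bar> / sqrt n"
        by (rule order_trans[OF abs_triangle_ineq]) (simp add: abs_divide)
      then show "\<bar>total_var \<omega> n - limit_var\<bar> \<le> \<bar>total_var \<omega> n - ?M n \<omega>\<bar> + \<bar>?A n \<omega>\<bar> / sqrt n + \<bar>?B n \<omega>\<bar> / sqrt n + \<bar>d n - limit_var\<bar>"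
        unfolding Md[symmetric] by linarith
    qed (use integrable_total_var iM iA in auto)
    also have "\<dots> = bound n" unfolding bound_def using integrable_total_var iM iA by (simp add: prob_space)
    finally show "expectation (\<lambda>\<omega>. \<bar>total_var \<omega> n - limit_var\<bar>) \<le> bound n" .
  qed
qed auto

end

section \<open>Comparison with a Gaussian characteristic function\<close>

text \<open>Both characteristic functions are compared with \<open>1 - v/2\<close>. Without a third moment, the Taylor remainder is
bounded by the second moment of the large values and by the third moment of the small ones.\<close>

lemma (in prob_space) char_vs_gauss:
  fixes Y :: "'a \<Rightarrow> real"
  assumes Y[measurable]: "Y \<in> borel_measurable M" and i2: "integrable M (\<lambda>x. (Y x)\<^sup>2)" and Y0: "expectation Y = 0"
    and v: "v = expectation (\<lambda>x. (Y x)\<^sup>2)"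
  shows "cmod ((\<integral>x. iexp (Y x) \<partial>M) - complex_of_real (exp (- v / 2))) \<le>
     expectation (\<lambda>x. (Y x)\<^sup>2 * min 1 \<bar>Y x\<bar>) + v * min 1 v"
proof -
  have i1: "integrable M Y" by (rule square_integrable_imp_integrable[OF Y i2])
  have v0: "0 \<le> v" unfolding v by simp
  have ch: "char (distr M borel Y) 1 = (\<integral>x. iexp (Y x) \<partial>M)"
    unfolding char_def by (subst integral_distr) auto
  have im: "integrable M (\<lambda>x. (Y x)\<^sup>2 * min 1 \<bar>Y x\<bar>)"
    by (rule Bochner_Integration.integrable_bound[OF i2]) (auto simp: abs_mult intro!: mult_left_le)
  have "cmod (char (distr M borel Y) 1 - (1 - 1\<^sup>2 * v / 2)) \<le> (1\<^sup>2 / 6) * expectation (\<lambda>x. min (6 * (Y x)\<^sup>2) (\<bar>1\<bar> * \<bar>Y x\<bar> ^ 3))"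
    by (rule char_approx3') (use Y i1 i2 Y0 v in auto)
  then have "cmod ((\<integral>x. iexp (Y x) \<partial>M) - (1 - v / 2)) \<le> (1 / 6) * expectation (\<lambda>x. min (6 * (Y x)\<^sup>2) (\<bar>Y x\<bar> ^ 3))"
    unfolding ch by simp
  also have "\<dots> = expectation (\<lambda>x. (1 / 6) * min (6 * (Y x)\<^sup>2) (\<bar>Y x\<bar> ^ 3))" by simp
  also have "\<dots> \<le> expectation (\<lambda>x. (Y x)\<^sup>2 * min 1 \<bar>Y x\<bar>)"
  proof (rule integral_mono_AE')
    show "AE x in M. (1 / 6) * min (6 * (Y x)\<^sup>2) (\<bar>Y x\<bar> ^ 3) \<le> (Y x)\<^sup>2 * min 1 \<bar>Y x\<bar>"
    proof (rule AE_I2)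
      fix x
      have c: "\<bar>Y x\<bar> ^ 3 = (Y x)\<^sup>2 * \<bar>Y x\<bar>" by (simp add: power3_eq_cube power2_eq_square)
      show "(1 / 6) * min (6 * (Y x)\<^sup>2) (\<bar>Y x\<bar> ^ 3) \<le> (Y x)\<^sup>2 * min 1 \<bar>Y x\<bar>"
      proof (cases "\<bar>Y x\<bar> \<le> 1")
        case True
        have "0 \<le> (Y x)\<^sup>2 * \<bar>Y x\<bar>" by simp
        then show ?thesis using True unfolding c by (simp only: min_absorb2)
      qed simp
    qed
  qed (use im in auto)
  finally have 1: "cmod ((\<integral>x. iexp (Y x) \<partial>M) - (1 - v / 2)) \<le> expectation (\<lambda>x. (Y x)\<^sup>2 * min 1 \<bar>Y x\<bar>)" .
  have "\<bar>exp (- (v / 2)) - (1 - v / 2)\<bar> \<le> v * min 1 v"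
  proof (cases "v \<le> 1")
    case True
    have "\<bar>exp (- (v / 2)) - (1 - v / 2)\<bar> \<le> (v / 2)\<^sup>2 / 2" using v0 by (intro exp_minus_taylor) simp
    also have "\<dots> \<le> v * v" by (simp add: power2_eq_square)
    finally show ?thesis using True by simp
  next
    case False
    have "0 \<le> exp (- (v / 2)) - (1 - v / 2)" using exp_ge_add_one_self[of "- (v / 2)"] by simp
    moreover have "exp (- (v / 2)) \<le> 1" using v0 by simp
    ultimately have "\<bar>exp (- (v / 2)) - (1 - v / 2)\<bar> \<le> v" using v0 by linarith
    then show ?thesis using False by simp
  qed
  moreover have "cmod (complex_of_real (exp (- v / 2)) - (1 - v / 2)) = \<bar>exp (- (v / 2)) - (1 - v / 2)\<bar>"
    by (metis minus_divide_left norm_of_real of_real_diff of_real_1)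
  moreover have "cmod ((\<integral>x. iexp (Y x) \<partial>M) - complex_of_real (exp (- v / 2))) \<le>
    cmod ((\<integral>x. iexp (Y x) \<partial>M) - (1 - v / 2)) + cmod (complex_of_real (exp (- v / 2)) - (1 - v / 2))"
    using norm_triangle_ineq4[of "(\<integral>x. iexp (Y x) \<partial>M) - (1 - v / 2)" "complex_of_real (exp (- v / 2)) - (1 - v / 2)"]
    by (simp only: diff_diff_eq2 diff_add_cancel)
  ultimately show ?thesis using 1 by linarith
qed

text \<open>The Lindeberg weight \<open>y\<^sup>2 min(1, y)\<close>.\<close>

definition trunc_sq :: "real \<Rightarrow> real" where "trunc_sq y = y\<^sup>2 * min 1 y"

lemma trunc_sq_mono: "0 \<le> y \<Longrightarrow> y \<le> z \<Longrightarrow> trunc_sq y \<le> trunc_sq z"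
  unfolding trunc_sq_def by (intro mult_mono power_mono) auto

lemma trunc_sq_nonneg: "0 \<le> y \<Longrightarrow> 0 \<le> trunc_sq y" unfolding trunc_sq_def by simp

lemma trunc_sq_add:
  assumes "0 \<le> y" "0 \<le> z" shows "trunc_sq (y + z) \<le> trunc_sq (2 * y) + trunc_sq (2 * z)"
proof (cases "y \<le> z")
  case True
  then have "trunc_sq (y + z) \<le> trunc_sq (2 * z)" using assms by (intro trunc_sq_mono) auto
  then show ?thesis using trunc_sq_nonneg[of "2 * y"] assms by simp
next
  case False
  then have "trunc_sq (y + z) \<le> trunc_sq (2 * y)" using assms by (intro trunc_sq_mono) auto
  then show ?thesis using trunc_sq_nonneg[of "2 * z"] assms by simp
qed

context current_fluctuations
begin

definition pathW :: "nat \<Rightarrow> int \<Rightarrow> (nat \<Rightarrow> int) \<Rightarrow> real" where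
  "pathW n x X = (\<Sum>i\<in>UNIV. \<theta> $ i * side (level n i) x (X (steps n i)))"

definition scale :: "nat \<Rightarrow> real" where "scale n = real n powr (- 1 / 4)"

lemma scale_nonneg: "0 \<le> scale n" unfolding scale_def by simp

lemma scale_square: "n > 0 \<Longrightarrow> (scale n)\<^sup>2 = 1 / sqrt n"
proof -
  assume n: "n > 0"
  then have "(scale n)\<^sup>2 = real n powr (- (1 / 2))"
    unfolding scale_def by (simp add: power2_eq_square powr_add[symmetric])
  also have "\<dots> = 1 / sqrt n" using n by (simp add: powr_minus_divide powr_half_sqrt)
  finally show ?thesis .
qed

lemma measurable_side_path: "(\<lambda>X. side a x (X k)) \<in> borel_measurable (\<Pi>\<^sub>M s\<in>(UNIV :: nat set). count_space UNIV)"
  by (rule measurable_compose[OF measurable_component_singleton[of k UNIV]]) auto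

lemma measurable_pathW: "pathW n x \<in> borel_measurable (\<Pi>\<^sub>M s\<in>UNIV. count_space UNIV)"
  unfolding pathW_def[abs_def] by (intro borel_measurable_sum borel_measurable_times borel_measurable_const measurable_side_path)

lemma pathW_increments: "X 0 = x \<Longrightarrow> pathW n x X = W n x (increments (horizon n) X)"
  unfolding pathW_def W_def using sum_list_increments[OF steps_le_horizon, of n _ X] by simp

lemma pathW_bound: "\<bar>pathW n x X\<bar> \<le> \<Theta>"
  unfolding pathW_def using weighted_abs_le_const[of _ 1] abs_side_le_1 by simp

text \<open>The centred and rescaled contribution of the particles that start at \<open>x\<close>.\<close>

definition site_dev :: "env \<Rightarrow> nat \<Rightarrow> int \<Rightarrow> conf \<Rightarrow> real" where
  "site_dev \<omega> n x c = site_sum (\<lambda>x X. scale n * pathW n x X) x c - occ_mean (shift x 0 \<omega>) * (scale n * EW \<omega> n x (W n x))"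

text \<open>The finite second moment in the assumptions is an averaged one; almost every environment has finite
quenched second moments at all sites.\<close>

definition good :: "env \<Rightarrow> bool" where
  "good \<omega> \<longleftrightarrow> \<omega> \<in> space P \<and> (\<forall>x. integrable (\<mu> \<omega> x) (\<lambda>k. (real k)\<^sup>2))"

lemma AE_good: "AE \<omega> in P. good \<omega>"
  using AE_sq_integrable AE_space unfolding good_def by eventually_elim auto

lemma occ_shift_eq:
  assumes "\<omega> \<in> space P"
  shows "occ_mean (shift x 0 \<omega>) = (\<integral>k. real k \<partial>\<mu> \<omega> x)" "occ_sq (shift x 0 \<omega>) = (\<integral>k. (real k)\<^sup>2 \<partial>\<mu> \<omega> x)"
    "occ_trunc a (shift x 0 \<omega>) = (\<integral>k. (real k)\<^sup>2 * min 1 (a * real k) \<partial>\<mu> \<omega> x)"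
  unfolding occ_mean_def occ_sq_def occ_trunc_def mu_shift[OF assms, of x] by auto

lemma good_shift:
  assumes "good \<omega>"
  shows "shift x 0 \<omega> \<in> space P" "integrable (\<mu> (shift x 0 \<omega>) 0) (\<lambda>k. (real k)\<^sup>2)"
  using assms shift_in_space[of \<omega> R x 0] mu_shift[of \<omega> x, symmetric] unfolding good_def space_P by auto

text \<open>A bound for the Lindeberg error at the origin, in terms of the occupation law there. It is \<open>o(n\<^sup>-\<^sup>1\<^sup>/\<^sup>2)\<close> in
mean, but its mean is the same for all its shifts, so it serves only near the origin.\<close>

definition near_err :: "nat \<Rightarrow> env \<Rightarrow> real" where
  "near_err n \<omega> = 4 * (scale n * \<Theta>)\<^sup>2 * (occ_trunc (2 * (scale n * \<Theta>)) \<omega> + occ_sq \<omega> * min 1 (2 * (scale n * \<Theta>) * occ_sq \<omega>))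
     + 2 * (scale n * \<Theta>)\<^sup>2 * (occ_sq \<omega> * min 1 (2 * (scale n * \<Theta>)\<^sup>2 * occ_sq \<omega>))"

lemma site_dev_moments:
  assumes g: "good \<omega>"
  shows "site_dev \<omega> n x \<in> borel_measurable (quenched \<mu> \<omega>)"
    and "integrable (quenched \<mu> \<omega>) (\<lambda>c. (site_dev \<omega> n x c)\<^sup>2)"
    and "(\<integral>c. (site_dev \<omega> n x c)\<^sup>2 \<partial>quenched \<mu> \<omega>) = (scale n)\<^sup>2 * site_var \<omega> n x"
    and "(\<integral>c. site_dev \<omega> n x c \<partial>quenched \<mu> \<omega>) = 0"
    and "\<bar>site_dev \<omega> n x c\<bar> \<le> scale n * \<Theta> * real (fst c x) + scale n * \<Theta> * occ_mean (shift x 0 \<omega>)"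
proof -
  have w: "\<omega> \<in> space P" and sq: "integrable (\<mu> \<omega> x) (\<lambda>k. (real k)\<^sup>2)" using g unfolding good_def by auto
  have we: "\<omega> \<in> space (env_space R)" using w space_P by simp
  interpret compound_system "\<mu> \<omega>" "walk_law \<omega>" by (rule compound[OF w])
  let ?w = "\<lambda>x X. scale n * pathW n x X"
  have wm: "?w y \<in> borel_measurable (\<Pi>\<^sub>M s\<in>UNIV. count_space UNIV)" for y using measurable_pathW by simp
  have wC: "\<bar>?w y X\<bar> \<le> scale n * \<Theta>" for y X
    unfolding abs_mult using pathW_bound scale_nonneg by (intro mult_mono) auto
  have b: "(\<integral>X. ?w x X \<partial>walk_law \<omega> x) = scale n * EW \<omega> n x (W n x)"
    using walk_law_integral[OF we measurable_pathW[of n x] pathW_increments[of _ x n]] by simp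
  have b2: "(\<integral>X. (?w x X)\<^sup>2 \<partial>walk_law \<omega> x) = (scale n)\<^sup>2 * EW \<omega> n x (\<lambda>l. W n x l * W n x l)"
  proof -
    have "(\<integral>X. (pathW n x X)\<^sup>2 \<partial>walk_law \<omega> x) = EW \<omega> n x (\<lambda>l. W n x l * W n x l)"
      by (rule walk_law_integral[OF we]) (use measurable_pathW pathW_increments in \<open>auto simp: power2_eq_square\<close>)
    then show ?thesis by (simp add: power_mult_distrib)
  qed
  have D: "site_dev \<omega> n x = (\<lambda>c. site_sum ?w x c - (\<integral>k. real k \<partial>\<mu> \<omega> x) * (\<integral>X. ?w x X \<partial>walk_law \<omega> x))"
    unfolding site_dev_def b occ_shift_eq[OF w] ..
  note mom = site_sum_moments[OF wm wC sq]
  show "site_dev \<omega> n x \<in> borel_measurable (quenched \<mu> \<omega>)"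
    unfolding quenched_eq D using measurable_site_sum[of ?w x, OF wm] by simp
  show "integrable (quenched \<mu> \<omega>) (\<lambda>c. (site_dev \<omega> n x c)\<^sup>2)" unfolding quenched_eq D by (rule mom(1))
  have var: "occ_var (shift x 0 \<omega>) = (\<integral>k. (real k)\<^sup>2 \<partial>\<mu> \<omega> x) - (occ_mean (shift x 0 \<omega>))\<^sup>2"
    using occ_pointwise(5)[OF good_shift[OF g, of x]] occ_shift_eq(2)[OF w, of x] by simp
  show "(\<integral>c. (site_dev \<omega> n x c)\<^sup>2 \<partial>quenched \<mu> \<omega>) = (scale n)\<^sup>2 * site_var \<omega> n x"
  proof -
    have "(\<integral>c. (site_dev \<omega> n x c)\<^sup>2 \<partial>quenched \<mu> \<omega>) = (\<integral>k. real k \<partial>\<mu> \<omega> x) * ((\<integral>X. (?w x X)\<^sup>2 \<partial>walk_law \<omega> x) - (\<integral>X. ?w x X \<partial>walk_law \<omega> x)\<^sup>2)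
       + ((\<integral>k. (real k)\<^sup>2 \<partial>\<mu> \<omega> x) - (\<integral>k. real k \<partial>\<mu> \<omega> x)\<^sup>2) * (\<integral>X. ?w x X \<partial>walk_law \<omega> x)\<^sup>2"
      unfolding quenched_eq D by (rule mom(2))
    then show ?thesis
      unfolding b b2 site_var_def var walk_var_def walk_mean_sq_def occ_shift_eq(1)[OF w, of x]
      by (simp add: power_mult_distrib algebra_simps)
  qed
  show "(\<integral>c. site_dev \<omega> n x c \<partial>quenched \<mu> \<omega>) = 0"
    unfolding quenched_eq D using mom(3,4) by (simp add: Q.prob_space)
  have s: "\<bar>site_sum ?w x c\<bar> \<le> scale n * \<Theta> * real (fst c x)"
  proof -
    have "\<bar>site_sum ?w x c\<bar> \<le> (\<Sum>j\<in>{1..fst c x}. \<bar>?w x (snd c (x, j))\<bar>)"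
      unfolding site_sum_def case_prod_unfold by (rule sum_abs)
    also have "\<dots> \<le> (\<Sum>j\<in>{1..fst c x}. scale n * \<Theta>)" by (rule sum_mono[OF wC])
    finally show ?thesis by (simp add: mult.commute)
  qed
  have "\<bar>occ_mean (shift x 0 \<omega>) * (scale n * EW \<omega> n x (W n x))\<bar> \<le> occ_mean (shift x 0 \<omega>) * (scale n * \<Theta>)"
    unfolding abs_mult using EW_W_bound[OF w, of n x] scale_nonneg[of n] occ_mean_nonneg[of "shift x 0 \<omega>"] by (intro mult_mono) auto
  then show "\<bar>site_dev \<omega> n x c\<bar> \<le> scale n * \<Theta> * real (fst c x) + scale n * \<Theta> * occ_mean (shift x 0 \<omega>)"
    unfolding site_dev_def using s by (simp add: mult_ac)
qed

definition site_err :: "env \<Rightarrow> nat \<Rightarrow> int \<Rightarrow> real" where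
  "site_err \<omega> n x = cmod ((\<integral>c. iexp (site_dev \<omega> n x c) \<partial>quenched \<mu> \<omega>) -
     complex_of_real (exp (- ((scale n)\<^sup>2 * site_var \<omega> n x) / 2)))"

lemma site_err_basic:
  assumes g: "good \<omega>"
  shows "site_err \<omega> n x \<le> (\<integral>c. (site_dev \<omega> n x c)\<^sup>2 * min 1 \<bar>site_dev \<omega> n x c\<bar> \<partial>quenched \<mu> \<omega>)
     + (scale n)\<^sup>2 * site_var \<omega> n x * min 1 ((scale n)\<^sup>2 * site_var \<omega> n x)"
proof -
  interpret q: prob_space "quenched \<mu> \<omega>" using quenched_space(1) g unfolding good_def by blast
  show ?thesis unfolding site_err_def
    by (rule q.char_vs_gauss[OF site_dev_moments(1,2,4)[OF g] site_dev_moments(3)[OF g, symmetric]])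
qed

text \<open>The trivial bound by the variance. It contains no gain in \<open>n\<close>, but it decays in \<open>x\<close>, because few walks reach
the levels from distant sites.\<close>

lemma site_err_far:
  assumes g: "good \<omega>" shows "site_err \<omega> n x \<le> 2 * ((scale n)\<^sup>2 * site_var \<omega> n x)"
proof -
  let ?v = "(scale n)\<^sup>2 * site_var \<omega> n x"
  have v0: "0 \<le> ?v" using site_var_nonneg g unfolding good_def by simp
  have "(\<integral>c. (site_dev \<omega> n x c)\<^sup>2 * min 1 \<bar>site_dev \<omega> n x c\<bar> \<partial>quenched \<mu> \<omega>) \<le> (\<integral>c. (site_dev \<omega> n x c)\<^sup>2 \<partial>quenched \<mu> \<omega>)"
    by (rule integral_mono'[OF site_dev_moments(2)[OF g]]) (auto intro!: mult_left_le)
  moreover have "?v * min 1 ?v \<le> ?v" using v0 by (intro mult_left_le) auto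
  ultimately show ?thesis using site_err_basic[OF g, of n x] site_dev_moments(3)[OF g, of n x] by linarith
qed

lemma site_err_near:
  assumes g: "good \<omega>" shows "site_err \<omega> n x \<le> near_err n (shift x 0 \<omega>)"
proof -
  have w: "\<omega> \<in> space P" and sq: "integrable (\<mu> \<omega> x) (\<lambda>k. (real k)\<^sup>2)" using g unfolding good_def by auto
  interpret compound_system "\<mu> \<omega>" "walk_law \<omega>" by (rule compound[OF w])
  interpret N: prob_space "\<mu> \<omega> x" by (rule mu_space(1)[OF w])
  define a where "a = scale n * \<Theta>"
  have a: "0 \<le> a" unfolding a_def using scale_nonneg \<Theta>_nonneg by simp
  define m where "m = occ_mean (shift x 0 \<omega>)"
  define q where "q = occ_sq (shift x 0 \<omega>)"
  note pw = occ_pointwise[OF good_shift[OF g, of x], folded m_def q_def]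
  have q0: "0 \<le> q" unfolding q_def by (rule occ_sq_nonneg)
  let ?f = "\<lambda>k. trunc_sq (2 * (a * real k)) + trunc_sq (2 * (a * m))"
  have tr: "trunc_sq (2 * (a * real k)) = 4 * a\<^sup>2 * ((real k)\<^sup>2 * min 1 (2 * a * real k))" for k
    unfolding trunc_sq_def by (simp add: power_mult_distrib mult_ac)
  have it: "integrable (\<mu> \<omega> x) (\<lambda>k. (real k)\<^sup>2 * min 1 (2 * a * real k))"
    by (rule Bochner_Integration.integrable_bound[OF sq]) (use a in \<open>auto simp: mu_borel[OF w] abs_mult intro!: mult_left_le\<close>)
  have fi: "integrable (\<mu> \<omega> x) ?f" unfolding tr using it by simp
  have fint: "(\<integral>k. ?f k \<partial>\<mu> \<omega> x) = 4 * a\<^sup>2 * occ_trunc (2 * a) (shift x 0 \<omega>) + trunc_sq (2 * (a * m))"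
    unfolding tr occ_shift_eq(3)[OF w] using it by (simp add: N.prob_space)
  have pt: "(site_dev \<omega> n x c)\<^sup>2 * min 1 \<bar>site_dev \<omega> n x c\<bar> \<le> ?f (fst c x)" for c
  proof -
    have "(site_dev \<omega> n x c)\<^sup>2 * min 1 \<bar>site_dev \<omega> n x c\<bar> = trunc_sq \<bar>site_dev \<omega> n x c\<bar>" by (simp add: trunc_sq_def)
    also have "\<dots> \<le> trunc_sq (a * real (fst c x) + a * m)"
      using site_dev_moments(5)[OF g, of n x c] unfolding a_def m_def by (intro trunc_sq_mono) auto
    also have "\<dots> \<le> ?f (fst c x)" using a pw(2) by (intro trunc_sq_add) auto
    finally show ?thesis .
  qed
  have "(\<integral>c. (site_dev \<omega> n x c)\<^sup>2 * min 1 \<bar>site_dev \<omega> n x c\<bar> \<partial>quenched \<mu> \<omega>) \<le> (\<integral>c. ?f (fst c x) \<partial>quenched \<mu> \<omega>)"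
  proof (rule integral_mono')
    show "integrable (quenched \<mu> \<omega>) (\<lambda>c. ?f (fst c x))" unfolding quenched_eq integral_eta(2)[of ?f x] by (rule fi)
    show "0 \<le> ?f (fst c x)" for c using a pw(2) by (intro add_nonneg_nonneg trunc_sq_nonneg) auto
  qed (rule pt)
  also have "(\<integral>c. ?f (fst c x) \<partial>quenched \<mu> \<omega>) = (\<integral>k. ?f k \<partial>\<mu> \<omega> x)" unfolding quenched_eq by (rule integral_eta(1)[of ?f x])
  also have "\<dots> \<le> 4 * a\<^sup>2 * occ_trunc (2 * a) (shift x 0 \<omega>) + 4 * a\<^sup>2 * (q * min 1 (2 * a * q))"
  proof -
    have "trunc_sq (2 * (a * m)) = 4 * a\<^sup>2 * (m\<^sup>2 * min 1 (2 * a * m))"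
      unfolding trunc_sq_def by (simp add: power_mult_distrib mult_ac)
    also have "\<dots> \<le> 4 * a\<^sup>2 * (q * min 1 (2 * a * q))"
      using pw(2,3,4) a q0 by (intro mult_left_mono mult_mono min.mono) auto
    finally show ?thesis unfolding fint by simp
  qed
  finally have 1: "(\<integral>c. (site_dev \<omega> n x c)\<^sup>2 * min 1 \<bar>site_dev \<omega> n x c\<bar> \<partial>quenched \<mu> \<omega>) \<le> 4 * a\<^sup>2 * (occ_trunc (2 * a) (shift x 0 \<omega>) + q * min 1 (2 * a * q))"
    by (simp add: distrib_left)
  let ?v = "(scale n)\<^sup>2 * site_var \<omega> n x"
  have v0: "0 \<le> ?v" using site_var_nonneg[OF w] by simp
  have "site_var \<omega> n x \<le> q * (\<Theta> * \<Theta>) + q * (\<Theta> * \<Theta>)"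
    unfolding site_var_def m_def[symmetric]
    using walk_var_bounds[OF w, of n x] walk_mean_sq_bounds[OF w, of n x] pw q0 \<Theta>_nonneg by (intro add_mono mult_mono) auto
  then have "?v \<le> (scale n)\<^sup>2 * (q * (\<Theta> * \<Theta>) + q * (\<Theta> * \<Theta>))" by (rule mult_left_mono) simp
  also have "\<dots> = 2 * a\<^sup>2 * q" unfolding a_def by (simp add: power2_eq_square algebra_simps)
  finally have vq: "?v \<le> 2 * a\<^sup>2 * q" .
  have "?v * min 1 ?v \<le> (2 * a\<^sup>2 * q) * min 1 (2 * a\<^sup>2 * q)"
    using vq v0 q0 by (intro mult_mono[of ?v _ "min 1 ?v"]) auto
  then have "site_err \<omega> n x \<le> 4 * a\<^sup>2 * (occ_trunc (2 * a) (shift x 0 \<omega>) + q * min 1 (2 * a * q)) + (2 * a\<^sup>2 * q) * min 1 (2 * a\<^sup>2 * q)"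
    using site_err_basic[OF g, of n x] 1 by linarith
  then show ?thesis unfolding near_err_def a_def[symmetric] q_def by (simp only: mult.assoc)
qed

text \<open>The cut-off \<open>H\<close> between the two bounds is taken as a large multiple of \<open>\<surd>n\<close>.\<close>

definition gauss_err :: "real \<Rightarrow> nat \<Rightarrow> env \<Rightarrow> real" where
  "gauss_err H n \<omega> = (\<Sum>x\<in>window n. if \<bar>real_of_int x\<bar> \<le> H then near_err n (shift x 0 \<omega>) else 2 * ((scale n)\<^sup>2 * site_var \<omega> n x))"

text \<open>The site contributions are independent, and \<open>|\<Prod> a\<^sub>x - \<Prod> b\<^sub>x| \<le> \<Sum> |a\<^sub>x - b\<^sub>x|\<close> for numbers in the unit disc.\<close>

lemma quenched_char_vs_gauss:
  assumes g: "good \<omega>" and n: "n > 0"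
  shows "cmod ((\<integral>c. iexp (\<Sum>x\<in>window n. site_dev \<omega> n x c) \<partial>quenched \<mu> \<omega>) - complex_of_real (exp (- total_var \<omega> n / 2)))
     \<le> gauss_err H n \<omega>"
proof -
  have w: "\<omega> \<in> space P" using g unfolding good_def by auto
  interpret compound_system "\<mu> \<omega>" "walk_law \<omega>" by (rule compound[OF w])
  let ?w = "\<lambda>x X. scale n * pathW n x X"
  have wm: "?w y \<in> borel_measurable (\<Pi>\<^sub>M s\<in>UNIV. count_space UNIV)" for y using measurable_pathW by simp
  have prod: "(\<integral>c. iexp (\<Sum>x\<in>window n. site_dev \<omega> n x c) \<partial>quenched \<mu> \<omega>) =
     (\<Prod>x\<in>window n. \<integral>c. iexp (site_dev \<omega> n x c) \<partial>quenched \<mu> \<omega>)"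
    unfolding quenched_eq site_dev_def by (rule integral_exp_site_sums_prod[OF finite_window wm])
  have tv: "- total_var \<omega> n / 2 = (\<Sum>x\<in>window n. - ((scale n)\<^sup>2 * site_var \<omega> n x) / 2)"
    unfolding total_var_def scale_square[OF n] by (simp add: sum_negf sum_divide_distrib)
  have gauss: "complex_of_real (exp (- total_var \<omega> n / 2)) = (\<Prod>x\<in>window n. complex_of_real (exp (- ((scale n)\<^sup>2 * site_var \<omega> n x) / 2)))"
    unfolding tv exp_sum[OF finite_window] by simp
  have "cmod ((\<integral>c. iexp (\<Sum>x\<in>window n. site_dev \<omega> n x c) \<partial>quenched \<mu> \<omega>) - complex_of_real (exp (- total_var \<omega> n / 2)))
    \<le> (\<Sum>x\<in>window n. site_err \<omega> n x)"
    unfolding prod gauss site_err_def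
  proof (rule norm_prod_diff)
    fix x
    have "cmod (\<integral>c. iexp (site_dev \<omega> n x c) \<partial>quenched \<mu> \<omega>) \<le> (\<integral>c. cmod (iexp (site_dev \<omega> n x c)) \<partial>quenched \<mu> \<omega>)"
      by (rule integral_norm_bound)
    then show "cmod (\<integral>c. iexp (site_dev \<omega> n x c) \<partial>quenched \<mu> \<omega>) \<le> 1"
      using prob_space.prob_space[OF quenched_space(1)[OF w]] by simp
    show "cmod (complex_of_real (exp (- ((scale n)\<^sup>2 * site_var \<omega> n x) / 2))) \<le> 1"
      using site_var_nonneg[OF w] by simp
  qed
  also have "\<dots> \<le> gauss_err H n \<omega>"
    unfolding gauss_err_def using site_err_near[OF g] site_err_far[OF g] by (intro sum_mono) auto
  finally show ?thesis .
qed

lemma integrable_near_err: "integrable P (near_err n)"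
proof -
  have a: "0 \<le> 2 * (scale n * \<Theta>)" "0 \<le> 2 * (scale n * \<Theta>)\<^sup>2" using scale_nonneg \<Theta>_nonneg by auto
  show ?thesis unfolding near_err_def
    by (intro Bochner_Integration.integrable_add Bochner_Integration.integrable_mult_right integrable_occ_trunc[OF a(1)] integrable_occ_sq_min[OF a(1)] integrable_occ_sq_min[OF a(2)] impI)
qed

text \<open>The prefactors are of order \<open>n\<^sup>-\<^sup>1\<^sup>/\<^sup>2\<close>, and the truncated second moments vanish by dominated convergence.\<close>

lemma near_err_limit: "(\<lambda>n. sqrt n * expectation (near_err n)) \<longlonglongrightarrow> 0"
proof -
  let ?a = "\<lambda>n. scale n * \<Theta>"
  have a: "0 \<le> 2 * ?a n" "0 \<le> 2 * (?a n)\<^sup>2" for n using scale_nonneg \<Theta>_nonneg by auto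
  have "(\<lambda>n. real n powr (- 1 / 4)) \<longlonglongrightarrow> 0" by real_asymp
  then have s0: "scale \<longlonglongrightarrow> 0" unfolding scale_def .
  have l1: "(\<lambda>n. 2 * ?a n) \<longlonglongrightarrow> 0" "(\<lambda>n. 2 * (?a n)\<^sup>2) \<longlonglongrightarrow> 0"
    using tendsto_mult[OF tendsto_const tendsto_mult[OF s0 tendsto_const], of 2 \<Theta>]
      tendsto_mult[OF tendsto_const tendsto_power[OF tendsto_mult[OF s0 tendsto_const]], of 2 \<Theta> 2] by simp_all
  define w where "w n = 4 * \<Theta>\<^sup>2 * (expectation (occ_trunc (2 * ?a n)) + expectation (\<lambda>\<omega>. occ_sq \<omega> * min 1 (2 * ?a n * occ_sq \<omega>)))
     + 2 * \<Theta>\<^sup>2 * expectation (\<lambda>\<omega>. occ_sq \<omega> * min 1 (2 * (?a n)\<^sup>2 * occ_sq \<omega>))" for n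
  have "w \<longlonglongrightarrow> 4 * \<Theta>\<^sup>2 * (0 + 0) + 2 * \<Theta>\<^sup>2 * 0"
    unfolding w_def
    by (intro tendsto_add tendsto_mult tendsto_const expectation_occ_trunc_tendsto expectation_occ_sq_min_tendsto l1 a)
  then have w0: "w \<longlonglongrightarrow> 0" by simp
  have "\<forall>\<^sub>F n in sequentially. sqrt n * expectation (near_err n) = w n"
    using eventually_gt_at_top[of 0]
  proof eventually_elim
    case (elim n)
    have sq: "sqrt n * (?a n)\<^sup>2 = \<Theta>\<^sup>2" using elim by (simp add: power_mult_distrib scale_square)
    have "expectation (near_err n) = 4 * (?a n)\<^sup>2 * (expectation (occ_trunc (2 * ?a n)) + expectation (\<lambda>\<omega>. occ_sq \<omega> * min 1 (2 * ?a n * occ_sq \<omega>)))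
     + 2 * (?a n)\<^sup>2 * expectation (\<lambda>\<omega>. occ_sq \<omega> * min 1 (2 * (?a n)\<^sup>2 * occ_sq \<omega>))"
      unfolding near_err_def using integrable_occ_trunc[OF a(1)] integrable_occ_sq_min[OF a(1)] integrable_occ_sq_min[OF a(2)] by simp
    then have "sqrt n * expectation (near_err n) = 4 * (sqrt n * (?a n)\<^sup>2) * (expectation (occ_trunc (2 * ?a n)) + expectation (\<lambda>\<omega>. occ_sq \<omega> * min 1 (2 * ?a n * occ_sq \<omega>)))
     + 2 * (sqrt n * (?a n)\<^sup>2) * expectation (\<lambda>\<omega>. occ_sq \<omega> * min 1 (2 * (?a n)\<^sup>2 * occ_sq \<omega>))"
      by (simp only: distrib_left mult.assoc mult.left_commute)
    then show ?case unfolding sq w_def .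
  qed
  then show ?thesis using w0 by (simp cong: tendsto_cong)
qed

lemma expectation_site_var: "expectation (\<lambda>\<omega>. site_var \<omega> n x) \<le> (rho0 P \<mu> + init_var P \<mu>) * (\<Theta> * HP n (\<lambda>l. \<bar>W n x l\<bar>))"
proof -
  have iE: "integrable P (\<lambda>\<omega>. EW \<omega> n x f)" for f by (rule integrable_EP)
  have "expectation (\<lambda>\<omega>. walk_var \<omega> n x) \<le> expectation (\<lambda>\<omega>. \<Theta> * EW \<omega> n x (\<lambda>l. \<bar>W n x l\<bar>))"
    "expectation (\<lambda>\<omega>. walk_mean_sq \<omega> n x) \<le> expectation (\<lambda>\<omega>. \<Theta> * EW \<omega> n x (\<lambda>l. \<bar>W n x l\<bar>))"
    using iE integrable_walk_var walk_var_bounds walk_mean_sq_bounds by (intro integral_mono; simp)+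
  moreover have "expectation (\<lambda>\<omega>. \<Theta> * EW \<omega> n x (\<lambda>l. \<bar>W n x l\<bar>)) = \<Theta> * HP n (\<lambda>l. \<bar>W n x l\<bar>)"
    by (simp add: expectation_EP)
  moreover have "expectation (\<lambda>\<omega>. site_var \<omega> n x) = rho0 P \<mu> * expectation (\<lambda>\<omega>. walk_var \<omega> n x) + init_var P \<mu> * expectation (\<lambda>\<omega>. walk_mean_sq \<omega> n x)"
    unfolding site_var_def
    by (simp add: occ_mean_times[OF integrable_walk_var(1) walk_var_determined(1)] occ_var_times[OF integrable_walk_var(2) walk_var_determined(2)]
      integrable_occ_mean_times[OF integrable_walk_var(1) walk_var_determined(1)] integrable_occ_var_times[OF integrable_walk_var(2) walk_var_determined(2)])
  ultimately show ?thesis using rho0_nonneg init_var_nonneg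
    by (simp only: distrib_right) (intro add_mono mult_left_mono; simp only:)
qed

lemma integrable_gauss_err: "integrable P (gauss_err H n)"
proof -
  have "integrable P (\<lambda>\<omega>. if \<bar>real_of_int x\<bar> \<le> H then near_err n (shift x 0 \<omega>) else 2 * ((scale n)\<^sup>2 * site_var \<omega> n x))" for x
    using integrable_shift[OF integrable_near_err] integrable_site_var by (cases "\<bar>real_of_int x\<bar> \<le> H") simp_all
  then show ?thesis unfolding gauss_err_def by simp
qed

lemma near_err_nonneg: "0 \<le> near_err n \<omega>"
proof -
  have "0 \<le> occ_trunc (2 * (scale n * \<Theta>)) \<omega>"
    unfolding occ_trunc_def using scale_nonneg \<Theta>_nonneg by (intro Bochner_Integration.integral_nonneg) auto
  then show ?thesis unfolding near_err_def using scale_nonneg \<Theta>_nonneg occ_sq_nonneg by (intro add_nonneg_nonneg mult_nonneg_nonneg) auto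
qed

lemma expectation_gauss_err:
  assumes n: "n > 0" and H: "H > 0"
  shows "expectation (gauss_err H n) \<le> (2 * H + 1) * expectation (near_err n) +
     2 * ((rho0 P \<mu> + init_var P \<mu>) * (\<Theta> * (\<Theta> * (CARD('n) * (D * n / H))))) / sqrt n"
proof -
  let ?r = "rho0 P \<mu> + init_var P \<mu>"
  have nm: "near_err n \<in> borel_measurable P" using integrable_near_err by auto
  have E0: "0 \<le> expectation (near_err n)" using near_err_nonneg by (intro Bochner_Integration.integral_nonneg) auto
  have r0: "0 \<le> ?r" using rho0_nonneg init_var_nonneg by simp
  let ?F = "\<lambda>x \<omega>. if \<bar>real_of_int x\<bar> \<le> H then near_err n (shift x 0 \<omega>) else 2 * ((scale n)\<^sup>2 * site_var \<omega> n x)"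
  have iF: "integrable P (?F x)" for x
    using integrable_shift[OF integrable_near_err] integrable_site_var by (cases "\<bar>real_of_int x\<bar> \<le> H") simp_all
  have eF: "expectation (?F x) \<le> (if \<bar>real_of_int x\<bar> \<le> H then expectation (near_err n) else 0) +
      2 * ((scale n)\<^sup>2 * (?r * (\<Theta> * (if H < \<bar>real_of_int x\<bar> then HP n (\<lambda>l. \<bar>W n x l\<bar>) else 0))))" for x
  proof (cases "\<bar>real_of_int x\<bar> \<le> H")
    case True then show ?thesis using integral_shift[OF nm, of x 0] by simp
  next
    case False
    have "2 * ((scale n)\<^sup>2 * expectation (\<lambda>\<omega>. site_var \<omega> n x)) \<le> 2 * ((scale n)\<^sup>2 * (?r * (\<Theta> * HP n (\<lambda>l. \<bar>W n x l\<bar>))))"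
      using expectation_site_var[of n x] by (intro mult_left_mono) auto
    then show ?thesis using False by (simp add: not_le)
  qed
  have "expectation (gauss_err H n) = (\<Sum>x\<in>window n. expectation (?F x))"
    unfolding gauss_err_def using iF by simp
  also have "\<dots> \<le> (\<Sum>x\<in>window n. (if \<bar>real_of_int x\<bar> \<le> H then expectation (near_err n) else 0) +
      2 * ((scale n)\<^sup>2 * (?r * (\<Theta> * (if H < \<bar>real_of_int x\<bar> then HP n (\<lambda>l. \<bar>W n x l\<bar>) else 0)))))"
    by (rule sum_mono[OF eF])
  also have "\<dots> = (\<Sum>x\<in>window n. if \<bar>real_of_int x\<bar> \<le> H then expectation (near_err n) else 0) +
      2 * ((scale n)\<^sup>2 * (?r * (\<Theta> * (\<Sum>x\<in>window n. if H < \<bar>real_of_int x\<bar> then HP n (\<lambda>l. \<bar>W n x l\<bar>) else 0))))"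
    by (simp only: sum.distrib sum_distrib_left)
  also have "\<dots> \<le> (2 * H + 1) * expectation (near_err n) + 2 * ((scale n)\<^sup>2 * (?r * (\<Theta> * (\<Theta> * (CARD('n) * (D * n / H))))))"
  proof (intro add_mono mult_left_mono sum_HP_abs_W_tail H)
    have "(\<Sum>x\<in>window n. if \<bar>real_of_int x\<bar> \<le> H then expectation (near_err n) else 0) = (\<Sum>x\<in>{x\<in>window n. \<bar>real_of_int x\<bar> \<le> H}. expectation (near_err n))"
      by (rule sum.inter_filter[OF finite_window, symmetric])
    also have "\<dots> = real (card {x\<in>window n. \<bar>real_of_int x\<bar> \<le> H}) * expectation (near_err n)" by simp
    also have "\<dots> \<le> (2 * H + 1) * expectation (near_err n)" by (rule mult_right_mono[OF card_window_le[OF less_imp_le[OF H]] E0])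
    finally show "(\<Sum>x\<in>window n. if \<bar>real_of_int x\<bar> \<le> H then expectation (near_err n) else 0) \<le> (2 * H + 1) * expectation (near_err n)" .
  qed (use r0 \<Theta>_nonneg in auto)
  finally show ?thesis unfolding scale_square[OF n] by (simp add: mult.commute)
qed

text \<open>The characteristic function of the currents agrees with that of the site contributions in good
environments, and \<open>C n \<omega>\<close> stands for either of them. The error at the
sites within \<open>A \<surd>n\<close> of the origin vanishes for fixed \<open>A\<close>; the rest is of order \<open>1/A\<close>.\<close>

theorem quenched_char_limit:
  assumes C: "\<And>n \<omega>. good \<omega> \<Longrightarrow> C n \<omega> = (\<integral>c. iexp (\<Sum>x\<in>window n. site_dev \<omega> n x c) \<partial>quenched \<mu> \<omega>)"
  shows "(\<lambda>n. expectation (\<lambda>\<omega>. cmod (C n \<omega> - complex_of_real (exp (- limit_var / 2))))) \<longlonglongrightarrow> 0"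
proof (rule tendsto_zero_if_small)
  fix e :: real assume e: "e > 0"
  let ?r = "rho0 P \<mu> + init_var P \<mu>"
  define B where "B = 2 * (?r * (\<Theta> * (\<Theta> * (CARD('n) * D))))"
  have B: "0 \<le> B" unfolding B_def using rho0_nonneg init_var_nonneg \<Theta>_nonneg D_nonneg by simp
  define A where "A = (B + 1) / e"
  have A: "A > 0" "B / A \<le> e" using B e by (auto simp: A_def divide_le_eq)
  have V0: "0 \<le> limit_var"
  proof (rule ccontr)
    assume neg: "\<not> 0 \<le> limit_var"
    have "- limit_var \<le> expectation (\<lambda>\<omega>. \<bar>total_var \<omega> n - limit_var\<bar>)" for n
    proof -
      have "expectation (\<lambda>\<omega>. - limit_var) \<le> expectation (\<lambda>\<omega>. \<bar>total_var \<omega> n - limit_var\<bar>)"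
      proof (rule integral_mono)
        show "integrable P (\<lambda>\<omega>. \<bar>total_var \<omega> n - limit_var\<bar>)" using integrable_total_var by simp
        fix \<omega> assume "\<omega> \<in> space P"
        then show "- limit_var \<le> \<bar>total_var \<omega> n - limit_var\<bar>" using total_var_nonneg[of \<omega> n] by linarith
      qed simp
      then show ?thesis by (simp add: prob_space)
    qed
    then have "- limit_var \<le> 0" by (intro LIMSEQ_le_const[OF total_var_limit]) auto
    then show False using neg by simp
  qed
  define w where "w n = (2 * A + 1) * (sqrt n * expectation (near_err n)) + expectation (\<lambda>\<omega>. \<bar>total_var \<omega> n - limit_var\<bar>)" for n :: nat
  have "w \<longlonglongrightarrow> (2 * A + 1) * 0 + 0" unfolding w_def by (intro tendsto_intros near_err_limit total_var_limit)
  then have w0: "w \<longlonglongrightarrow> 0" by simp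
  have "\<forall>\<^sub>F n in sequentially. expectation (\<lambda>\<omega>. cmod (C n \<omega> - complex_of_real (exp (- limit_var / 2)))) \<le> w n + e"
    using eventually_gt_at_top[of 0]
  proof eventually_elim
    case (elim n)
    define H where "H = A * sqrt n"
    have H: "H > 0" unfolding H_def using A elim by simp
    have n1: "1 \<le> sqrt n" using elim by simp
    have lip: "\<bar>exp (- a / 2) - exp (- b / 2)\<bar> \<le> \<bar>a - b\<bar>" if "0 \<le> a" "0 \<le> b" for a b :: real
    proof -
      have *: "\<bar>exp (- a / 2) - exp (- b / 2)\<bar> \<le> b - a" if "0 \<le> a" "a \<le> b" for a b :: real
      proof -
        have "exp (- b / 2) \<le> exp (- a / 2)" using that by simp
        moreover have "exp (- a / 2) - exp (- b / 2) = exp (- a / 2) * (1 - exp (- (b - a) / 2))"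
          by (simp add: right_diff_distrib exp_add[symmetric] diff_divide_distrib)
        moreover have "\<dots> \<le> 1 * ((b - a) / 2)"
        proof (rule mult_mono)
          show "1 - exp (- (b - a) / 2) \<le> (b - a) / 2" using exp_ge_add_one_self[of "- (b - a) / 2"] by linarith
        qed (use that in auto)
        ultimately have "exp (- a / 2) - exp (- b / 2) \<le> (b - a) / 2" "0 \<le> exp (- a / 2) - exp (- b / 2)" by simp_all
        moreover have "(b - a) / 2 \<le> b - a" using that by simp
        ultimately show ?thesis by (simp only: abs_of_nonneg order_trans)
      qed
      show ?thesis
      proof (cases "a \<le> b")
        case True then show ?thesis using *[OF \<open>0 \<le> a\<close>] by simp
      next
        case False then show ?thesis using *[OF \<open>0 \<le> b\<close>, of a] by (simp add: abs_minus_commute)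
      qed
    qed
    have "expectation (\<lambda>\<omega>. cmod (C n \<omega> - complex_of_real (exp (- limit_var / 2)))) \<le>
      expectation (\<lambda>\<omega>. \<bar>gauss_err H n \<omega>\<bar> + \<bar>total_var \<omega> n - limit_var\<bar>)"
    proof (rule integral_mono_AE')
      show "AE \<omega> in P. cmod (C n \<omega> - complex_of_real (exp (- limit_var / 2))) \<le> \<bar>gauss_err H n \<omega>\<bar> + \<bar>total_var \<omega> n - limit_var\<bar>"
        using AE_good
      proof eventually_elim
        case (elim \<omega>)
        let ?c = "C n \<omega>"
        have tv0: "0 \<le> total_var \<omega> n" using total_var_nonneg elim unfolding good_def by blast
        have "cmod (complex_of_real (exp (- total_var \<omega> n / 2)) - complex_of_real (exp (- limit_var / 2))) = \<bar>exp (- total_var \<omega> n / 2) - exp (- limit_var / 2)\<bar>"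
          by (metis norm_of_real of_real_diff)
        then have 2: "cmod (complex_of_real (exp (- total_var \<omega> n / 2)) - complex_of_real (exp (- limit_var / 2))) \<le> \<bar>total_var \<omega> n - limit_var\<bar>"
          using lip[OF tv0 V0] by simp
        have "cmod (?c - complex_of_real (exp (- limit_var / 2))) \<le> cmod (?c - complex_of_real (exp (- total_var \<omega> n / 2))) + cmod (complex_of_real (exp (- total_var \<omega> n / 2)) - complex_of_real (exp (- limit_var / 2)))"
          by (metis dist_norm dist_triangle)
        then show ?case using quenched_char_vs_gauss[OF elim \<open>n > 0\<close>, of H, folded C[OF elim]] 2 by linarith
      qed
    qed (use integrable_gauss_err integrable_total_var in auto)
    also have "\<dots> = expectation (gauss_err H n) + expectation (\<lambda>\<omega>. \<bar>total_var \<omega> n - limit_var\<bar>)"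
    proof -
      have "0 \<le> gauss_err H n \<omega>" if "\<omega> \<in> space P" for \<omega>
        unfolding gauss_err_def using near_err_nonneg site_var_nonneg[OF that] by (intro sum_nonneg) auto
      then have "expectation (\<lambda>\<omega>. \<bar>gauss_err H n \<omega>\<bar>) = expectation (gauss_err H n)" by (intro Bochner_Integration.integral_cong) auto
      then show ?thesis using integrable_gauss_err integrable_total_var by simp
    qed
    also have "expectation (gauss_err H n) \<le> (2 * A + 1) * (sqrt n * expectation (near_err n)) + e"
    proof -
      have "expectation (gauss_err H n) \<le> (2 * H + 1) * expectation (near_err n) + 2 * (?r * (\<Theta> * (\<Theta> * (CARD('n) * (D * n / H))))) / sqrt n"
        by (rule expectation_gauss_err[OF elim H])
      also have "2 * (?r * (\<Theta> * (\<Theta> * (CARD('n) * (D * n / H))))) / sqrt n = B / A"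
        unfolding B_def H_def using elim A by (simp add: field_simps)
      also have "(2 * H + 1) * expectation (near_err n) \<le> ((2 * A + 1) * sqrt n) * expectation (near_err n)"
        unfolding H_def using near_err_nonneg n1 by (intro mult_right_mono Bochner_Integration.integral_nonneg) (auto simp: algebra_simps)
      finally show ?thesis using A by (simp add: mult.assoc)
    qed
    finally show ?case unfolding w_def by simp
  qed
  with w0 show "\<exists>w. w \<longlonglongrightarrow> 0 \<and> (\<forall>\<^sub>F n in sequentially. expectation (\<lambda>\<omega>. cmod (C n \<omega> - complex_of_real (exp (- limit_var / 2)))) \<le> w n + e)" by blast
qed simp

end

section \<open>Characteristic functions of the limit process\<close>

text \<open>The linear combination has a normal law by assumption, and its two parameters are determined by its first two
moments. The one-point laws are normal too, so all the products are integrable and the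
second moment may be expanded.\<close>

lemma gaussian_process_char:
  fixes q :: "'n :: finite \<Rightarrow> 'i" and \<theta> :: "'n \<Rightarrow> real"
  assumes G: "gaussian_process M I Z" and q: "inj q" "range q \<subseteq> I"
    and m0: "\<And>i. i \<in> I \<Longrightarrow> (\<integral>z. Z i z \<partial>M) = 0"
  shows "(\<integral>z. iexp (\<Sum>i\<in>UNIV. \<theta> i * Z (q i) z) \<partial>M) =
    complex_of_real (exp (- (\<Sum>i\<in>UNIV. \<Sum>j\<in>UNIV. \<theta> i * \<theta> j * (\<integral>z. Z (q i) z * Z (q j) z \<partial>M)) / 2))"
proof -
  interpret prob_space M using G unfolding gaussian_process_def by blast
  have Zm[measurable]: "Z i \<in> borel_measurable M" if "i \<in> I" for i
    using G that unfolding gaussian_process_def by blast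
  have fin_dim: "\<exists>m s. 0 \<le> s \<and> distr M borel (\<lambda>z. \<Sum>i\<in>J. c i * Z i z) = normal_law m s" if "finite J" "J \<subseteq> I" for J c
    using G that unfolding gaussian_process_def by blast
  have qI: "q i \<in> I" for i using q by blast
  have Zq[measurable]: "Z (q i) \<in> borel_measurable M" for i using Zm[OF qI] .
  have sqZ: "integrable M (\<lambda>z. (Z (q i) z)\<^sup>2)" for i
  proof -
    obtain m s where s: "0 \<le> s" "distr M borel (\<lambda>z. \<Sum>j\<in>{q i}. 1 * Z j z) = normal_law m s"
      using fin_dim[of "{q i}" "\<lambda>_. 1"] qI[of i] by auto
    then have "integrable (distr M borel (Z (q i))) (\<lambda>x. x\<^sup>2)" using normal_law_moments(3)[OF s(1)] by simp
    then show ?thesis by (subst (asm) integrable_distr_eq) auto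
  qed
  have iZ: "integrable M (Z (q i))" for i by (rule square_integrable_imp_integrable[OF Zq sqZ])
  have iZZ: "integrable M (\<lambda>z. Z (q i) z * Z (q j) z)" for i j
  proof (rule Bochner_Integration.integrable_bound[OF Bochner_Integration.integrable_add[OF sqZ[of i] sqZ[of j]]])
    show "AE z in M. norm (Z (q i) z * Z (q j) z) \<le> norm ((Z (q i) z)\<^sup>2 + (Z (q j) z)\<^sup>2)"
    proof (rule AE_I2)
      fix z
      have "2 * (\<bar>Z (q i) z\<bar> * \<bar>Z (q j) z\<bar>) \<le> (Z (q i) z)\<^sup>2 + (Z (q j) z)\<^sup>2"
        using zero_le_power2[of "\<bar>Z (q i) z\<bar> - \<bar>Z (q j) z\<bar>"] by (simp add: power2_diff)
      moreover have "0 \<le> \<bar>Z (q i) z\<bar> * \<bar>Z (q j) z\<bar>" by simp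
      ultimately show "norm (Z (q i) z * Z (q j) z) \<le> norm ((Z (q i) z)\<^sup>2 + (Z (q j) z)\<^sup>2)"
        unfolding real_norm_def abs_mult by linarith
    qed
  qed auto
  define Y where "Y z = (\<Sum>i\<in>UNIV. \<theta> i * Z (q i) z)" for z
  have Ym[measurable]: "Y \<in> borel_measurable M" unfolding Y_def by measurable
  \<comment> \<open>The definition of a Gaussian process speaks of sums over sets of indices; injectivity of \<open>q\<close> carries the
     sum over \<open>UNIV\<close> to its range.\<close>
  have "(\<Sum>j\<in>range q. \<theta> (inv_into UNIV q j) * Z j z) = Y z" for z
    unfolding Y_def by (subst sum.reindex[OF q(1)]) (simp add: inv_f_f[OF q(1)])
  moreover have "\<exists>m s. 0 \<le> s \<and> distr M borel (\<lambda>z. \<Sum>j\<in>range q. \<theta> (inv_into UNIV q j) * Z j z) = normal_law m s"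
    using fin_dim[of "range q" "\<lambda>j. \<theta> (inv_into UNIV q j)"] q(2) by simp
  ultimately obtain m s where s: "0 \<le> s" "distr M borel Y = normal_law m s" by auto
  have "m = (\<integral>x. x \<partial>distr M borel Y)" unfolding s(2) normal_law_moments(2)[OF s(1)] ..
  also have "\<dots> = (\<integral>z. Y z \<partial>M)" by (rule integral_distr) auto
  also have "\<dots> = 0" unfolding Y_def using iZ m0[OF qI] by simp
  finally have m: "m = 0" .
  have "s\<^sup>2 = (\<integral>x. x\<^sup>2 \<partial>distr M borel Y)" unfolding s(2) normal_law_moments(4)[OF s(1)] m by simp
  also have "\<dots> = (\<integral>z. (Y z)\<^sup>2 \<partial>M)" by (rule integral_distr) auto
  also have "\<dots> = (\<integral>z. (\<Sum>i\<in>UNIV. \<Sum>j\<in>UNIV. \<theta> i * \<theta> j * (Z (q i) z * Z (q j) z)) \<partial>M)"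
    unfolding Y_def by (simp add: power2_eq_square sum_product mult_ac)
  also have "\<dots> = (\<Sum>i\<in>UNIV. \<Sum>j\<in>UNIV. \<theta> i * \<theta> j * (\<integral>z. Z (q i) z * Z (q j) z \<partial>M))"
    using iZZ by simp
  finally have s2: "s\<^sup>2 = (\<Sum>i\<in>UNIV. \<Sum>j\<in>UNIV. \<theta> i * \<theta> j * (\<integral>z. Z (q i) z * Z (q j) z \<partial>M))" .
  have "(\<integral>z. iexp (Y z) \<partial>M) = (\<integral>x. iexp x \<partial>distr M borel Y)"
    by (subst integral_distr) auto
  also have "\<dots> = complex_of_real (exp (- s\<^sup>2 / 2))" unfolding s(2) m by (rule normal_law_moments(5)[OF s(1)])
  finally show ?thesis unfolding s2 Y_def .
qed

section \<open>The current as a finite sum of independent site contributions\<close>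

text \<open>Both sides are zero if \<open>f\<close> is not summable. As an integral, the sum depends measurably on parameters, also
where it diverges.\<close>

lemma infsum_eq_integral_count_space:
  fixes f :: "'a \<Rightarrow> real" assumes "\<And>x. 0 \<le> f x"
  shows "infsum f A = (\<integral>x. f x \<partial>count_space A)"
proof -
  have "f summable_on A \<longleftrightarrow> Infinite_Set_Sum.abs_summable_on f A"
    using abs_summable_equivalent[of f A] assms by simp
  then show ?thesis
    using infsetsum_infsum[of f A] infsum_not_exists[of f A] not_integrable_integral_eq[of "count_space A" f]
    unfolding infsetsum_def abs_summable_on_def by metis
qed

lemma borel_measurable_vec_lambda_components:
  fixes f :: "'n::finite \<Rightarrow> 'a \<Rightarrow> real"
  assumes "\<And>i. f i \<in> borel_measurable M" shows "(\<lambda>x. \<chi> i. f i x) \<in> borel_measurable M"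
proof (subst borel_measurable_euclidean_space, rule ballI)
  fix b :: "real ^ 'n" assume "b \<in> Basis"
  then obtain i where "b = axis i 1" by (auto simp: Basis_vec_def)
  then have "(\<lambda>x. (\<chi> i. f i x) \<bullet> b) = f i" by (simp add: inner_axis fun_eq_iff)
  then show "(\<lambda>x. (\<chi> i. f i x) \<bullet> b) \<in> borel_measurable M" using assms[of i] by simp
qed

context particle_system
begin

lemma integral_averaged_bounded_complex:
  fixes f :: "env \<times> conf \<Rightarrow> complex"
  assumes f[measurable]: "f \<in> borel_measurable (P \<Otimes>\<^sub>M conf_space)" and B: "\<And>z. cmod (f z) \<le> B"
  shows "(\<integral>z. f z \<partial>averaged P \<mu>) = (\<integral>\<omega>. \<integral>c. f (\<omega>, c) \<partial>quenched \<mu> \<omega> \<partial>P)"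
    and "integrable P (\<lambda>\<omega>. \<integral>c. f (\<omega>, c) \<partial>quenched \<mu> \<omega>)"
proof -
  interpret A: prob_space "averaged P \<mu>" by (rule prob_space_averaged)
  have fA: "f \<in> borel_measurable (averaged P \<mu>)" using f by (simp add: measurable_cong_sets[OF sets_averaged refl])
  have iA: "integrable (averaged P \<mu>) f" by (rule A.integrable_const_bound[of _ B]) (use B fA in auto)
  have RI: "(\<lambda>z. Re (f z)) \<in> borel_measurable (P \<Otimes>\<^sub>M conf_space)" "(\<lambda>z. Im (f z)) \<in> borel_measurable (P \<Otimes>\<^sub>M conf_space)"
    by measurable
  have RIB: "\<bar>Re (f z)\<bar> \<le> B" "\<bar>Im (f z)\<bar> \<le> B" for z
    using B[of z] abs_Re_le_cmod[of "f z"] abs_Im_le_cmod[of "f z"] by linarith+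
  note re = integral_averaged_bounded[OF RI(1) RIB(1)] and im = integral_averaged_bounded[OF RI(2) RIB(2)]
  let ?F = "\<lambda>\<omega>. \<integral>c. f (\<omega>, c) \<partial>quenched \<mu> \<omega>"
  have F: "?F \<omega> = Complex (\<integral>c. Re (f (\<omega>, c)) \<partial>quenched \<mu> \<omega>) (\<integral>c. Im (f (\<omega>, c)) \<partial>quenched \<mu> \<omega>)" and FB: "cmod (?F \<omega>) \<le> B" if w: "\<omega> \<in> space P" for \<omega>
  proof -
    interpret q: prob_space "quenched \<mu> \<omega>" by (rule quenched_space(1)[OF w])
    have "(\<lambda>c. f (\<omega>, c)) \<in> borel_measurable conf_space" using w by measurable
    then have i: "integrable (quenched \<mu> \<omega>) (\<lambda>c. f (\<omega>, c))"
      by (intro q.integrable_const_bound[of _ B]) (use B in \<open>auto simp: measurable_cong_sets[OF quenched_space(2)[OF w] refl]\<close>)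
    show "?F \<omega> = Complex (\<integral>c. Re (f (\<omega>, c)) \<partial>quenched \<mu> \<omega>) (\<integral>c. Im (f (\<omega>, c)) \<partial>quenched \<mu> \<omega>)"
      using i by (simp add: complex_eq_iff)
    have "cmod (?F \<omega>) \<le> (\<integral>c. cmod (f (\<omega>, c)) \<partial>quenched \<mu> \<omega>)" by (rule integral_norm_bound)
    also have "\<dots> \<le> (\<integral>c. B \<partial>quenched \<mu> \<omega>)" using i B by (intro integral_mono) auto
    finally show "cmod (?F \<omega>) \<le> B" by (simp add: q.prob_space)
  qed
  have Fm: "?F \<in> borel_measurable P"
    by (subst measurable_cong[OF F]) (use re(2) im(2) in \<open>auto simp: borel_measurable_complex_iff\<close>)
  show iF: "integrable P ?F" by (rule integrable_const_bound[of _ B]) (use FB Fm in auto)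
  have RF: "(\<integral>\<omega>. Re (?F \<omega>) \<partial>P) = (\<integral>\<omega>. \<integral>c. Re (f (\<omega>, c)) \<partial>quenched \<mu> \<omega> \<partial>P)"
    and IF: "(\<integral>\<omega>. Im (?F \<omega>) \<partial>P) = (\<integral>\<omega>. \<integral>c. Im (f (\<omega>, c)) \<partial>quenched \<mu> \<omega> \<partial>P)"
    by (rule Bochner_Integration.integral_cong, simp, simp add: F)+
  show "(\<integral>z. f z \<partial>averaged P \<mu>) = (\<integral>\<omega>. ?F \<omega> \<partial>P)"
    using re(1) im(1) iA iF RF IF by (simp add: complex_eq_iff)
qed

lemma measurable_site_sum_conf:
  assumes "\<And>x. w x \<in> borel_measurable (\<Pi>\<^sub>M s\<in>UNIV. count_space UNIV)"
  shows "site_sum w x \<in> borel_measurable conf_space"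
proof -
  obtain \<omega> where w: "\<omega> \<in> space P" using not_empty by blast
  interpret compound_system "\<mu> \<omega>" "walk_law \<omega>" by (rule compound[OF w])
  show ?thesis using measurable_site_sum[of w, OF assms] by (simp only: measurable_cong_sets[OF sets_Q refl])
qed

lemma measurable_infsum_site_sum:
  assumes w: "\<And>x. w x \<in> borel_measurable (\<Pi>\<^sub>M s\<in>UNIV. count_space UNIV)" and w0: "\<And>x X. 0 \<le> w x X"
  shows "(\<lambda>c. \<Sum>\<^sub>\<infinity>x\<in>A. site_sum w x c) \<in> borel_measurable conf_space"
proof -
  have 0: "0 \<le> site_sum w x c" for x c
    unfolding site_sum_def case_prod_unfold by (intro sum_nonneg w0)
  interpret A: sigma_finite_measure "count_space A" by (rule sigma_finite_measure_count_space)
  have "(\<lambda>p. site_sum w (snd p) (fst p)) \<in> borel_measurable (conf_space \<Otimes>\<^sub>M count_space A)"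
  proof (rule measurable_compose_countable'[where f = "\<lambda>x p. site_sum w x (fst p)" and g = snd and I = A])
    show "(\<lambda>p. site_sum w x (fst p)) \<in> borel_measurable (conf_space \<Otimes>\<^sub>M count_space A)" for x
      by (rule measurable_compose[OF measurable_fst measurable_site_sum_conf[OF w]])
  qed auto
  then have "(\<lambda>c. \<integral>x. site_sum w x c \<partial>count_space A) \<in> borel_measurable conf_space"
    by (intro A.borel_measurable_lebesgue_integral) (simp add: case_prod_unfold)
  then show ?thesis by (simp only: infsum_eq_integral_count_space[OF 0])
qed

lemma measurable_current: "current u n s q \<in> borel_measurable conf_space"
proof -
  define k a where "k = nat \<lfloor>real n * s\<rfloor>" and "a = \<lfloor>real n * u * s\<rfloor> + \<lfloor>q * sqrt (real n)\<rfloor>"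
  have p: "(\<lambda>X. of_bool (B (X k)) :: real) \<in> borel_measurable (\<Pi>\<^sub>M s\<in>(UNIV :: nat set). count_space (UNIV :: int set))" for B
    by (rule measurable_compose[OF measurable_component_singleton[of k UNIV]]) auto
  have "current u n s q = (\<lambda>c. (\<Sum>\<^sub>\<infinity>x\<in>{0<..}. site_sum (\<lambda>x X. of_bool (X k \<le> a)) x c) - (\<Sum>\<^sub>\<infinity>x\<in>{..0}. site_sum (\<lambda>x X. of_bool (a < X k)) x c))"
    unfolding current_def site_sum_def k_def a_def by (auto simp: fun_eq_iff)
  then show ?thesis by (simp only:) (intro borel_measurable_diff measurable_infsum_site_sum p, auto)
qed

lemma measurable_current_bar:
  "(\<lambda>z. current_bar P \<mu> n s q (fst z) (snd z)) \<in> borel_measurable (P \<Otimes>\<^sub>M conf_space)"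
proof -
  have "(\<lambda>\<omega>. quenched \<mu> \<omega>) \<in> P \<rightarrow>\<^sub>M subprob_algebra conf_space"
    using quenched_kernel by (rule measurable_prob_algebraD)
  from measurable_compose[OF this integral_measurable_subprob_algebra[OF measurable_current]]
  have "(\<lambda>\<omega>. \<integral>c. current v n s q c \<partial>quenched \<mu> \<omega>) \<in> borel_measurable P" by simp
  from measurable_compose[OF measurable_fst this] measurable_compose[OF measurable_snd measurable_current]
  show ?thesis unfolding current_bar_def by (intro borel_measurable_times borel_measurable_diff borel_measurable_const) auto
qed

text \<open>There are only countably many particles and times, so the almost sure bounds hold simultaneously.\<close>

lemma AE_confined:
  assumes w: "\<omega> \<in> space P"
  shows "AE c in quenched \<mu> \<omega>. \<forall>x j k. \<bar>snd c (x, j) k - x\<bar> \<le> int R * int k"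
proof -
  have we: "\<omega> \<in> space (env_space R)" using w space_P by simp
  interpret compound_system "\<mu> \<omega>" "walk_law \<omega>" by (rule compound[OF w])
  have "AE c in Q. \<bar>snd c (x, j) k - x\<bar> \<le> int R * int k" for x j k
  proof (rule Q.AE_pair_measure)
    have "(\<lambda>c. snd c (x, j) k) \<in> Q \<rightarrow>\<^sub>M count_space UNIV"
      by (rule measurable_compose[OF measurable_walk measurable_component_singleton]) simp
    then have "Measurable.pred Q (\<lambda>c. \<bar>snd c (x, j) k - x\<bar> \<le> int R * int k)"
      by (rule measurable_compose[where g = "\<lambda>y. \<bar>y - x\<bar> \<le> int R * int k"]) simp
    then show "{c \<in> space Q. \<bar>snd c (x, j) k - x\<bar> \<le> int R * int k} \<in> sets Q" by simp
    have "AE X in PiM UNIV (\<lambda>i. walk_law \<omega> (fst i)). \<bar>X (x, j) k - x\<bar> \<le> int R * int k"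
      by (rule AE_PiM_component[where P = "\<lambda>X. \<bar>X k - x\<bar> \<le> int R * int k"]) (simp_all only: fst_conv K(1) AE_walk_range[OF we] UNIV_I)
    then show "AE \<eta> in occ. AE X in walks. \<bar>snd (\<eta>, X) (x, j) k - x\<bar> \<le> int R * int k"
      unfolding walks_eq by simp
  qed
  then show ?thesis unfolding quenched_eq by (simp add: AE_all_countable)
qed

end

context current_fluctuations
begin

text \<open>A particle that starts outside of the window stays on its side of the level, so the two infinite sums
collapse to the window; there the two kinds of indicators are \<open>side\<close> and \<open>- side\<close>.\<close>

lemma current_eq_sum:
  assumes c: "\<And>x j k. \<bar>snd c (x, j) k - x\<bar> \<le> int R * int k"
  shows "current v n (t $ i) (r $ i) c = (\<Sum>x\<in>window n. site_sum (\<lambda>x X. side (level n i) x (X (steps n i))) x c)"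
proof -
  obtain \<eta> X where c_eq: "c = (\<eta>, X)" by (cases c)
  let ?a = "level n i" and ?k = "steps n i"
  have out: "side ?a x (X (x, j) ?k) = 0" if "x \<notin> window n" for x j
  proof (rule ccontr)
    assume "side ?a x (X (x, j) ?k) \<noteq> 0"
    then have "side ?a x (x + (X (x, j) ?k - x)) \<noteq> 0" by simp
    then have "\<bar>x\<bar> \<le> \<bar>?a - (X (x, j) ?k - x)\<bar>" by (rule side_nonzero)
    also have "\<dots> \<le> int (n * radius)" by (rule level_pos_bound) (use c[of x j ?k] c_eq in simp)
    finally show False using that unfolding window_def by auto
  qed
  have right: "of_bool (X (x, j) ?k \<le> ?a) = side ?a x (X (x, j) ?k)" if "0 < x" for x j
    using that by (auto simp: side_def of_bool_def)
  have left: "of_bool (?a < X (x, j) ?k) = - side ?a x (X (x, j) ?k)" if "x \<le> 0" for x j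
    using that by (auto simp: side_def of_bool_def)
  have collapse: "infsum f A = sum f (window n \<inter> A)" if "\<And>x. x \<in> A \<Longrightarrow> x \<notin> window n \<Longrightarrow> f x = 0" for f :: "int \<Rightarrow> real" and A
  proof -
    have "infsum f A = infsum f (window n \<inter> A)" by (rule infsum_cong_neutral) (use that in auto)
    then show ?thesis using finite_window by simp
  qed
  let ?s = "\<lambda>x. \<Sum>j\<in>{1..\<eta> x}. side ?a x (X (x, j) ?k)"
  have "(\<Sum>\<^sub>\<infinity>x\<in>{0<..}. \<Sum>j\<in>{1..\<eta> x}. of_bool (X (x, j) ?k \<le> ?a)) = (\<Sum>\<^sub>\<infinity>x\<in>{0<..}. ?s x)"
    by (intro infsum_cong sum.cong) (auto simp: right)
  also have "\<dots> = sum ?s (window n \<inter> {0<..})" by (rule collapse) (simp add: out)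
  finally have 1: "(\<Sum>\<^sub>\<infinity>x\<in>{0<..}. \<Sum>j\<in>{1..\<eta> x}. of_bool (X (x, j) ?k \<le> ?a)) = sum ?s (window n \<inter> {0<..})" .
  have "(\<Sum>\<^sub>\<infinity>x\<in>{..0}. \<Sum>j\<in>{1..\<eta> x}. of_bool (?a < X (x, j) ?k)) = (\<Sum>\<^sub>\<infinity>x\<in>{..0}. - ?s x)"
    unfolding sum_negf[symmetric] by (intro infsum_cong sum.cong) (auto simp: left)
  also have "\<dots> = sum (\<lambda>x. - ?s x) (window n \<inter> {..0})" by (rule collapse) (simp add: out)
  finally have 2: "(\<Sum>\<^sub>\<infinity>x\<in>{..0}. \<Sum>j\<in>{1..\<eta> x}. of_bool (?a < X (x, j) ?k)) = - sum ?s (window n \<inter> {..0})"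
    by (simp add: sum_negf)
  have "sum ?s (window n) = sum ?s (window n \<inter> {0<..}) + sum ?s (window n \<inter> {..0})"
    by (subst sum.union_disjoint[symmetric]) (use finite_window in \<open>auto intro!: sum.cong\<close>)
  then show ?thesis
    unfolding c_eq current_def site_sum_def prod.case steps_def[symmetric] level_def[symmetric] using 1 2 by simp
qed

text \<open>Both sides are the same linear combination of currents minus a constant, and both are centred, so that the
constants agree.\<close>

lemma sum_current_bar_eq_sum_site_dev:
  assumes g: "good \<omega>"
  shows "AE c in quenched \<mu> \<omega>. (\<Sum>i\<in>UNIV. \<theta> $ i * current_bar P \<mu> n (t $ i) (r $ i) \<omega> c) = (\<Sum>x\<in>window n. site_dev \<omega> n x c)"
proof -
  have w: "\<omega> \<in> space P" and sq: "\<And>x. integrable (\<mu> \<omega> x) (\<lambda>k. (real k)\<^sup>2)" using g unfolding good_def by auto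
  interpret compound_system "\<mu> \<omega>" "walk_law \<omega>" by (rule compound[OF w])
  let ?q = "quenched \<mu> \<omega>"
  interpret q: prob_space ?q by (rule quenched_space(1)[OF w])
  let ?w = "\<lambda>i x X. side (level n i) x (X (steps n i))"
  let ?J = "\<lambda>i. current v n (t $ i) (r $ i)"
  let ?S = "\<lambda>c. \<Sum>x\<in>window n. site_sum (\<lambda>x X. scale n * pathW n x X) x c"
  have iS: "integrable ?q (site_sum (?w i) x)" for i x
    unfolding quenched_eq
    by (rule site_sum_moments(3)[OF measurable_side_path _ sq]) (rule abs_side_le_1)
  have AEJ: "AE c in ?q. \<forall>i. ?J i c = (\<Sum>x\<in>window n. site_sum (?w i) x c)"
    using AE_confined[OF w] by eventually_elim (use current_eq_sum in blast)
  have Jm: "?J i \<in> borel_measurable ?q" for i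
    using measurable_current by (simp add: measurable_cong_sets[OF quenched_space(2)[OF w] refl])
  have iJ: "integrable ?q (?J i)" for i
  proof (rule integrable_cong_AE_imp[OF _ Jm])
    show "integrable ?q (\<lambda>c. \<Sum>x\<in>window n. site_sum (?w i) x c)" using iS by simp
    show "AE c in ?q. (\<Sum>x\<in>window n. site_sum (?w i) x c) = ?J i c" using AEJ by eventually_elim simp
  qed
  have lin: "(\<Sum>i\<in>UNIV. \<theta> $ i * (scale n * ?J i c)) = ?S c" if "\<forall>i. ?J i c = (\<Sum>x\<in>window n. site_sum (?w i) x c)" for c
  proof -
    have "site_sum (\<lambda>x X. scale n * pathW n x X) x c = (\<Sum>i\<in>UNIV. \<theta> $ i * (scale n * site_sum (?w i) x c))" for x
    proof -
      have "site_sum (\<lambda>x X. scale n * pathW n x X) x c = (\<Sum>j\<in>{1..fst c x}. \<Sum>i\<in>UNIV. \<theta> $ i * (scale n * ?w i x (snd c (x, j))))"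
        unfolding site_sum_def case_prod_unfold pathW_def by (simp add: sum_distrib_left mult_ac)
      also have "\<dots> = (\<Sum>i\<in>UNIV. \<Sum>j\<in>{1..fst c x}. \<theta> $ i * (scale n * ?w i x (snd c (x, j))))" by (rule sum.swap)
      finally show ?thesis unfolding site_sum_def case_prod_unfold by (simp add: sum_distrib_left)
    qed
    then have "?S c = (\<Sum>x\<in>window n. \<Sum>i\<in>UNIV. \<theta> $ i * (scale n * site_sum (?w i) x c))" by simp
    also have "\<dots> = (\<Sum>i\<in>UNIV. \<Sum>x\<in>window n. \<theta> $ i * (scale n * site_sum (?w i) x c))" by (rule sum.swap)
    finally show ?thesis using that by (simp add: sum_distrib_left)
  qed
  define m where "m = (\<Sum>x\<in>window n. occ_mean (shift x 0 \<omega>) * (scale n * EW \<omega> n x (W n x)))"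
  have dev: "(\<Sum>x\<in>window n. site_dev \<omega> n x c) = ?S c - m" for c
    unfolding site_dev_def m_def by (simp add: sum_subtractf)
  have AES: "AE c in ?q. ?S c = (\<Sum>i\<in>UNIV. \<theta> $ i * (scale n * ?J i c))" using AEJ by eventually_elim (rule lin[symmetric])
  have "(\<integral>c. (\<Sum>x\<in>window n. site_dev \<omega> n x c) \<partial>?q) = 0"
  proof -
    have "integrable ?q (site_dev \<omega> n x)" for x
      by (rule q.square_integrable_imp_integrable[OF site_dev_moments(1,2)[OF g]])
    then show ?thesis using site_dev_moments(4)[OF g] by simp
  qed
  moreover have "(\<integral>c. (\<Sum>x\<in>window n. site_dev \<omega> n x c) \<partial>?q) = (\<integral>c. (\<Sum>i\<in>UNIV. \<theta> $ i * (scale n * ?J i c)) - m \<partial>?q)"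
  proof (rule integral_cong_AE)
    show "AE c in ?q. (\<Sum>x\<in>window n. site_dev \<omega> n x c) = (\<Sum>i\<in>UNIV. \<theta> $ i * (scale n * ?J i c)) - m"
      using AES by eventually_elim (simp add: dev)
  qed (use site_dev_moments(1)[OF g] Jm in \<open>auto intro!: borel_measurable_sum borel_measurable_diff borel_measurable_times\<close>)
  moreover have "(\<integral>c. (\<Sum>i\<in>UNIV. \<theta> $ i * (scale n * ?J i c)) - m \<partial>?q) = (\<Sum>i\<in>UNIV. \<theta> $ i * (scale n * (\<integral>c. ?J i c \<partial>?q))) - m"
    using iJ by (simp add: q.prob_space)
  ultimately have m: "m = (\<Sum>i\<in>UNIV. \<theta> $ i * (scale n * (\<integral>c. ?J i c \<partial>?q)))" by simp
  show ?thesis using AES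
  proof eventually_elim
    case (elim c)
    have "(\<Sum>i\<in>UNIV. \<theta> $ i * current_bar P \<mu> n (t $ i) (r $ i) \<omega> c) = (\<Sum>i\<in>UNIV. \<theta> $ i * (scale n * ?J i c)) - m"
      unfolding current_bar_def scale_def[symmetric] m by (simp add: right_diff_distrib sum_subtractf)
    then show ?case unfolding dev elim .
  qed
qed

lemma current_char_limit:
  "(\<lambda>n. \<integral>\<omega>. cmod ((\<integral>c. iexp (\<Sum>i\<in>UNIV. \<theta> $ i * current_bar P \<mu> n (t $ i) (r $ i) \<omega> c) \<partial>quenched \<mu> \<omega>)
     - complex_of_real (exp (- limit_var / 2))) \<partial>P) \<longlonglongrightarrow> 0"
proof -
  let ?A = "\<lambda>n \<omega>. \<integral>c. iexp (\<Sum>i\<in>UNIV. \<theta> $ i * current_bar P \<mu> n (t $ i) (r $ i) \<omega> c) \<partial>quenched \<mu> \<omega>"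
  let ?B = "\<lambda>n \<omega>. \<integral>c. iexp (\<Sum>x\<in>window n. site_dev \<omega> n x c) \<partial>quenched \<mu> \<omega>"
  have AB: "?A n \<omega> = ?B n \<omega>" if g: "good \<omega>" for n \<omega>
  proof (rule integral_cong_AE)
    have w: "\<omega> \<in> space P" using g unfolding good_def by simp
    have "current_bar P \<mu> n (t $ i) (r $ i) \<omega> \<in> borel_measurable (quenched \<mu> \<omega>)" for i
      unfolding current_bar_def[abs_def] using measurable_current
      by (simp add: measurable_cong_sets[OF quenched_space(2)[OF w] refl])
    then show "(\<lambda>c. iexp (\<Sum>i\<in>UNIV. \<theta> $ i * current_bar P \<mu> n (t $ i) (r $ i) \<omega> c)) \<in> borel_measurable (quenched \<mu> \<omega>)"
      by measurable
    have "site_dev \<omega> n x \<in> borel_measurable (quenched \<mu> \<omega>)" for x by (rule site_dev_moments(1)[OF g])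
    then show "(\<lambda>c. iexp (\<Sum>x\<in>window n. site_dev \<omega> n x c)) \<in> borel_measurable (quenched \<mu> \<omega>)"
      by measurable
    show "AE c in quenched \<mu> \<omega>. iexp (\<Sum>i\<in>UNIV. \<theta> $ i * current_bar P \<mu> n (t $ i) (r $ i) \<omega> c) =
        iexp (\<Sum>x\<in>window n. site_dev \<omega> n x c)"
      using sum_current_bar_eq_sum_site_dev[OF g, of n] by eventually_elim simp
  qed
  show ?thesis by (rule quenched_char_limit[of ?A, OF AB])
qed

end

section \<open>Convergence of the current fluctuations\<close>

theorem theorem1p4:
  fixes R :: nat
    and \<P> :: "env measure"
    and \<mu> :: "env \<Rightarrow> int \<Rightarrow> nat measure"
    and Q :: "'z measure" and Z :: "real \<times> real \<Rightarrow> 'z \<Rightarrow> real"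
    and t r \<theta> :: "real ^ 'n :: {finite, linorder}"
  assumes "prob_space \<P>" and "sets \<P> = sets (env_space R)"
    and "A1 R \<P>" and "A2 \<P>" and "A3 \<P>"
    and "B1 R \<mu>" and "B2 \<P> \<mu>"
    and "limit_process (jump_var \<P>) (rho0 \<P> \<mu>) (init_var \<P> \<mu>) Q Z"
    and "\<forall>i. 0 < t $ i" and "strict_mono (\<lambda>i. t $ i)"
  shows "(\<lambda>n. \<integral>\<omega>. cmod
            ((\<integral>c. exp (\<i> * complex_of_real
                (\<Sum>i\<in>UNIV. \<theta> $ i * current_bar \<P> \<mu> n (t $ i) (r $ i) \<omega> c)) \<partial>quenched \<mu> \<omega>) -
             (\<integral>z. exp (\<i> * complex_of_real (\<Sum>i\<in>UNIV. \<theta> $ i * Z (t $ i, r $ i) z)) \<partial>Q)) \<partial>\<P>)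
           \<longlonglongrightarrow> 0 \<and>
         weak_conv_vec
           (\<lambda>n. distr (averaged \<P> \<mu>) borel
              (\<lambda>(\<omega>, c). \<chi> i. current_bar \<P> \<mu> n (t $ i) (r $ i) \<omega> c))
           (distr Q borel (\<lambda>z. \<chi> i. Z (t $ i, r $ i) z))"
proof
  interpret particle_system \<P> R \<mu>
    using assms by (intro particle_system.intro iid_environment.intro iid_environment_axioms.intro particle_system_axioms.intro)
  have G: "gaussian_process Q ({0..} \<times> UNIV) Z"
    and Z0: "\<And>i. i \<in> {0..} \<times> UNIV \<Longrightarrow> (\<integral>z. Z i z \<partial>Q) = 0"
    and ZZ: "\<And>i j. i \<in> {0..} \<times> UNIV \<Longrightarrow> j \<in> {0..} \<times> UNIV \<Longrightarrow>
        (\<integral>z. Z i z * Z j z \<partial>Q) = rho0 \<P> \<mu> * Gamma1 (jump_var \<P>) i j + init_var \<P> \<mu> * Gamma2 (jump_var \<P>) i j"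
    using \<open>limit_process _ _ _ Q Z\<close> unfolding limit_process_def by blast+
  interpret Q: prob_space Q using G unfolding gaussian_process_def by blast
  let ?q = "\<lambda>i. (t $ i, r $ i)"
  have q: "inj ?q" "range ?q \<subseteq> {0..} \<times> UNIV" "\<And>i. ?q i \<in> {0..} \<times> UNIV"
    using strict_mono_imp_inj_on[OF \<open>strict_mono (\<lambda>i. t $ i)\<close>] \<open>\<forall>i. 0 < t $ i\<close> by (auto simp: inj_def less_imp_le)
  let ?J = "\<lambda>n i \<omega> c. current_bar \<P> \<mu> n (t $ i) (r $ i) \<omega> c"
  have limit: "(\<lambda>n. \<integral>\<omega>. cmod
            ((\<integral>c. iexp (\<Sum>i\<in>UNIV. \<theta> $ i * ?J n i \<omega> c) \<partial>quenched \<mu> \<omega>) -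
             (\<integral>z. iexp (\<Sum>i\<in>UNIV. \<theta> $ i * Z (?q i) z) \<partial>Q)) \<partial>\<P>) \<longlonglongrightarrow> 0" for \<theta> :: "(real, 'n) vec"
  proof -
    interpret current_fluctuations \<P> R \<mu> t r \<theta>
      by unfold_locales (use assms in auto)
    have "(\<Sum>i\<in>UNIV. \<Sum>j\<in>UNIV. \<theta> $ i * \<theta> $ j * (\<integral>z. Z (?q i) z * Z (?q j) z \<partial>Q)) = limit_var"
      unfolding ZZ[OF q(3) q(3)] limit_var_def G1_def G2_def
      by (simp add: sum_distrib_left distrib_left sum.distrib mult_ac)
    then have "(\<integral>z. iexp (\<Sum>i\<in>UNIV. \<theta> $ i * Z (?q i) z) \<partial>Q) = complex_of_real (exp (- limit_var / 2))"
      using gaussian_process_char[OF G q(1,2) Z0, of "\<lambda>i. \<theta> $ i"] by simp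
    then show ?thesis using current_char_limit by simp
  qed
  then show "(\<lambda>n. \<integral>\<omega>. cmod
            ((\<integral>c. iexp (\<Sum>i\<in>UNIV. \<theta> $ i * ?J n i \<omega> c) \<partial>quenched \<mu> \<omega>) -
             (\<integral>z. iexp (\<Sum>i\<in>UNIV. \<theta> $ i * Z (?q i) z) \<partial>Q)) \<partial>\<P>) \<longlonglongrightarrow> 0" .
  let ?V = "\<lambda>n (\<omega>, c). \<chi> i. ?J n i \<omega> c" and ?W = "\<lambda>z. \<chi> i. Z (?q i) z"
  interpret A: prob_space "averaged \<P> \<mu>" by (rule prob_space_averaged)
  have V_P: "?V n \<in> borel_measurable (\<P> \<Otimes>\<^sub>M conf_space)" for n
    unfolding case_prod_unfold by (rule borel_measurable_vec_lambda_components) (rule measurable_current_bar)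
  then have V: "?V n \<in> borel_measurable (averaged \<P> \<mu>)" for n
    by (simp add: measurable_cong_sets[OF sets_averaged refl])
  have W: "?W \<in> borel_measurable Q"
    using G q(3) unfolding gaussian_process_def by (intro borel_measurable_vec_lambda_components) blast
  show "weak_conv_vec (\<lambda>n. distr (averaged \<P> \<mu>) borel (?V n)) (distr Q borel ?W)"
  proof (rule levy_continuity_vec)
    show "prob_space (distr (averaged \<P> \<mu>) borel (?V n))" for n by (rule A.prob_space_distr[OF V])
    show "prob_space (distr Q borel ?W)" by (rule Q.prob_space_distr[OF W])
    fix \<theta> :: "(real, 'n) vec"
    let ?e = "\<lambda>n \<omega> c. iexp (\<Sum>i\<in>UNIV. \<theta> $ i * ?J n i \<omega> c)"
    let ?g = "\<integral>z. iexp (\<Sum>i\<in>UNIV. \<theta> $ i * Z (?q i) z) \<partial>Q"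
    have g: "(\<integral>x. iexp (\<theta> \<bullet> x) \<partial>distr Q borel ?W) = ?g"
      by (subst integral_distr[OF W]) (simp_all add: inner_vec_def)
    \<comment> \<open>The averaged characteristic function is the mean of the quenched one, so its distance from the limit is at
       most the mean distance.\<close>
    have "cmod ((\<integral>x. iexp (\<theta> \<bullet> x) \<partial>distr (averaged \<P> \<mu>) borel (?V n)) - ?g) \<le>
        (\<integral>\<omega>. cmod ((\<integral>c. ?e n \<omega> c \<partial>quenched \<mu> \<omega>) - ?g) \<partial>\<P>)" for n
    proof -
      have em: "(\<lambda>(\<omega>, c). ?e n \<omega> c) \<in> borel_measurable (\<P> \<Otimes>\<^sub>M conf_space)"
        unfolding case_prod_unfold using measurable_current_bar by measurable
      note av = integral_averaged_bounded_complex[OF em, of 1, unfolded prod.case]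
      have "(\<integral>x. iexp (\<theta> \<bullet> x) \<partial>distr (averaged \<P> \<mu>) borel (?V n)) = (\<integral>z. (case z of (\<omega>, c) \<Rightarrow> ?e n \<omega> c) \<partial>averaged \<P> \<mu>)"
        by (subst integral_distr[OF V]) (simp_all add: inner_vec_def case_prod_unfold)
      also have "\<dots> = (\<integral>\<omega>. \<integral>c. ?e n \<omega> c \<partial>quenched \<mu> \<omega> \<partial>\<P>)" by (rule av(1)) auto
      finally have "(\<integral>x. iexp (\<theta> \<bullet> x) \<partial>distr (averaged \<P> \<mu>) borel (?V n)) - ?g =
          (\<integral>\<omega>. (\<integral>c. ?e n \<omega> c \<partial>quenched \<mu> \<omega>) - ?g \<partial>\<P>)"
        using av(2) by (simp add: prob_space case_prod_unfold)
      then show ?thesis by (simp only: integral_norm_bound)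
    qed
    then have "(\<lambda>n. (\<integral>x. iexp (\<theta> \<bullet> x) \<partial>distr (averaged \<P> \<mu>) borel (?V n)) - ?g) \<longlonglongrightarrow> 0"
      by (intro Lim_null_comparison[OF _ limit[of \<theta>]]) (rule always_eventually, simp)
    then show "(\<lambda>n. \<integral>x. iexp (\<theta> \<bullet> x) \<partial>distr (averaged \<P> \<mu>) borel (?V n)) \<longlonglongrightarrow> (\<integral>x. iexp (\<theta> \<bullet> x) \<partial>distr Q borel ?W)"
      unfolding g by (rule LIM_zero_cancel)
  qed auto
qed

end
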